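(* Let $\mathcal C$ be a finite category, $k$ an algebraically closed field and $\mathfrak M$ a finitely generated left $k\mathcal C$-module. Then there is a commutative diagram: the composite $$\mathrm{Ext}^*_{kF(\mathcal C)}(\underline k,\underline k)\xrightarrow{\ \cong\ }\mathrm{Ext}^*_{k\mathcal C}(\underline k,\underline k)\xrightarrow{\ -\hat\otimes\mathfrak M\ }\mathrm{Ext}^*_{k\mathcal C}(\mathfrak M,\mathfrak M)$$ equals the composite $$\mathrm{Ext}^*_{kF(\mathcal C)}(\underline k,\underline k)\longrightarrow\mathrm{Ext}^*_{k\mathcal C^e}(k\mathcal C,k\mathcal C)\xrightarrow{\ -\otimes_{k\mathcal C}\mathfrak M\ }\mathrm{Ext}^*_{k\mathcal C}(\mathfrak M,\mathfrak M),$$ where the first map of the first composite is the isomorphism induced by the left Kan extension $LK^{\mathcal C}_{F(\mathcal C)}$, and the first map of the second composite, induced by $LK^{\mathcal C^e}_{F(\mathcal C)}$, is an injective algebra homomorphism.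
   Context: For a finite category $\mathcal D$, the category algebra $k\mathcal D$ has the morphisms of $\mathcal D$ as basis, the product of two morphisms being their composite if composable and $0$ otherwise; finitely generated left $k\mathcal D$-modules are identified with covariant functors from $\mathcal D$ to finite-dimensional $k$-vector spaces. $\underline k$ is the constant functor with value $k$. $\mathfrak M\hat\otimes\mathfrak N$ is the pointwise tensor product $(\mathfrak M\hat\otimes\mathfrak N)(x)=\mathfrak M(x)\otimes_k\mathfrak N(x)$, a morphism $\alpha$ acting by $\alpha\otimes\alpha$; the exact functor $-\hat\otimes\mathfrak M$ induces the ring homomorphism $\mathrm{Ext}^*_{k\mathcal C}(\underline k,\underline k)\to\mathrm{Ext}^*_{k\mathcal C}(\mathfrak M,\mathfrak M)$. $\mathcal C^e=\mathcal C\times\mathcal C^{op}$, so that $k\mathcal C^e=k\mathcal C\otimes_k(k\mathcal C)^{op}$ and $k\mathcal C$ is the $k\mathcal C^e$-module (functor) $(x,y)\mapsto k\mathrm{Hom}_{\mathcal C}(y,x)$. The functor $-\otimes_{k\mathcal C}\mathfrak M$ induces $\mathrm{Ext}^*_{k\mathcal C^e}(k\mathcal C,k\mathcal C)\to\mathrm{Ext}^*_{k\mathcal C}(\mathfrak M,\mathfrak M)$. The category of factorizations $F(\mathcal C)$ has as objects the morphisms of $\mathcal C$, written $[\alpha]$; a morphism $[\alpha]\to[\beta]$ is a pair $(\mu,\gamma)$ of morphisms of $\mathcal C$ with $\beta=\mu\alpha\gamma$. Writing $t(\alpha),s(\alpha)$ for target and source of $\alpha$, there are functors $t:F(\mathcal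 C)\to\mathcal C$ and $\nabla=(t,s):F(\mathcal C)\to\mathcal C^e$. $LK^{\mathcal C}_{F(\mathcal C)}$ and $LK^{\mathcal C^e}_{F(\mathcal C)}$ are the left Kan extensions along $t$ and $\nabla$ (left adjoints of the restrictions, i.e. precompositions). One has $LK^{\mathcal C}_{F(\mathcal C)}\underline k\cong\underline k$ and $LK^{\mathcal C^e}_{F(\mathcal C)}\underline k\cong k\mathcal C$. The maps they induce on Ext are obtained by applying them to the bar resolution $\mathfrak B^{F(\mathcal C)}_*=\mathbb C_*(\mathrm{Id}_{F(\mathcal C)}/-,k)$ of $\underline k$ (the normalized chain complexes of nerves of overcategories), which yields projective resolutions $\mathbb C_*(t/-,k)$ of $\underline k\in k\mathcal C$-mod and $\mathbb C_*(\nabla/-,k)$ of $k\mathcal C\in k\mathcal C^e$-mod, and applying them to representing cocycles. *)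

theory Defs
  imports
    "HOL-Library.Poly_Mapping"
    "HOL-Algebra.Algebraic_Closure_Type"
    "Jordan_Normal_Form.Missing_VectorSpace"
begin

section \<open>Finite categories\<close>

text \<open>\<open>Comp C g f\<close> is the composite of \<open>f\<close> followed by \<open>g\<close>.\<close>

record ('o, 'm) category =
  Obj :: "'o set"
  Arr :: "'m set"
  Dom :: "'m \<Rightarrow> 'o"
  Cod :: "'m \<Rightarrow> 'o"
  Ident :: "'o \<Rightarrow> 'm"
  Comp :: "'m \<Rightarrow> 'm \<Rightarrow> 'm"

locale finite_category =
  fixes C :: "('o, 'm) category"
  assumes finite_Obj: "finite (Obj C)"
    and finite_Arr: "finite (Arr C)"
    and Dom_Obj: "f \<in> Arr C \<Longrightarrow> Dom C f \<in> Obj C"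
    and Cod_Obj: "f \<in> Arr C \<Longrightarrow> Cod C f \<in> Obj C"
    and Ident_Arr: "x \<in> Obj C \<Longrightarrow> Ident C x \<in> Arr C"
    and Dom_Ident: "x \<in> Obj C \<Longrightarrow> Dom C (Ident C x) = x"
    and Cod_Ident: "x \<in> Obj C \<Longrightarrow> Cod C (Ident C x) = x"
    and Comp_Arr: "\<lbrakk>f \<in> Arr C; g \<in> Arr C; Dom C g = Cod C f\<rbrakk> \<Longrightarrow> Comp C g f \<in> Arr C"
    and Dom_Comp: "\<lbrakk>f \<in> Arr C; g \<in> Arr C; Dom C g = Cod C f\<rbrakk> \<Longrightarrow> Dom C (Comp C g f) = Dom C f"
    and Cod_Comp: "\<lbrakk>f \<in> Arr C; g \<in> Arr C; Dom C g = Cod C f\<rbrakk> \<Longrightarrow> Cod C (Comp C g f) = Cod C g"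
    and Comp_Ident_right: "f \<in> Arr C \<Longrightarrow> Comp C f (Ident C (Dom C f)) = f"
    and Comp_Ident_left: "f \<in> Arr C \<Longrightarrow> Comp C (Ident C (Cod C f)) f = f"
    and Comp_assoc:
      "\<lbrakk>f \<in> Arr C; g \<in> Arr C; h \<in> Arr C; Dom C g = Cod C f; Dom C h = Cod C g\<rbrakk>
        \<Longrightarrow> Comp C h (Comp C g f) = Comp C (Comp C h g) f"

record ('o1, 'm1, 'o2, 'm2) cat_functor =
  omap :: "'o1 \<Rightarrow> 'o2"
  amap :: "'m1 \<Rightarrow> 'm2"

definition id_functor :: "('o, 'm, 'o, 'm) cat_functor" where
  "id_functor = \<lparr>omap = \<lambda>x. x, amap = \<lambda>f. f\<rparr>"

text \<open>The enveloping category \<open>C \<times> C\<^sup>o\<^sup>p\<close>; the second component of an arrow \<open>(\<mu>, \<gamma>)\<close> is an arrow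
  of \<open>C\<close> from the second component of the codomain to that of the domain.\<close>

definition env_cat :: "('o, 'm) category \<Rightarrow> ('o \<times> 'o, 'm \<times> 'm) category" where
  "env_cat C =
    \<lparr>Obj = Obj C \<times> Obj C,
     Arr = Arr C \<times> Arr C,
     Dom = \<lambda>(\<mu>, \<gamma>). (Dom C \<mu>, Cod C \<gamma>),
     Cod = \<lambda>(\<mu>, \<gamma>). (Cod C \<mu>, Dom C \<gamma>),
     Ident = \<lambda>(x, y). (Ident C x, Ident C y),
     Comp = \<lambda>(\<mu>', \<gamma>') (\<mu>, \<gamma>). (Comp C \<mu>' \<mu>, Comp C \<gamma> \<gamma>')\<rparr>"

text \<open>The category of factorizations. The arrow \<open>(\<mu>, \<gamma>) : [\<alpha>] \<rightarrow> [\<mu> \<alpha> \<gamma>]\<close> is encoded as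
  \<open>(\<alpha>, \<mu>, \<gamma>)\<close>, which determines its domain and codomain.\<close>

definition fact_cat :: "('o, 'm) category \<Rightarrow> ('m, 'm \<times> 'm \<times> 'm) category" where
  "fact_cat C =
    \<lparr>Obj = Arr C,
     Arr = {(\<alpha>, \<mu>, \<gamma>). \<alpha> \<in> Arr C \<and> \<mu> \<in> Arr C \<and> \<gamma> \<in> Arr C \<and>
                       Dom C \<mu> = Cod C \<alpha> \<and> Cod C \<gamma> = Dom C \<alpha>},
     Dom = \<lambda>(\<alpha>, \<mu>, \<gamma>). \<alpha>,
     Cod = \<lambda>(\<alpha>, \<mu>, \<gamma>). Comp C \<mu> (Comp C \<alpha> \<gamma>),
     Ident = \<lambda>\<alpha>. (\<alpha>, Ident C (Cod C \<alpha>), Ident C (Dom C \<alpha>)),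
     Comp = \<lambda>(\<beta>, \<mu>', \<gamma>') (\<alpha>, \<mu>, \<gamma>). (\<alpha>, Comp C \<mu>' \<mu>, Comp C \<gamma> \<gamma>')\<rparr>"

definition fact_target :: "('o, 'm) category \<Rightarrow> ('m, 'm \<times> 'm \<times> 'm, 'o, 'm) cat_functor" where
  "fact_target C = \<lparr>omap = Cod C, amap = \<lambda>(\<alpha>, \<mu>, \<gamma>). \<mu>\<rparr>"

definition fact_nabla ::
    "('o, 'm) category \<Rightarrow> ('m, 'm \<times> 'm \<times> 'm, 'o \<times> 'o, 'm \<times> 'm) cat_functor" where
  "fact_nabla C = \<lparr>omap = \<lambda>\<alpha>. (Cod C \<alpha>, Dom C \<alpha>), amap = \<lambda>(\<alpha>, \<mu>, \<gamma>). (\<mu>, \<gamma>)\<rparr>"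

text \<open>The overcategory \<open>u/x\<close> of a functor \<open>u : D \<rightarrow> C\<close>. The arrow
  \<open>\<delta> : (a, \<beta> \<circ> u \<delta>) \<rightarrow> (a', \<beta>)\<close> is encoded as \<open>(\<delta>, \<beta>)\<close>.\<close>

definition over_cat ::
    "('a, 'b, 'o, 'm) cat_functor \<Rightarrow> ('a, 'b) category \<Rightarrow> ('o, 'm) category \<Rightarrow> 'o
      \<Rightarrow> ('a \<times> 'm, 'b \<times> 'm) category" where
  "over_cat u D C x =
    \<lparr>Obj = {(a, \<beta>). a \<in> Obj D \<and> \<beta> \<in> Arr C \<and> Dom C \<beta> = omap u a \<and> Cod C \<beta> = x},
     Arr = {(\<delta>, \<beta>). \<delta> \<in> Arr D \<and> \<beta> \<in> Arr C \<and> Dom C \<beta> = omap u (Cod D \<delta>) \<and> Cod C \<beta> = x},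
     Dom = \<lambda>(\<delta>, \<beta>). (Dom D \<delta>, Comp C \<beta> (amap u \<delta>)),
     Cod = \<lambda>(\<delta>, \<beta>). (Cod D \<delta>, \<beta>),
     Ident = \<lambda>(a, \<beta>). (Ident D a, \<beta>),
     Comp = \<lambda>(\<delta>', \<beta>') (\<delta>, \<beta>). (Comp D \<delta>' \<delta>, \<beta>')\<rparr>"


section \<open>Vector spaces by generators and relations\<close>

abbreviation fld :: "'k::field ring" where
  "fld \<equiv> ring_of_type_algebra"

text \<open>The fields \<open>mult\<close> and \<open>one\<close> of a module record play no role for vector spaces.\<close>

definition free_space :: "'b set \<Rightarrow> ('k::field, 'b \<Rightarrow>\<^sub>0 'k) module" where
  "free_space U =
    \<lparr>carrier = {f. Poly_Mapping.keys f \<subseteq> U},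
     monoid.mult = undefined, one = undefined,
     zero = 0, add = (+),
     module.smult = \<lambda>c. Poly_Mapping.map ((*) c)\<rparr>"

definition push :: "('b \<Rightarrow> 'c) \<Rightarrow> ('b \<Rightarrow>\<^sub>0 'k::field) \<Rightarrow> ('c \<Rightarrow>\<^sub>0 'k)" where
  "push \<phi> f = (\<Sum>x\<in>Poly_Mapping.keys f. Poly_Mapping.single (\<phi> x) (Poly_Mapping.lookup f x))"

definition quot_space :: "('k::field, 'b) module \<Rightarrow> 'b set \<Rightarrow> ('k, 'b set) module" where
  "quot_space V W =
    \<lparr>carrier = a_rcosets\<^bsub>V\<^esub> W,
     monoid.mult = undefined, one = undefined,
     zero = W, add = \<lambda>A B. A <+>\<^bsub>V\<^esub> B,
     module.smult = \<lambda>c A. \<Union>a\<in>A. W +>\<^bsub>V\<^esub> (c \<odot>\<^bsub>V\<^esub> a)\<rparr>"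

abbreviation rel_span :: "'b set \<Rightarrow> ('b \<Rightarrow>\<^sub>0 'k::field) set \<Rightarrow> ('b \<Rightarrow>\<^sub>0 'k) set" where
  "rel_span U R \<equiv> module.span fld (free_space U) R"

definition presented :: "'b set \<Rightarrow> ('b \<Rightarrow>\<^sub>0 'k::field) set \<Rightarrow> ('k, ('b \<Rightarrow>\<^sub>0 'k) set) module" where
  "presented U R = quot_space (free_space U) (rel_span U R)"

text \<open>Linear maps out of a presented space determined by their values on generators: into the space
  presented by \<open>U\<close> and \<open>R\<close> with generators going to generators, and into an arbitrary space
  \<open>V\<close>. They make sense when \<open>\<phi>\<close> respects the relations.\<close>

definition pres_map ::
    "'c set \<Rightarrow> ('c \<Rightarrow>\<^sub>0 'k::field) set \<Rightarrow> ('b \<Rightarrow> 'c) \<Rightarrow> ('b \<Rightarrow>\<^sub>0 'k) set \<Rightarrow> ('c \<Rightarrow>\<^sub>0 'k) set" where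
  "pres_map U R \<phi> A = (\<Union>f\<in>A. rel_span U R +>\<^bsub>free_space U\<^esub> push \<phi> f)"

definition pres_out ::
    "('k::field, 'w) module \<Rightarrow> ('b \<Rightarrow> 'w) \<Rightarrow> ('b \<Rightarrow>\<^sub>0 'k) set \<Rightarrow> 'w" where
  "pres_out V \<phi> A =
    the_elem ((\<lambda>f. \<Oplus>\<^bsub>V\<^esub>x\<in>Poly_Mapping.keys f. Poly_Mapping.lookup f x \<odot>\<^bsub>V\<^esub> \<phi> x) ` A)"

text \<open>The relations that make \<open>i\<close> linear on \<open>V\<close>.\<close>

definition linear_rels :: "('k::field, 'v) module \<Rightarrow> ('v \<Rightarrow> 'b) \<Rightarrow> ('b \<Rightarrow>\<^sub>0 'k) set" where
  "linear_rels V i =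
    {Poly_Mapping.single (i (v \<oplus>\<^bsub>V\<^esub> w)) 1 - Poly_Mapping.single (i v) 1 - Poly_Mapping.single (i w) 1
      | v w. v \<in> carrier V \<and> w \<in> carrier V} \<union>
    {Poly_Mapping.single (i (c \<odot>\<^bsub>V\<^esub> v)) 1 - Poly_Mapping.single (i v) c
      | c v. v \<in> carrier V}"


section \<open>Modules over a category algebra as functors\<close>

record ('o, 'm, 'k, 'v) kfunctor =
  sp :: "'o \<Rightarrow> ('k, 'v) module"
  act :: "'m \<Rightarrow> 'v \<Rightarrow> 'v"

definition kmodule :: "('o, 'm) category \<Rightarrow> ('o, 'm, 'k::field, 'v) kfunctor \<Rightarrow> bool" where
  "kmodule D M \<longleftrightarrow>
    (\<forall>x\<in>Obj D. vectorspace fld (sp M x) \<and> vectorspace.fin_dim fld (sp M x)) \<and>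
    (\<forall>f\<in>Arr D. act M f \<in> module_hom fld (sp M (Dom D f)) (sp M (Cod D f))) \<and>
    (\<forall>x\<in>Obj D. \<forall>v\<in>carrier (sp M x). act M (Ident D x) v = v) \<and>
    (\<forall>f\<in>Arr D. \<forall>g\<in>Arr D. Dom D g = Cod D f \<longrightarrow>
      (\<forall>v\<in>carrier (sp M (Dom D f)). act M (Comp D g f) v = act M g (act M f v)))"

text \<open>Homomorphisms. Only the values on the carriers matter.\<close>

definition nat_trans ::
    "('o, 'm) category \<Rightarrow> ('o, 'm, 'k::field, 'v) kfunctor \<Rightarrow> ('o, 'm, 'k, 'w) kfunctor
      \<Rightarrow> ('o \<Rightarrow> 'v \<Rightarrow> 'w) \<Rightarrow> bool" where
  "nat_trans D M N \<eta> \<longleftrightarrow>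
    (\<forall>x\<in>Obj D. \<eta> x \<in> module_hom fld (sp M x) (sp N x)) \<and>
    (\<forall>f\<in>Arr D. \<forall>v\<in>carrier (sp M (Dom D f)).
      \<eta> (Cod D f) (act M f v) = act N f (\<eta> (Dom D f) v))"

definition const_mod :: "('o, 'm, 'k::field, 'k) kfunctor" where
  "const_mod =
    \<lparr>sp = \<lambda>x. \<lparr>carrier = UNIV, monoid.mult = (*), one = 1, zero = 0, add = (+), module.smult = (*)\<rparr>,
     act = \<lambda>f c. c\<rparr>"

text \<open>The free left module \<open>(kD)\<^sup>n\<close>: its value at \<open>x\<close> is \<open>1\<^sub>x (kD)\<^sup>n\<close>, with basis the pairs of an
  index below \<open>n\<close> and an arrow ending in \<open>x\<close>.\<close>

definition free_mod :: "('o, 'm) category \<Rightarrow> nat \<Rightarrow> ('o, 'm, 'k::field, nat \<times> 'm \<Rightarrow>\<^sub>0 'k) kfunctor" where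
  "free_mod D n =
    \<lparr>sp = \<lambda>x. free_space ({..<n} \<times> {f \<in> Arr D. Cod D f = x}),
     act = \<lambda>g. push (\<lambda>(i, f). (i, Comp D g f))\<rparr>"

text \<open>A finitely generated module is projective iff it is a direct summand of a free module of finite
  rank; unlike the lifting property, this does not quantify over modules on other types.\<close>

definition projective :: "('o, 'm) category \<Rightarrow> ('o, 'm, 'k::field, 'v) kfunctor \<Rightarrow> bool" where
  "projective D P \<longleftrightarrow> kmodule D P \<and>
    (\<exists>n i p. nat_trans D P (free_mod D n) i \<and> nat_trans D (free_mod D n) P p \<and>
      (\<forall>x\<in>Obj D. \<forall>v\<in>carrier (sp P x). p x (i x v) = v))"


section \<open>Resolutions and Ext\<close>

text \<open>\<open>bdry P n\<close> goes from degree \<open>n + 1\<close> to degree \<open>n\<close>.\<close>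

record ('o, 'm, 'k, 'v, 'w) aug_complex =
  mods :: "nat \<Rightarrow> ('o, 'm, 'k, 'v) kfunctor"
  bdry :: "nat \<Rightarrow> 'o \<Rightarrow> 'v \<Rightarrow> 'v"
  aug :: "'o \<Rightarrow> 'v \<Rightarrow> 'w"

definition projective_resolution ::
    "('o, 'm) category \<Rightarrow> ('o, 'm, 'k::field, 'w) kfunctor \<Rightarrow> ('o, 'm, 'k, 'v, 'w) aug_complex
      \<Rightarrow> bool" where
  "projective_resolution D M P \<longleftrightarrow>
    (\<forall>n. projective D (mods P n)) \<and>
    (\<forall>n. nat_trans D (mods P (Suc n)) (mods P n) (bdry P n)) \<and>
    nat_trans D (mods P 0) M (aug P) \<and>
    (\<forall>x\<in>Obj D.
      aug P x ` carrier (sp (mods P 0) x) = carrier (sp M x) \<and>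
      {v \<in> carrier (sp (mods P 0) x). aug P x v = \<zero>\<^bsub>sp M x\<^esub>} =
        bdry P 0 x ` carrier (sp (mods P 1) x) \<and>
      (\<forall>n. {v \<in> carrier (sp (mods P (Suc n)) x). bdry P n x v = \<zero>\<^bsub>sp (mods P n) x\<^esub>} =
        bdry P (Suc n) x ` carrier (sp (mods P (Suc (Suc n))) x)))"

definition cocycles ::
    "('o, 'm) category \<Rightarrow> ('o, 'm, 'k::field, 'v, 'u) aug_complex \<Rightarrow> ('o, 'm, 'k, 'w) kfunctor
      \<Rightarrow> nat \<Rightarrow> ('o \<Rightarrow> 'v \<Rightarrow> 'w) set" where
  "cocycles D P N n = {f. nat_trans D (mods P n) N f \<and>
    (\<forall>x\<in>Obj D. \<forall>v\<in>carrier (sp (mods P (Suc n)) x). f x (bdry P n x v) = \<zero>\<^bsub>sp N x\<^esub>)}"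

definition coboundaries ::
    "('o, 'm) category \<Rightarrow> ('o, 'm, 'k::field, 'v, 'u) aug_complex \<Rightarrow> ('o, 'm, 'k, 'w) kfunctor
      \<Rightarrow> nat \<Rightarrow> ('o \<Rightarrow> 'v \<Rightarrow> 'w) set" where
  "coboundaries D P N n = {b. nat_trans D (mods P n) N b \<and>
    (case n of
      0 \<Rightarrow> \<forall>x\<in>Obj D. \<forall>v\<in>carrier (sp (mods P 0) x). b x v = \<zero>\<^bsub>sp N x\<^esub>
    | Suc m \<Rightarrow> \<exists>h. nat_trans D (mods P m) N h \<and>
        (\<forall>x\<in>Obj D. \<forall>v\<in>carrier (sp (mods P n) x). b x v = h x (bdry P m x v)))}"

definition coh_class ::
    "('o, 'm) category \<Rightarrow> ('o, 'm, 'k::field, 'v, 'u) aug_complex \<Rightarrow> ('o, 'm, 'k, 'w) kfunctor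
      \<Rightarrow> nat \<Rightarrow> ('o \<Rightarrow> 'v \<Rightarrow> 'w) \<Rightarrow> ('o \<Rightarrow> 'v \<Rightarrow> 'w) set" where
  "coh_class D P N n f = {g \<in> cocycles D P N n. \<exists>b\<in>coboundaries D P N n.
    \<forall>x\<in>Obj D. \<forall>v\<in>carrier (sp (mods P n) x). g x v = f x v \<oplus>\<^bsub>sp N x\<^esub> b x v}"

text \<open>\<open>ext_space D P N n\<close> is \<open>Ext\<^sup>n(M, N)\<close>, computed from a projective resolution \<open>P\<close> of \<open>M\<close>. Here and
  below, operations on cohomology classes are written as unions over all representatives (and all
  chain maps) of the resulting class, which is always the same one.\<close>

definition ext_space ::
    "('o, 'm) category \<Rightarrow> ('o, 'm, 'k::field, 'v, 'u) aug_complex \<Rightarrow> ('o, 'm, 'k, 'w) kfunctor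
      \<Rightarrow> nat \<Rightarrow> ('k, ('o \<Rightarrow> 'v \<Rightarrow> 'w) set) module" where
  "ext_space D P N n =
    \<lparr>carrier = coh_class D P N n ` cocycles D P N n,
     monoid.mult = undefined, one = undefined,
     zero = coh_class D P N n (\<lambda>x v. \<zero>\<^bsub>sp N x\<^esub>),
     add = \<lambda>A B. \<Union>f\<in>A. \<Union>g\<in>B. coh_class D P N n (\<lambda>x v. f x v \<oplus>\<^bsub>sp N x\<^esub> g x v),
     module.smult = \<lambda>c A. \<Union>f\<in>A. coh_class D P N n (\<lambda>x v. c \<odot>\<^bsub>sp N x\<^esub> f x v)\<rparr>"

text \<open>Chain maps \<open>P\<^bsub>j+*\<^esub> \<rightarrow> Y\<^sub>*\<close> that lift the map \<open>f\<close> from \<open>P\<^sub>j\<close> to the target of the augmentation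
  of \<open>Y\<close>. For \<open>j = 0\<close> and \<open>f = aug P\<close> they lift the identity.\<close>

definition lifts ::
    "('o, 'm) category \<Rightarrow> ('o, 'm, 'k::field, 'v, 'u) aug_complex \<Rightarrow> nat
      \<Rightarrow> ('o, 'm, 'k, 'w, 'z) aug_complex \<Rightarrow> ('o \<Rightarrow> 'v \<Rightarrow> 'z) \<Rightarrow> (nat \<Rightarrow> 'o \<Rightarrow> 'v \<Rightarrow> 'w) set" where
  "lifts D P j Y f = {\<phi>.
    (\<forall>i. nat_trans D (mods P (j + i)) (mods Y i) (\<phi> i)) \<and>
    (\<forall>x\<in>Obj D. \<forall>v\<in>carrier (sp (mods P j) x). aug Y x (\<phi> 0 x v) = f x v) \<and>
    (\<forall>i. \<forall>x\<in>Obj D. \<forall>v\<in>carrier (sp (mods P (j + Suc i)) x).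
      bdry Y i x (\<phi> (Suc i) x v) = \<phi> i x (bdry P (j + i) x v))}"

text \<open>The product \<open>Ext\<^sup>i(M, M) \<times> Ext\<^sup>j(M, M) \<rightarrow> Ext\<^bsup>i+j\<^esup>(M, M)\<close>: represent the right factor by a chain
  map and compose, without signs.\<close>

definition ext_prod ::
    "('o, 'm) category \<Rightarrow> ('o, 'm, 'k::field, 'v, 'w) aug_complex \<Rightarrow> ('o, 'm, 'k, 'w) kfunctor
      \<Rightarrow> nat \<Rightarrow> nat \<Rightarrow> ('o \<Rightarrow> 'v \<Rightarrow> 'w) set \<Rightarrow> ('o \<Rightarrow> 'v \<Rightarrow> 'w) set \<Rightarrow> ('o \<Rightarrow> 'v \<Rightarrow> 'w) set" where
  "ext_prod D P M i j A B =
    (\<Union>g\<in>A. \<Union>f\<in>B. \<Union>\<phi>\<in>lifts D P j P f. coh_class D P M (i + j) (\<lambda>x v. g x (\<phi> i x v)))"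

text \<open>The graded algebra \<open>Ext\<^sup>*(M, M)\<close>, the direct sum over all degrees.\<close>

definition ext_algebra ::
    "('o, 'm) category \<Rightarrow> ('o, 'm, 'k::field, 'v, 'w) aug_complex \<Rightarrow> ('o, 'm, 'k, 'w) kfunctor
      \<Rightarrow> ('k, nat \<Rightarrow> ('o \<Rightarrow> 'v \<Rightarrow> 'w) set) module" where
  "ext_algebra D P M =
    \<lparr>carrier = {c. (\<forall>n. c n \<in> carrier (ext_space D P M n)) \<and>
                   finite {n. c n \<noteq> \<zero>\<^bsub>ext_space D P M n\<^esub>}},
     monoid.mult = \<lambda>c d n. \<Oplus>\<^bsub>ext_space D P M n\<^esub>i\<in>{..n}. ext_prod D P M i (n - i) (c i) (d (n - i)),
     one = \<lambda>n. if n = 0 then coh_class D P M 0 (aug P) else \<zero>\<^bsub>ext_space D P M n\<^esub>,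
     zero = \<lambda>n. \<zero>\<^bsub>ext_space D P M n\<^esub>,
     add = \<lambda>c d n. c n \<oplus>\<^bsub>ext_space D P M n\<^esub> d n,
     module.smult = \<lambda>a c n. a \<odot>\<^bsub>ext_space D P M n\<^esub> c n\<rparr>"

definition algebra_hom ::
    "('k::field, 'a) module \<Rightarrow> ('k, 'b) module \<Rightarrow> ('a \<Rightarrow> 'b) set" where
  "algebra_hom A B = ring_hom A B \<inter> module_hom fld A B"

text \<open>The map that a functor \<open>T\<close> with a given isomorphism \<open>T M \<cong> N\<close> induces on Ext. \<open>F\<close> gives its
  values on modules, \<open>Fm\<close> its values on homomorphisms (with prescribed target module), and \<open>Fa\<close> its
  values on homomorphisms to \<open>M\<close>, composed with the isomorphism. Applying it to a resolution \<open>P\<close> of \<open>M\<close>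
  gives an augmented complex over \<open>N\<close>, and a cocycle \<open>f\<close> on \<open>P\<close> becomes a cocycle \<open>Fa f\<close> on it, which
  is pulled back to the resolution \<open>Q\<close> of \<open>N\<close>.\<close>

definition image_complex ::
    "(('o, 'm, 'k, 'v) kfunctor \<Rightarrow> ('a, 'b, 'k, 'u) kfunctor)
      \<Rightarrow> (('o, 'm, 'k, 'v) kfunctor \<Rightarrow> ('o \<Rightarrow> 'v \<Rightarrow> 'v) \<Rightarrow> 'a \<Rightarrow> 'u \<Rightarrow> 'u)
      \<Rightarrow> (('o \<Rightarrow> 'v \<Rightarrow> 'w) \<Rightarrow> 'a \<Rightarrow> 'u \<Rightarrow> 'z)
      \<Rightarrow> ('o, 'm, 'k, 'v, 'w) aug_complex \<Rightarrow> ('a, 'b, 'k, 'u, 'z) aug_complex" where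
  "image_complex F Fm Fa P =
    \<lparr>mods = \<lambda>n. F (mods P n),
     bdry = \<lambda>n. Fm (mods P n) (bdry P n),
     aug = Fa (aug P)\<rparr>"

definition induced_map ::
    "('a, 'b) category \<Rightarrow> ('a, 'b, 'k::field, 'z) kfunctor
      \<Rightarrow> ('a, 'b, 'k, 'q, 'z) aug_complex \<Rightarrow> ('a, 'b, 'k, 'u, 'z) aug_complex
      \<Rightarrow> (('o \<Rightarrow> 'v \<Rightarrow> 'w) \<Rightarrow> 'a \<Rightarrow> 'u \<Rightarrow> 'z)
      \<Rightarrow> (nat \<Rightarrow> ('o \<Rightarrow> 'v \<Rightarrow> 'w) set) \<Rightarrow> nat \<Rightarrow> ('a \<Rightarrow> 'q \<Rightarrow> 'z) set" where
  "induced_map D N Q Y Fa c n =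
    (\<Union>f\<in>c n. \<Union>\<phi>\<in>lifts D Q 0 Y (aug Q). coh_class D Q N n (\<lambda>x v. Fa f x (\<phi> n x v)))"


section \<open>The bar resolution\<close>

fun is_path :: "('o, 'm) category \<Rightarrow> 'o \<Rightarrow> 'm list \<Rightarrow> bool" where
  "is_path E x [] \<longleftrightarrow> x \<in> Obj E"
| "is_path E x (f # fs) \<longleftrightarrow> f \<in> Arr E \<and> Dom E f = x \<and> is_path E (Cod E f) fs"

text \<open>Nondegenerate simplices of the nerve: the first object and the list of arrows, in order.\<close>

definition nd_simplices :: "('o, 'm) category \<Rightarrow> nat \<Rightarrow> ('o \<times> 'm list) set" where
  "nd_simplices E n = {(x, fs). is_path E x fs \<and> length fs = n \<and>
    (\<forall>f\<in>set fs. f \<noteq> Ident E (Dom E f))}"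

definition face :: "('o, 'm) category \<Rightarrow> nat \<Rightarrow> 'o \<times> 'm list \<Rightarrow> 'o \<times> 'm list" where
  "face E i = (\<lambda>(x, fs).
    if i = 0 then (Cod E (hd fs), tl fs)
    else if i = length fs then (x, butlast fs)
    else (x, take (i - 1) fs @ Comp E (fs ! i) (fs ! (i - 1)) # drop (i + 1) fs))"

text \<open>Differential of the normalized chain complex: degenerate faces are zero.\<close>

definition nerve_bdry ::
    "('o, 'm) category \<Rightarrow> nat \<Rightarrow> (('o \<times> 'm list) \<Rightarrow>\<^sub>0 'k::field) \<Rightarrow> (('o \<times> 'm list) \<Rightarrow>\<^sub>0 'k)" where
  "nerve_bdry E n c =
    (\<Sum>\<sigma>\<in>Poly_Mapping.keys c. \<Sum>i\<le>Suc n.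
      if face E i \<sigma> \<in> nd_simplices E n
      then Poly_Mapping.single (face E i \<sigma>) ((-1) ^ i * Poly_Mapping.lookup c \<sigma>) else 0)"

text \<open>The functor \<open>x \<mapsto> C\<^sub>n(u/x, k)\<close>.\<close>

definition over_chains ::
    "('a, 'b, 'o, 'm) cat_functor \<Rightarrow> ('a, 'b) category \<Rightarrow> ('o, 'm) category \<Rightarrow> nat
      \<Rightarrow> ('o, 'm, 'k::field, (('a \<times> 'm) \<times> ('b \<times> 'm) list) \<Rightarrow>\<^sub>0 'k) kfunctor" where
  "over_chains u D C n =
    \<lparr>sp = \<lambda>x. free_space (nd_simplices (over_cat u D C x) n),
     act = \<lambda>g. push (\<lambda>((a, \<beta>), fs). ((a, Comp C g \<beta>), map (\<lambda>(\<delta>, \<beta>'). (\<delta>, Comp C g \<beta>')) fs))\<rparr>"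

definition bar ::
    "('o, 'm) category
      \<Rightarrow> ('o, 'm, 'k::field, (('o \<times> 'm) \<times> ('m \<times> 'm) list) \<Rightarrow>\<^sub>0 'k, 'k) aug_complex" where
  "bar D =
    \<lparr>mods = over_chains id_functor D D,
     bdry = \<lambda>n x. nerve_bdry (over_cat id_functor D D x) n,
     aug = \<lambda>x c. \<Sum>\<sigma>\<in>Poly_Mapping.keys c. Poly_Mapping.lookup c \<sigma>\<rparr>"

text \<open>The isomorphism from Ext of the constant functor computed with \<open>P\<close> to that computed with the
  bar resolution.\<close>

definition to_bar ::
    "('o, 'm) category \<Rightarrow> ('o, 'm, 'k::field, 'v, 'k) aug_complex
      \<Rightarrow> (nat \<Rightarrow> ('o \<Rightarrow> 'v \<Rightarrow> 'k) set)
      \<Rightarrow> nat \<Rightarrow> ('o \<Rightarrow> ((('o \<times> 'm) \<times> ('m \<times> 'm) list) \<Rightarrow>\<^sub>0 'k) \<Rightarrow> 'k) set" where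
  "to_bar D P = induced_map D const_mod (bar D) P (\<lambda>f. f)"


section \<open>Left Kan extension\<close>

text \<open>The left Kan extension of \<open>F\<close> along \<open>u : D \<rightarrow> C\<close> at \<open>x\<close> is the colimit of \<open>F\<close> over \<open>u/x\<close>: it is
  generated by the \<open>(a, \<beta>, v)\<close> with \<open>\<beta> : u a \<rightarrow> x\<close> and \<open>v \<in> F a\<close>, linearly in \<open>v\<close>, subject to
  \<open>(a', \<beta>, F \<delta> v) = (a, \<beta> \<circ> u \<delta>, v)\<close> for \<open>\<delta> : a \<rightarrow> a'\<close>.\<close>

definition lan_gens ::
    "('a, 'b, 'o, 'm) cat_functor \<Rightarrow> ('a, 'b) category \<Rightarrow> ('o, 'm) category
      \<Rightarrow> ('a, 'b, 'k::field, 'v) kfunctor \<Rightarrow> 'o \<Rightarrow> ('a \<times> 'm \<times> 'v) set" where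
  "lan_gens u D C F x =
    {(a, \<beta>, v). (a, \<beta>) \<in> Obj (over_cat u D C x) \<and> v \<in> carrier (sp F a)}"

definition lan_rels ::
    "('a, 'b, 'o, 'm) cat_functor \<Rightarrow> ('a, 'b) category \<Rightarrow> ('o, 'm) category
      \<Rightarrow> ('a, 'b, 'k::field, 'v) kfunctor \<Rightarrow> 'o \<Rightarrow> (('a \<times> 'm \<times> 'v) \<Rightarrow>\<^sub>0 'k) set" where
  "lan_rels u D C F x =
    (\<Union>(a, \<beta>)\<in>Obj (over_cat u D C x). linear_rels (sp F a) (\<lambda>v. (a, \<beta>, v))) \<union>
    {Poly_Mapping.single (Cod D \<delta>, \<beta>, act F \<delta> v) 1
       - Poly_Mapping.single (Dom D \<delta>, Comp C \<beta> (amap u \<delta>), v) 1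
      | \<delta> \<beta> v. (\<delta>, \<beta>) \<in> Arr (over_cat u D C x) \<and> v \<in> carrier (sp F (Dom D \<delta>))}"

definition lan ::
    "('a, 'b, 'o, 'm) cat_functor \<Rightarrow> ('a, 'b) category \<Rightarrow> ('o, 'm) category
      \<Rightarrow> ('a, 'b, 'k::field, 'v) kfunctor
      \<Rightarrow> ('o, 'm, 'k, (('a \<times> 'm \<times> 'v) \<Rightarrow>\<^sub>0 'k) set) kfunctor" where
  "lan u D C F =
    \<lparr>sp = \<lambda>x. presented (lan_gens u D C F x) (lan_rels u D C F x),
     act = \<lambda>g. pres_map (lan_gens u D C F (Cod C g)) (lan_rels u D C F (Cod C g))
                 (\<lambda>(a, \<beta>, v). (a, Comp C g \<beta>, v))\<rparr>"

definition lan_map ::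
    "('a, 'b, 'o, 'm) cat_functor \<Rightarrow> ('a, 'b) category \<Rightarrow> ('o, 'm) category
      \<Rightarrow> ('a, 'b, 'k::field, 'w) kfunctor \<Rightarrow> ('a \<Rightarrow> 'v \<Rightarrow> 'w)
      \<Rightarrow> 'o \<Rightarrow> (('a \<times> 'm \<times> 'v) \<Rightarrow>\<^sub>0 'k) set \<Rightarrow> (('a \<times> 'm \<times> 'w) \<Rightarrow>\<^sub>0 'k) set" where
  "lan_map u D C G \<eta> x =
    pres_map (lan_gens u D C G x) (lan_rels u D C G x) (\<lambda>(a, \<beta>, v). (a, \<beta>, \<eta> a v))"

text \<open>\<open>kC\<close> as a functor on the enveloping category: \<open>(x, y) \<mapsto> k Hom(y, x)\<close>.\<close>

definition bimod :: "('o, 'm) category \<Rightarrow> ('o \<times> 'o, 'm \<times> 'm, 'k::field, 'm \<Rightarrow>\<^sub>0 'k) kfunctor" where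
  "bimod C =
    \<lparr>sp = \<lambda>(x, y). free_space {\<alpha> \<in> Arr C. Dom C \<alpha> = y \<and> Cod C \<alpha> = x},
     act = \<lambda>(\<mu>, \<gamma>). push (\<lambda>\<alpha>. Comp C \<mu> (Comp C \<alpha> \<gamma>))\<rparr>"

text \<open>The canonical isomorphisms from the left Kan extensions of the constant functor, along \<open>t\<close> to the
  constant functor and along \<open>\<nabla>\<close> to \<open>kC\<close>.\<close>

definition lan_target_const ::
    "'o \<Rightarrow> (('m \<times> 'm \<times> 'k) \<Rightarrow>\<^sub>0 'k::field) set \<Rightarrow> 'k" where
  "lan_target_const x = pres_out (sp (const_mod :: ('o, 'm, 'k, 'k) kfunctor) x) (\<lambda>(\<alpha>, \<beta>, c). c)"

definition lan_nabla_const ::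
    "('o, 'm) category \<Rightarrow> 'o \<times> 'o \<Rightarrow> (('m \<times> ('m \<times> 'm) \<times> 'k) \<Rightarrow>\<^sub>0 'k::field) set \<Rightarrow> ('m \<Rightarrow>\<^sub>0 'k)" where
  "lan_nabla_const C x =
    pres_out (sp (bimod C) x) (\<lambda>(\<alpha>, (\<mu>, \<gamma>), c). Poly_Mapping.single (Comp C \<mu> (Comp C \<alpha> \<gamma>)) c)"

definition lan_target_aug ::
    "('o, 'm) category \<Rightarrow> ('m \<Rightarrow> 'v \<Rightarrow> 'k::field) \<Rightarrow> 'o \<Rightarrow> (('m \<times> 'm \<times> 'v) \<Rightarrow>\<^sub>0 'k) set \<Rightarrow> 'k" where
  "lan_target_aug C f x A =
    lan_target_const x (lan_map (fact_target C) (fact_cat C) C const_mod f x A)"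

definition lan_nabla_aug ::
    "('o, 'm) category \<Rightarrow> ('m \<Rightarrow> 'v \<Rightarrow> 'k::field)
      \<Rightarrow> 'o \<times> 'o \<Rightarrow> (('m \<times> ('m \<times> 'm) \<times> 'v) \<Rightarrow>\<^sub>0 'k) set \<Rightarrow> ('m \<Rightarrow>\<^sub>0 'k)" where
  "lan_nabla_aug C f x A =
    lan_nabla_const C x (lan_map (fact_nabla C) (fact_cat C) (env_cat C) const_mod f x A)"

text \<open>The maps on Ext induced by the left Kan extensions along \<open>t\<close> and \<open>\<nabla>\<close>, applied to the bar
  resolution; \<open>P\<close>, \<open>R\<close>, \<open>S\<close> are the resolutions used to compute Ext over \<open>F(C)\<close>, \<open>C\<close> and the
  enveloping category.\<close>

definition ext_lan_target ::
    "('o, 'm) category \<Rightarrow> ('m, 'm \<times> 'm \<times> 'm, 'k::field, 'p, 'k) aug_complex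
      \<Rightarrow> ('o, 'm, 'k, 'r, 'k) aug_complex
      \<Rightarrow> (nat \<Rightarrow> ('m \<Rightarrow> 'p \<Rightarrow> 'k) set) \<Rightarrow> nat \<Rightarrow> ('o \<Rightarrow> 'r \<Rightarrow> 'k) set" where
  "ext_lan_target C P R c =
    induced_map C const_mod R
      (image_complex (lan (fact_target C) (fact_cat C) C) (lan_map (fact_target C) (fact_cat C) C)
        (lan_target_aug C) (bar (fact_cat C)))
      (lan_target_aug C) (to_bar (fact_cat C) P c)"

definition ext_lan_nabla ::
    "('o, 'm) category \<Rightarrow> ('m, 'm \<times> 'm \<times> 'm, 'k::field, 'p, 'k) aug_complex
      \<Rightarrow> ('o \<times> 'o, 'm \<times> 'm, 'k, 's, 'm \<Rightarrow>\<^sub>0 'k) aug_complex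
      \<Rightarrow> (nat \<Rightarrow> ('m \<Rightarrow> 'p \<Rightarrow> 'k) set) \<Rightarrow> nat \<Rightarrow> ('o \<times> 'o \<Rightarrow> 's \<Rightarrow> 'm \<Rightarrow>\<^sub>0 'k) set" where
  "ext_lan_nabla C P S c =
    induced_map (env_cat C) (bimod C) S
      (image_complex (lan (fact_nabla C) (fact_cat C) (env_cat C))
        (lan_map (fact_nabla C) (fact_cat C) (env_cat C))
        (lan_nabla_aug C) (bar (fact_cat C)))
      (lan_nabla_aug C) (to_bar (fact_cat C) P c)"


section \<open>Pointwise tensor product\<close>

text \<open>The first argument of \<open>ptensor C M N\<close> after \<open>C\<close> is the fixed module \<open>M\<close>: it is the value of the
  functor \<open>- \<otimes> M\<close> at \<open>N\<close>, and similarly for \<open>btensor\<close> below.\<close>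

definition tensor_gens ::
    "('k::field, 'v) module \<Rightarrow> ('k, 'w) module \<Rightarrow> ('v \<times> 'w) set" where
  "tensor_gens V W = carrier V \<times> carrier W"

definition tensor_rels ::
    "('k::field, 'v) module \<Rightarrow> ('k, 'w) module \<Rightarrow> (('v \<times> 'w) \<Rightarrow>\<^sub>0 'k) set" where
  "tensor_rels V W =
    (\<Union>w\<in>carrier W. linear_rels V (\<lambda>v. (v, w))) \<union> (\<Union>v\<in>carrier V. linear_rels W (\<lambda>w. (v, w)))"

definition ptensor ::
    "('o, 'm) category \<Rightarrow> ('o, 'm, 'k::field, 'w) kfunctor \<Rightarrow> ('o, 'm, 'k, 'v) kfunctor
      \<Rightarrow> ('o, 'm, 'k, (('v \<times> 'w) \<Rightarrow>\<^sub>0 'k) set) kfunctor" where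
  "ptensor C M N =
    \<lparr>sp = \<lambda>x. presented (tensor_gens (sp N x) (sp M x)) (tensor_rels (sp N x) (sp M x)),
     act = \<lambda>g. pres_map (tensor_gens (sp N (Cod C g)) (sp M (Cod C g)))
                 (tensor_rels (sp N (Cod C g)) (sp M (Cod C g)))
                 (\<lambda>(v, w). (act N g v, act M g w))\<rparr>"

definition ptensor_map ::
    "('o, 'm, 'k::field, 'w) kfunctor \<Rightarrow> ('o, 'm, 'k, 'u) kfunctor \<Rightarrow> ('o \<Rightarrow> 'v \<Rightarrow> 'u)
      \<Rightarrow> 'o \<Rightarrow> (('v \<times> 'w) \<Rightarrow>\<^sub>0 'k) set \<Rightarrow> (('u \<times> 'w) \<Rightarrow>\<^sub>0 'k) set" where
  "ptensor_map M N \<eta> x =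
    pres_map (tensor_gens (sp N x) (sp M x)) (tensor_rels (sp N x) (sp M x))
      (\<lambda>(v, w). (\<eta> x v, w))"

text \<open>Composition with the isomorphism \<open>k \<otimes> M \<cong> M\<close>, \<open>c \<otimes> w \<mapsto> c w\<close>.\<close>

definition ptensor_aug ::
    "('o, 'm, 'k::field, 'w) kfunctor \<Rightarrow> ('o \<Rightarrow> 'v \<Rightarrow> 'k) \<Rightarrow> 'o \<Rightarrow> (('v \<times> 'w) \<Rightarrow>\<^sub>0 'k) set \<Rightarrow> 'w" where
  "ptensor_aug M f x A =
    pres_out (sp M x) (\<lambda>(c, w). c \<odot>\<^bsub>sp M x\<^esub> w) (ptensor_map M const_mod f x A)"

definition ext_ptensor ::
    "('o, 'm) category \<Rightarrow> ('o, 'm, 'k::field, 'w) kfunctor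
      \<Rightarrow> ('o, 'm, 'k, 'r, 'k) aug_complex \<Rightarrow> ('o, 'm, 'k, 'q, 'w) aug_complex
      \<Rightarrow> (nat \<Rightarrow> ('o \<Rightarrow> 'r \<Rightarrow> 'k) set) \<Rightarrow> nat \<Rightarrow> ('o \<Rightarrow> 'q \<Rightarrow> 'w) set" where
  "ext_ptensor C M R Q =
    induced_map C M Q
      (image_complex (ptensor C M) (ptensor_map M) (ptensor_aug M) R) (ptensor_aug M)"


section \<open>Tensor product over the category algebra\<close>

text \<open>For a functor \<open>B\<close> on the enveloping category, the value of \<open>B \<otimes>\<^bsub>kC\<^esub> M\<close> at \<open>x\<close> is generated by the
  \<open>(y, b, w)\<close> with \<open>b \<in> B (x, y)\<close> and \<open>w \<in> M y\<close>, bilinearly, subject to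
  \<open>(y', b, M \<alpha> w) = (y, b \<alpha>, w)\<close> for \<open>\<alpha> : y \<rightarrow> y'\<close>.\<close>

definition btensor_gens ::
    "('o, 'm) category \<Rightarrow> ('o, 'm, 'k::field, 'w) kfunctor
      \<Rightarrow> ('o \<times> 'o, 'm \<times> 'm, 'k, 'v) kfunctor \<Rightarrow> 'o \<Rightarrow> ('o \<times> 'v \<times> 'w) set" where
  "btensor_gens C M B x =
    {(y, b, w). y \<in> Obj C \<and> b \<in> carrier (sp B (x, y)) \<and> w \<in> carrier (sp M y)}"

definition btensor_rels ::
    "('o, 'm) category \<Rightarrow> ('o, 'm, 'k::field, 'w) kfunctor
      \<Rightarrow> ('o \<times> 'o, 'm \<times> 'm, 'k, 'v) kfunctor \<Rightarrow> 'o \<Rightarrow> (('o \<times> 'v \<times> 'w) \<Rightarrow>\<^sub>0 'k) set" where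
  "btensor_rels C M B x =
    (\<Union>y\<in>Obj C. \<Union>w\<in>carrier (sp M y). linear_rels (sp B (x, y)) (\<lambda>b. (y, b, w))) \<union>
    (\<Union>y\<in>Obj C. \<Union>b\<in>carrier (sp B (x, y)). linear_rels (sp M y) (\<lambda>w. (y, b, w))) \<union>
    {Poly_Mapping.single (Cod C \<alpha>, b, act M \<alpha> w) 1
       - Poly_Mapping.single (Dom C \<alpha>, act B (Ident C x, \<alpha>) b, w) 1
      | \<alpha> b w. \<alpha> \<in> Arr C \<and> b \<in> carrier (sp B (x, Cod C \<alpha>)) \<and> w \<in> carrier (sp M (Dom C \<alpha>))}"

definition btensor ::
    "('o, 'm) category \<Rightarrow> ('o, 'm, 'k::field, 'w) kfunctor
      \<Rightarrow> ('o \<times> 'o, 'm \<times> 'm, 'k, 'v) kfunctor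
      \<Rightarrow> ('o, 'm, 'k, (('o \<times> 'v \<times> 'w) \<Rightarrow>\<^sub>0 'k) set) kfunctor" where
  "btensor C M B =
    \<lparr>sp = \<lambda>x. presented (btensor_gens C M B x) (btensor_rels C M B x),
     act = \<lambda>g. pres_map (btensor_gens C M B (Cod C g)) (btensor_rels C M B (Cod C g))
                 (\<lambda>(y, b, w). (y, act B (g, Ident C y) b, w))\<rparr>"

definition btensor_map ::
    "('o, 'm) category \<Rightarrow> ('o, 'm, 'k::field, 'w) kfunctor
      \<Rightarrow> ('o \<times> 'o, 'm \<times> 'm, 'k, 'u) kfunctor \<Rightarrow> ('o \<times> 'o \<Rightarrow> 'v \<Rightarrow> 'u)
      \<Rightarrow> 'o \<Rightarrow> (('o \<times> 'v \<times> 'w) \<Rightarrow>\<^sub>0 'k) set \<Rightarrow> (('o \<times> 'u \<times> 'w) \<Rightarrow>\<^sub>0 'k) set" where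
  "btensor_map C M B \<eta> x =
    pres_map (btensor_gens C M B x) (btensor_rels C M B x) (\<lambda>(y, b, w). (y, \<eta> (x, y) b, w))"

text \<open>Composition with the isomorphism \<open>kC \<otimes>\<^bsub>kC\<^esub> M \<cong> M\<close>, \<open>b \<otimes> w \<mapsto> b w\<close>.\<close>

definition btensor_aug ::
    "('o, 'm) category \<Rightarrow> ('o, 'm, 'k::field, 'w) kfunctor \<Rightarrow> ('o \<times> 'o \<Rightarrow> 'v \<Rightarrow> 'm \<Rightarrow>\<^sub>0 'k)
      \<Rightarrow> 'o \<Rightarrow> (('o \<times> 'v \<times> 'w) \<Rightarrow>\<^sub>0 'k) set \<Rightarrow> 'w" where
  "btensor_aug C M f x A =
    pres_out (sp M x)
      (\<lambda>(y, b, w). \<Oplus>\<^bsub>sp M x\<^esub>\<alpha>\<in>Poly_Mapping.keys b. Poly_Mapping.lookup b \<alpha> \<odot>\<^bsub>sp M x\<^esub> act M \<alpha> w)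
      (btensor_map C M (bimod C) f x A)"

definition ext_btensor ::
    "('o, 'm) category \<Rightarrow> ('o, 'm, 'k::field, 'w) kfunctor
      \<Rightarrow> ('o \<times> 'o, 'm \<times> 'm, 'k, 's, 'm \<Rightarrow>\<^sub>0 'k) aug_complex \<Rightarrow> ('o, 'm, 'k, 'q, 'w) aug_complex
      \<Rightarrow> (nat \<Rightarrow> ('o \<times> 'o \<Rightarrow> 's \<Rightarrow> 'm \<Rightarrow>\<^sub>0 'k) set) \<Rightarrow> nat \<Rightarrow> ('o \<Rightarrow> 'q \<Rightarrow> 'w) set" where
  "ext_btensor C M S Q =
    induced_map C M Q
      (image_complex (btensor C M) (btensor_map C M) (btensor_aug C M) S) (btensor_aug C M)"

end

theory Submission
  imports Defs
begin

text \<open>Every map on Ext in the diagram comes from a functor applied to a resolution, so two of them agree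
  as soon as the chain maps involved lift the same homomorphism. The overcategories \<open>\<nabla>/(x, y)\<close> are
  disjoint unions of categories with a terminal object, hence \<open>LK\<close> along \<open>\<nabla>\<close> is exact, and \<open>LK\<close>
  along \<open>t\<close> is a natural retract of the composite of \<open>LK\<close> along \<open>\<nabla>\<close> with \<open>- \<otimes>\<^bsub>kC\<^esub> k\<close>; so both turn the bar
  resolution into resolutions. The assignment \<open>[\<alpha>, (\<mu>, \<gamma>), v] \<otimes> w \<mapsto> [\<alpha>, \<mu>, v] \<otimes> M(\<mu> \<alpha> \<gamma>) w\<close> is a
  homomorphism from \<open>LK\<^sub>\<nabla> G \<otimes>\<^bsub>kC\<^esub> M\<close> to \<open>LK\<^sub>t G \<otimes> M\<close>, natural in \<open>G\<close> and compatible with the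
  augmentations, and it makes both composites pull back one and the same cocycle along lifts of the
  identity of \<open>M\<close>. The map induced by \<open>LK\<close> along \<open>t\<close> is bijective because \<open>Hom(LK\<^sub>t G, k) = Hom(G, k)\<close>,
  and the one induced by \<open>LK\<close> along \<open>\<nabla>\<close> is injective because, for \<open>M = k\<close>, it is the first factor
  of this bijection.\<close>

section \<open>Vector spaces\<close>

text \<open>Lifts and their homotopies need projectivity in the source but only exactness in the
  target. So the image of a resolution under a tensor product with \<open>M\<close> need not consist
  of projectives, but its exactness has to be earned. It comes from splittings, which consist of
  maps and therefore survive additive functors: over the single identity at an object every
  resolution of the constant functor splits, and over the pairs \<open>(x, y)\<close> with
  \<open>x\<close> fixed a resolution of \<open>kC\<close> splits, by the Yoneda lemma.
  \<open>LK\<close> along \<open>t\<close> admits no such argument, as colimits over the categories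
  \<open>t/x\<close> are not exact in general; this is why exactness is inherited there through a
  retraction. Two features of the setting shape the details. Projectivity cannot quantify over
  modules on all types, so it is used through finite dual bases. Classes are sets of total functions
  and operations on them are unions over representatives, so each evaluation rests on showing that
  such a union is constant.\<close>

abbreviation "single \<equiv> Poly_Mapping.single"
abbreviation "keys \<equiv> Poly_Mapping.keys"
abbreviation "lookup \<equiv> Poly_Mapping.lookup"
abbreviation "car G x \<equiv> carrier (sp G x)"

lemma fld_simps [simp]:
  "carrier (fld :: 'k::field ring) = UNIV" "x \<otimes>\<^bsub>fld\<^esub> y = x * (y::'k)" "x \<oplus>\<^bsub>fld\<^esub> y = x + (y::'k)"
  "\<one>\<^bsub>fld\<^esub> = (1::'k)" "\<zero>\<^bsub>fld\<^esub> = (0::'k)"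
  by (simp_all add: ring_of_type_algebra_def)

lemma fld_minus [simp]: "\<ominus>\<^bsub>fld\<^esub> (x::'k::field) = - x"
proof -
  interpret F: field "fld :: 'k ring" by (rule field_from_type_algebra)
  show ?thesis by (rule F.minus_equality) auto
qed

abbreviation vs :: "('k::field, 'v) module => bool" where
  "vs V \<equiv> Module.module fld V"

lemma vs_vectorspace: "vectorspace fld V = vs V"
  unfolding vectorspace_def using field_from_type_algebra by auto

text \<open>Inverses are required in the form \<open>(-1) \<odot> x\<close>: the records for
  quotients and Ext spaces provide sums, zero and multiples but no negation, and subtraction is
  written in this way everywhere below.\<close>

lemma vsI:
  fixes V :: "('k::field, 'v) module"
  assumes "\<zero>\<^bsub>V\<^esub> \<in> carrier V"
    and "\<And>x y. x \<in> carrier V ==> y \<in> carrier V ==> x \<oplus>\<^bsub>V\<^esub> y \<in> carrier V"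
    and "\<And>c x. x \<in> carrier V ==> c \<odot>\<^bsub>V\<^esub> x \<in> carrier V"
    and "\<And>x y z. [|x \<in> carrier V; y \<in> carrier V; z \<in> carrier V|] ==> x \<oplus>\<^bsub>V\<^esub> y \<oplus>\<^bsub>V\<^esub> z = x \<oplus>\<^bsub>V\<^esub> (y \<oplus>\<^bsub>V\<^esub> z)"
    and "\<And>x y. x \<in> carrier V ==> y \<in> carrier V ==> x \<oplus>\<^bsub>V\<^esub> y = y \<oplus>\<^bsub>V\<^esub> x"
    and "\<And>x. x \<in> carrier V ==> \<zero>\<^bsub>V\<^esub> \<oplus>\<^bsub>V\<^esub> x = x"
    and "\<And>x. x \<in> carrier V ==> x \<oplus>\<^bsub>V\<^esub> (-1) \<odot>\<^bsub>V\<^esub> x = \<zero>\<^bsub>V\<^esub>"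
    and "\<And>c x y. x \<in> carrier V ==> y \<in> carrier V ==> c \<odot>\<^bsub>V\<^esub> (x \<oplus>\<^bsub>V\<^esub> y) = c \<odot>\<^bsub>V\<^esub> x \<oplus>\<^bsub>V\<^esub> c \<odot>\<^bsub>V\<^esub> y"
    and "\<And>c d x. x \<in> carrier V ==> (c + d) \<odot>\<^bsub>V\<^esub> x = c \<odot>\<^bsub>V\<^esub> x \<oplus>\<^bsub>V\<^esub> d \<odot>\<^bsub>V\<^esub> x"
    and "\<And>c d x. x \<in> carrier V ==> (c * d) \<odot>\<^bsub>V\<^esub> x = c \<odot>\<^bsub>V\<^esub> (d \<odot>\<^bsub>V\<^esub> x)"
    and "\<And>x. x \<in> carrier V ==> 1 \<odot>\<^bsub>V\<^esub> x = x"
  shows "vs V"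
proof (rule moduleI)
  show "cring (fld :: 'k ring)" by (rule cring_from_type_algebra)
  show "abelian_group V"
  proof (rule abelian_groupI)
    fix x assume "x \<in> carrier V"
    then show "\<exists>y\<in>carrier V. y \<oplus>\<^bsub>V\<^esub> x = \<zero>\<^bsub>V\<^esub>"
      using assms(3)[of x "-1"] assms(5)[of x "(-1) \<odot>\<^bsub>V\<^esub> x"] assms(7)[of x] by metis
  qed (use assms in auto)
qed (use assms in auto)

section \<open>Calculation rules in a single vector space\<close>

context
  fixes V :: "('k::field, 'v) module"
  assumes V: "vs V"
begin

interpretation V: Module.module fld V by (rule V)

text \<open>These rules carry \<open>vs V\<close> as a premise because \<open>V\<close> is usually a
  value \<open>sp M x\<close> at a bound object, where a locale interpretation cannot be made once
  and for all.\<close>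

lemma vs_closed:
  "\<zero>\<^bsub>V\<^esub> \<in> carrier V"
  "x \<in> carrier V ==> y \<in> carrier V ==> x \<oplus>\<^bsub>V\<^esub> y \<in> carrier V"
  "x \<in> carrier V ==> c \<odot>\<^bsub>V\<^esub> x \<in> carrier V"
  "f \<in> A \<rightarrow> carrier V ==> finsum V f A \<in> carrier V"
  by auto

lemma vs_ac:
  "[|x \<in> carrier V; y \<in> carrier V; z \<in> carrier V|] ==> x \<oplus>\<^bsub>V\<^esub> y \<oplus>\<^bsub>V\<^esub> z = x \<oplus>\<^bsub>V\<^esub> (y \<oplus>\<^bsub>V\<^esub> z)"
  "[|x \<in> carrier V; y \<in> carrier V|] ==> x \<oplus>\<^bsub>V\<^esub> y = y \<oplus>\<^bsub>V\<^esub> x"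
  "[|x \<in> carrier V; y \<in> carrier V; z \<in> carrier V|] ==> x \<oplus>\<^bsub>V\<^esub> (y \<oplus>\<^bsub>V\<^esub> z) = y \<oplus>\<^bsub>V\<^esub> (x \<oplus>\<^bsub>V\<^esub> z)"
  by (auto simp: V.a_ac)

lemma vs_zero:
  "x \<in> carrier V ==> \<zero>\<^bsub>V\<^esub> \<oplus>\<^bsub>V\<^esub> x = x" "x \<in> carrier V ==> x \<oplus>\<^bsub>V\<^esub> \<zero>\<^bsub>V\<^esub> = x"
  "x \<in> carrier V ==> 0 \<odot>\<^bsub>V\<^esub> x = \<zero>\<^bsub>V\<^esub>" "c \<odot>\<^bsub>V\<^esub> \<zero>\<^bsub>V\<^esub> = \<zero>\<^bsub>V\<^esub>"
  using V.smult_l_null[of x] by auto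

lemma vs_smult:
  "x \<in> carrier V ==> y \<in> carrier V ==> c \<odot>\<^bsub>V\<^esub> (x \<oplus>\<^bsub>V\<^esub> y) = c \<odot>\<^bsub>V\<^esub> x \<oplus>\<^bsub>V\<^esub> c \<odot>\<^bsub>V\<^esub> y"
  "x \<in> carrier V ==> (c + d) \<odot>\<^bsub>V\<^esub> x = c \<odot>\<^bsub>V\<^esub> x \<oplus>\<^bsub>V\<^esub> d \<odot>\<^bsub>V\<^esub> x"
  "x \<in> carrier V ==> c \<odot>\<^bsub>V\<^esub> (d \<odot>\<^bsub>V\<^esub> x) = (c * d) \<odot>\<^bsub>V\<^esub> x"
  "x \<in> carrier V ==> 1 \<odot>\<^bsub>V\<^esub> x = x"
  using V.smult_r_distr[of c x y] V.smult_l_distr[of c d x] V.smult_assoc1[of c d x] V.smult_one[of x]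
  by auto

lemma vs_cancel:
  "x \<in> carrier V ==> x \<oplus>\<^bsub>V\<^esub> (-1) \<odot>\<^bsub>V\<^esub> x = \<zero>\<^bsub>V\<^esub>"
  "x \<in> carrier V ==> (-1) \<odot>\<^bsub>V\<^esub> x \<oplus>\<^bsub>V\<^esub> x = \<zero>\<^bsub>V\<^esub>"
  "[|x \<in> carrier V; y \<in> carrier V|] ==> x \<oplus>\<^bsub>V\<^esub> ((-1) \<odot>\<^bsub>V\<^esub> x \<oplus>\<^bsub>V\<^esub> y) = y"
  "[|x \<in> carrier V; y \<in> carrier V|] ==> (-1) \<odot>\<^bsub>V\<^esub> x \<oplus>\<^bsub>V\<^esub> (x \<oplus>\<^bsub>V\<^esub> y) = y"
proof -
  show *: "x \<oplus>\<^bsub>V\<^esub> (-1) \<odot>\<^bsub>V\<^esub> x = \<zero>\<^bsub>V\<^esub>" "(-1) \<odot>\<^bsub>V\<^esub> x \<oplus>\<^bsub>V\<^esub> x = \<zero>\<^bsub>V\<^esub>" if "x \<in> carrier V" for x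
    using vs_smult(2)[of x 1 "-1"] vs_smult(2)[of x "-1" 1] vs_smult(4)[of x] vs_zero(3)[of x] that
    by auto
  show "x \<oplus>\<^bsub>V\<^esub> ((-1) \<odot>\<^bsub>V\<^esub> x \<oplus>\<^bsub>V\<^esub> y) = y" if "x \<in> carrier V" "y \<in> carrier V"
    using that * by (simp flip: vs_ac(1) add: vs_closed vs_zero)
  show "(-1) \<odot>\<^bsub>V\<^esub> x \<oplus>\<^bsub>V\<^esub> (x \<oplus>\<^bsub>V\<^esub> y) = y" if "x \<in> carrier V" "y \<in> carrier V"
    using that * by (simp flip: vs_ac(1) add: vs_closed vs_zero)
qed

lemma vs_eq_iff:
  assumes "x \<in> carrier V" "y \<in> carrier V"
  shows "x \<oplus>\<^bsub>V\<^esub> (-1) \<odot>\<^bsub>V\<^esub> y = \<zero>\<^bsub>V\<^esub> \<longleftrightarrow> x = y"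
  using assms vs_cancel(3)[of y x] vs_ac(2)[of x "(-1) \<odot>\<^bsub>V\<^esub> y"] vs_cancel(1)[of x]
  by (auto simp: vs_closed vs_zero)

lemma vs_a_minus: "x \<in> carrier V ==> \<ominus>\<^bsub>V\<^esub> x = (-1) \<odot>\<^bsub>V\<^esub> x"
  using V.smult_l_minus[of 1 x] V.smult_one[of x] by simp

lemma vs_comm_monoid: "abelian_monoid V" "abelian_group V" by unfold_locales

end

section \<open>Linear maps, as total functions that matter only on the carrier\<close>

abbreviation lhom :: "('k::field, 'v) module => ('k, 'w) module => ('v => 'w) set" where
  "lhom V W \<equiv> module_hom fld V W"

lemma lhomI:
  assumes "\<And>v. v \<in> carrier V ==> h v \<in> carrier W"
    and "\<And>v w. v \<in> carrier V ==> w \<in> carrier V ==> h (v \<oplus>\<^bsub>V\<^esub> w) = h v \<oplus>\<^bsub>W\<^esub> h w"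
    and "\<And>c v. v \<in> carrier V ==> h (c \<odot>\<^bsub>V\<^esub> v) = c \<odot>\<^bsub>W\<^esub> h v"
  shows "h \<in> lhom V W"
  using assms by (auto simp: module_hom_def ring_of_type_algebra_def)

lemma lhomD:
  assumes "h \<in> lhom V W"
  shows "v \<in> carrier V ==> h v \<in> carrier W"
    and "v \<in> carrier V ==> w \<in> carrier V ==> h (v \<oplus>\<^bsub>V\<^esub> w) = h v \<oplus>\<^bsub>W\<^esub> h w"
    and "v \<in> carrier V ==> h (c \<odot>\<^bsub>V\<^esub> v) = c \<odot>\<^bsub>W\<^esub> h v"
  using assms by (auto simp: module_hom_def ring_of_type_algebra_def)

lemma lhom_zero: "h \<in> lhom V W ==> vs V ==> vs W ==> h \<zero>\<^bsub>V\<^esub> = \<zero>\<^bsub>W\<^esub>"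
  by (metis lhomD(1,3) vs_closed(1) vs_zero(3))

lemma lhom_id: "(\<lambda>v. v) \<in> lhom V V"
  by (auto simp: module_hom_def)

lemma lhom_comp: "h \<in> lhom V W ==> h' \<in> lhom W Y ==> (\<lambda>v. h' (h v)) \<in> lhom V Y"
  by (auto simp: module_hom_def Pi_iff)

lemma lhom_cong: "h \<in> lhom V W ==> vs V ==> (\<And>v. v \<in> carrier V ==> h' v = h v) ==> h' \<in> lhom V W"
  by (rule lhomI) (simp_all add: lhomD vs_closed)

lemma lhom_add:
  "h \<in> lhom V W ==> h' \<in> lhom V W ==> vs W ==> (\<lambda>v. h v \<oplus>\<^bsub>W\<^esub> h' v) \<in> lhom V W"
  by (rule lhomI) (auto simp: lhomD vs_closed vs_ac vs_smult)

lemma lhom_scale: "h \<in> lhom V W ==> vs W ==> (\<lambda>v. c \<odot>\<^bsub>W\<^esub> h v) \<in> lhom V W"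
  by (rule lhomI) (auto simp: lhomD vs_closed vs_ac vs_smult mult.commute)

lemma lhom_const_zero: "vs W ==> (\<lambda>v. \<zero>\<^bsub>W\<^esub>) \<in> lhom V W"
  by (rule lhomI) (auto simp: vs_closed vs_zero)

lemma lhom_finsum:
  assumes "h \<in> lhom V W" "vs V" "vs W" "finite A" "f \<in> A \<rightarrow> carrier V"
  shows "h (finsum V f A) = finsum W (\<lambda>a. h (f a)) A"
proof -
  interpret V: Module.module fld V by fact
  interpret W: Module.module fld W by fact
  from assms(4,5) show ?thesis
  proof (induction A)
    case empty then show ?case using lhom_zero[OF assms(1-3)] by simp
  next
    case (insert a A)
    then have "f a \<in> carrier V" "f \<in> A \<rightarrow> carrier V" by auto
    then show ?case using insert lhomD[OF assms(1)]
      by (simp add: Pi_iff)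
  qed
qed

subsection \<open>Free spaces\<close>

abbreviation scale :: "'k::field => ('b \<Rightarrow>\<^sub>0 'k) => ('b \<Rightarrow>\<^sub>0 'k)" where
  "scale c \<equiv> Poly_Mapping.map ((*) c)"

lemma lookup_scale [simp]: "lookup (scale c f) x = c * lookup f x"
  by (simp add: Poly_Mapping.map.rep_eq when_def)

lemma free_space_simps [simp]:
  "f \<in> carrier (free_space U) \<longleftrightarrow> keys f \<subseteq> U"
  "\<zero>\<^bsub>free_space U\<^esub> = 0" "f \<oplus>\<^bsub>free_space U\<^esub> g = f + g" "c \<odot>\<^bsub>free_space U\<^esub> f = scale c f"
  by (simp_all add: free_space_def)

lemma scale_simps:
  "scale c (f + g) = scale c f + scale c g" "scale (c + d) f = scale c f + scale d f"
  "scale (c * d) f = scale c (scale d f)" "scale 1 f = f" "scale (-1) f = - f" "scale 0 f = 0"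
  by (auto intro!: poly_mapping_eqI simp: lookup_add algebra_simps)

lemma keys_scale: "keys (scale (c::'k::field) f) \<subseteq> keys f"
  by (auto simp: in_keys_iff)

lemma vs_free_space: "vs (free_space U)"
  by (rule vsI)
     (auto simp: scale_simps ac_simps dest!: subsetD[OF Poly_Mapping.keys_add] subsetD[OF keys_scale])

lemma poly_mapping_sum_single:
  "(f :: 'b \<Rightarrow>\<^sub>0 'k::field) = (\<Sum>u\<in>keys f. single u (lookup f u))"
  by (rule poly_mapping_eqI) (auto simp: lookup_sum lookup_single when_def in_keys_iff sum.delta)

lemma free_induct [consumes 1, case_names zero single add]:
  fixes f :: "'b \<Rightarrow>\<^sub>0 'k::field"
  assumes "keys f \<subseteq> U"
    and "P 0" "\<And>u c. u \<in> U ==> P (single u c)"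
    and "\<And>f g. [|P f; P g; keys f \<subseteq> U; keys g \<subseteq> U|] ==> P (f + g)"
  shows "P f"
proof -
  have "P (\<Sum>u\<in>A. single u (lookup f u)) \<and>
      keys (\<Sum>u\<in>A. single u (lookup f u)) \<subseteq> U"
    if "finite A" "A \<subseteq> U" for A
    using that
  proof (induction A)
    case (insert a A)
    then have *: "keys (single a (lookup f a)) \<subseteq> U" by auto
    with insert have "P (single a (lookup f a) +
        (\<Sum>u\<in>A. single u (lookup f u)))"
      by (intro assms(4) assms(3)) auto
    with insert * show ?case
      using Poly_Mapping.keys_add[of "single a (lookup f a)"
          "\<Sum>u\<in>A. single u (lookup f u)"] by auto
  qed (use assms(2) in auto)
  from this[of "keys f"] assms(1) show ?thesis
    using poly_mapping_sum_single[of f] by simp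
qed

lemma free_ext:
  assumes "h \<in> lhom (free_space U) V" "h' \<in> lhom (free_space U) V" "vs V"
    and "\<And>u. u \<in> U ==> h (single u 1) = h' (single u 1)"
    and "keys f \<subseteq> U"
  shows "h f = h' f"
  using assms(5)
proof (induction f rule: free_induct)
  case zero
  show ?case using lhom_zero[OF assms(1) vs_free_space assms(3)]
      lhom_zero[OF assms(2) vs_free_space assms(3)] by simp
next
  case (single u c)
  then show ?case
    using lhomD(3)[OF assms(1), of "single u 1" c]
      lhomD(3)[OF assms(2), of "single u 1" c] assms(4)[of u] by simp
next
  case (add f g)
  then show ?case
    using lhomD(2)[OF assms(1), of f g] lhomD(2)[OF assms(2), of f g] by simp
qed

text \<open>The expression that \<open>pres_out\<close> evaluates on a representative, named so that
  it can be treated as a linear map on the free space.\<close>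

definition lin :: "('k::field, 'v) module => ('b => 'v) => ('b \<Rightarrow>\<^sub>0 'k) => 'v" where
  "lin V ph f = (\<Oplus>\<^bsub>V\<^esub>x\<in>keys f. lookup f x \<odot>\<^bsub>V\<^esub> ph x)"

context
  fixes V :: "('k::field, 'v) module" and ph :: "'b => 'v" and U :: "'b set"
  assumes V: "vs V" and ph: "\<And>u. u \<in> U ==> ph u \<in> carrier V"
begin

interpretation V: Module.module fld V by (rule V)

text \<open>Summing over a set larger than the support allows two elements with different supports
  to be added under one sum; the extra terms have coefficient zero.\<close>

lemma lin_superset:
  assumes "finite A" "keys f \<subseteq> A" "A \<subseteq> U"
  shows "lin V ph f = (\<Oplus>\<^bsub>V\<^esub>x\<in>A. lookup f x \<odot>\<^bsub>V\<^esub> ph x)"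
  unfolding lin_def
  by (rule V.add.finprod_mono_neutral_cong_left)
     (use assms ph V in \<open>auto simp: in_keys_iff vs_zero intro!: vs_closed\<close>)

lemma lin_single: "u \<in> U ==> lin V ph (single u c) = c \<odot>\<^bsub>V\<^esub> ph u"
  by (subst lin_superset[of "{u}"]) (use ph V in \<open>auto simp: vs_zero intro!: vs_closed\<close>)

lemma lin_lhom: "lin V ph \<in> lhom (free_space U) V"
proof (rule lhomI)
  fix f g :: "'b \<Rightarrow>\<^sub>0 'k" and c
  assume f: "f \<in> carrier (free_space U)"
  then have mem: "(\<lambda>x. lookup h x \<odot>\<^bsub>V\<^esub> ph x) \<in> keys f \<rightarrow> carrier V" for h :: "'b \<Rightarrow>\<^sub>0 'k"
    using ph V by (auto intro!: vs_closed)
  show "lin V ph f \<in> carrier V" unfolding lin_def by (rule V.finsum_closed[OF mem])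
  have "lin V ph (scale c f) = (\<Oplus>\<^bsub>V\<^esub>x\<in>keys f. lookup (scale c f) x \<odot>\<^bsub>V\<^esub> ph x)"
    by (rule lin_superset) (use f keys_scale[of c f] in auto)
  also have "\<dots> = (\<Oplus>\<^bsub>V\<^esub>x\<in>keys f. c \<odot>\<^bsub>V\<^esub> (lookup f x \<odot>\<^bsub>V\<^esub> ph x))"
    by (rule V.finsum_cong') (use f ph V in \<open>auto simp: vs_smult intro!: vs_closed\<close>)
  also have "\<dots> = c \<odot>\<^bsub>V\<^esub> lin V ph f"
    unfolding lin_def by (rule V.finsum_smult_ldistr[symmetric]) (use f ph V in \<open>auto intro!: vs_closed\<close>)
  finally show "lin V ph (c \<odot>\<^bsub>free_space U\<^esub> f) = c \<odot>\<^bsub>V\<^esub> lin V ph f" by simp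
  assume g: "g \<in> carrier (free_space U)"
  let ?A = "keys f \<union> keys g"
  have "lin V ph (f + g) = (\<Oplus>\<^bsub>V\<^esub>x\<in>?A. lookup (f + g) x \<odot>\<^bsub>V\<^esub> ph x)"
    by (rule lin_superset) (use f g Poly_Mapping.keys_add[of f g] in auto)
  also have "\<dots> = (\<Oplus>\<^bsub>V\<^esub>x\<in>?A. lookup f x \<odot>\<^bsub>V\<^esub> ph x \<oplus>\<^bsub>V\<^esub> lookup g x \<odot>\<^bsub>V\<^esub> ph x)"
    by (rule V.finsum_cong') (use f g ph V in \<open>auto simp: lookup_add vs_smult intro!: vs_closed\<close>)
  also have "\<dots> = (\<Oplus>\<^bsub>V\<^esub>x\<in>?A. lookup f x \<odot>\<^bsub>V\<^esub> ph x) \<oplus>\<^bsub>V\<^esub> (\<Oplus>\<^bsub>V\<^esub>x\<in>?A. lookup g x \<odot>\<^bsub>V\<^esub> ph x)"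
    by (rule V.finsum_addf) (use f g ph V in \<open>auto intro!: vs_closed\<close>)
  also have "(\<Oplus>\<^bsub>V\<^esub>x\<in>?A. lookup f x \<odot>\<^bsub>V\<^esub> ph x) = lin V ph f"
    by (rule lin_superset[symmetric]) (use f g in auto)
  also have "(\<Oplus>\<^bsub>V\<^esub>x\<in>?A. lookup g x \<odot>\<^bsub>V\<^esub> ph x) = lin V ph g"
    by (rule lin_superset[symmetric]) (use f g in auto)
  finally show "lin V ph (f \<oplus>\<^bsub>free_space U\<^esub> g) = lin V ph f \<oplus>\<^bsub>V\<^esub> lin V ph g" by simp
qed

end

lemma lin_comp:
  assumes "h \<in> lhom V W" "vs V" "vs W" "\<And>u. u \<in> U ==> ph u \<in> carrier V" "keys f \<subseteq> U"
  shows "h (lin V ph f) = lin W (\<lambda>u. h (ph u)) f"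
proof (rule free_ext[of "\<lambda>f. h (lin V ph f)"])
  show "(\<lambda>f. h (lin V ph f)) \<in> lhom (free_space U) W"
    by (rule lhom_comp[OF lin_lhom assms(1)]) (use assms in auto)
  show "lin W (\<lambda>u. h (ph u)) \<in> lhom (free_space U) W"
    by (rule lin_lhom) (use assms lhomD(1)[OF assms(1)] in auto)
qed (use assms lhomD(1)[OF assms(1)] in \<open>auto simp: lin_single[where U = U] vs_smult\<close>)

lemma lin_eq:
  assumes "h \<in> lhom (free_space U) V" "vs V" "keys f \<subseteq> U"
  shows "lin V (\<lambda>u. h (single u 1)) f = h f"
  by (rule free_ext[OF lin_lhom assms(1,2)])
     (use assms lhomD(1)[OF assms(1)] in \<open>auto simp: lin_single[where U = U] vs_smult\<close>)

lemma finsum_free_space: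
  assumes "finite A" "\<And>a. a \<in> A ==> keys (f a) \<subseteq> U"
  shows "finsum (free_space U) f A = sum f A"
proof -
  interpret V: Module.module fld "free_space U" by (rule vs_free_space)
  from assms show ?thesis by (induction A) (auto simp: Pi_iff)
qed

lemma lin_free_space:
  assumes "\<And>x. x \<in> keys f ==> keys (ph x) \<subseteq> U"
  shows "lin (free_space U) ph f = (\<Sum>x\<in>keys f. scale (lookup f x) (ph x))"
  unfolding lin_def free_space_simps
  by (rule finsum_free_space) (use assms keys_scale in fastforce)+

lemma push_lhom:
  fixes U :: "'b set"
  assumes "\<And>u. u \<in> U ==> ph u \<in> U'"
  shows "push ph \<in> lhom (free_space U :: ('k::field, _) module) (free_space U')"
proof (rule lhom_cong[OF lin_lhom[where ph = "\<lambda>u. single (ph u) 1"] vs_free_space])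
  fix v :: "'b \<Rightarrow>\<^sub>0 'k" assume "v \<in> carrier (free_space U)"
  then show "push ph v = lin (free_space U') (\<lambda>u. single (ph u) 1) v"
    using assms by (subst lin_free_space) (auto simp: push_def)
qed (use assms vs_free_space in auto)

lemma push_single [simp]: "push ph (single u c) = single (ph u) c"
  by (cases "c = 0") (auto simp: push_def)

subsection \<open>Spaces given by generators and relations\<close>

context
  fixes V :: "('k::field, 'v) module" and W
  assumes V: "vs V" and W: "submodule fld W V"
begin

interpretation V: Module.module fld V by (rule V)
interpretation W: submodule fld W V by (rule W)

lemma sub_additive: "additive_subgroup W V"
  unfolding additive_subgroup_def
proof (rule V.add.subgroupI)
  show "\<ominus>\<^bsub>V\<^esub> w \<in> W" if "w \<in> W" for w
    using that W.subset vs_a_minus[OF V, of w] W.smult_closed[of "-1" w] by auto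
  show "W \<noteq> {}" using W.zero_closed by blast
qed (use W.subset in auto)

lemma sub_abelian: "abelian_subgroup W V"
  by (rule abelian_subgroupI3) (auto simp: sub_additive V.abelian_group_axioms)

interpretation Q: abelian_subgroup W V by (rule sub_abelian)

lemma coset_eq_iff:
  assumes "v \<in> carrier V" "w \<in> carrier V"
  shows "W +>\<^bsub>V\<^esub> v = W +>\<^bsub>V\<^esub> w \<longleftrightarrow> v \<oplus>\<^bsub>V\<^esub> (-1) \<odot>\<^bsub>V\<^esub> w \<in> W"
proof -
  have "W +>\<^bsub>V\<^esub> v = W +>\<^bsub>V\<^esub> w \<longleftrightarrow> v \<in> W +>\<^bsub>V\<^esub> w"
    using Q.a_repr_independence'[of v w] Q.a_rcos_self[of v] assms by auto
  also have "\<dots> \<longleftrightarrow> v \<ominus>\<^bsub>V\<^esub> w \<in> W"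
    using Q.a_rcos_module assms by (simp add: a_minus_def)
  finally show ?thesis using assms V by (simp add: a_minus_def vs_a_minus)
qed

lemma quot_space_simps:
  "\<zero>\<^bsub>quot_space V W\<^esub> = W +>\<^bsub>V\<^esub> \<zero>\<^bsub>V\<^esub>"
  "v \<in> carrier V ==> w \<in> carrier V ==>
    (W +>\<^bsub>V\<^esub> v) \<oplus>\<^bsub>quot_space V W\<^esub> (W +>\<^bsub>V\<^esub> w) = W +>\<^bsub>V\<^esub> (v \<oplus>\<^bsub>V\<^esub> w)"
  "v \<in> carrier V ==> c \<odot>\<^bsub>quot_space V W\<^esub> (W +>\<^bsub>V\<^esub> v) = W +>\<^bsub>V\<^esub> (c \<odot>\<^bsub>V\<^esub> v)"
proof -
  show "\<zero>\<^bsub>quot_space V W\<^esub> = W +>\<^bsub>V\<^esub> \<zero>\<^bsub>V\<^esub>"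
    by (simp add: quot_space_def V.a_coset_add_zero Q.a_subset)
  show "(W +>\<^bsub>V\<^esub> v) \<oplus>\<^bsub>quot_space V W\<^esub> (W +>\<^bsub>V\<^esub> w) = W +>\<^bsub>V\<^esub> (v \<oplus>\<^bsub>V\<^esub> w)"
    if "v \<in> carrier V" "w \<in> carrier V"
    using that by (simp add: quot_space_def Q.a_rcos_sum)
  show "c \<odot>\<^bsub>quot_space V W\<^esub> (W +>\<^bsub>V\<^esub> v) = W +>\<^bsub>V\<^esub> (c \<odot>\<^bsub>V\<^esub> v)" if v: "v \<in> carrier V"
  proof -
    \<comment> \<open>Multiplication by \<open>c\<close> is a union over all representatives
      \<open>a\<close> of the coset; it is a single coset because \<open>c\<close> times the
      difference of \<open>a\<close> and \<open>v\<close> stays in \<open>W\<close>.\<close>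
    have "W +>\<^bsub>V\<^esub> (c \<odot>\<^bsub>V\<^esub> a) = W +>\<^bsub>V\<^esub> (c \<odot>\<^bsub>V\<^esub> v)" if "a \<in> W +>\<^bsub>V\<^esub> v" for a
    proof -
      have a: "a \<in> carrier V" using that v Q.a_elemrcos_carrier by blast
      have "W +>\<^bsub>V\<^esub> a = W +>\<^bsub>V\<^esub> v" using that v Q.a_repr_independence' by blast
      then have "a \<oplus>\<^bsub>V\<^esub> (-1) \<odot>\<^bsub>V\<^esub> v \<in> W" using coset_eq_iff a v by blast
      then have "c \<odot>\<^bsub>V\<^esub> (a \<oplus>\<^bsub>V\<^esub> (-1) \<odot>\<^bsub>V\<^esub> v) \<in> W" by (auto intro: W.smult_closed)
      also have "c \<odot>\<^bsub>V\<^esub> (a \<oplus>\<^bsub>V\<^esub> (-1) \<odot>\<^bsub>V\<^esub> v) = c \<odot>\<^bsub>V\<^esub> a \<oplus>\<^bsub>V\<^esub> (-1) \<odot>\<^bsub>V\<^esub> (c \<odot>\<^bsub>V\<^esub> v)"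
        using a v V by (simp add: vs_smult vs_closed)
      finally show ?thesis using a v V by (subst coset_eq_iff) (auto intro: vs_closed)
    qed
    moreover have "W +>\<^bsub>V\<^esub> v \<noteq> {}" using Q.a_rcos_self[OF v] by auto
    ultimately show ?thesis by (auto simp: quot_space_def)
  qed
qed

lemma carrier_quot_space: "carrier (quot_space V W) = (\<lambda>v. W +>\<^bsub>V\<^esub> v) ` carrier V"
  by (auto simp: quot_space_def A_RCOSETS_def' )

lemma vs_quot_space: "vs (quot_space V W)"
  by (rule vsI; (unfold carrier_quot_space)?; (elim imageE)?; (hypsubst)?)
     (simp_all add: quot_space_simps vs_closed[OF V] vs_zero[OF V] vs_smult[OF V] vs_ac[OF V] vs_cancel[OF V])

text \<open>A map vanishing on \<open>W\<close> has only one value on each coset, which is what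
  gives \<open>the_elem\<close> in \<open>pres_out\<close> a meaning.\<close>

lemma quot_space_image:
  assumes "h \<in> lhom V Y" "vs Y" "\<And>w. w \<in> W ==> h w = \<zero>\<^bsub>Y\<^esub>" "v \<in> carrier V"
  shows "h ` (W +>\<^bsub>V\<^esub> v) = {h v}"
proof -
  have "h a = h v" if "a \<in> W +>\<^bsub>V\<^esub> v" for a
  proof -
    from that obtain w where w: "w \<in> W" "a = w \<oplus>\<^bsub>V\<^esub> v" by (auto simp: a_r_coset_def')
    have wV: "w \<in> carrier V" using Q.a_subset w(1) by blast
    show ?thesis
      by (simp only: w(2) lhomD(2)[OF assms(1) wV assms(4)] assms(3)[OF w(1)]
          vs_zero(1)[OF assms(2) lhomD(1)[OF assms(1,4)]])
  qed
  then show ?thesis using Q.a_rcos_self[OF assms(4)] by blast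
qed

end

section \<open>Generators and the universal property of a presented space\<close>

definition gen :: "'b set => ('b \<Rightarrow>\<^sub>0 'k::field) set => 'b => ('b \<Rightarrow>\<^sub>0 'k) set" where
  "gen U R u = rel_span U R +>\<^bsub>free_space U\<^esub> single u 1"

context
  fixes U :: "'b set" and R :: "('b \<Rightarrow>\<^sub>0 'k::field) set"
  assumes R: "R \<subseteq> carrier (free_space U)"
begin

interpretation F: Module.module fld "free_space U" by (rule vs_free_space)

lemma rel_span_submodule: "submodule fld (rel_span U R) (free_space U)"
  by (rule F.span_is_submodule[OF R])

lemmas presented_coset =
  quot_space_simps[OF vs_free_space rel_span_submodule, folded presented_def]
  carrier_quot_space[OF vs_free_space rel_span_submodule, folded presented_def]

lemma vs_presented: "vs (presented U R)"
  unfolding presented_def by (rule vs_quot_space[OF vs_free_space rel_span_submodule])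

lemma coset_lhom: "(\<lambda>f. rel_span U R +>\<^bsub>free_space U\<^esub> f) \<in> lhom (free_space U) (presented U R)"
  by (rule lhomI) (simp_all only: presented_coset imageI)

lemma gen_closed: "u \<in> U ==> gen U R u \<in> carrier (presented U R)"
  unfolding gen_def by (rule lhomD(1)[OF coset_lhom]) auto

text \<open>Any member of a coset may serve as its representative; this reduces the union over
  members in \<open>pres_map\<close> to one constant term.\<close>

lemma presented_repr:
  assumes A: "A \<in> carrier (presented U R)"
  shows "g \<in> A ==> keys g \<subseteq> U \<and> A = rel_span U R +>\<^bsub>free_space U\<^esub> g" and "A \<noteq> {}"
proof -
  obtain f where f: "f \<in> carrier (free_space U)" "A = rel_span U R +>\<^bsub>free_space U\<^esub> f"
    using A unfolding presented_coset by blast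
  interpret Q: abelian_subgroup "rel_span U R" "free_space U"
    by (rule sub_abelian[OF vs_free_space rel_span_submodule])
  show "A \<noteq> {}" using Q.a_rcos_self[OF f(1)] f(2) by blast
  show "keys g \<subseteq> U \<and> A = rel_span U R +>\<^bsub>free_space U\<^esub> g" if "g \<in> A"
    using Q.a_elemrcos_carrier[OF f(1), of g] that f(2) Q.a_repr_independence'[OF _ f(1), of g]
    unfolding free_space_simps by blast
qed

lemma presented_ext:
  assumes "h \<in> lhom (presented U R) V" "h' \<in> lhom (presented U R) V" "vs V"
    and "\<And>u. u \<in> U ==> h (gen U R u) = h' (gen U R u)"
    and "z \<in> carrier (presented U R)"
  shows "h z = h' z"
proof -
  from assms(5) obtain f where f: "keys f \<subseteq> U" "z = rel_span U R +>\<^bsub>free_space U\<^esub> f"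
    by (auto simp: presented_coset)
  show ?thesis unfolding f(2)
    by (rule free_ext[OF lhom_comp[OF coset_lhom assms(1)] lhom_comp[OF coset_lhom assms(2)] assms(3) _ f(1)])
       (use assms(4) in \<open>auto simp: gen_def\<close>)
qed

lemma gen_lin: "keys f \<subseteq> U ==>
  lin (presented U R) (gen U R) f = rel_span U R +>\<^bsub>free_space U\<^esub> f"
  using lin_eq[OF coset_lhom vs_presented] by (simp add: gen_def[abs_def])

lemma gen_rel: "r \<in> R ==> lin (presented U R) (gen U R) r = \<zero>\<^bsub>presented U R\<^esub>"
proof -
  assume r: "r \<in> R"
  then have k: "r \<in> carrier (free_space U)" "\<zero>\<^bsub>free_space U\<^esub> \<in> carrier (free_space U)"
    using subsetD[OF R] by auto
  have "r \<in> rel_span U R" using F.in_own_span[OF R] r by blast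
  then have "rel_span U R +>\<^bsub>free_space U\<^esub> r = rel_span U R +>\<^bsub>free_space U\<^esub> \<zero>\<^bsub>free_space U\<^esub>"
    by (subst coset_eq_iff[OF vs_free_space rel_span_submodule k]) (simp add: scale_simps)
  then show ?thesis using k by (subst gen_lin) (auto simp: presented_coset)
qed

text \<open>The kernel of the linear extension is a submodule containing the relations, hence their
  span, so the extension is constant on cosets. Together with \<open>presented_ext\<close> this is
  the universal property on which every construction by generators rests.\<close>

lemma presented_out:
  assumes V: "vs V" and ph: "\<And>u. u \<in> U ==> ph u \<in> carrier V"
    and rel: "\<And>r. r \<in> R ==> lin V ph r = \<zero>\<^bsub>V\<^esub>"
  shows "pres_out V ph \<in> lhom (presented U R) V"
    and "u \<in> U ==> pres_out V ph (gen U R u) = ph u"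
    and "keys f \<subseteq> U ==> pres_out V ph (rel_span U R +>\<^bsub>free_space U\<^esub> f) = lin V ph f"
proof -
  let ?h = "lin V ph"
  have h: "?h \<in> lhom (free_space U) V" by (rule lin_lhom[OF V ph])
  have "mod_hom fld (free_space U) V ?h"
    by (simp add: mod_hom_def mod_hom_axioms_def h V vs_free_space)
  then interpret H: mod_hom fld "free_space U" V ?h .
  have "rel_span U R \<subseteq> H.ker"
    by (rule F.span_is_subset[OF _ H.ker_is_submodule]) (use subsetD[OF R] rel in \<open>auto simp: H.ker_def simp del: free_space_simps\<close>)
  then have z: "?h w = \<zero>\<^bsub>V\<^esub>" if "w \<in> rel_span U R" for w using that by (auto simp: H.ker_def)
  have im: "pres_out V ph (rel_span U R +>\<^bsub>free_space U\<^esub> f) = ?h f" if "keys f \<subseteq> U" for f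
    using quot_space_image[OF vs_free_space rel_span_submodule h V z, of f] that
    by (simp add: pres_out_def lin_def[abs_def])
  then show "keys f \<subseteq> U ==> pres_out V ph (rel_span U R +>\<^bsub>free_space U\<^esub> f) = lin V ph f" .
  show "pres_out V ph (gen U R u) = ph u" if "u \<in> U"
    unfolding gen_def using that V ph[OF that] by (subst im) (auto simp: lin_single[OF V ph] vs_smult)
  show "pres_out V ph \<in> lhom (presented U R) V"
  proof (rule lhomI)
    fix A B c assume "A \<in> carrier (presented U R)"
    then obtain f where f: "f \<in> carrier (free_space U)" "A = rel_span U R +>\<^bsub>free_space U\<^esub> f"
      by (auto simp: presented_coset)
    then have im': "pres_out V ph (rel_span U R +>\<^bsub>free_space U\<^esub> f) = ?h f" if "f \<in> carrier (free_space U)" for f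
      using im that by simp
    note cl = vs_closed[OF vs_free_space]
    show "pres_out V ph A \<in> carrier V" using f h im' lhomD(1)[OF h f(1)] by simp
    show "pres_out V ph (c \<odot>\<^bsub>presented U R\<^esub> A) = c \<odot>\<^bsub>V\<^esub> pres_out V ph A"
      using f(1) lhomD[OF h] unfolding f(2) by (simp only: presented_coset im' cl)
    assume "B \<in> carrier (presented U R)"
    then obtain g where g: "g \<in> carrier (free_space U)" "B = rel_span U R +>\<^bsub>free_space U\<^esub> g"
      by (auto simp: presented_coset)
    show "pres_out V ph (A \<oplus>\<^bsub>presented U R\<^esub> B) = pres_out V ph A \<oplus>\<^bsub>V\<^esub> pres_out V ph B"
      using f(1) g(1) lhomD[OF h] unfolding f(2) g(2) by (simp only: presented_coset im' cl)
  qed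
qed

end

text \<open>The target is itself a vector space, so the universal property gives a map into it;
  \<open>pres_map\<close>, defined through cosets, agrees with that map on every
  representative.\<close>

lemma presented_map:
  assumes R: "R \<subseteq> carrier (free_space U)" and R': "R' \<subseteq> carrier (free_space U')"
    and ph: "\<And>u. u \<in> U ==> ph u \<in> U'"
    and rel: "\<And>r. r \<in> R ==> lin (presented U' R') (\<lambda>u. gen U' R' (ph u)) r = \<zero>\<^bsub>presented U' R'\<^esub>"
  shows "pres_map U' R' ph \<in> lhom (presented U R) (presented U' R')"
    and "u \<in> U ==> pres_map U' R' ph (gen U R u) = gen U' R' (ph u)"
proof -
  let ?V = "presented U' R'" and ?ph = "\<lambda>u. gen U' R' (ph u)"
  have V: "vs ?V" and cl: "\<And>u. u \<in> U ==> ?ph u \<in> carrier ?V"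
    using vs_presented[OF R'] gen_closed[OF R'] ph by auto
  have out: "pres_out ?V ?ph \<in> lhom (presented U R) ?V" "\<And>u. u \<in> U ==> pres_out ?V ?ph (gen U R u) = ?ph u"
    "\<And>f. keys f \<subseteq> U ==> pres_out ?V ?ph (rel_span U R +>\<^bsub>free_space U\<^esub> f) = lin ?V ?ph f"
    using presented_out[OF R V cl rel] by blast+
  have push: "lin ?V ?ph f = rel_span U' R' +>\<^bsub>free_space U'\<^esub> push ph f" if "keys f \<subseteq> U" for f
  proof (rule free_ext[OF lin_lhom _ V _ that])
    show "(\<lambda>f. rel_span U' R' +>\<^bsub>free_space U'\<^esub> push ph f) \<in> lhom (free_space U) ?V"
      by (rule lhom_comp[OF push_lhom coset_lhom[OF R']]) (rule ph)
  qed (use V cl in \<open>auto simp: lin_single[where U = U] vs_smult gen_def\<close>)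
  have eq: "pres_map U' R' ph A = pres_out ?V ?ph A" if A: "A \<in> carrier (presented U R)" for A
    unfolding pres_map_def
  proof (rule UN_constant_eq)
    show "(SOME f. f \<in> A) \<in> A" using presented_repr(2)[OF R A] by (simp add: some_in_eq)
    show "\<forall>g\<in>A. rel_span U' R' +>\<^bsub>free_space U'\<^esub> push ph g = pres_out ?V ?ph A"
    proof
      fix g assume "g \<in> A"
      from presented_repr(1)[OF R A this]
      have kg: "keys g \<subseteq> U" and Ag: "A = rel_span U R +>\<^bsub>free_space U\<^esub> g" by blast+
      show "rel_span U' R' +>\<^bsub>free_space U'\<^esub> push ph g = pres_out ?V ?ph A"
        unfolding Ag by (rule trans[OF push[OF kg, symmetric] out(3)[OF kg, symmetric]])
    qed
  qed
  show "pres_map U' R' ph \<in> lhom (presented U R) ?V"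
    by (rule lhom_cong[OF out(1) vs_presented[OF R]]) (rule eq)
  show "pres_map U' R' ph (gen U R u) = gen U' R' (ph u)" if "u \<in> U"
    by (rule trans[OF eq[OF gen_closed[OF R that]] out(2)[OF that]])
qed

lemma lin_single_at: "vs V ==> ph u \<in> carrier V ==> lin V ph (single u c) = c \<odot>\<^bsub>V\<^esub> ph u"
  by (rule lin_single[of V "{u}"]) auto

lemma push_cong: "(\<And>u. u \<in> keys f ==> ph u = ps u) ==> push ph f = push ps f"
  by (simp add: push_def)

lemma push_push: "push ph (push ps f) = push (\<lambda>u. ph (ps u)) f"
proof (rule free_ext[of "\<lambda>f. push ph (push ps f)" UNIV "free_space UNIV"])
  show "(\<lambda>f. push ph (push ps f)) \<in> lhom (free_space UNIV) (free_space UNIV)"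
    by (rule lhom_comp[OF push_lhom push_lhom]) auto
  show "push (\<lambda>u. ph (ps u)) \<in> lhom (free_space UNIV) (free_space UNIV)"
    by (rule push_lhom) auto
qed (auto simp: vs_free_space)

lemma push_id: "push (\<lambda>u. u) f = f"
  using poly_mapping_sum_single[of f] by (simp add: push_def)

lemma lin_cong:
  assumes "vs V" "\<And>u. u \<in> keys f ==> ph u \<in> carrier V"
    "\<And>u. u \<in> keys f ==> ps u = ph u"
  shows "lin V ps f = lin V ph f"
proof -
  interpret Module.module fld V by fact
  show ?thesis unfolding lin_def
    by (rule finsum_cong') (use assms in \<open>auto intro!: vs_closed\<close>)
qed

lemma lin_push:
  assumes "vs V" "\<And>u. u \<in> keys f ==> ph (ps u) \<in> carrier V"
  shows "lin V ph (push ps f) = lin V (\<lambda>u. ph (ps u)) f"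
proof (rule free_ext[of "\<lambda>f. lin V ph (push ps f)" "keys f"])
  have cl: "u \<in> ps ` keys f ==> ph u \<in> carrier V" for u using assms(2) by auto
  show "(\<lambda>f. lin V ph (push ps f)) \<in> lhom (free_space (keys f)) V"
    by (rule lhom_comp[OF push_lhom lin_lhom[where U = "ps ` keys f"]])
       (use assms(1) cl in auto)
  show "lin V (\<lambda>u. ph (ps u)) \<in> lhom (free_space (keys f)) V"
    by (rule lin_lhom) (use assms in auto)
  show "lin V ph (push ps (single u 1)) = lin V (\<lambda>u. ph (ps u)) (single u 1)"
    if "u \<in> keys f" for u
    using assms(2)[OF that] by (simp add: lin_single_at assms(1))
qed (use assms in auto)

lemma lin_span:
  assumes "vs V" "submodule fld W V" "\<And>u. u \<in> keys f ==> ph u \<in> W"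
  shows "lin V ph f \<in> W"
proof -
  interpret W: submodule fld W V by fact
  have "keys f \<subseteq> keys f" by simp
  then show ?thesis
  proof (induction f rule: free_induct)
    case zero
    show ?case using lhom_zero[OF lin_lhom[OF assms(1), of "{}" ph] vs_free_space assms(1)] by simp
  next
    case (single u c)
    then have "ph u \<in> W" by (rule assms(3))
    then show ?case using W.subset assms(1)
      by (subst lin_single[where U = "{u}"]) (auto intro!: W.smult_closed)
  next
    case (add g h)
    have "lin V ph \<in> lhom (free_space (keys f)) V"
      by (rule lin_lhom) (use assms W.subset in auto)
    from lhomD(2)[OF this, of g h] show ?case using add by auto
  qed
qed

section \<open>Functors to vector spaces\<close>

text \<open>\<open>kmodule\<close> without finite dimension. Kan extensions and tensor products are
  quotients of free spaces on sets of vectors, so finiteness is left aside here and recovered, where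
  projectivity demands it, from a finite dual basis.\<close>

definition fmod :: "('o, 'm) category => ('o, 'm, 'k::field, 'v) kfunctor => bool" where
  "fmod D M \<longleftrightarrow>
    (\<forall>x\<in>Obj D. vs (sp M x)) \<and>
    (\<forall>f\<in>Arr D. act M f \<in> lhom (sp M (Dom D f)) (sp M (Cod D f))) \<and>
    (\<forall>x\<in>Obj D. \<forall>v\<in>car M x. act M (Ident D x) v = v) \<and>
    (\<forall>f\<in>Arr D. \<forall>g\<in>Arr D. Dom D g = Cod D f \<longrightarrow>
      (\<forall>v\<in>car M (Dom D f). act M (Comp D g f) v = act M g (act M f v)))"

lemma kmodule_iff:
  "kmodule D M \<longleftrightarrow> fmod D M \<and> (\<forall>x\<in>Obj D. vectorspace.fin_dim fld (sp M x))"
  unfolding kmodule_def fmod_def vs_vectorspace by blast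

lemma fmodD:
  assumes "fmod D M"
  shows "x \<in> Obj D ==> vs (sp M x)"
    and "f \<in> Arr D ==> act M f \<in> lhom (sp M (Dom D f)) (sp M (Cod D f))"
    and "f \<in> Arr D ==> v \<in> car M (Dom D f) ==> act M f v \<in> car M (Cod D f)"
    and "x \<in> Obj D ==> v \<in> car M x ==> act M (Ident D x) v = v"
    and "[|f \<in> Arr D; g \<in> Arr D; Dom D g = Cod D f; v \<in> car M (Dom D f)|]
      ==> act M (Comp D g f) v = act M g (act M f v)"
proof -
  show h: "f \<in> Arr D ==> act M f \<in> lhom (sp M (Dom D f)) (sp M (Cod D f))"
    using assms by (simp add: fmod_def)
  show "f \<in> Arr D ==> v \<in> car M (Dom D f) ==> act M f v \<in> car M (Cod D f)"
    using lhomD(1)[OF h] .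
qed (use assms in \<open>simp_all add: fmod_def\<close>)

lemma nat_transI:
  assumes "\<And>x. x \<in> Obj D ==> et x \<in> lhom (sp M x) (sp N x)"
    and "\<And>f v. f \<in> Arr D ==> v \<in> car M (Dom D f)
      ==> et (Cod D f) (act M f v) = act N f (et (Dom D f) v)"
  shows "nat_trans D M N et"
  using assms by (auto simp: nat_trans_def)

lemma nat_transD:
  assumes "nat_trans D M N et"
  shows "x \<in> Obj D ==> et x \<in> lhom (sp M x) (sp N x)"
    and "x \<in> Obj D ==> v \<in> car M x ==> et x v \<in> car N x"
    and "f \<in> Arr D ==> v \<in> car M (Dom D f)
      ==> et (Cod D f) (act M f v) = act N f (et (Dom D f) v)"
proof -
  show h: "x \<in> Obj D ==> et x \<in> lhom (sp M x) (sp N x)"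
    using assms by (simp add: nat_trans_def)
  show "x \<in> Obj D ==> v \<in> car M x ==> et x v \<in> car N x"
    using lhomD(1)[OF h] .
qed (use assms in \<open>simp add: nat_trans_def\<close>)

lemma nat_trans_id: "nat_trans D M M (\<lambda>x v. v)"
  by (auto simp: nat_trans_def lhom_id)

context
  fixes D :: "('o, 'm) category"
  assumes D: "finite_category D"
begin

interpretation D: finite_category D by (rule D)

lemma nat_trans_comp:
  "nat_trans D M N et ==> nat_trans D N L th ==> nat_trans D M L (\<lambda>x v. th x (et x v))"
  by (rule nat_transI, rule lhom_comp[OF nat_transD(1) nat_transD(1)]) (simp_all add: nat_transD D.Dom_Obj)

lemma nat_trans_cong:
  assumes "nat_trans D M N et" "fmod D M" "\<And>x v. x \<in> Obj D ==> v \<in> car M x ==> th x v = et x v"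
  shows "nat_trans D M N th"
proof (rule nat_transI)
  show "th x \<in> lhom (sp M x) (sp N x)" if "x \<in> Obj D" for x
    by (rule lhom_cong[OF nat_transD(1)[OF assms(1) that] fmodD(1)[OF assms(2) that]])
       (use assms(3) that in auto)
qed (simp add: assms(3) nat_transD[OF assms(1)] fmodD[OF assms(2)] D.Dom_Obj D.Cod_Obj)

lemma nat_trans_add:
  assumes "nat_trans D M N et" "nat_trans D M N th" "fmod D N"
  shows "nat_trans D M N (\<lambda>x v. et x v \<oplus>\<^bsub>sp N x\<^esub> th x v)"
  by (rule nat_transI)
     (auto simp: nat_transD[OF assms(1)] nat_transD[OF assms(2)] fmodD[OF assms(3)] D.Dom_Obj
       lhomD(2)[OF fmodD(2)[OF assms(3)]] intro!: lhom_add)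

lemma nat_trans_scale:
  assumes "nat_trans D M N et" "fmod D N"
  shows "nat_trans D M N (\<lambda>x v. c \<odot>\<^bsub>sp N x\<^esub> et x v)"
  by (rule nat_transI)
     (auto simp: nat_transD[OF assms(1)] fmodD[OF assms(2)] D.Dom_Obj
       lhomD(3)[OF fmodD(2)[OF assms(2)]] intro!: lhom_scale)

lemma nat_trans_zero:
  assumes "fmod D N"
  shows "nat_trans D M N (\<lambda>x v. \<zero>\<^bsub>sp N x\<^esub>)"
  by (rule nat_transI)
     (auto simp: lhom_zero[OF fmodD(2)[OF assms]] fmodD[OF assms] D.Dom_Obj D.Cod_Obj intro!: lhom_const_zero)

lemma nat_trans_zero_at:
  "nat_trans D M N et ==> fmod D M ==> fmod D N ==> x \<in> Obj D ==> et x \<zero>\<^bsub>sp M x\<^esub> = \<zero>\<^bsub>sp N x\<^esub>"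
  by (rule lhom_zero[OF nat_transD(1)]) (auto simp: fmodD)

end

subsection \<open>Projective functors\<close>

text \<open>A dual basis \<open>(e, c)\<close> over an index set \<open>I\<close>, with \<open>e i\<close> in the value of \<open>P\<close> at \<open>d i\<close>, exhibits
  \<open>P\<close> as a retract of a finite sum of representable functors.\<close>

definition free_gens :: "('o, 'm) category => 'i set => ('i => 'o) => 'o => ('i \<times> 'm) set" where
  "free_gens D I d x = {(i, f). i \<in> I \<and> f \<in> Arr D \<and> Dom D f = d i \<and> Cod D f = x}"

definition dual_basis ::
    "('o, 'm) category => ('o, 'm, 'k::field, 'v) kfunctor => 'i set => ('i => 'o) => ('i => 'v)
      => ('o => 'v => ('i \<times> 'm) \<Rightarrow>\<^sub>0 'k) => bool" where
  "dual_basis D P I d e c \<longleftrightarrow> finite I \<and>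
    (\<forall>i\<in>I. d i \<in> Obj D \<and> e i \<in> car P (d i)) \<and>
    (\<forall>x\<in>Obj D. c x \<in> lhom (sp P x) (free_space (free_gens D I d x))) \<and>
    (\<forall>f\<in>Arr D. \<forall>v\<in>car P (Dom D f).
      c (Cod D f) (act P f v) = push (\<lambda>(i, h). (i, Comp D f h)) (c (Dom D f) v)) \<and>
    (\<forall>x\<in>Obj D. \<forall>v\<in>car P x. lin (sp P x) (\<lambda>(i, f). act P f (e i)) (c x v) = v)"

lemma dual_basisD:
  assumes "dual_basis D P I d e c"
  shows "finite I" "i \<in> I ==> d i \<in> Obj D" "i \<in> I ==> e i \<in> car P (d i)"
    and "x \<in> Obj D ==> c x \<in> lhom (sp P x) (free_space (free_gens D I d x))"
    and "x \<in> Obj D ==> v \<in> car P x ==> keys (c x v) \<subseteq> free_gens D I d x"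
    and "f \<in> Arr D ==> v \<in> car P (Dom D f) ==>
      c (Cod D f) (act P f v) = push (\<lambda>(i, h). (i, Comp D f h)) (c (Dom D f) v)"
    and "x \<in> Obj D ==> v \<in> car P x ==> lin (sp P x) (\<lambda>(i, f). act P f (e i)) (c x v) = v"
  using assms lhomD(1)[of "c x" "sp P x" "free_space (free_gens D I d x)" v]
  unfolding dual_basis_def by auto

lemma free_mod_simps:
  "sp (free_mod D n) x = free_space ({..<n} \<times> {f \<in> Arr D. Cod D f = x})"
  "act (free_mod D n) g = push (\<lambda>(i, f). (i, Comp D g f))"
  by (simp_all add: free_mod_def)

context
  fixes D :: "('o, 'm) category"
  assumes D: "finite_category D"
begin

interpretation D: finite_category D by (rule D)

text \<open>The value of the free module at an object has a basis element for each arrow of any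
  domain; the module is the sum of the representable functors at all objects, each taken
  \<open>n\<close> times. An arrow \<open>f\<close> in the coordinate \<open>k\<close> is therefore
  assigned the index \<open>(k, Dom D f)\<close>, and \<open>e\<close> consists of the images of the
  identities.\<close>

lemma projective_dual_basis:
  fixes P :: "('o, 'm, 'k::field, 'v) kfunctor"
  assumes "projective D P"
  obtains I :: "(nat \<times> 'o) set" and d e c where "dual_basis D P I d e c"
proof -
  from assms obtain n i p where M: "fmod D P" and i: "nat_trans D P (free_mod D n) i"
    and p: "nat_trans D (free_mod D n) P p" and pi: "\<forall>x\<in>Obj D. \<forall>v\<in>car P x. p x (i x v) = v"
    unfolding projective_def kmodule_iff by blast
  define e :: "nat \<times> 'o => 'v" where "e = (\<lambda>(k, y). p y (single (k, Ident D y) 1))"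
  define c where "c = (\<lambda>x v. push (\<lambda>(k, f). ((k, Dom D f), f)) (i x v))"
  have ik: "keys (i x v) \<subseteq> {..<n} \<times> {f \<in> Arr D. Cod D f = x}"
    if "x \<in> Obj D" "v \<in> car P x" for x v
    using nat_transD(2)[OF i that] by (simp add: free_mod_simps)
  have act_e: "act P f (e (k, Dom D f)) = p (Cod D f) (single (k, f) 1)"
    if "k < n" "f \<in> Arr D" for k f
    using nat_transD(3)[OF p that(2), of "single (k, Ident D (Dom D f)) 1"] that
    by (simp add: e_def free_mod_simps D.Ident_Arr D.Cod_Ident D.Dom_Obj D.Comp_Ident_right)
  have "dual_basis D P ({..<n} \<times> Obj D) snd e c"
    unfolding dual_basis_def
  proof (intro conjI ballI)
    show "finite ({..<n} \<times> Obj D)" using D.finite_Obj by auto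
    fix ky assume "ky \<in> {..<n} \<times> Obj D"
    then show "snd ky \<in> Obj D" "e ky \<in> car P (snd ky)"
      using nat_transD(2)[OF p, of "snd ky"]
      by (auto simp: e_def free_mod_simps D.Ident_Arr D.Cod_Ident)
  next
    fix x assume x: "x \<in> Obj D"
    show "c x \<in> lhom (sp P x) (free_space (free_gens D ({..<n} \<times> Obj D) snd x))"
      unfolding c_def
      by (rule lhom_comp[OF nat_transD(1)[OF i x, unfolded free_mod_simps] push_lhom])
         (auto simp: free_gens_def D.Dom_Obj)
    fix v assume v: "v \<in> car P x"
    have "lin (sp P x) (\<lambda>(i, f). act P f (e i)) (c x v)
        = lin (sp P x) (\<lambda>(k, f). act P f (e (k, Dom D f))) (i x v)"
      unfolding c_def
      by (subst lin_push) (use fmodD[OF M] x ik[OF x v] act_e nat_transD(2)[OF p x] in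
          \<open>auto simp: subset_iff free_mod_simps case_prod_beta'\<close>)
    also have "\<dots> = lin (sp P x) (\<lambda>u. p x (single u 1)) (i x v)"
      by (rule lin_cong) (use fmodD[OF M] x ik[OF x v] act_e nat_transD(2)[OF p x] in
          \<open>auto simp: subset_iff free_mod_simps\<close>)
    also have "\<dots> = p x (i x v)"
      by (rule lin_eq[OF nat_transD(1)[OF p x, unfolded free_mod_simps]])
         (use fmodD[OF M] x ik[OF x v] in auto)
    finally show "lin (sp P x) (\<lambda>(i, f). act P f (e i)) (c x v) = v" using pi x v by simp
  next
    fix f v assume f: "f \<in> Arr D" and v: "v \<in> car P (Dom D f)"
    have "push (\<lambda>(k, h). ((k, Dom D h), h)) (push (\<lambda>(i, h). (i, Comp D f h)) (i (Dom D f) v))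
        = push (\<lambda>(i, h). (i, Comp D f h)) (push (\<lambda>(k, h). ((k, Dom D h), h)) (i (Dom D f) v))"
      unfolding push_push
      by (rule push_cong) (use ik[OF D.Dom_Obj[OF f] v] f in \<open>auto simp: subset_iff D.Dom_Comp\<close>)
    then show "c (Cod D f) (act P f v) = push (\<lambda>(i, h). (i, Comp D f h)) (c (Dom D f) v)"
      using nat_transD(3)[OF i f v] by (simp add: c_def free_mod_simps)
  qed
  then show thesis by (rule that)
qed

context
  fixes P :: "('o, 'm, 'k::field, 'v) kfunctor" and I :: "'i set" and d e c
  assumes P: "fmod D P" and B: "dual_basis D P I d e c"
begin

text \<open>The finitely many vectors obtained by moving the \<open>e i\<close> along arrows into
  \<open>x\<close> span the value at \<open>x\<close>, by the last clause of the dual basis.\<close>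

lemma dual_basis_fin_dim:
  assumes x: "x \<in> Obj D"
  shows "vectorspace.fin_dim fld (sp P x)"
proof -
  have V: "vs (sp P x)" using P x by (rule fmodD)
  interpret V: vectorspace fld "sp P x" using V by (simp add: vs_vectorspace)
  let ?A = "(\<lambda>(i, f). act P f (e i)) ` free_gens D I d x"
  have "free_gens D I d x \<subseteq> I \<times> Arr D" by (auto simp: free_gens_def)
  then have fin: "finite ?A" using dual_basisD(1)[OF B] D.finite_Arr
    by (meson finite_SigmaI finite_imageI finite_subset)
  have sub: "?A \<subseteq> car P x"
    using dual_basisD(3)[OF B] fmodD(3)[OF P] by (fastforce simp: free_gens_def)
  have "v \<in> V.span ?A" if v: "v \<in> car P x" for v
    using lin_span[OF V V.span_is_submodule[OF sub], of "c x v" "\<lambda>(i, f). act P f (e i)"]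
      dual_basisD(5,7)[OF B x v] V.in_own_span[OF sub] by auto
  moreover have "V.span ?A \<subseteq> car P x" using sub by (rule V.span_is_subset2)
  ultimately have "V.gen_set ?A" by auto
  with fin sub show ?thesis unfolding V.fin_dim_def by blast
qed

text \<open>The index set is renumbered by \<open>ix\<close> to an initial segment of the naturals,
  and the sum of representables becomes a summand of the free module of that rank.\<close>

lemma dual_basis_projective: "projective D P"
proof -
  obtain ix :: "'i => nat" and n where ix: "bij_betw ix I {..<n}"
    using ex_bij_betw_finite_nat[OF dual_basisD(1)[OF B]] by (auto simp: atLeast0LessThan)
  define iv where "iv = inv_into I ix"
  have iv: "iv (ix i) = i" if "i \<in> I" for i
    using bij_betw_inv_into_left[OF ix that] by (simp add: iv_def)
  have ivI: "iv k \<in> I" if "k < n" for k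
    using bij_betw_inv_into[OF ix] that by (auto simp: iv_def bij_betw_def)
  have ixn: "ix i < n" if "i \<in> I" for i using bij_betwE[OF ix] that by auto
  define i where "i = (\<lambda>x v. push (\<lambda>(i, f). (ix i, f)) (c x v))"
  \<comment> \<open>A basis element whose arrow does not start at the object belonging to its index
    lies outside this summand and is sent to zero; postcomposition keeps the domain, so the choice
    is natural.\<close>
  define q where "q = (\<lambda>x (k, f). if Dom D f = d (iv k) then act P f (e (iv k)) else \<zero>\<^bsub>sp P x\<^esub>)"
  define p where "p = (\<lambda>x. lin (sp P x) (q x))"
  have q: "q x u \<in> car P x" if "x \<in> Obj D" "u \<in> {..<n} \<times> {f \<in> Arr D. Cod D f = x}" for x u
    using that vs_closed(1)[OF fmodD(1)[OF P that(1)]] dual_basisD(3)[OF B ivI]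
      fmodD(3)[OF P, of _ "e (iv (fst u))"] by (auto simp: q_def)
  have "nat_trans D P (free_mod D n) i"
  proof (rule nat_transI)
    show "i x \<in> lhom (sp P x) (sp (free_mod D n) x)" if x: "x \<in> Obj D" for x
      unfolding i_def free_mod_simps
      by (rule lhom_comp[OF dual_basisD(4)[OF B x] push_lhom]) (auto simp: free_gens_def ixn)
    show "i (Cod D f) (act P f v) = act (free_mod D n) f (i (Dom D f) v)"
      if "f \<in> Arr D" "v \<in> car P (Dom D f)" for f v
      unfolding i_def free_mod_simps dual_basisD(6)[OF B that] push_push
      by (rule push_cong) auto
  qed
  moreover have "nat_trans D (free_mod D n) P p"
  proof (rule nat_transI)
    show pl: "p x \<in> lhom (sp (free_mod D n) x) (sp P x)" if x: "x \<in> Obj D" for x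
      unfolding p_def free_mod_simps by (rule lin_lhom[OF fmodD(1)[OF P x] q[OF x]])
    fix f and v :: "nat \<times> 'm \<Rightarrow>\<^sub>0 'k"
    assume f: "f \<in> Arr D" and v: "v \<in> car (free_mod D n) (Dom D f)"
    have fin: "Dom D f \<in> Obj D" "Cod D f \<in> Obj D" using f by (auto simp: D.Dom_Obj D.Cod_Obj)
    have vk: "keys v \<subseteq> {..<n} \<times> {h \<in> Arr D. Cod D h = Dom D f}"
      using v by (simp add: free_mod_simps)
    have qq: "q (Cod D f) (k, Comp D f h) = act P f (q (Dom D f) (k, h))"
      if "k < n" "h \<in> Arr D" "Cod D h = Dom D f" for k h
      using that f fmodD(5)[OF P that(2) f, of "e (iv k)"] dual_basisD(3)[OF B ivI[OF that(1)]]
        lhom_zero[OF fmodD(2)[OF P f]] fmodD(1)[OF P] fin by (auto simp: q_def D.Dom_Comp)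
    have cl: "act P f (q (Dom D f) u) \<in> car P (Cod D f)"
      if "u \<in> {..<n} \<times> {h \<in> Arr D. Cod D h = Dom D f}" for u
      using fmodD(3)[OF P f q[OF fin(1) that]] .
    have "p (Cod D f) (act (free_mod D n) f v)
        = lin (sp P (Cod D f)) (\<lambda>u. q (Cod D f) (case u of (k, h) => (k, Comp D f h))) v"
      unfolding p_def free_mod_simps
      by (rule lin_push) (use fmodD(1)[OF P fin(2)] vk qq cl in \<open>force split: prod.splits\<close>)+
    also have "\<dots> = lin (sp P (Cod D f)) (\<lambda>u. act P f (q (Dom D f) u)) v"
      by (rule lin_cong) (use fmodD(1)[OF P fin(2)] vk qq cl in \<open>force split: prod.splits\<close>)+
    also have "\<dots> = act P f (p (Dom D f) v)"
      unfolding p_def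
      by (rule lin_comp[OF fmodD(2)[OF P f], symmetric]) (use fmodD(1)[OF P] fin q vk in auto)
    finally show "p (Cod D f) (act (free_mod D n) f v) = act P f (p (Dom D f) v)" .
  qed
  moreover have "p x (i x v) = v" if x: "x \<in> Obj D" and v: "v \<in> car P x" for x v
  proof -
    have qe: "q x (ix j, f) = act P f (e j)" if "(j, f) \<in> free_gens D I d x" for j f
      using that iv[of j] by (simp add: q_def free_gens_def)
    have cl: "act P f (e j) \<in> car P x" if "(j, f) \<in> free_gens D I d x" for j f
      using that dual_basisD(3)[OF B] fmodD(3)[OF P] by (fastforce simp: free_gens_def)
    have k: "keys (c x v) \<subseteq> free_gens D I d x" by (rule dual_basisD(5)[OF B x v])
    have "p x (i x v) = lin (sp P x) (\<lambda>u. q x (case u of (j, f) => (ix j, f))) (c x v)"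
      unfolding p_def i_def
      by (rule lin_push) (use fmodD(1)[OF P x] k qe cl in \<open>force split: prod.splits\<close>)+
    also have "\<dots> = lin (sp P x) (\<lambda>(j, f). act P f (e j)) (c x v)"
      by (rule lin_cong) (use fmodD(1)[OF P x] k qe cl in \<open>force split: prod.splits\<close>)+
    finally show ?thesis using dual_basisD(7)[OF B x v] by simp
  qed
  ultimately show ?thesis
    unfolding projective_def kmodule_iff using P dual_basis_fin_dim by blast
qed

text \<open>Preimages \<open>m i\<close> of the vectors \<open>f (e i)\<close> determine the lift by
  the Yoneda lemma: \<open>m\<close> takes the place of \<open>e\<close> in the expansion of
  \<open>v\<close> by the coefficients \<open>c\<close>. The functors \<open>N\<close> and
  \<open>N'\<close> may live on types unrelated to that of \<open>P\<close>.\<close>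

lemma dual_basis_lift:
  assumes N: "fmod D N" and N': "fmod D N'" and q: "nat_trans D N N' q" and f: "nat_trans D P N' f"
    and im: "\<And>x v. x \<in> Obj D ==> v \<in> car P x ==> f x v \<in> q x ` car N x"
  obtains g where "nat_trans D P N g"
    and "\<And>x v. x \<in> Obj D ==> v \<in> car P x ==> q x (g x v) = f x v"
proof -
  have "\<exists>m. m \<in> car N (d i) \<and> q (d i) m = f (d i) (e i)" if "i \<in> I" for i
    using im[OF dual_basisD(2,3)[OF B that]] by auto
  then obtain m where m: "\<And>i. i \<in> I ==> m i \<in> car N (d i)"
      "\<And>i. i \<in> I ==> q (d i) (m i) = f (d i) (e i)"
    by metis
  define g where "g = (\<lambda>x v. lin (sp N x) (\<lambda>(i, h). act N h (m i)) (c x v))"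
  have cl: "(\<lambda>(i, h). act N h (m i)) u \<in> car N x" if "u \<in> free_gens D I d x" for x u
    using that m(1) fmodD(3)[OF N] by (fastforce simp: free_gens_def)
  have "nat_trans D P N g"
  proof (rule nat_transI)
    show "g x \<in> lhom (sp P x) (sp N x)" if x: "x \<in> Obj D" for x
      unfolding g_def
      by (rule lhom_comp[OF dual_basisD(4)[OF B x] lin_lhom[OF fmodD(1)[OF N x] cl]])
    fix k v assume k: "k \<in> Arr D" and v: "v \<in> car P (Dom D k)"
    have ob: "Dom D k \<in> Obj D" "Cod D k \<in> Obj D" using k by (auto simp: D.Dom_Obj D.Cod_Obj)
    have key: "keys (c (Dom D k) v) \<subseteq> free_gens D I d (Dom D k)"
      by (rule dual_basisD(5)[OF B ob(1) v])
    have eq: "act N (Comp D k h) (m i) = act N k (act N h (m i))"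
      if "(i, h) \<in> free_gens D I d (Dom D k)" for i h
      using that m(1) fmodD(5)[OF N _ k, of h "m i"] by (auto simp: free_gens_def)
    have cl': "act N k ((\<lambda>(i, h). act N h (m i)) u) \<in> car N (Cod D k)"
      if "u \<in> free_gens D I d (Dom D k)" for u using fmodD(3)[OF N k cl[OF that]] .
    have "g (Cod D k) (act P k v)
        = lin (sp N (Cod D k)) (\<lambda>u. (\<lambda>(i, h). act N h (m i)) ((\<lambda>(i, h). (i, Comp D k h)) u)) (c (Dom D k) v)"
      unfolding g_def dual_basisD(6)[OF B k v]
      by (rule lin_push) (use fmodD(1)[OF N ob(2)] key eq cl' in \<open>force split: prod.splits\<close>)+
    also have "\<dots> = lin (sp N (Cod D k)) (\<lambda>u. act N k ((\<lambda>(i, h). act N h (m i)) u)) (c (Dom D k) v)"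
      by (rule lin_cong) (use fmodD(1)[OF N ob(2)] key eq cl' in \<open>force split: prod.splits\<close>)+
    also have "\<dots> = act N k (g (Dom D k) v)"
      unfolding g_def
      by (rule lin_comp[OF fmodD(2)[OF N k] _ _ cl key, symmetric]) (use fmodD(1)[OF N] ob in auto)
    finally show "g (Cod D k) (act P k v) = act N k (g (Dom D k) v)" .
  qed
  moreover have "q x (g x v) = f x v" if x: "x \<in> Obj D" and v: "v \<in> car P x" for x v
  proof -
    have key: "keys (c x v) \<subseteq> free_gens D I d x" by (rule dual_basisD(5)[OF B x v])
    have clP: "(\<lambda>(i, h). act P h (e i)) u \<in> car P x" if "u \<in> free_gens D I d x" for u
      using that dual_basisD(3)[OF B] fmodD(3)[OF P] by (fastforce simp: free_gens_def)
    have eq: "q x ((\<lambda>(i, h). act N h (m i)) u) = f x ((\<lambda>(i, h). act P h (e i)) u)"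
      if u: "u \<in> free_gens D I d x" for u
    proof -
      obtain i h where ih: "u = (i, h)" "i \<in> I" "h \<in> Arr D" "Dom D h = d i" "Cod D h = x"
        using u by (auto simp: free_gens_def)
      show ?thesis
        using nat_transD(3)[OF q ih(3), of "m i"] nat_transD(3)[OF f ih(3), of "e i"] m[OF ih(2)]
          dual_basisD(3)[OF B ih(2)] ih by simp
    qed
    have "q x (g x v) = lin (sp N' x) (\<lambda>u. q x ((\<lambda>(i, h). act N h (m i)) u)) (c x v)"
      unfolding g_def
      by (rule lin_comp[OF nat_transD(1)[OF q x] fmodD(1)[OF N x] fmodD(1)[OF N' x] cl key])
    also have "\<dots> = lin (sp N' x) (\<lambda>u. f x ((\<lambda>(i, h). act P h (e i)) u)) (c x v)"
      by (rule lin_cong[OF fmodD(1)[OF N' x]])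
         (use key eq nat_transD(2)[OF f x] clP in blast)+
    also have "\<dots> = f x (lin (sp P x) (\<lambda>(i, h). act P h (e i)) (c x v))"
      by (rule lin_comp[OF nat_transD(1)[OF f x] fmodD(1)[OF P x] fmodD(1)[OF N' x] clP key, symmetric])
    finally show ?thesis using dual_basisD(7)[OF B x v] by simp
  qed
  ultimately show thesis by (rule that)
qed

end

lemma projective_fmod: "projective D P ==> fmod D P"
  by (simp add: projective_def kmodule_iff)

lemma projective_lift:
  assumes "projective D P" "fmod D N" "fmod D N'" "nat_trans D N N' q" "nat_trans D P N' f"
    and "\<And>x v. x \<in> Obj D ==> v \<in> car P x ==> f x v \<in> q x ` car N x"
  obtains g where "nat_trans D P N g"
    and "\<And>x v. x \<in> Obj D ==> v \<in> car P x ==> q x (g x v) = f x v"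
proof -
  obtain I :: "(nat \<times> 'o) set" and d e c where "dual_basis D P I d e c"
    by (rule projective_dual_basis[OF assms(1)])
  from dual_basis_lift[OF projective_fmod[OF assms(1)] this assms(2-6)] show thesis
    using that by blast
qed

end

subsection \<open>Subcategories\<close>

text \<open>Not assumed full. Two instances matter: a single object with its identity, and the
  arrows of the enveloping category that are the identity of a fixed \<open>x\<close> in the first
  variable. Over these the resolutions of the constant functor and of \<open>kC\<close>
  split.\<close>

locale subcategory = D: finite_category D + K: finite_category K
  for D K :: "('o, 'm) category" +
  assumes sub: "Obj K \<subseteq> Obj D" "Arr K \<subseteq> Arr D"
    and same: "Dom K = Dom D" "Cod K = Cod D" "Ident K = Ident D" "Comp K = Comp D"
begin

lemma sub_fmod: "fmod D M ==> fmod K M"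
  unfolding fmod_def using sub by (auto simp: same subset_iff)

lemma sub_nat_trans: "nat_trans D M N et ==> nat_trans K M N et"
  unfolding nat_trans_def using sub by (auto simp: same subset_iff)

text \<open>If every arrow of \<open>D\<close> into \<open>K\<close> factors uniquely as \<open>hh f \<circ> jj f\<close> with \<open>hh f\<close> in \<open>K\<close> and
  \<open>jj f\<close> from a fixed set of arrows, then representable functors restrict to sums of such.\<close>

lemma sub_projective:
  assumes P: "projective D P"
    and hh: "\<And>f. f \<in> Arr D ==> Cod D f \<in> Obj K ==>
      hh f \<in> Arr K \<and> jj f \<in> Arr D \<and> Dom D (hh f) = Cod D (jj f) \<and> Comp D (hh f) (jj f) = f"
    and nat: "\<And>f k. f \<in> Arr D ==> k \<in> Arr K ==> Dom D k = Cod D f ==>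
      hh (Comp D k f) = Comp D k (hh f) \<and> jj (Comp D k f) = jj f"
  shows "projective K P"
proof -
  have P': "fmod D P" by (rule projective_fmod[OF D.finite_category_axioms P])
  obtain I :: "(nat \<times> 'o) set" and d e c where B: "dual_basis D P I d e c"
    by (rule projective_dual_basis[OF D.finite_category_axioms P])
  \<comment> \<open>The representable functor at \<open>d i\<close> restricts to a sum of
    representables of \<open>K\<close>, placed at the targets of the arrows \<open>jj f\<close>.
    \<open>J\<close> admits every arrow from \<open>d i\<close> into \<open>K\<close>; the
    coefficients \<open>c'\<close> meet only those of the form \<open>jj f\<close>.\<close>
  define J where "J = {(i, j). i \<in> I \<and> j \<in> Arr D \<and> Dom D j = d i \<and> Cod D j \<in> Obj K}"
  define e' where "e' = (\<lambda>(i, j). act P j (e i))"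
  define c' where "c' = (\<lambda>x v. push (\<lambda>(i, f). ((i, jj f), hh f)) (c x v))"
  have DC: "f \<in> Arr D ==> g \<in> Arr D ==> Dom D f = Cod D g ==> Dom D (Comp D f g) = Dom D g"
    "f \<in> Arr D ==> g \<in> Arr D ==> Dom D f = Cod D g ==> Cod D (Comp D f g) = Cod D f" for f g
    by (auto simp: D.Dom_Comp D.Cod_Comp)
  have fact: "hh f \<in> Arr K \<and> hh f \<in> Arr D \<and> jj f \<in> Arr D \<and> Dom D (hh f) = Cod D (jj f) \<and> Comp D (hh f) (jj f) = f
      \<and> Dom D (jj f) = Dom D f \<and> Cod D (hh f) = Cod D f \<and> Cod D (jj f) \<in> Obj K"
    if "f \<in> Arr D" "Cod D f \<in> Obj K" for f
    using hh[OF that] sub(2) DC[of "hh f" "jj f"] K.Dom_Obj[of "hh f"] by (auto simp: same)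
  have "dual_basis K P J (\<lambda>(i, j). Cod D j) e' c'"
    unfolding dual_basis_def
  proof (intro conjI ballI)
    have "J \<subseteq> I \<times> Arr D" by (auto simp: J_def)
    then show "finite J" using dual_basisD(1)[OF B] D.finite_Arr
      by (meson finite_SigmaI finite_subset)
    fix ij assume "ij \<in> J"
    then obtain i j where ij: "ij = (i, j)" "i \<in> I" "j \<in> Arr D" "Dom D j = d i" "Cod D j \<in> Obj K"
      unfolding J_def by blast
    then show "(case ij of (i, j) => Cod D j) \<in> Obj K"
        "e' ij \<in> car P (case ij of (i, j) => Cod D j)"
      using dual_basisD(3)[OF B ij(2)] fmodD(3)[OF P' ij(3), of "e i"] by (simp_all add: e'_def)
  next
    fix x assume x: "x \<in> Obj K"
    then have xD: "x \<in> Obj D" using sub by auto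
    have k: "(\<lambda>(i, f). ((i, jj f), hh f)) u \<in> free_gens K J (\<lambda>(i, j). Cod D j) x"
      if u: "u \<in> free_gens D I d x" for u
    proof -
      obtain i f where "u = (i, f)" "i \<in> I" "f \<in> Arr D" "Dom D f = d i" "Cod D f = x"
        using u by (auto simp: free_gens_def)
      then show ?thesis using fact[of f] x by (simp add: free_gens_def J_def same)
    qed
    show "c' x \<in> lhom (sp P x) (free_space (free_gens K J (\<lambda>(i, j). Cod D j) x))"
      unfolding c'_def by (rule lhom_comp[OF dual_basisD(4)[OF B xD] push_lhom[OF k]])
    fix v assume v: "v \<in> car P x"
    have key: "keys (c x v) \<subseteq> free_gens D I d x" by (rule dual_basisD(5)[OF B xD v])
    have eq: "act P (hh f) (e' (i, jj f)) = act P f (e i)" "act P f (e i) \<in> car P x"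
      if "(i, f) \<in> keys (c x v)" for i f
    proof -
      have i: "i \<in> I" "f \<in> Arr D" "Dom D f = d i" "Cod D f = x"
        using that key by (auto simp: free_gens_def)
      then have "Cod D f \<in> Obj K" using x by simp
      note fa = fact[OF i(2) this]
      show "act P (hh f) (e' (i, jj f)) = act P f (e i)"
        using fmodD(5)[OF P', of "jj f" "hh f" "e i"] fa i dual_basisD(3)[OF B i(1)] by (simp add: e'_def)
      show "act P f (e i) \<in> car P x"
        using fmodD(3)[OF P' i(2), of "e i"] i dual_basisD(3)[OF B i(1)] by simp
    qed
    have "lin (sp P x) (\<lambda>(i, f). act P f (e' i)) (c' x v)
        = lin (sp P x) (\<lambda>u. (\<lambda>(i, f). act P f (e' i)) ((\<lambda>(i, f). ((i, jj f), hh f)) u)) (c x v)"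
      unfolding c'_def by (rule lin_push[OF fmodD(1)[OF P' xD]]) (use eq in \<open>auto split: prod.splits\<close>)
    also have "\<dots> = lin (sp P x) (\<lambda>(i, f). act P f (e i)) (c x v)"
      by (rule lin_cong[OF fmodD(1)[OF P' xD]]) (use eq in \<open>auto split: prod.splits\<close>)
    finally show "lin (sp P x) (\<lambda>(i, f). act P f (e' i)) (c' x v) = v"
      using dual_basisD(7)[OF B xD v] by simp
  next
    fix f v assume f: "f \<in> Arr K" and v: "v \<in> car P (Dom K f)"
    then have fD: "f \<in> Arr D" and vD: "v \<in> car P (Dom D f)" using sub by (auto simp: same)
    have key: "keys (c (Dom D f) v) \<subseteq> free_gens D I d (Dom D f)"
      by (rule dual_basisD(5)[OF B D.Dom_Obj[OF fD] vD])
    show "c' (Cod K f) (act P f v) = push (\<lambda>(i, h). (i, Comp K f h)) (c' (Dom K f) v)"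
      unfolding c'_def same dual_basisD(6)[OF B fD vD] push_push
      by (rule push_cong) (use key f nat in \<open>auto simp: free_gens_def subset_iff split: prod.splits\<close>)
  qed
  from dual_basis_projective[OF K.finite_category_axioms sub_fmod[OF P'] this] show ?thesis .
qed

end

section \<open>Resolutions\<close>

text \<open>Exactness without projectivity, all that a target of lifts has to satisfy.\<close>

definition resolution ::
    "('o, 'm) category => ('o, 'm, 'k::field, 'w) kfunctor => ('o, 'm, 'k, 'v, 'w) aug_complex
      => bool" where
  "resolution D M P \<longleftrightarrow> fmod D M \<and>
    (\<forall>n. fmod D (mods P n)) \<and>
    (\<forall>n. nat_trans D (mods P (Suc n)) (mods P n) (bdry P n)) \<and>
    nat_trans D (mods P 0) M (aug P) \<and>
    (\<forall>x\<in>Obj D.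
      aug P x ` car (mods P 0) x = car M x \<and>
      {v \<in> car (mods P 0) x. aug P x v = \<zero>\<^bsub>sp M x\<^esub>} =
        bdry P 0 x ` car (mods P 1) x \<and>
      (\<forall>n. {v \<in> car (mods P (Suc n)) x. bdry P n x v = \<zero>\<^bsub>sp (mods P n) x\<^esub>} =
        bdry P (Suc n) x ` car (mods P (Suc (Suc n))) x))"

lemma resolutionD:
  assumes "resolution D M P"
  shows "fmod D M" "fmod D (mods P n)" "nat_trans D (mods P (Suc n)) (mods P n) (bdry P n)"
    "nat_trans D (mods P 0) M (aug P)"
  using assms by (auto simp: resolution_def)

lemma resolution_exact:
  assumes "resolution D M P" "x \<in> Obj D"
  shows "w \<in> car M x ==> w \<in> aug P x ` car (mods P 0) x"
    and "v \<in> car (mods P 1) x ==> aug P x (bdry P 0 x v) = \<zero>\<^bsub>sp M x\<^esub>"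
    and "v \<in> car (mods P (Suc (Suc n))) x ==> bdry P n x (bdry P (Suc n) x v) = \<zero>\<^bsub>sp (mods P n) x\<^esub>"
    and "v \<in> car (mods P 0) x ==> aug P x v = \<zero>\<^bsub>sp M x\<^esub> ==> v \<in> bdry P 0 x ` car (mods P 1) x"
    and "u \<in> car (mods P (Suc n)) x ==> bdry P n x u = \<zero>\<^bsub>sp (mods P n) x\<^esub> ==>
      u \<in> bdry P (Suc n) x ` car (mods P (Suc (Suc n))) x"
proof -
  have *: "aug P x ` car (mods P 0) x = car M x"
    "{v \<in> car (mods P 0) x. aug P x v = \<zero>\<^bsub>sp M x\<^esub>} = bdry P 0 x ` car (mods P 1) x"
    "\<And>n. {v \<in> car (mods P (Suc n)) x. bdry P n x v = \<zero>\<^bsub>sp (mods P n) x\<^esub>} =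
        bdry P (Suc n) x ` car (mods P (Suc (Suc n))) x"
    using assms by (auto simp: resolution_def)
  show "w \<in> car M x ==> w \<in> aug P x ` car (mods P 0) x" using *(1) by simp
  show "v \<in> car (mods P 1) x ==> aug P x (bdry P 0 x v) = \<zero>\<^bsub>sp M x\<^esub>" using *(2) by blast
  show "v \<in> car (mods P (Suc (Suc n))) x ==> bdry P n x (bdry P (Suc n) x v) = \<zero>\<^bsub>sp (mods P n) x\<^esub>"
    using *(3)[of n] by blast
  show "v \<in> car (mods P 0) x ==> aug P x v = \<zero>\<^bsub>sp M x\<^esub> ==> v \<in> bdry P 0 x ` car (mods P 1) x"
    using *(2) by blast
  show "u \<in> car (mods P (Suc n)) x ==> bdry P n x u = \<zero>\<^bsub>sp (mods P n) x\<^esub> ==>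
      u \<in> bdry P (Suc n) x ` car (mods P (Suc (Suc n))) x"
    using *(3)[of n] by blast
qed

lemma resolutionI:
  assumes "finite_category D" "fmod D M" "\<And>n. fmod D (mods P n)"
    and b: "\<And>n. nat_trans D (mods P (Suc n)) (mods P n) (bdry P n)"
    and "nat_trans D (mods P 0) M (aug P)"
    and "\<And>x w. x \<in> Obj D ==> w \<in> car M x ==> \<exists>v\<in>car (mods P 0) x. aug P x v = w"
    and "\<And>x v. x \<in> Obj D ==> v \<in> car (mods P 1) x ==> aug P x (bdry P 0 x v) = \<zero>\<^bsub>sp M x\<^esub>"
    and "\<And>x v n. x \<in> Obj D ==> v \<in> car (mods P (Suc (Suc n))) x ==>
      bdry P n x (bdry P (Suc n) x v) = \<zero>\<^bsub>sp (mods P n) x\<^esub>"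
    and "\<And>x v. x \<in> Obj D ==> v \<in> car (mods P 0) x ==> aug P x v = \<zero>\<^bsub>sp M x\<^esub> ==>
      \<exists>u\<in>car (mods P 1) x. v = bdry P 0 x u"
    and "\<And>x v n. x \<in> Obj D ==> v \<in> car (mods P (Suc n)) x ==>
      bdry P n x v = \<zero>\<^bsub>sp (mods P n) x\<^esub> ==> \<exists>u\<in>car (mods P (Suc (Suc n))) x. v = bdry P (Suc n) x u"
  shows "resolution D M P"
  unfolding resolution_def
proof (intro conjI allI ballI)
  fix x n assume x: "x \<in> Obj D"
  have cl: "\<And>n v. v \<in> car (mods P (Suc n)) x ==> bdry P n x v \<in> car (mods P n) x"
    using nat_transD(2)[OF b x] .
  show "aug P x ` car (mods P 0) x = car M x"
    using assms(6)[OF x] nat_transD(2)[OF assms(5) x] by blast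
  show "{v \<in> car (mods P 0) x. aug P x v = \<zero>\<^bsub>sp M x\<^esub>} = bdry P 0 x ` car (mods P 1) x"
    using assms(7)[OF x] assms(9)[OF x] cl[of _ 0] by (intro equalityI subsetI) auto
  show "{v \<in> car (mods P (Suc n)) x. bdry P n x v = \<zero>\<^bsub>sp (mods P n) x\<^esub>} =
        bdry P (Suc n) x ` car (mods P (Suc (Suc n))) x"
    using assms(8)[OF x, of _ n] assms(10)[OF x, of _ n] cl[of _ "Suc n"]
    by (intro equalityI subsetI) (blast, blast)
qed (use assms in auto)

lemma (in subcategory) sub_resolution:
  assumes "resolution D M P"
  shows "resolution K M P"
  unfolding resolution_def
proof (intro conjI allI ballI)
  fix x n assume "x \<in> Obj K"
  then have x: "x \<in> Obj D" using sub by blast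
  show "aug P x ` car (mods P 0) x = car M x"
    "{v \<in> car (mods P 0) x. aug P x v = \<zero>\<^bsub>sp M x\<^esub>} = bdry P 0 x ` car (mods P 1) x"
    "{v \<in> car (mods P (Suc n)) x. bdry P n x v = \<zero>\<^bsub>sp (mods P n) x\<^esub>} =
        bdry P (Suc n) x ` car (mods P (Suc (Suc n))) x"
    using assms x by (simp_all add: resolution_def)
qed (intro sub_fmod sub_nat_trans resolutionD[OF assms])+

definition proj_resolution where
  "proj_resolution D M P \<longleftrightarrow> resolution D M P \<and> (\<forall>n. projective D (mods P n))"

lemma projective_resolution_iff:
  assumes "finite_category D" "fmod D M"
  shows "projective_resolution D M P \<longleftrightarrow> proj_resolution D M P"
proof -
  have "(A \<and> B \<and> C \<and> E) = ((F \<and> G \<and> B \<and> C \<and> E) \<and> A)" if F "A ==> G" for A B C E F G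
    using that by blast
  then show ?thesis
    unfolding projective_resolution_def proj_resolution_def resolution_def
    by this (use projective_fmod[OF assms(1)] assms(2) in auto)
qed

lemma cocyclesD:
  assumes "f \<in> cocycles D P N n"
  shows "nat_trans D (mods P n) N f"
    "x \<in> Obj D ==> v \<in> car (mods P (Suc n)) x ==> f x (bdry P n x v) = \<zero>\<^bsub>sp N x\<^esub>"
  using assms by (auto simp: cocycles_def)

lemma liftsD:
  assumes "ph \<in> lifts D P j Y f"
  shows "nat_trans D (mods P (j + i)) (mods Y i) (ph i)"
    "x \<in> Obj D ==> v \<in> car (mods P j) x ==> aug Y x (ph 0 x v) = f x v"
    "x \<in> Obj D ==> v \<in> car (mods P (Suc (j + i))) x ==>
      bdry Y i x (ph (Suc i) x v) = ph i x (bdry P (j + i) x v)"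
  using assms by (auto simp: lifts_def)

lemma liftsI:
  assumes "\<And>i. nat_trans D (mods P (j + i)) (mods Y i) (ph i)"
    "\<And>x v. x \<in> Obj D ==> v \<in> car (mods P j) x ==> aug Y x (ph 0 x v) = f x v"
    "\<And>i x v. x \<in> Obj D ==> v \<in> car (mods P (Suc (j + i))) x ==>
      bdry Y i x (ph (Suc i) x v) = ph i x (bdry P (j + i) x v)"
  shows "ph \<in> lifts D P j Y f"
  using assms by (auto simp: lifts_def)

text \<open>With the augmentation viewed as a cocycle in degree zero, a lift of the identity becomes
  a special case of a lift of a cocycle.\<close>

lemma aug_cocycle: "resolution D M P ==> aug P \<in> cocycles D P M 0"
  using resolution_exact(2) resolutionD(4) by (fastforce simp: cocycles_def)

lemma vs_move:
  assumes "vs V" "a \<in> carrier V" "b \<in> carrier V" "c \<in> carrier V"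
  shows "d \<in> carrier V ==> a \<oplus>\<^bsub>V\<^esub> (-1) \<odot>\<^bsub>V\<^esub> b \<oplus>\<^bsub>V\<^esub> (-1) \<odot>\<^bsub>V\<^esub> d = c ==> a = b \<oplus>\<^bsub>V\<^esub> c \<oplus>\<^bsub>V\<^esub> d"
    and "a \<oplus>\<^bsub>V\<^esub> (-1) \<odot>\<^bsub>V\<^esub> b = c ==> a = b \<oplus>\<^bsub>V\<^esub> c"
    and "a = b \<oplus>\<^bsub>V\<^esub> c ==> a \<oplus>\<^bsub>V\<^esub> (-1) \<odot>\<^bsub>V\<^esub> b \<oplus>\<^bsub>V\<^esub> (-1) \<odot>\<^bsub>V\<^esub> c = \<zero>\<^bsub>V\<^esub>"
    and "a = b \<oplus>\<^bsub>V\<^esub> c ==> b = a \<oplus>\<^bsub>V\<^esub> (-1) \<odot>\<^bsub>V\<^esub> c"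
proof -
  note V = vs_closed[OF assms(1)] vs_ac[OF assms(1)] vs_cancel[OF assms(1)] vs_zero[OF assms(1)]
  have *: "x \<oplus>\<^bsub>V\<^esub> (y \<oplus>\<^bsub>V\<^esub> ((-1) \<odot>\<^bsub>V\<^esub> x \<oplus>\<^bsub>V\<^esub> z)) = y \<oplus>\<^bsub>V\<^esub> z"
    if "x \<in> carrier V" "y \<in> carrier V" "z \<in> carrier V" for x y z
  proof -
    have "y \<oplus>\<^bsub>V\<^esub> ((-1) \<odot>\<^bsub>V\<^esub> x \<oplus>\<^bsub>V\<^esub> z) = (-1) \<odot>\<^bsub>V\<^esub> x \<oplus>\<^bsub>V\<^esub> (y \<oplus>\<^bsub>V\<^esub> z)"
      using that by (intro vs_ac(3)[OF assms(1)]) (auto simp: V)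
    then show ?thesis using that by (simp add: vs_cancel(3)[OF assms(1)] vs_closed[OF assms(1)])
  qed
  show "d \<in> carrier V ==> a \<oplus>\<^bsub>V\<^esub> (-1) \<odot>\<^bsub>V\<^esub> b \<oplus>\<^bsub>V\<^esub> (-1) \<odot>\<^bsub>V\<^esub> d = c ==> a = b \<oplus>\<^bsub>V\<^esub> c \<oplus>\<^bsub>V\<^esub> d"
    and "a \<oplus>\<^bsub>V\<^esub> (-1) \<odot>\<^bsub>V\<^esub> b = c ==> a = b \<oplus>\<^bsub>V\<^esub> c"
    and "a = b \<oplus>\<^bsub>V\<^esub> c ==> a \<oplus>\<^bsub>V\<^esub> (-1) \<odot>\<^bsub>V\<^esub> b \<oplus>\<^bsub>V\<^esub> (-1) \<odot>\<^bsub>V\<^esub> c = \<zero>\<^bsub>V\<^esub>"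
    and "a = b \<oplus>\<^bsub>V\<^esub> c ==> b = a \<oplus>\<^bsub>V\<^esub> (-1) \<odot>\<^bsub>V\<^esub> c"
    using assms(2-4) by (auto simp: V *)
qed

section \<open>Existence and homotopy uniqueness of lifts\<close>

context
  fixes D :: "('o, 'm) category" and M :: "('o, 'm, 'k::field, 'w) kfunctor"
    and P :: "('o, 'm, 'k, 'v, 'w) aug_complex" and N :: "('o, 'm, 'k, 'z) kfunctor"
    and Y :: "('o, 'm, 'k, 'y, 'z) aug_complex" and f :: "'o => 'v => 'z" and j :: nat
  assumes D: "finite_category D" and P: "proj_resolution D M P" and Y: "resolution D N Y"
begin

interpretation D: finite_category D by (rule D)

lemma PR: "resolution D M P" and PP: "projective D (mods P n)"
  using P by (auto simp: proj_resolution_def)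

text \<open>Dependent choice, degree by degree. The invariant \<open>A\<close> has to promise more
  than naturality: the component constructed last sends boundaries to boundaries, which is exactly
  what the next application of projectivity needs. It holds initially because \<open>f\<close> is a
  cocycle, later because the boundary of \<open>P\<close> squares to zero.\<close>

lemma lifts_exist:
  assumes f: "f \<in> cocycles D P N j"
  obtains ph where "ph \<in> lifts D P j Y f"
proof -
  define A where "A = (\<lambda>n ph. nat_trans D (mods P (j + n)) (mods Y n) ph \<and>
    (n = 0 \<longrightarrow> (\<forall>x\<in>Obj D. \<forall>v\<in>car (mods P j) x. aug Y x (ph x v) = f x v)) \<and>
    (\<forall>x\<in>Obj D. \<forall>v\<in>car (mods P (Suc (j + n))) x.
      ph x (bdry P (j + n) x v) \<in> bdry Y n x ` car (mods Y (Suc n)) x))"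
  have "\<exists>ph. A 0 ph"
  proof -
    obtain ph where g: "nat_trans D (mods P j) (mods Y 0) ph"
      "\<And>x v. x \<in> Obj D ==> v \<in> car (mods P j) x ==> aug Y x (ph x v) = f x v"
    proof (rule projective_lift[OF D PP resolutionD(2)[OF Y] resolutionD(1)[OF Y] resolutionD(4)[OF Y] cocyclesD(1)[OF f]])
      fix x v assume "x \<in> Obj D" "v \<in> car (mods P j) x"
      then show "f x v \<in> aug Y x ` car (mods Y 0) x"
        using resolution_exact(1)[OF Y] nat_transD(2)[OF cocyclesD(1)[OF f]] by blast
    qed blast
    have "ph x (bdry P j x v) \<in> bdry Y 0 x ` car (mods Y (Suc 0)) x"
      if x: "x \<in> Obj D" and v: "v \<in> car (mods P (Suc j)) x" for x v
    proof -
      have b: "bdry P j x v \<in> car (mods P j) x" by (rule nat_transD(2)[OF resolutionD(3)[OF PR] x v])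
      show ?thesis
        using resolution_exact(4)[OF Y x nat_transD(2)[OF g(1) x b]] g(2)[OF x b] cocyclesD(2)[OF f x v] by simp
    qed
    with g show ?thesis by (auto simp: A_def)
  qed
  moreover have "\<exists>ps. A (Suc n) ps \<and> (\<forall>x\<in>Obj D. \<forall>v\<in>car (mods P (Suc (j + n))) x.
      bdry Y n x (ps x v) = ph x (bdry P (j + n) x v))" if A: "A n ph" for n ph
  proof -
    have ph: "nat_trans D (mods P (j + n)) (mods Y n) ph" using A by (simp add: A_def)
    obtain ps where g: "nat_trans D (mods P (Suc (j + n))) (mods Y (Suc n)) ps"
      "\<And>x v. x \<in> Obj D ==> v \<in> car (mods P (Suc (j + n))) x ==> bdry Y n x (ps x v) = ph x (bdry P (j + n) x v)"
    proof (rule projective_lift[OF D PP resolutionD(2)[OF Y] resolutionD(2)[OF Y] resolutionD(3)[OF Y]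
          nat_trans_comp[OF D resolutionD(3)[OF PR] ph]])
      fix x v assume "x \<in> Obj D" "v \<in> car (mods P (Suc (j + n))) x"
      then show "ph x (bdry P (j + n) x v) \<in> bdry Y n x ` car (mods Y (Suc n)) x"
        using A by (simp add: A_def)
    qed blast
    have "ps x (bdry P (Suc (j + n)) x v) \<in> bdry Y (Suc n) x ` car (mods Y (Suc (Suc n))) x"
      if x: "x \<in> Obj D" and v: "v \<in> car (mods P (Suc (Suc (j + n)))) x" for x v
    proof -
      have b: "bdry P (Suc (j + n)) x v \<in> car (mods P (Suc (j + n))) x"
        by (rule nat_transD(2)[OF resolutionD(3)[OF PR] x v])
      show ?thesis
        using resolution_exact(5)[OF Y x nat_transD(2)[OF g(1) x b]] g(2)[OF x b] resolution_exact(3)[OF PR x v]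
          nat_trans_zero_at[OF D ph resolutionD(2)[OF PR] resolutionD(2)[OF Y] x] by simp
    qed
    with g show ?thesis by (auto simp: A_def)
  qed
  ultimately obtain ph where "\<And>n. A n (ph n)" "\<And>n. \<forall>x\<in>Obj D. \<forall>v\<in>car (mods P (Suc (j + n))) x.
      bdry Y n x (ph (Suc n) x v) = ph n x (bdry P (j + n) x v)"
    using dependent_nat_choice[of A "\<lambda>n ph ps. \<forall>x\<in>Obj D. \<forall>v\<in>car (mods P (Suc (j + n))) x.
      bdry Y n x (ps x v) = ph x (bdry P (j + n) x v)"] by blast
  then have "ph \<in> lifts D P j Y f"
    by (intro liftsI) (auto simp: A_def)
  then show thesis by (rule that)
qed

text \<open>Again a dependent choice, with \<open>B\<close> recording the homotopy relation between
  consecutive stages. The last clause of \<open>A\<close> is that relation restricted to boundaries;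
  it makes the difference to be killed in the next degree a cycle, hence a boundary by exactness of
  \<open>Y\<close>.\<close>

lemma lifts_homotopy:
  assumes ph: "ph \<in> lifts D P j Y f" and ps: "ps \<in> lifts D P j Y f"
  obtains h where "\<And>i. nat_trans D (mods P (j + i)) (mods Y (Suc i)) (h i)"
    "\<And>x v. x \<in> Obj D ==> v \<in> car (mods P j) x ==>
      ph 0 x v = ps 0 x v \<oplus>\<^bsub>sp (mods Y 0) x\<^esub> bdry Y 0 x (h 0 x v)"
    "\<And>i x v. x \<in> Obj D ==> v \<in> car (mods P (Suc (j + i))) x ==>
      ph (Suc i) x v = ps (Suc i) x v \<oplus>\<^bsub>sp (mods Y (Suc i)) x\<^esub> bdry Y (Suc i) x (h (Suc i) x v)
        \<oplus>\<^bsub>sp (mods Y (Suc i)) x\<^esub> h i x (bdry P (j + i) x v)"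
proof -
  note nY = resolutionD(3)[OF Y] and nP = resolutionD(3)[OF PR] and fY = resolutionD(2)[OF Y]
  define A where "A = (\<lambda>n h. nat_trans D (mods P (j + n)) (mods Y (Suc n)) h \<and>
    (n = 0 \<longrightarrow> (\<forall>x\<in>Obj D. \<forall>v\<in>car (mods P j) x.
      ph 0 x v = ps 0 x v \<oplus>\<^bsub>sp (mods Y 0) x\<^esub> bdry Y 0 x (h x v))) \<and>
    (\<forall>x\<in>Obj D. \<forall>v\<in>car (mods P (Suc (j + n))) x.
      ph n x (bdry P (j + n) x v) =
        ps n x (bdry P (j + n) x v) \<oplus>\<^bsub>sp (mods Y n) x\<^esub> bdry Y n x (h x (bdry P (j + n) x v))))"
  define B where "B = (\<lambda>n h h'. \<forall>x\<in>Obj D. \<forall>v\<in>car (mods P (Suc (j + n))) x.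
      ph (Suc n) x v = ps (Suc n) x v \<oplus>\<^bsub>sp (mods Y (Suc n)) x\<^esub> bdry Y (Suc n) x (h' x v)
        \<oplus>\<^bsub>sp (mods Y (Suc n)) x\<^esub> h x (bdry P (j + n) x v))"
  have "\<exists>h. A 0 h"
  proof -
    let ?f = "\<lambda>x v. ph 0 x v \<oplus>\<^bsub>sp (mods Y 0) x\<^esub> (-1) \<odot>\<^bsub>sp (mods Y 0) x\<^esub> ps 0 x v"
    have f: "nat_trans D (mods P j) (mods Y 0) ?f"
      using liftsD(1)[OF ph, of 0] liftsD(1)[OF ps, of 0] fY
      by (intro nat_trans_add[OF D] nat_trans_scale[OF D]) auto
    obtain h where h: "nat_trans D (mods P j) (mods Y (Suc 0)) h"
      "\<And>x v. x \<in> Obj D ==> v \<in> car (mods P j) x ==> bdry Y 0 x (h x v) = ?f x v"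
    proof (rule projective_lift[OF D PP fY fY nY f])
      fix x v assume x: "x \<in> Obj D" and v: "v \<in> car (mods P j) x"
      have c: "ph 0 x v \<in> car (mods Y 0) x" "ps 0 x v \<in> car (mods Y 0) x"
        using nat_transD(2)[OF liftsD(1)[OF ph, of 0] x] nat_transD(2)[OF liftsD(1)[OF ps, of 0] x] v by auto
      have V: "vs (sp (mods Y 0) x)" "vs (sp N x)" using fmodD(1)[OF fY x] fmodD(1)[OF resolutionD(1)[OF Y] x] .
      note au = nat_transD(1)[OF resolutionD(4)[OF Y] x]
      have "aug Y x (?f x v) = \<zero>\<^bsub>sp N x\<^esub>"
        using lhomD[OF au] c liftsD(2)[OF ph x v] liftsD(2)[OF ps x v] vs_cancel(1)[OF V(2)] lhomD(1)[OF au c(1)]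
        by (simp add: vs_closed[OF V(1)])
      then show "?f x v \<in> bdry Y 0 x ` car (mods Y (Suc 0)) x"
        using resolution_exact(4)[OF Y x, of "?f x v"] c by (simp add: vs_closed[OF V(1)])
    qed blast
    have eq: "ph 0 x v = ps 0 x v \<oplus>\<^bsub>sp (mods Y 0) x\<^esub> bdry Y 0 x (h x v)"
      if x: "x \<in> Obj D" and v: "v \<in> car (mods P j) x" for x v
    proof (rule vs_move(2)[OF fmodD(1)[OF fY x]])
      show "ph 0 x v \<in> car (mods Y 0) x" "ps 0 x v \<in> car (mods Y 0) x"
        using nat_transD(2)[OF liftsD(1)[OF ph, of 0] x] nat_transD(2)[OF liftsD(1)[OF ps, of 0] x] v by auto
      show "bdry Y 0 x (h x v) \<in> car (mods Y 0) x"
        by (rule nat_transD(2)[OF nY x nat_transD(2)[OF h(1) x v]])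
    qed (auto simp: h(2)[OF x v] vs_closed[OF fmodD(1)[OF fY x]])
    have "A 0 h" unfolding A_def using h(1) eq nat_transD(2)[OF nP] by simp
    then show ?thesis by blast
  qed
  moreover have "\<exists>h'. A (Suc n) h' \<and> B n h h'" if A: "A n h" for n h
  proof -
    have h: "nat_trans D (mods P (j + n)) (mods Y (Suc n)) h" using A by (simp add: A_def)
    let ?d = "bdry P (j + n)"
    let ?f = "\<lambda>x v. ph (Suc n) x v \<oplus>\<^bsub>sp (mods Y (Suc n)) x\<^esub> (-1) \<odot>\<^bsub>sp (mods Y (Suc n)) x\<^esub> ps (Suc n) x v
      \<oplus>\<^bsub>sp (mods Y (Suc n)) x\<^esub> (-1) \<odot>\<^bsub>sp (mods Y (Suc n)) x\<^esub> h x (?d x v)"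
    have f: "nat_trans D (mods P (Suc (j + n))) (mods Y (Suc n)) ?f"
      using liftsD(1)[OF ph, of "Suc n"] liftsD(1)[OF ps, of "Suc n"] fY nat_trans_comp[OF D nP h]
      by (intro nat_trans_add[OF D] nat_trans_scale[OF D]) auto
    have c: "ph (Suc n) x v \<in> car (mods Y (Suc n)) x" "ps (Suc n) x v \<in> car (mods Y (Suc n)) x"
        "?d x v \<in> car (mods P (j + n)) x" "h x (?d x v) \<in> car (mods Y (Suc n)) x"
      if x: "x \<in> Obj D" and v: "v \<in> car (mods P (Suc (j + n))) x" for x v
      using nat_transD(2)[OF liftsD(1)[OF ph, of "Suc n"] x] nat_transD(2)[OF liftsD(1)[OF ps, of "Suc n"] x]
        nat_transD(2)[OF nP x v] nat_transD(2)[OF h x] v by auto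
    obtain h' where h': "nat_trans D (mods P (Suc (j + n))) (mods Y (Suc (Suc n))) h'"
      "\<And>x v. x \<in> Obj D ==> v \<in> car (mods P (Suc (j + n))) x ==> bdry Y (Suc n) x (h' x v) = ?f x v"
    proof (rule projective_lift[OF D PP fY fY nY f])
      fix x v assume x: "x \<in> Obj D" and v: "v \<in> car (mods P (Suc (j + n))) x"
      note V = fmodD(1)[OF fY x] and c = c[OF x v]
      have c': "ph n x (?d x v) \<in> car (mods Y n) x" "ps n x (?d x v) \<in> car (mods Y n) x"
        using nat_transD(2)[OF liftsD(1)[OF ph] x c(3)] nat_transD(2)[OF liftsD(1)[OF ps] x c(3)] by auto
      note bY = nat_transD(1)[OF nY x, of n]
      have "bdry Y n x (?f x v) = ph n x (?d x v) \<oplus>\<^bsub>sp (mods Y n) x\<^esub> (-1) \<odot>\<^bsub>sp (mods Y n) x\<^esub> ps n x (?d x v)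
          \<oplus>\<^bsub>sp (mods Y n) x\<^esub> (-1) \<odot>\<^bsub>sp (mods Y n) x\<^esub> bdry Y n x (h x (?d x v))"
        using lhomD[OF bY] c liftsD(3)[OF ph x v] liftsD(3)[OF ps x v] by (simp add: vs_closed[OF V])
      also have "\<dots> = \<zero>\<^bsub>sp (mods Y n) x\<^esub>"
        by (rule vs_move(3)[OF V c'(1,2) lhomD(1)[OF bY c(4)]])
           (use A x v in \<open>simp add: A_def\<close>)
      finally show "?f x v \<in> bdry Y (Suc n) x ` car (mods Y (Suc (Suc n))) x"
        using resolution_exact(5)[OF Y x, of "?f x v"] c by (simp add: vs_closed[OF V])
    qed blast
    have eq: "ph (Suc n) x v = ps (Suc n) x v \<oplus>\<^bsub>sp (mods Y (Suc n)) x\<^esub> bdry Y (Suc n) x (h' x v)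
        \<oplus>\<^bsub>sp (mods Y (Suc n)) x\<^esub> h x (?d x v)"
      if x: "x \<in> Obj D" and v: "v \<in> car (mods P (Suc (j + n))) x" for x v
      by (rule vs_move(1)[OF fmodD(1)[OF fY x] c(1,2)[OF x v] nat_transD(2)[OF nY x nat_transD(2)[OF h'(1) x v]] c(4)[OF x v]])
         (simp add: h'(2)[OF x v])
    then have "B n h h'" by (simp add: B_def)
    moreover have "A (Suc n) h'" unfolding A_def
    proof (intro conjI ballI)
      fix x v assume x: "x \<in> Obj D" and v: "v \<in> car (mods P (Suc (j + Suc n))) x"
      then have v': "v \<in> car (mods P (Suc (Suc (j + n)))) x" by simp
      have b: "bdry P (Suc (j + n)) x v \<in> car (mods P (Suc (j + n))) x"
        by (rule nat_transD(2)[OF nP x v'])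
      show "ph (Suc n) x (bdry P (j + Suc n) x v) = ps (Suc n) x (bdry P (j + Suc n) x v)
          \<oplus>\<^bsub>sp (mods Y (Suc n)) x\<^esub> bdry Y (Suc n) x (h' x (bdry P (j + Suc n) x v))"
        using eq[OF x b] c[OF x b] nat_transD(2)[OF nY x nat_transD(2)[OF h'(1) x b]]
        by (simp add: resolution_exact(3)[OF PR x v'] vs_closed[OF fmodD(1)[OF fY x]] vs_zero[OF fmodD(1)[OF fY x]]
          nat_trans_zero_at[OF D h resolutionD(2)[OF PR] resolutionD(2)[OF Y] x])
    qed (use h' in auto)
    ultimately show ?thesis by blast
  qed
  ultimately obtain h where h: "\<And>n. A n (h n)" "\<And>n. B n (h n) (h (Suc n))"
    using dependent_nat_choice[of A B] by blast
  show thesis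
    by (rule that[of h]) (use h(1)[unfolded A_def] h(2)[unfolded B_def] in blast)+
qed

end

section \<open>Cohomology\<close>

text \<open>Cocycles are total functions, so two that agree on all carriers may still differ.
  Comparing values on carriers only, this relation identifies them, and the class of a cocycle is
  the set of all functions related to it.\<close>

definition cohom ::
    "('o, 'm) category => ('o, 'm, 'k::field, 'v, 'u) aug_complex => ('o, 'm, 'k, 'w) kfunctor
      => nat => ('o => 'v => 'w) => ('o => 'v => 'w) => bool" where
  "cohom D P N n f g \<longleftrightarrow> f \<in> cocycles D P N n \<and> g \<in> cocycles D P N n \<and>
    (\<exists>b\<in>coboundaries D P N n.
      \<forall>x\<in>Obj D. \<forall>v\<in>car (mods P n) x. g x v = f x v \<oplus>\<^bsub>sp N x\<^esub> b x v)"

lemma coh_class_cohom: "f \<in> cocycles D P N n ==> coh_class D P N n f = Collect (cohom D P N n f)"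
  by (auto simp: coh_class_def cohom_def)

lemma cohomD: "cohom D P N n f g ==> f \<in> cocycles D P N n" "cohom D P N n f g ==> g \<in> cocycles D P N n"
  by (auto simp: cohom_def)

context
  fixes D :: "('o, 'm) category" and M :: "('o, 'm, 'k::field, 'u) kfunctor"
    and P :: "('o, 'm, 'k, 'v, 'u) aug_complex" and N :: "('o, 'm, 'k, 'w) kfunctor"
  assumes D: "finite_category D" and P: "resolution D M P" and N: "fmod D N"
begin

interpretation D: finite_category D by (rule D)

lemma cocycle_cong:
  assumes "f \<in> cocycles D P N n" "\<And>x v. x \<in> Obj D ==> v \<in> car (mods P n) x ==> g x v = f x v"
  shows "g \<in> cocycles D P N n"
  unfolding cocycles_def
  using nat_trans_cong[OF D cocyclesD(1)[OF assms(1)] resolutionD(2)[OF P] assms(2)]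
    nat_transD(2)[OF resolutionD(3)[OF P]] cocyclesD(2)[OF assms(1)]
  by (simp add: assms(2))

lemma cocycle_zero: "(\<lambda>x v. \<zero>\<^bsub>sp N x\<^esub>) \<in> cocycles D P N n"
  by (simp add: cocycles_def nat_trans_zero[OF D N])

lemma cocycle_add:
  "f \<in> cocycles D P N n ==> g \<in> cocycles D P N n ==> (\<lambda>x v. f x v \<oplus>\<^bsub>sp N x\<^esub> g x v) \<in> cocycles D P N n"
  by (simp add: cocycles_def nat_trans_add[OF D _ _ N] fmodD[OF N] vs_zero vs_closed)

lemma cocycle_scale: "f \<in> cocycles D P N n ==> (\<lambda>x v. c \<odot>\<^bsub>sp N x\<^esub> f x v) \<in> cocycles D P N n"
  by (simp add: cocycles_def nat_trans_scale[OF D _ N] fmodD[OF N] vs_zero vs_closed)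

lemma coboundary_cocycle:
  assumes "b \<in> coboundaries D P N n"
  shows "b \<in> cocycles D P N n"
proof -
  have b: "nat_trans D (mods P n) N b" using assms by (simp add: coboundaries_def)
  have "b x (bdry P n x v) = \<zero>\<^bsub>sp N x\<^esub>" if x: "x \<in> Obj D" and v: "v \<in> car (mods P (Suc n)) x" for x v
  proof (cases n)
    case 0
    then show ?thesis using assms nat_transD(2)[OF resolutionD(3)[OF P] x v] x by (simp add: coboundaries_def)
  next
    case (Suc m)
    with assms obtain h where h: "nat_trans D (mods P m) N h"
      "\<And>x v. x \<in> Obj D ==> v \<in> car (mods P n) x ==> b x v = h x (bdry P m x v)"
      by (auto simp: coboundaries_def)
    show ?thesis
      using h(2)[OF x nat_transD(2)[OF resolutionD(3)[OF P] x v]] resolution_exact(3)[OF P x, of v m] v Suc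
        nat_trans_zero_at[OF D h(1) resolutionD(2)[OF P] N x] by simp
  qed
  with b show ?thesis by (simp add: cocycles_def)
qed

lemma coboundary_zero: "(\<lambda>x v. \<zero>\<^bsub>sp N x\<^esub>) \<in> coboundaries D P N n"
  by (auto simp: coboundaries_def nat_trans_zero[OF D N] split: nat.split
      intro!: exI[of _ "\<lambda>x v. \<zero>\<^bsub>sp N x\<^esub>"])

lemma coboundary_add:
  assumes "b \<in> coboundaries D P N n" "c \<in> coboundaries D P N n"
  shows "(\<lambda>x v. b x v \<oplus>\<^bsub>sp N x\<^esub> c x v) \<in> coboundaries D P N n"
proof (cases n)
  case 0
  then show ?thesis using assms
    by (auto simp: coboundaries_def nat_trans_add[OF D _ _ N] fmodD[OF N] vs_zero vs_closed)
next
  case (Suc m)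
  from assms obtain h k where "nat_trans D (mods P m) N h" "nat_trans D (mods P m) N k"
    "\<forall>x\<in>Obj D. \<forall>v\<in>car (mods P n) x. b x v = h x (bdry P m x v)"
    "\<forall>x\<in>Obj D. \<forall>v\<in>car (mods P n) x. c x v = k x (bdry P m x v)"
    by (auto simp: coboundaries_def Suc)
  then show ?thesis using assms Suc
    by (auto simp: coboundaries_def nat_trans_add[OF D _ _ N]
        intro!: exI[of _ "\<lambda>x v. h x v \<oplus>\<^bsub>sp N x\<^esub> k x v"])
qed

lemma coboundary_scale:
  assumes "b \<in> coboundaries D P N n"
  shows "(\<lambda>x v. a \<odot>\<^bsub>sp N x\<^esub> b x v) \<in> coboundaries D P N n"
proof (cases n)
  case 0
  then show ?thesis using assms
    by (auto simp: coboundaries_def nat_trans_scale[OF D _ N] fmodD[OF N] vs_zero vs_closed)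
next
  case (Suc m)
  from assms obtain h where "nat_trans D (mods P m) N h"
    "\<forall>x\<in>Obj D. \<forall>v\<in>car (mods P n) x. b x v = h x (bdry P m x v)"
    by (auto simp: coboundaries_def Suc)
  then show ?thesis using assms Suc
    by (auto simp: coboundaries_def nat_trans_scale[OF D _ N]
        intro!: exI[of _ "\<lambda>x v. a \<odot>\<^bsub>sp N x\<^esub> h x v"])
qed

lemma cocycle_val: "f \<in> cocycles D P N n ==> x \<in> Obj D ==> v \<in> car (mods P n) x ==> f x v \<in> car N x"
  by (rule nat_transD(2)[OF cocyclesD(1)])

lemma cohomI:
  assumes "f \<in> cocycles D P N n" "b \<in> coboundaries D P N n"
    "\<And>x v. x \<in> Obj D ==> v \<in> car (mods P n) x ==> g x v = f x v \<oplus>\<^bsub>sp N x\<^esub> b x v"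
  shows "cohom D P N n f g"
proof -
  have "g \<in> cocycles D P N n"
    by (rule cocycle_cong[OF cocycle_add[OF assms(1) coboundary_cocycle[OF assms(2)]] assms(3)])
  with assms show ?thesis unfolding cohom_def by blast
qed

lemma cohom_eq:
  assumes "f \<in> cocycles D P N n" "\<And>x v. x \<in> Obj D ==> v \<in> car (mods P n) x ==> g x v = f x v"
  shows "cohom D P N n f g"
  by (rule cohomI[OF assms(1) coboundary_zero])
     (use assms cocycle_val[OF assms(1)] in \<open>simp add: fmodD[OF N] vs_zero\<close>)

lemma cohomE:
  assumes "cohom D P N n f g"
  obtains b where "b \<in> coboundaries D P N n"
    "\<And>x v. x \<in> Obj D ==> v \<in> car (mods P n) x ==> g x v = f x v \<oplus>\<^bsub>sp N x\<^esub> b x v"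
  using assms unfolding cohom_def by blast

lemma cohom_sym: "cohom D P N n f g ==> cohom D P N n g f"
proof -
  assume fg: "cohom D P N n f g"
  from cohomE[OF fg] obtain b where b: "b \<in> coboundaries D P N n"
    "\<And>x v. x \<in> Obj D ==> v \<in> car (mods P n) x ==> g x v = f x v \<oplus>\<^bsub>sp N x\<^esub> b x v" by blast
  show ?thesis
  proof (rule cohomI[OF cohomD(2)[OF fg] coboundary_scale[OF b(1), of "-1"]])
    fix x v assume *: "x \<in> Obj D" "v \<in> car (mods P n) x"
    show "f x v = g x v \<oplus>\<^bsub>sp N x\<^esub> - 1 \<odot>\<^bsub>sp N x\<^esub> b x v"
      by (rule vs_move(4)[OF fmodD(1)[OF N *(1)]])
         (use cocycle_val[OF cohomD(1)[OF fg] *] cocycle_val[OF cohomD(2)[OF fg] *]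
           cocycle_val[OF coboundary_cocycle[OF b(1)] *] b(2)[OF *] in auto)
  qed
qed

lemma cohom_trans: "cohom D P N n f g ==> cohom D P N n g h ==> cohom D P N n f h"
proof -
  assume fg: "cohom D P N n f g" and gh: "cohom D P N n g h"
  from cohomE[OF fg] obtain b where b: "b \<in> coboundaries D P N n"
    "\<And>x v. x \<in> Obj D ==> v \<in> car (mods P n) x ==> g x v = f x v \<oplus>\<^bsub>sp N x\<^esub> b x v" by blast
  from cohomE[OF gh] obtain c where c: "c \<in> coboundaries D P N n"
    "\<And>x v. x \<in> Obj D ==> v \<in> car (mods P n) x ==> h x v = g x v \<oplus>\<^bsub>sp N x\<^esub> c x v" by blast
  show ?thesis
  proof (rule cohomI[OF cohomD(1)[OF fg] coboundary_add[OF b(1) c(1)]])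
    fix x v assume *: "x \<in> Obj D" "v \<in> car (mods P n) x"
    show "h x v = f x v \<oplus>\<^bsub>sp N x\<^esub> (b x v \<oplus>\<^bsub>sp N x\<^esub> c x v)"
      unfolding c(2)[OF *] b(2)[OF *]
      by (rule vs_ac(1)[OF fmodD(1)[OF N *(1)]])
         (use cocycle_val[OF cohomD(1)[OF fg] *] cocycle_val[OF coboundary_cocycle[OF c(1)] *]
           cocycle_val[OF coboundary_cocycle[OF b(1)] *] in auto)
  qed
qed

lemma coh_class_eq_iff:
  assumes "f \<in> cocycles D P N n" "g \<in> cocycles D P N n"
  shows "coh_class D P N n f = coh_class D P N n g \<longleftrightarrow> cohom D P N n f g"
proof
  assume "coh_class D P N n f = coh_class D P N n g"
  moreover have "cohom D P N n g g" by (rule cohom_eq[OF assms(2)]) simp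
  ultimately show "cohom D P N n f g" using assms by (simp add: coh_class_cohom set_eq_iff)
next
  assume fg: "cohom D P N n f g"
  show "coh_class D P N n f = coh_class D P N n g"
    using cohom_trans[OF fg] cohom_trans[OF cohom_sym[OF fg]] assms by (auto simp: coh_class_cohom)
qed

lemma coh_class_self: "f \<in> cocycles D P N n ==> f \<in> coh_class D P N n f"
  using cohom_eq[of f n f] by (simp add: coh_class_cohom)

text \<open>Operations on classes are defined as unions over representatives; this evaluates such a
  union once its terms are known to depend on the class only.\<close>

lemma coh_class_UN:
  assumes "f \<in> cocycles D P N n" "\<And>g. cohom D P N n f g ==> B g = B f"
  shows "(\<Union>g\<in>coh_class D P N n f. B g) = B f"
  by (rule UN_constant_eq[OF coh_class_self[OF assms(1)]])
     (use assms in \<open>auto simp: coh_class_cohom\<close>)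

lemma cohom_add:
  assumes "cohom D P N n f f'" "cohom D P N n g g'"
  shows "cohom D P N n (\<lambda>x v. f x v \<oplus>\<^bsub>sp N x\<^esub> g x v) (\<lambda>x v. f' x v \<oplus>\<^bsub>sp N x\<^esub> g' x v)"
proof -
  from cohomE[OF assms(1)] obtain b where b: "b \<in> coboundaries D P N n"
    "\<And>x v. x \<in> Obj D ==> v \<in> car (mods P n) x ==> f' x v = f x v \<oplus>\<^bsub>sp N x\<^esub> b x v" by blast
  from cohomE[OF assms(2)] obtain c where c: "c \<in> coboundaries D P N n"
    "\<And>x v. x \<in> Obj D ==> v \<in> car (mods P n) x ==> g' x v = g x v \<oplus>\<^bsub>sp N x\<^esub> c x v" by blast
  show ?thesis
  proof (rule cohomI[OF cocycle_add[OF cohomD(1)[OF assms(1)] cohomD(1)[OF assms(2)]] coboundary_add[OF b(1) c(1)]])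
    fix x v assume *: "x \<in> Obj D" "v \<in> car (mods P n) x"
    note V = fmodD(1)[OF N *(1)]
    show "f' x v \<oplus>\<^bsub>sp N x\<^esub> g' x v = f x v \<oplus>\<^bsub>sp N x\<^esub> g x v \<oplus>\<^bsub>sp N x\<^esub> (b x v \<oplus>\<^bsub>sp N x\<^esub> c x v)"
      unfolding b(2)[OF *] c(2)[OF *]
      using cocycle_val[OF cohomD(1)[OF assms(1)] *] cocycle_val[OF cohomD(1)[OF assms(2)] *]
        cocycle_val[OF coboundary_cocycle[OF b(1)] *] cocycle_val[OF coboundary_cocycle[OF c(1)] *]
      by (simp add: vs_closed[OF V] vs_ac[OF V])
  qed
qed

lemma cohom_scale:
  assumes "cohom D P N n f f'"
  shows "cohom D P N n (\<lambda>x v. a \<odot>\<^bsub>sp N x\<^esub> f x v) (\<lambda>x v. a \<odot>\<^bsub>sp N x\<^esub> f' x v)"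
proof -
  from cohomE[OF assms(1)] obtain b where b: "b \<in> coboundaries D P N n"
    "\<And>x v. x \<in> Obj D ==> v \<in> car (mods P n) x ==> f' x v = f x v \<oplus>\<^bsub>sp N x\<^esub> b x v" by blast
  show ?thesis
  proof (rule cohomI[OF cocycle_scale[OF cohomD(1)[OF assms(1)]] coboundary_scale[OF b(1)]])
    fix x v assume *: "x \<in> Obj D" "v \<in> car (mods P n) x"
    note V = fmodD(1)[OF N *(1)]
    show "a \<odot>\<^bsub>sp N x\<^esub> f' x v = a \<odot>\<^bsub>sp N x\<^esub> f x v \<oplus>\<^bsub>sp N x\<^esub> a \<odot>\<^bsub>sp N x\<^esub> b x v"
      unfolding b(2)[OF *]
      using cocycle_val[OF cohomD(1)[OF assms(1)] *] cocycle_val[OF coboundary_cocycle[OF b(1)] *]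
      by (simp add: vs_smult[OF V])
  qed
qed

text \<open>Changing a representative by a coboundary changes a sum or a multiple by a coboundary.
  For the sum the inner union is evaluated first, for each fixed member of the outer class.\<close>

lemma ext_space_simps:
  "carrier (ext_space D P N n) = coh_class D P N n ` cocycles D P N n"
  "\<zero>\<^bsub>ext_space D P N n\<^esub> = coh_class D P N n (\<lambda>x v. \<zero>\<^bsub>sp N x\<^esub>)"
  "[|f \<in> cocycles D P N n; g \<in> cocycles D P N n|] ==>
    coh_class D P N n f \<oplus>\<^bsub>ext_space D P N n\<^esub> coh_class D P N n g = coh_class D P N n (\<lambda>x v. f x v \<oplus>\<^bsub>sp N x\<^esub> g x v)"
  "f \<in> cocycles D P N n ==>
    c \<odot>\<^bsub>ext_space D P N n\<^esub> coh_class D P N n f = coh_class D P N n (\<lambda>x v. c \<odot>\<^bsub>sp N x\<^esub> f x v)"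
proof -
  show "coh_class D P N n f \<oplus>\<^bsub>ext_space D P N n\<^esub> coh_class D P N n g = coh_class D P N n (\<lambda>x v. f x v \<oplus>\<^bsub>sp N x\<^esub> g x v)"
    if f: "f \<in> cocycles D P N n" and g: "g \<in> cocycles D P N n"
  proof -
    have "(\<Union>g'\<in>coh_class D P N n g. coh_class D P N n (\<lambda>x v. f' x v \<oplus>\<^bsub>sp N x\<^esub> g' x v))
        = coh_class D P N n (\<lambda>x v. f' x v \<oplus>\<^bsub>sp N x\<^esub> g x v)" if f': "f' \<in> cocycles D P N n" for f'
      by (rule coh_class_UN[OF g], subst coh_class_eq_iff)
         (auto intro!: cocycle_add cohom_add f' g dest: cohomD cohom_sym intro: cohom_eq)
    then have "(\<Union>f'\<in>coh_class D P N n f. \<Union>g'\<in>coh_class D P N n g. coh_class D P N n (\<lambda>x v. f' x v \<oplus>\<^bsub>sp N x\<^esub> g' x v))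
        = (\<Union>f'\<in>coh_class D P N n f. coh_class D P N n (\<lambda>x v. f' x v \<oplus>\<^bsub>sp N x\<^esub> g x v))"
      by (intro SUP_cong refl) (simp add: coh_class_def)
    also have "\<dots> = coh_class D P N n (\<lambda>x v. f x v \<oplus>\<^bsub>sp N x\<^esub> g x v)"
      by (rule coh_class_UN[OF f], subst coh_class_eq_iff)
         (auto intro!: cocycle_add cohom_add f g dest: cohomD cohom_sym intro: cohom_eq)
    finally show ?thesis by (simp add: ext_space_def)
  qed
  show "c \<odot>\<^bsub>ext_space D P N n\<^esub> coh_class D P N n f = coh_class D P N n (\<lambda>x v. c \<odot>\<^bsub>sp N x\<^esub> f x v)"
    if f: "f \<in> cocycles D P N n"
  proof -
    have "(\<Union>f'\<in>coh_class D P N n f. coh_class D P N n (\<lambda>x v. c \<odot>\<^bsub>sp N x\<^esub> f' x v))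
        = coh_class D P N n (\<lambda>x v. c \<odot>\<^bsub>sp N x\<^esub> f x v)"
      by (rule coh_class_UN[OF f], subst coh_class_eq_iff)
         (auto intro!: cocycle_scale cohom_scale f dest: cohomD cohom_sym)
    then show ?thesis by (simp add: ext_space_def)
  qed
qed (auto simp: ext_space_def)

text \<open>The laws hold for representatives on carriers only, not as equations of functions; each
  of them therefore passes through \<open>eq\<close>, by which functions agreeing on carriers have
  the same class.\<close>

lemma vs_ext_space: "vs (ext_space D P N n)"
proof -
  have eq: "coh_class D P N n g = coh_class D P N n f"
    if "f \<in> cocycles D P N n" "\<And>x v. x \<in> Obj D ==> v \<in> car (mods P n) x ==> g x v = f x v" for f g
    using cohom_eq[OF that] cocycle_cong[OF that] coh_class_eq_iff[OF that(1), of g] by simp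
  note C = cocycle_add cocycle_scale cocycle_zero
  note val = cocycle_val
  have V: "x \<in> Obj D ==> vs (sp N x)" for x by (rule fmodD(1)[OF N])
  show ?thesis
  proof (rule vsI; (unfold ext_space_simps(1))?; (elim imageE)?; (hypsubst)?)
    fix f assume f: "f \<in> cocycles D P N n"
    show "\<zero>\<^bsub>ext_space D P N n\<^esub> \<oplus>\<^bsub>ext_space D P N n\<^esub> coh_class D P N n f = coh_class D P N n f"
      unfolding ext_space_simps(2) ext_space_simps(3)[OF cocycle_zero f]
      by (rule eq[OF f]) (simp add: vs_zero[OF V] val[OF f])
    show "coh_class D P N n f \<oplus>\<^bsub>ext_space D P N n\<^esub> - 1 \<odot>\<^bsub>ext_space D P N n\<^esub> coh_class D P N n f = \<zero>\<^bsub>ext_space D P N n\<^esub>"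
      unfolding ext_space_simps(2) ext_space_simps(4)[OF f] ext_space_simps(3)[OF f cocycle_scale[OF f]]
      by (rule eq[OF cocycle_zero]) (simp add: vs_cancel[OF V] val[OF f])
    show "1 \<odot>\<^bsub>ext_space D P N n\<^esub> coh_class D P N n f = coh_class D P N n f"
      unfolding ext_space_simps(4)[OF f] by (rule eq[OF f]) (simp add: vs_smult[OF V] val[OF f])
    fix c d
    show "c \<odot>\<^bsub>ext_space D P N n\<^esub> coh_class D P N n f \<in> coh_class D P N n ` cocycles D P N n"
      by (simp add: ext_space_simps C f)
    show "(c + d) \<odot>\<^bsub>ext_space D P N n\<^esub> coh_class D P N n f = c \<odot>\<^bsub>ext_space D P N n\<^esub> coh_class D P N n f
        \<oplus>\<^bsub>ext_space D P N n\<^esub> d \<odot>\<^bsub>ext_space D P N n\<^esub> coh_class D P N n f"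
      unfolding ext_space_simps(4)[OF f] ext_space_simps(3)[OF cocycle_scale[OF f] cocycle_scale[OF f]]
      by (rule eq[OF cocycle_add[OF cocycle_scale[OF f] cocycle_scale[OF f]]]) (simp add: vs_smult[OF V] val[OF f])
    show "(c * d) \<odot>\<^bsub>ext_space D P N n\<^esub> coh_class D P N n f = c \<odot>\<^bsub>ext_space D P N n\<^esub> (d \<odot>\<^bsub>ext_space D P N n\<^esub> coh_class D P N n f)"
      unfolding ext_space_simps(4)[OF f] ext_space_simps(4)[OF cocycle_scale[OF f]]
      by (rule eq[OF cocycle_scale[OF cocycle_scale[OF f]]]) (simp add: vs_smult[OF V] val[OF f])
    fix g assume g: "g \<in> cocycles D P N n"
    show "coh_class D P N n f \<oplus>\<^bsub>ext_space D P N n\<^esub> coh_class D P N n g \<in> coh_class D P N n ` cocycles D P N n"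
      by (simp add: ext_space_simps C f g)
    show "coh_class D P N n f \<oplus>\<^bsub>ext_space D P N n\<^esub> coh_class D P N n g = coh_class D P N n g \<oplus>\<^bsub>ext_space D P N n\<^esub> coh_class D P N n f"
      unfolding ext_space_simps(3)[OF f g] ext_space_simps(3)[OF g f]
      by (rule eq[OF cocycle_add[OF g f]]) (simp add: vs_ac[OF V] val[OF f] val[OF g])
    show "c \<odot>\<^bsub>ext_space D P N n\<^esub> (coh_class D P N n f \<oplus>\<^bsub>ext_space D P N n\<^esub> coh_class D P N n g)
        = c \<odot>\<^bsub>ext_space D P N n\<^esub> coh_class D P N n f \<oplus>\<^bsub>ext_space D P N n\<^esub> c \<odot>\<^bsub>ext_space D P N n\<^esub> coh_class D P N n g"
      unfolding ext_space_simps(3)[OF f g] ext_space_simps(4)[OF cocycle_add[OF f g]] ext_space_simps(4)[OF f]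
        ext_space_simps(4)[OF g] ext_space_simps(3)[OF cocycle_scale[OF f] cocycle_scale[OF g]]
      by (rule eq[OF cocycle_add[OF cocycle_scale[OF f] cocycle_scale[OF g]]])
         (simp add: vs_smult[OF V] val[OF f] val[OF g])
    fix h assume h: "h \<in> cocycles D P N n"
    show "coh_class D P N n f \<oplus>\<^bsub>ext_space D P N n\<^esub> coh_class D P N n g \<oplus>\<^bsub>ext_space D P N n\<^esub> coh_class D P N n h
        = coh_class D P N n f \<oplus>\<^bsub>ext_space D P N n\<^esub> (coh_class D P N n g \<oplus>\<^bsub>ext_space D P N n\<^esub> coh_class D P N n h)"
      unfolding ext_space_simps(3)[OF f g] ext_space_simps(3)[OF g h] ext_space_simps(3)[OF cocycle_add[OF f g] h]
        ext_space_simps(3)[OF f cocycle_add[OF g h]]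
      by (rule eq[OF cocycle_add[OF f cocycle_add[OF g h]]])
         (simp add: vs_ac(1)[OF V] val[OF f] val[OF g] val[OF h])
  qed (simp add: ext_space_simps C)
qed

end

section \<open>Pulling cocycles back along lifts\<close>

context
  fixes D :: "('o, 'm) category" and M :: "('o, 'm, 'k::field, 'u) kfunctor"
    and P :: "('o, 'm, 'k, 'v, 'u) aug_complex" and N :: "('o, 'm, 'k, 'z) kfunctor"
    and Y :: "('o, 'm, 'k, 'y, 'z) aug_complex" and L :: "('o, 'm, 'k, 'w) kfunctor"
  assumes D: "finite_category D" and P: "proj_resolution D M P" and Y: "resolution D N Y"
    and L: "fmod D L"
begin

interpretation D: finite_category D by (rule D)

lemma PR': "resolution D M P"
  using P by (simp add: proj_resolution_def)

lemma cocycle_comp: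
  assumes "ph \<in> lifts D P j Y f" "g \<in> cocycles D Y L i"
  shows "(\<lambda>x v. g x (ph i x v)) \<in> cocycles D P L (j + i)"
  unfolding cocycles_def
proof (intro CollectI conjI ballI)
  show "nat_trans D (mods P (j + i)) L (\<lambda>x v. g x (ph i x v))"
    by (rule nat_trans_comp[OF D liftsD(1)[OF assms(1)] cocyclesD(1)[OF assms(2)]])
  fix x v assume x: "x \<in> Obj D" and v: "v \<in> car (mods P (Suc (j + i))) x"
  have "ph (Suc i) x v \<in> car (mods Y (Suc i)) x"
    using nat_transD(2)[OF liftsD(1)[OF assms(1), of "Suc i"] x] v by simp
  then show "g x (ph i x (bdry P (j + i) x v)) = \<zero>\<^bsub>sp L x\<^esub>"
    using liftsD(3)[OF assms(1) x v] cocyclesD(2)[OF assms(2) x] by metis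
qed

text \<open>A chain map turns \<open>h\<close> after the boundary of \<open>Y\<close> into a cochain
  after the boundary of \<open>P\<close>, so coboundaries pull back to coboundaries. For
  \<open>i = 0\<close> a coboundary on \<open>Y\<close> vanishes and the two pullbacks
  agree.\<close>

lemma cohom_comp:
  assumes ph: "ph \<in> lifts D P j Y f" and g: "cohom D Y L i g g'"
  shows "cohom D P L (j + i) (\<lambda>x v. g x (ph i x v)) (\<lambda>x v. g' x (ph i x v))"
proof -
  from cohomE[OF D Y L g] obtain b where b: "b \<in> coboundaries D Y L i"
    "\<And>x v. x \<in> Obj D ==> v \<in> car (mods Y i) x ==> g' x v = g x v \<oplus>\<^bsub>sp L x\<^esub> b x v" by blast
  note phn = liftsD(1)[OF ph] and c = cocycle_comp[OF ph]
  note gc = c[OF cohomD(1)[OF g]]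
  show ?thesis
  proof (cases i)
    case 0
    show ?thesis
      by (rule cohom_eq[OF D PR' L gc])
         (use 0 b nat_transD(2)[OF phn] nat_transD(2)[OF cocyclesD(1)[OF cohomD(1)[OF g]]] in
           \<open>simp add: coboundaries_def vs_zero[OF fmodD(1)[OF L]]\<close>)
  next
    case (Suc m)
    with b(1) obtain h where h: "nat_trans D (mods Y m) L h"
      "\<And>x v. x \<in> Obj D ==> v \<in> car (mods Y i) x ==> b x v = h x (bdry Y m x v)"
      by (auto simp: coboundaries_def)
    have "(\<lambda>x v. h x (ph m x (bdry P (j + m) x v))) \<in> coboundaries D P L (j + i)"
      unfolding coboundaries_def Suc
      using nat_trans_comp[OF D phn[of m] h(1)]
        nat_trans_comp[OF D resolutionD(3)[OF PR'] nat_trans_comp[OF D phn[of m] h(1)]]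
      by (auto intro!: exI[of _ "\<lambda>x v. h x (ph m x v)"])
    then show ?thesis
    proof (rule cohomI[OF D PR' L gc])
      fix x v assume x: "x \<in> Obj D" and v: "v \<in> car (mods P (j + i)) x"
      have p: "ph i x v \<in> car (mods Y i) x" by (rule nat_transD(2)[OF phn x v])
      have "bdry Y m x (ph i x v) = ph m x (bdry P (j + m) x v)"
        using liftsD(3)[OF ph x, of v m] v Suc by simp
      then show "g' x (ph i x v) = g x (ph i x v) \<oplus>\<^bsub>sp L x\<^esub> h x (ph m x (bdry P (j + m) x v))"
        using b(2)[OF x p] h(2)[OF x p] by simp
    qed
  qed
qed

text \<open>In the homotopy between the lifts, the term with the boundary of \<open>Y\<close> is
  killed by the cocycle \<open>g\<close>, and the term with the boundary of \<open>P\<close>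
  contributes a coboundary. For \<open>i = 0\<close> the second term is absent, so the pullbacks
  agree on carriers even when \<open>j + i\<close> is positive.\<close>

lemma lifts_unique:
  assumes ph: "ph \<in> lifts D P j Y f" and ps: "ps \<in> lifts D P j Y f" and g: "g \<in> cocycles D Y L i"
  shows "cohom D P L (j + i) (\<lambda>x v. g x (ps i x v)) (\<lambda>x v. g x (ph i x v))"
proof -
  obtain h where h: "\<And>i. nat_trans D (mods P (j + i)) (mods Y (Suc i)) (h i)"
    "\<And>x v. x \<in> Obj D ==> v \<in> car (mods P j) x ==>
      ph 0 x v = ps 0 x v \<oplus>\<^bsub>sp (mods Y 0) x\<^esub> bdry Y 0 x (h 0 x v)"
    "\<And>i x v. x \<in> Obj D ==> v \<in> car (mods P (Suc (j + i))) x ==>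
      ph (Suc i) x v = ps (Suc i) x v \<oplus>\<^bsub>sp (mods Y (Suc i)) x\<^esub> bdry Y (Suc i) x (h (Suc i) x v)
        \<oplus>\<^bsub>sp (mods Y (Suc i)) x\<^esub> h i x (bdry P (j + i) x v)"
    by (rule lifts_homotopy[OF D P Y ph ps]) blast
  note gn = cocyclesD(1)[OF g] and gc = cocycle_comp[OF ps g] and bY = resolutionD(3)[OF Y]
  have fin: "ps i x v \<in> car (mods Y i) x" "bdry Y i x (h i x v) \<in> car (mods Y i) x"
    "g x (bdry Y i x (h i x v)) = \<zero>\<^bsub>sp L x\<^esub>" "g x (ps i x v) \<in> car L x"
    if x: "x \<in> Obj D" and v: "v \<in> car (mods P (j + i)) x" for x v
  proof -
    note hv = nat_transD(2)[OF h(1) x v]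
    show p: "ps i x v \<in> car (mods Y i) x" by (rule nat_transD(2)[OF liftsD(1)[OF ps] x v])
    show "bdry Y i x (h i x v) \<in> car (mods Y i) x" by (rule nat_transD(2)[OF bY x hv])
    show "g x (bdry Y i x (h i x v)) = \<zero>\<^bsub>sp L x\<^esub>" by (rule cocyclesD(2)[OF g x hv])
    show "g x (ps i x v) \<in> car L x" by (rule nat_transD(2)[OF gn x p])
  qed
  show ?thesis
  proof (cases i)
    case 0
    show ?thesis
    proof (rule cohom_eq[OF D PR' L gc])
      fix x v assume x: "x \<in> Obj D" and v: "v \<in> car (mods P (j + i)) x"
      show "g x (ph i x v) = g x (ps i x v)"
        using h(2)[OF x, of v] fin[OF x v] lhomD(2)[OF nat_transD(1)[OF gn x]] 0 v
        by (simp add: vs_zero[OF fmodD(1)[OF L x]])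
    qed
  next
    case (Suc m)
    have gh: "nat_trans D (mods P (j + m)) L (\<lambda>x v. g x (h m x v))"
      using nat_trans_comp[OF D h(1)[of m] gn[unfolded Suc]] .
    have "(\<lambda>x v. g x (h m x (bdry P (j + m) x v))) \<in> coboundaries D P L (j + i)"
      unfolding coboundaries_def Suc
      using gh nat_trans_comp[OF D resolutionD(3)[OF PR'] gh]
      by (auto intro!: exI[of _ "\<lambda>x v. g x (h m x v)"])
    then show ?thesis
    proof (rule cohomI[OF D PR' L gc])
      fix x v assume x: "x \<in> Obj D" and v: "v \<in> car (mods P (j + i)) x"
      have v': "v \<in> car (mods P (Suc (j + m))) x" using v Suc by simp
      have hm: "h m x (bdry P (j + m) x v) \<in> car (mods Y i) x"
        using nat_transD(2)[OF h(1) x nat_transD(2)[OF resolutionD(3)[OF PR'] x v']] Suc by simp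
      have "ph i x v = ps i x v \<oplus>\<^bsub>sp (mods Y i) x\<^esub> bdry Y i x (h i x v) \<oplus>\<^bsub>sp (mods Y i) x\<^esub> h m x (bdry P (j + m) x v)"
        using h(3)[OF x v'] Suc by simp
      then show "g x (ph i x v) = g x (ps i x v) \<oplus>\<^bsub>sp L x\<^esub> g x (h m x (bdry P (j + m) x v))"
        using fin[OF x v] lhomD(2)[OF nat_transD(1)[OF gn x]] hm
        by (simp add: vs_zero[OF fmodD(1)[OF L x]] vs_closed[OF fmodD(1)[OF resolutionD(2)[OF Y] x]])
    qed
  qed
qed

text \<open>If \<open>f'\<close> exceeds \<open>f\<close> by \<open>h\<close> after the boundary,
  then \<open>h\<close> lifts through the augmentation of \<open>Y\<close> to \<open>k\<close>, and
  adding \<open>k\<close> after the boundary to the degree zero component of \<open>ph\<close> alone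
  gives a lift of \<open>f'\<close>. After composition with \<open>g\<close> it differs from
  \<open>ph\<close> by a coboundary, and from \<open>ps\<close> by uniqueness of lifts as
  well.\<close>

lemma lifts_cohom:
  assumes ph: "ph \<in> lifts D P j Y f" and ps: "ps \<in> lifts D P j Y f'" and ff': "cohom D P N j f f'"
    and g: "g \<in> cocycles D Y L i"
  shows "cohom D P L (j + i) (\<lambda>x v. g x (ph i x v)) (\<lambda>x v. g x (ps i x v))"
proof -
  note N = resolutionD(1)[OF Y] and gn = cocyclesD(1)[OF g]
  from cohomE[OF D PR' N ff'] obtain b where b: "b \<in> coboundaries D P N j"
    "\<And>x v. x \<in> Obj D ==> v \<in> car (mods P j) x ==> f' x v = f x v \<oplus>\<^bsub>sp N x\<^esub> b x v" by blast
  show ?thesis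
  proof (cases j)
    case 0
    have "f' x v = f x v" if "x \<in> Obj D" "v \<in> car (mods P j) x" for x v
      using b 0 that nat_transD(2)[OF cocyclesD(1)[OF cohomD(1)[OF ff']] that]
      by (simp add: coboundaries_def vs_zero[OF fmodD(1)[OF N]])
    then have "ps \<in> lifts D P j Y f" using ps by (auto simp: lifts_def)
    then show ?thesis using ph g by (rule lifts_unique)
  next
    case (Suc m)
    with b(1) obtain h where h: "nat_trans D (mods P m) N h"
      "\<And>x v. x \<in> Obj D ==> v \<in> car (mods P j) x ==> b x v = h x (bdry P m x v)"
      by (auto simp: coboundaries_def)
    obtain k where k: "nat_trans D (mods P m) (mods Y 0) k"
      "\<And>x v. x \<in> Obj D ==> v \<in> car (mods P m) x ==> aug Y x (k x v) = h x v"
    proof (rule projective_lift[OF D _ resolutionD(2)[OF Y] N resolutionD(4)[OF Y] h(1)])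
      show "projective D (mods P m)" using P by (simp add: proj_resolution_def)
    qed (use resolution_exact(1)[OF Y] nat_transD(2)[OF h(1)] in blast)+
    define ch where "ch = (\<lambda>i x v. if i = 0 then ph 0 x v \<oplus>\<^bsub>sp (mods Y 0) x\<^esub> k x (bdry P m x v) else ph i x v)"
    have kd: "nat_trans D (mods P j) (mods Y 0) (\<lambda>x v. k x (bdry P m x v))"
      using nat_trans_comp[OF D resolutionD(3)[OF PR', of m] k(1)] Suc by simp
    have "ch \<in> lifts D P j Y f'"
    proof (rule liftsI)
      fix i
      show "nat_trans D (mods P (j + i)) (mods Y i) (ch i)"
        using liftsD(1)[OF ph, of i] nat_trans_add[OF D _ kd resolutionD(2)[OF Y], of "ph 0"]
        by (cases i) (auto simp: ch_def[abs_def])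
      fix x v assume x: "x \<in> Obj D" and v: "v \<in> car (mods P (Suc (j + i))) x"
      have "k x (bdry P m x (bdry P j x v)) = \<zero>\<^bsub>sp (mods Y 0) x\<^esub>" if "i = 0"
        using resolution_exact(3)[OF PR' x, of v m] v that Suc
          nat_trans_zero_at[OF D k(1) resolutionD(2)[OF PR'] resolutionD(2)[OF Y] x] by simp
      moreover have "ph i x (bdry P (j + i) x v) \<in> car (mods Y i) x"
        by (rule nat_transD(2)[OF liftsD(1)[OF ph] x nat_transD(2)[OF resolutionD(3)[OF PR'] x v]])
      ultimately show "bdry Y i x (ch (Suc i) x v) = ch i x (bdry P (j + i) x v)"
        using liftsD(3)[OF ph x v] vs_zero(2)[OF fmodD(1)[OF resolutionD(2)[OF Y] x]]
        by (cases i) (simp_all add: ch_def)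
    next
      fix x v assume x: "x \<in> Obj D" and v: "v \<in> car (mods P j) x"
      have "bdry P m x v \<in> car (mods P m) x"
        using nat_transD(2)[OF resolutionD(3)[OF PR'] x, of v m] v Suc by simp
      then show "aug Y x (ch 0 x v) = f' x v"
        using b(2)[OF x v] h(2)[OF x v] k(2)[OF x] liftsD(2)[OF ph x v]
          lhomD(2)[OF nat_transD(1)[OF resolutionD(4)[OF Y] x]]
          nat_transD(2)[OF liftsD(1)[OF ph, of 0] x, of v] nat_transD(2)[OF kd x v] v
        by (simp add: ch_def)
    qed
    note c1 = lifts_unique[OF ps this g]
    have "cohom D P L (j + i) (\<lambda>x v. g x (ph i x v)) (\<lambda>x v. g x (ch i x v))"
    proof (cases "i = 0")
      case True
      have gk: "nat_trans D (mods P m) L (\<lambda>x v. g x (k x v))"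
        using nat_trans_comp[OF D k(1) gn[unfolded True]] .
      have "(\<lambda>x v. g x (k x (bdry P m x v))) \<in> coboundaries D P L (j + i)"
        unfolding coboundaries_def Suc True
        using gk nat_trans_comp[OF D resolutionD(3)[OF PR'] gk]
        by (auto intro!: exI[of _ "\<lambda>x v. g x (k x v)"])
      then show ?thesis
      proof (rule cohomI[OF D PR' L cocycle_comp[OF ph g]])
        fix x v assume x: "x \<in> Obj D" and v: "v \<in> car (mods P (j + i)) x"
        show "g x (ch i x v) = g x (ph i x v) \<oplus>\<^bsub>sp L x\<^esub> g x (k x (bdry P m x v))"
          using lhomD(2)[OF nat_transD(1)[OF gn x]] nat_transD(2)[OF liftsD(1)[OF ph, of 0] x, of v]
            nat_transD(2)[OF kd x, of v] v by (simp add: ch_def True)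
      qed
    next
      case False
      show ?thesis by (rule cohom_eq[OF D PR' L cocycle_comp[OF ph g]]) (simp add: ch_def False)
    qed
    then show ?thesis using c1 by (rule cohom_trans[OF D PR' L])
  qed
qed

end

text \<open>The three nested unions of \<open>ext_prod\<close> range over both classes and all
  lifts. They collapse because the class of the composite depends on none of these choices, and
  because lifts exist, so that no union is empty.\<close>

lemma ext_prod_eq:
  assumes D: "finite_category D" and P: "proj_resolution D M P"
    and g: "g \<in> cocycles D P M i" and f: "f \<in> cocycles D P M j" and ph: "ph \<in> lifts D P j P f"
  shows "ext_prod D P M i j (coh_class D P M i g) (coh_class D P M j f)
    = coh_class D P M (i + j) (\<lambda>x v. g x (ph i x v))"
proof -
  have R: "resolution D M P" using P by (simp add: proj_resolution_def)
  note M = resolutionD(1)[OF R]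
  have "coh_class D P M (i + j) (\<lambda>x v. g' x (ph' i x v)) = coh_class D P M (i + j) (\<lambda>x v. g x (ph i x v))"
    if g': "g' \<in> coh_class D P M i g" and f': "f' \<in> coh_class D P M j f" and ph': "ph' \<in> lifts D P j P f'"
    for g' f' ph'
  proof -
    have gg: "cohom D P M i g g'" and ff: "cohom D P M j f f'"
      using g' f' by (simp_all add: coh_class_cohom g f)
    have c: "cohom D P M (j + i) (\<lambda>x v. g x (ph i x v)) (\<lambda>x v. g' x (ph' i x v))"
      using cohom_trans[OF D R M lifts_cohom[OF D P R M ph ph' ff g] cohom_comp[OF D P R M ph' gg]] .
    then show ?thesis
      using coh_class_eq_iff[OF D R M cohomD(1)[OF c] cohomD(2)[OF c]] by (simp add: add.commute)
  qed
  note eq = this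
  have ne: "lifts D P j P f' \<noteq> {}" if "f' \<in> coh_class D P M j f" for f'
  proof -
    have "f' \<in> cocycles D P M j" using that by (simp add: coh_class_def)
    from lifts_exist[OF D P R this] show ?thesis by blast
  qed
  show ?thesis
    unfolding ext_prod_def
  proof (intro UN_constant_eq[OF coh_class_self[OF D R M g]] ballI)
    fix g' assume g': "g' \<in> coh_class D P M i g"
    show "(\<Union>f'\<in>coh_class D P M j f. \<Union>ph'\<in>lifts D P j P f'. coh_class D P M (i + j) (\<lambda>x v. g' x (ph' i x v)))
        = coh_class D P M (i + j) (\<lambda>x v. g x (ph i x v))"
    proof (intro UN_constant_eq[OF coh_class_self[OF D R M f]] ballI)
      fix f' assume f': "f' \<in> coh_class D P M j f"
      then obtain ph' where ph': "ph' \<in> lifts D P j P f'" using ne by blast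
      show "(\<Union>ph'\<in>lifts D P j P f'. coh_class D P M (i + j) (\<lambda>x v. g' x (ph' i x v)))
          = coh_class D P M (i + j) (\<lambda>x v. g x (ph i x v))"
        by (intro UN_constant_eq[OF ph'] ballI eq[OF g' f'])
    qed
  qed
qed

section \<open>Maps induced on Ext\<close>

text \<open>One axiomatization for five functors: \<open>LK\<close> along \<open>t\<close> and along
  \<open>\<nabla>\<close>, the two tensor products, and the identity. The axioms concern only the
  modules of \<open>P\<close> and only values on carriers. \<open>Fm_Fm\<close> merges functoriality
  with congruence: composites that agree on carriers are sent to composites that agree. Exactness is
  assumed for the one complex obtained from \<open>P\<close>, without projectivity.\<close>

locale ext_functor =
  fixes D :: "('o, 'm) category" and M :: "('o, 'm, 'k::field, 'w) kfunctor"
    and P :: "('o, 'm, 'k, 'v, 'w) aug_complex"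
    and E :: "('a, 'b) category" and N :: "('a, 'b, 'k, 'z) kfunctor"
    and Q :: "('a, 'b, 'k, 'q, 'z) aug_complex"
    and F :: "('o, 'm, 'k, 'v) kfunctor => ('a, 'b, 'k, 'u) kfunctor"
    and Fm :: "('o, 'm, 'k, 'v) kfunctor => ('o => 'v => 'v) => 'a => 'u => 'u"
    and Fa :: "('o => 'v => 'w) => 'a => 'u => 'z"
  assumes D: "finite_category D" and E: "finite_category E"
    and P: "proj_resolution D M P" and Q: "proj_resolution E N Q"
    and Y: "resolution E N (image_complex F Fm Fa P)"
    and Fa_nt: "\<And>n f. nat_trans D (mods P n) M f ==> nat_trans E (F (mods P n)) N (Fa f)"
    and Fa_cong: "\<And>n f g x u. [|nat_trans D (mods P n) M f; nat_trans D (mods P n) M g;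
        \<And>y v. y \<in> Obj D ==> v \<in> car (mods P n) y ==> f y v = g y v;
        x \<in> Obj E; u \<in> car (F (mods P n)) x|] ==> Fa f x u = Fa g x u"
    and Fa_add: "\<And>n f g x u. [|nat_trans D (mods P n) M f; nat_trans D (mods P n) M g;
        x \<in> Obj E; u \<in> car (F (mods P n)) x|]
      ==> Fa (\<lambda>y v. f y v \<oplus>\<^bsub>sp M y\<^esub> g y v) x u = Fa f x u \<oplus>\<^bsub>sp N x\<^esub> Fa g x u"
    and Fa_scale: "\<And>n c f x u. [|nat_trans D (mods P n) M f; x \<in> Obj E; u \<in> car (F (mods P n)) x|]
      ==> Fa (\<lambda>y v. c \<odot>\<^bsub>sp M y\<^esub> f y v) x u = c \<odot>\<^bsub>sp N x\<^esub> Fa f x u"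
    and Fm_nt: "\<And>n m ph. nat_trans D (mods P n) (mods P m) ph ==>
      nat_trans E (F (mods P n)) (F (mods P m)) (Fm (mods P m) ph)"
    and Fa_Fm: "\<And>n m ph f x u. [|nat_trans D (mods P n) (mods P m) ph; nat_trans D (mods P m) M f;
        x \<in> Obj E; u \<in> car (F (mods P n)) x|]
      ==> Fa f x (Fm (mods P m) ph x u) = Fa (\<lambda>y v. f y (ph y v)) x u"
    and Fm_Fm: "\<And>n m m' l ph ps ph' ps' x u. [|nat_trans D (mods P n) (mods P m) ph; nat_trans D (mods P m) (mods P l) ps;
        nat_trans D (mods P n) (mods P m') ph'; nat_trans D (mods P m') (mods P l) ps';
        \<And>y v. y \<in> Obj D ==> v \<in> car (mods P n) y ==> ps y (ph y v) = ps' y (ph' y v);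
        x \<in> Obj E; u \<in> car (F (mods P n)) x|]
      ==> Fm (mods P l) ps x (Fm (mods P m) ph x u) = Fm (mods P l) ps' x (Fm (mods P m') ph' x u)"
begin

abbreviation "Y \<equiv> image_complex F Fm Fa P"

lemma Y_simps: "mods Y n = F (mods P n)" "bdry Y n = Fm (mods P n) (bdry P n)" "aug Y = Fa (aug P)"
  by (simp_all add: image_complex_def)

lemma RP: "resolution D M P" and RQ: "resolution E N Q"
  using P Q by (auto simp: proj_resolution_def)

lemmas fM = resolutionD(1)[OF RP] and fN = resolutionD(1)[OF RQ]

text \<open>A map that vanishes on carriers agrees there with its multiple by \<open>0\<close>, so
  the zero rule follows from congruence and homogeneity.\<close>

lemma Fa_zero:
  assumes f: "nat_trans D (mods P n) M f" "\<And>y v. y \<in> Obj D ==> v \<in> car (mods P n) y ==> f y v = \<zero>\<^bsub>sp M y\<^esub>"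
    and "x \<in> Obj E" "u \<in> car (F (mods P n)) x"
  shows "Fa f x u = \<zero>\<^bsub>sp N x\<^esub>"
proof -
  have "Fa f x u = Fa (\<lambda>y v. 0 \<odot>\<^bsub>sp M y\<^esub> f y v) x u"
    by (rule Fa_cong[OF f(1) nat_trans_scale[OF D f(1) fM] _ assms(3,4)])
       (simp add: f(2) vs_zero[OF fmodD(1)[OF fM]])
  also have "\<dots> = 0 \<odot>\<^bsub>sp N x\<^esub> Fa f x u" by (rule Fa_scale[OF f(1) assms(3,4)])
  also have "\<dots> = \<zero>\<^bsub>sp N x\<^esub>"
    by (rule vs_zero(3)[OF fmodD(1)[OF fN assms(3)] nat_transD(2)[OF Fa_nt[OF f(1)] assms(3,4)]])
  finally show ?thesis .
qed

lemma Fa_cocycle: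
  assumes f: "f \<in> cocycles D P M n"
  shows "Fa f \<in> cocycles E Y N n"
  unfolding cocycles_def Y_simps
proof (intro CollectI conjI ballI)
  show "nat_trans E (F (mods P n)) N (Fa f)" by (rule Fa_nt[OF cocyclesD(1)[OF f]])
  fix x u assume x: "x \<in> Obj E" and u: "u \<in> car (F (mods P (Suc n))) x"
  have nt: "nat_trans D (mods P (Suc n)) M (\<lambda>y v. f y (bdry P n y v))"
    by (rule nat_trans_comp[OF D resolutionD(3)[OF RP] cocyclesD(1)[OF f]])
  show "Fa f x (Fm (mods P n) (bdry P n) x u) = \<zero>\<^bsub>sp N x\<^esub>"
    unfolding Fa_Fm[OF resolutionD(3)[OF RP] cocyclesD(1)[OF f] x u]
    by (rule Fa_zero[OF nt cocyclesD(2)[OF f] x u])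
qed

lemma Fa_cohom:
  assumes "cohom D P M n f g"
  shows "cohom E Y N n (Fa f) (Fa g)"
proof -
  from cohomE[OF D RP fM assms] obtain b where b: "b \<in> coboundaries D P M n"
    "\<And>x v. x \<in> Obj D ==> v \<in> car (mods P n) x ==> g x v = f x v \<oplus>\<^bsub>sp M x\<^esub> b x v" by blast
  have bn: "nat_trans D (mods P n) M b" using b(1) by (simp add: coboundaries_def)
  note fg = cocyclesD(1)[OF cohomD(1)[OF assms]] cocyclesD(1)[OF cohomD(2)[OF assms]]
  have "Fa b \<in> coboundaries E Y N n"
  proof (cases n)
    case 0
    then show ?thesis using b(1) Fa_nt[OF bn] Fa_zero[OF bn] by (simp add: coboundaries_def Y_simps)
  next
    case (Suc m)
    with b(1) obtain h where h: "nat_trans D (mods P m) M h"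
      "\<And>x v. x \<in> Obj D ==> v \<in> car (mods P n) x ==> b x v = h x (bdry P m x v)"
      by (auto simp: coboundaries_def)
    have "Fa b x u = Fa h x (Fm (mods P m) (bdry P m) x u)"
      if x: "x \<in> Obj E" and u: "u \<in> car (F (mods P (Suc m))) x" for x u
      unfolding Fa_Fm[OF resolutionD(3)[OF RP] h(1) x u]
      by (rule Fa_cong[OF bn[unfolded Suc] nat_trans_comp[OF D resolutionD(3)[OF RP] h(1)] h(2)[unfolded Suc] x u])
    then show ?thesis using Fa_nt[OF bn] Fa_nt[OF h(1)]
      by (auto simp: coboundaries_def Y_simps Suc)
  qed
  then show ?thesis
  proof (rule cohomI[OF E Y fN Fa_cocycle[OF cohomD(1)[OF assms]]])
    fix x u assume x: "x \<in> Obj E" and u: "u \<in> car (mods Y n) x"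
    then have u': "u \<in> car (F (mods P n)) x" by (simp add: Y_simps)
    show "Fa g x u = Fa f x u \<oplus>\<^bsub>sp N x\<^esub> Fa b x u"
      unfolding Fa_add[OF fg(1) bn x u', symmetric]
      by (rule Fa_cong[OF fg(2) nat_trans_add[OF D fg(1) bn fM] b(2) x u'])
  qed
qed

lemma lift_exists: obtains ph where "ph \<in> lifts E Q 0 Y (aug Q)"
  by (rule lifts_exist[OF E Q Y aug_cocycle[OF RQ]])

definition H where
  "H n A = (\<Union>f\<in>A. \<Union>ph\<in>lifts E Q 0 Y (aug Q). coh_class E Q N n (\<lambda>x v. Fa f x (ph n x v)))"

lemma induced_map_H: "induced_map E N Q Y Fa c n = H n (c n)"
  by (simp add: induced_map_def H_def)

lemma H_cocycle:
  "f \<in> cocycles D P M n ==> ph \<in> lifts E Q 0 Y (aug Q) ==> (\<lambda>x v. Fa f x (ph n x v)) \<in> cocycles E Q N n"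
  using cocycle_comp[OF E Q Y fN, of ph 0 "aug Q" "Fa f" n] Fa_cocycle[of f n] by simp

lemma H_eq:
  assumes f: "f \<in> cocycles D P M n" and ph: "ph \<in> lifts E Q 0 Y (aug Q)"
  shows "H n (coh_class D P M n f) = coh_class E Q N n (\<lambda>x v. Fa f x (ph n x v))"
proof -
  have "coh_class E Q N n (\<lambda>x v. Fa f' x (ph' n x v)) = coh_class E Q N n (\<lambda>x v. Fa f x (ph n x v))"
    if f': "f' \<in> coh_class D P M n f" and ph': "ph' \<in> lifts E Q 0 Y (aug Q)" for f' ph'
  proof -
    have ff: "cohom D P M n f f'" using f' by (simp add: coh_class_cohom f)
    have c: "cohom E Q N n (\<lambda>x v. Fa f x (ph n x v)) (\<lambda>x v. Fa f' x (ph' n x v))"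
      using cohom_trans[OF E RQ fN lifts_unique[OF E Q Y fN ph' ph Fa_cocycle[OF f]]
        cohom_comp[OF E Q Y fN ph' Fa_cohom[OF ff]]] by simp
    then show ?thesis using coh_class_eq_iff[OF E RQ fN cohomD[OF c]] by simp
  qed
  note eq = this
  show ?thesis
    unfolding H_def
    by (intro UN_constant_eq[OF coh_class_self[OF D RP fM f]] ballI UN_constant_eq[OF ph] eq)
qed

lemma H_lhom: "H n \<in> lhom (ext_space D P M n) (ext_space E Q N n)"
proof -
  obtain ph where ph: "ph \<in> lifts E Q 0 Y (aug Q)" by (rule lift_exists)
  have phn: "ph n x v \<in> car (F (mods P n)) x" if "x \<in> Obj E" "v \<in> car (mods Q n) x" for x v
    using nat_transD(2)[OF liftsD(1)[OF ph, of n] that(1)] that(2) by (simp add: Y_simps)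
  have eq: "coh_class E Q N n g = coh_class E Q N n f"
    if "f \<in> cocycles E Q N n" "\<And>x v. x \<in> Obj E ==> v \<in> car (mods Q n) x ==> g x v = f x v" for f g
    using cohom_eq[OF E RQ fN that] cocycle_cong[OF E RQ fN that] coh_class_eq_iff[OF E RQ fN that(1), of g] by simp
  show ?thesis
  proof (rule lhomI; (unfold ext_space_simps(1)[OF D RP fM] ext_space_simps(1)[OF E RQ fN])?; (elim imageE)?; hypsubst)
    fix f assume f: "f \<in> cocycles D P M n"
    show "H n (coh_class D P M n f) \<in> coh_class E Q N n ` cocycles E Q N n"
      unfolding H_eq[OF f ph] by (rule imageI[OF H_cocycle[OF f ph]])
    fix c
    show "H n (c \<odot>\<^bsub>ext_space D P M n\<^esub> coh_class D P M n f) = c \<odot>\<^bsub>ext_space E Q N n\<^esub> H n (coh_class D P M n f)"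
      unfolding ext_space_simps(4)[OF D RP fM f] H_eq[OF f ph] H_eq[OF cocycle_scale[OF D RP fM f] ph]
        ext_space_simps(4)[OF E RQ fN H_cocycle[OF f ph]]
      by (rule eq[OF cocycle_scale[OF E RQ fN H_cocycle[OF f ph]]])
         (rule Fa_scale[OF cocyclesD(1)[OF f] _ phn])
    fix g assume g: "g \<in> cocycles D P M n"
    show "H n (coh_class D P M n f \<oplus>\<^bsub>ext_space D P M n\<^esub> coh_class D P M n g)
        = H n (coh_class D P M n f) \<oplus>\<^bsub>ext_space E Q N n\<^esub> H n (coh_class D P M n g)"
      unfolding ext_space_simps(3)[OF D RP fM f g] H_eq[OF f ph] H_eq[OF g ph] H_eq[OF cocycle_add[OF D RP fM f g] ph]
        ext_space_simps(3)[OF E RQ fN H_cocycle[OF f ph] H_cocycle[OF g ph]]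
      by (rule eq[OF cocycle_add[OF E RQ fN H_cocycle[OF f ph] H_cocycle[OF g ph]]])
         (rule Fa_add[OF cocyclesD(1)[OF f] cocyclesD(1)[OF g] _ phn])
  qed
qed

lemma ext_prod_closed:
  assumes "A \<in> carrier (ext_space D P M i)" "B \<in> carrier (ext_space D P M j)"
  shows "ext_prod D P M i j A B \<in> carrier (ext_space D P M (i + j))"
proof -
  from assms obtain g f where g: "g \<in> cocycles D P M i" "A = coh_class D P M i g"
    and f: "f \<in> cocycles D P M j" "B = coh_class D P M j f"
    by (auto simp: ext_space_simps[OF D RP fM])
  obtain ph where ph: "ph \<in> lifts D P j P f" by (rule lifts_exist[OF D P RP f(1)])
  show ?thesis
    unfolding g(2) f(2) ext_prod_eq[OF D P g(1) f(1) ph] ext_space_simps(1)[OF D RP fM]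
    using cocycle_comp[OF D P RP fM ph g(1)] by (simp add: add.commute)
qed

text \<open>Two lifts of the transported cocycle to the image complex are compared:
  \<open>ch'\<close>, a lift over \<open>Q\<close>, followed by \<open>ph\<close>; and
  \<open>ph\<close> in shifted degrees followed by the image of \<open>ch\<close>, a lift over
  \<open>P\<close>. Uniqueness of lifts makes the two products agree, without signs since the
  product is defined without them.\<close>

lemma H_prod:
  assumes "A \<in> carrier (ext_space D P M i)" "B \<in> carrier (ext_space D P M j)"
  shows "H (i + j) (ext_prod D P M i j A B) = ext_prod E Q N i j (H i A) (H j B)"
proof -
  from assms obtain g f where g: "g \<in> cocycles D P M i" "A = coh_class D P M i g"
    and f: "f \<in> cocycles D P M j" "B = coh_class D P M j f"
    by (auto simp: ext_space_simps[OF D RP fM])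
  obtain ph where ph: "ph \<in> lifts E Q 0 Y (aug Q)" by (rule lift_exists)
  have phn: "ph n x v \<in> car (F (mods P n)) x" if "x \<in> Obj E" "v \<in> car (mods Q n) x" for n x v
    using nat_transD(2)[OF liftsD(1)[OF ph, of n] that(1)] that(2) by (simp add: Y_simps)
  have pht: "nat_trans E (mods Q n) (F (mods P n)) (ph n)" for n
    using liftsD(1)[OF ph, of n] by (simp add: Y_simps)
  obtain ch where ch: "ch \<in> lifts D P j P f" by (rule lifts_exist[OF D P RP f(1)])
  let ?f = "\<lambda>x v. Fa f x (ph j x v)" and ?g = "\<lambda>x v. Fa g x (ph i x v)"
  have f': "?f \<in> cocycles E Q N j" and g': "?g \<in> cocycles E Q N i"
    by (rule H_cocycle[OF f(1) ph] H_cocycle[OF g(1) ph])+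
  obtain ch' where ch': "ch' \<in> lifts E Q j Q ?f" by (rule lifts_exist[OF E Q RQ f'])
  have gc: "(\<lambda>y v. g y (ch i y v)) \<in> cocycles D P M (i + j)"
    using cocycle_comp[OF D P RP fM ch g(1)] by (simp add: add.commute)
  have al: "(\<lambda>i x v. ph i x (ch' i x v)) \<in> lifts E Q j Y ?f"
  proof (rule liftsI)
    fix i
    show "nat_trans E (mods Q (j + i)) (mods Y i) (\<lambda>x v. ph i x (ch' i x v))"
      unfolding Y_simps by (rule nat_trans_comp[OF E liftsD(1)[OF ch'] pht])
    fix x v assume x: "x \<in> Obj E" and v: "v \<in> car (mods Q (Suc (j + i))) x"
    have "ch' (Suc i) x v \<in> car (mods Q (Suc i)) x"
      using nat_transD(2)[OF liftsD(1)[OF ch', of "Suc i"] x] v by simp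
    then show "bdry Y i x (ph (Suc i) x (ch' (Suc i) x v)) = ph i x (ch' i x (bdry Q (j + i) x v))"
      using liftsD(3)[OF ph x, of _ i] liftsD(3)[OF ch' x v] by simp
  next
    fix x v assume x: "x \<in> Obj E" and v: "v \<in> car (mods Q j) x"
    have "ch' 0 x v \<in> car (mods Q 0) x"
      using nat_transD(2)[OF liftsD(1)[OF ch', of 0] x] v by simp
    then show "aug Y x (ph 0 x (ch' 0 x v)) = Fa f x (ph j x v)"
      using liftsD(2)[OF ph x] liftsD(2)[OF ch' x v] by simp
  qed
  \<comment> \<open>This family commutes with the boundaries by \<open>Fm_Fm\<close>, applied to the
    squares in which \<open>ch\<close> commutes with the boundaries of \<open>P\<close>.\<close>
  have be: "(\<lambda>i x v. Fm (mods P i) (ch i) x (ph (j + i) x v)) \<in> lifts E Q j Y ?f"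
  proof (rule liftsI)
    fix i
    show "nat_trans E (mods Q (j + i)) (mods Y i) (\<lambda>x v. Fm (mods P i) (ch i) x (ph (j + i) x v))"
      unfolding Y_simps by (rule nat_trans_comp[OF E pht Fm_nt[OF liftsD(1)[OF ch]]])
    fix x v assume x: "x \<in> Obj E" and v: "v \<in> car (mods Q (Suc (j + i))) x"
    have "bdry Y i x (Fm (mods P (Suc i)) (ch (Suc i)) x (ph (j + Suc i) x v))
        = Fm (mods P i) (ch i) x (Fm (mods P (j + i)) (bdry P (j + i)) x (ph (j + Suc i) x v))"
      unfolding Y_simps
      by (rule Fm_Fm[where n = "j + Suc i", OF liftsD(1)[OF ch] resolutionD(3)[OF RP] _ liftsD(1)[OF ch] _ x phn[OF x]])
         (use resolutionD(3)[OF RP, of "j + i"] v liftsD(3)[OF ch] in auto)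
    also have "Fm (mods P (j + i)) (bdry P (j + i)) x (ph (j + Suc i) x v) = ph (j + i) x (bdry Q (j + i) x v)"
      using liftsD(3)[OF ph x, of v "j + i"] v by (simp add: Y_simps)
    finally show "bdry Y i x (Fm (mods P (Suc i)) (ch (Suc i)) x (ph (j + Suc i) x v))
        = Fm (mods P i) (ch i) x (ph (j + i) x (bdry Q (j + i) x v))" .
  next
    fix x v assume x: "x \<in> Obj E" and v: "v \<in> car (mods Q j) x"
    have c0: "nat_trans D (mods P j) (mods P 0) (ch 0)" using liftsD(1)[OF ch, of 0] by simp
    have "aug Y x (Fm (mods P 0) (ch 0) x (ph j x v)) = Fa (\<lambda>y v. aug P y (ch 0 y v)) x (ph j x v)"
      unfolding Y_simps by (rule Fa_Fm[OF c0 resolutionD(4)[OF RP] x phn[OF x v]])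
    also have "\<dots> = Fa f x (ph j x v)"
      by (rule Fa_cong[OF nat_trans_comp[OF D c0 resolutionD(4)[OF RP]] cocyclesD(1)[OF f(1)] liftsD(2)[OF ch] x phn[OF x v]])
    finally show "aug Y x (Fm (mods P 0) (ch 0) x (ph (j + 0) x v)) = Fa f x (ph j x v)" by simp
  qed
  have 1: "cohom E Q N (j + i) (\<lambda>x v. Fa g x (ph i x (ch' i x v)))
      (\<lambda>x v. Fa g x (Fm (mods P i) (ch i) x (ph (j + i) x v)))"
    by (rule lifts_unique[OF E Q Y fN be al Fa_cocycle[OF g(1)]])
  have "cohom E Q N (j + i) (\<lambda>x v. Fa g x (Fm (mods P i) (ch i) x (ph (j + i) x v)))
      (\<lambda>x v. Fa (\<lambda>y v. g y (ch i y v)) x (ph (j + i) x v))"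
    by (rule cohom_eq[OF E RQ fN cohomD(2)[OF 1]])
       (rule Fa_Fm[OF liftsD(1)[OF ch] cocyclesD(1)[OF g(1)] _ phn, symmetric])
  note 2 = cohom_trans[OF E RQ fN 1 this, unfolded add.commute[of j i]]
  show ?thesis
    unfolding g(2) f(2) ext_prod_eq[OF D P g(1) f(1) ch] H_eq[OF g(1) ph] H_eq[OF f(1) ph] H_eq[OF gc ph]
      ext_prod_eq[OF E Q g' f' ch']
    using coh_class_eq_iff[OF E RQ fN cohomD[OF 2]] 2 by simp
qed

theorem induced_map_hom:
  "induced_map E N Q Y Fa \<in> algebra_hom (ext_algebra D P M) (ext_algebra E Q N)"
proof -
  note vD = vs_ext_space[OF D RP fM] and vE = vs_ext_space[OF E RQ fN]
  have cl: "A \<in> carrier (ext_space D P M n) ==> H n A \<in> carrier (ext_space E Q N n)" for n A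
    by (rule lhomD(1)[OF H_lhom])
  have z: "H n \<zero>\<^bsub>ext_space D P M n\<^esub> = \<zero>\<^bsub>ext_space E Q N n\<^esub>" for n
    by (rule lhom_zero[OF H_lhom vD vE])
  have mem: "c n \<in> carrier (ext_space D P M n)" if "c \<in> carrier (ext_algebra D P M)" for c n
    using that by (simp add: ext_algebra_def)
  have c: "induced_map E N Q Y Fa c \<in> carrier (ext_algebra E Q N)" if c: "c \<in> carrier (ext_algebra D P M)" for c
  proof -
    \<comment> \<open>Each degree is mapped linearly, so zero components stay zero and finiteness of
      the support is preserved.\<close>
    have "{n. H n (c n) \<noteq> \<zero>\<^bsub>ext_space E Q N n\<^esub>} \<subseteq> {n. c n \<noteq> \<zero>\<^bsub>ext_space D P M n\<^esub>}" using z by auto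
    moreover have "finite {n. c n \<noteq> \<zero>\<^bsub>ext_space D P M n\<^esub>}" using c by (simp add: ext_algebra_def)
    ultimately show ?thesis using cl[OF mem[OF c]]
      by (auto simp: ext_algebra_def induced_map_H intro: finite_subset)
  qed
  have add: "induced_map E N Q Y Fa (c \<oplus>\<^bsub>ext_algebra D P M\<^esub> d)
      = induced_map E N Q Y Fa c \<oplus>\<^bsub>ext_algebra E Q N\<^esub> induced_map E N Q Y Fa d"
    if "c \<in> carrier (ext_algebra D P M)" "d \<in> carrier (ext_algebra D P M)" for c d
    using lhomD(2)[OF H_lhom mem[OF that(1)] mem[OF that(2)]]
    by (auto simp: ext_algebra_def induced_map_H fun_eq_iff)
  have smult: "induced_map E N Q Y Fa (a \<odot>\<^bsub>ext_algebra D P M\<^esub> c)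
      = a \<odot>\<^bsub>ext_algebra E Q N\<^esub> induced_map E N Q Y Fa c"
    if "c \<in> carrier (ext_algebra D P M)" for a c
    using lhomD(3)[OF H_lhom mem[OF that]] by (auto simp: ext_algebra_def induced_map_H fun_eq_iff)
  have mult: "induced_map E N Q Y Fa (c \<otimes>\<^bsub>ext_algebra D P M\<^esub> d)
      = induced_map E N Q Y Fa c \<otimes>\<^bsub>ext_algebra E Q N\<^esub> induced_map E N Q Y Fa d"
    if c: "c \<in> carrier (ext_algebra D P M)" and d: "d \<in> carrier (ext_algebra D P M)" for c d
  proof
    fix n
    let ?p = "\<lambda>i. ext_prod D P M i (n - i) (c i) (d (n - i))"
    have pc: "?p i \<in> carrier (ext_space D P M n)" if "i \<le> n" for i
      using ext_prod_closed[OF mem[OF c, of i] mem[OF d, of "n - i"]] that by simp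
    have hp: "H n (?p i) = ext_prod E Q N i (n - i) (H i (c i)) (H (n - i) (d (n - i)))" if "i \<le> n" for i
      using H_prod[OF mem[OF c, of i] mem[OF d, of "n - i"]] that by simp
    have "H n (finsum (ext_space D P M n) ?p {..n}) = finsum (ext_space E Q N n) (\<lambda>i. H n (?p i)) {..n}"
      by (rule lhom_finsum[OF H_lhom vD vE]) (use pc in auto)
    also have "\<dots> = finsum (ext_space E Q N n)
        (\<lambda>i. ext_prod E Q N i (n - i) (H i (c i)) (H (n - i) (d (n - i)))) {..n}"
      by (rule abelian_monoid.finsum_cong'[OF vs_comm_monoid(1)[OF vE]])
         (use hp cl[OF pc] in \<open>auto simp flip: hp\<close>)
    finally show "induced_map E N Q Y Fa (c \<otimes>\<^bsub>ext_algebra D P M\<^esub> d) n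
        = (induced_map E N Q Y Fa c \<otimes>\<^bsub>ext_algebra E Q N\<^esub> induced_map E N Q Y Fa d) n"
      by (simp add: ext_algebra_def induced_map_H)
  qed
  \<comment> \<open>The unit is the class of the augmentation, and the augmentation of the image
    complex after a lift of the identity is the augmentation of \<open>Q\<close>.\<close>
  have one: "induced_map E N Q Y Fa \<one>\<^bsub>ext_algebra D P M\<^esub> = \<one>\<^bsub>ext_algebra E Q N\<^esub>"
  proof
    fix n
    obtain ph where ph: "ph \<in> lifts E Q 0 Y (aug Q)" by (rule lift_exists)
    have "cohom E Q N 0 (aug Q) (\<lambda>x v. Fa (aug P) x (ph 0 x v))"
      by (rule cohom_eq[OF E RQ fN aug_cocycle[OF RQ]]) (use liftsD(2)[OF ph] in \<open>simp add: Y_simps\<close>)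
    then have "H 0 (coh_class D P M 0 (aug P)) = coh_class E Q N 0 (aug Q)"
      unfolding H_eq[OF aug_cocycle[OF RP] ph]
      using coh_class_eq_iff[OF E RQ fN aug_cocycle[OF RQ] H_cocycle[OF aug_cocycle[OF RP] ph]] by simp
    then show "induced_map E N Q Y Fa \<one>\<^bsub>ext_algebra D P M\<^esub> n = \<one>\<^bsub>ext_algebra E Q N\<^esub> n"
      using z[of n] by (auto simp: ext_algebra_def induced_map_H)
  qed
  show ?thesis
    unfolding algebra_hom_def
    by (intro IntI ring_hom_memI lhomI c add smult mult one)
qed

end

section \<open>The bar resolution\<close>

fun path_end :: "('o, 'm) category => 'o => 'm list => 'o" where
  "path_end E x [] = x"
| "path_end E x (f # fs) = path_end E (Cod E f) fs"

lemma path_end_append [simp]: "path_end E x (fs @ [g]) = Cod E g"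
  by (induction fs arbitrary: x) auto

lemma path_end_Cod_last: "fs \<noteq> [] ==> path_end E x fs = Cod E (last fs)"
  by (induction fs arbitrary: x) auto

context finite_category
begin

lemma is_path_append:
  "is_path C x (fs @ [g]) \<longleftrightarrow> is_path C x fs \<and> g \<in> Arr C \<and> Dom C g = path_end C x fs"
  by (induction fs arbitrary: x) (auto simp: Cod_Obj Dom_Obj)

lemma is_path_Obj: "is_path C x fs ==> x \<in> Obj C" "is_path C x fs ==> path_end C x fs \<in> Obj C"
  by (induction fs arbitrary: x) (auto simp: Dom_Obj)

lemma is_path_Arr: "is_path C x fs ==> set fs \<subseteq> Arr C"
  by (induction fs arbitrary: x) auto

lemma finite_nd_simplices: "finite (nd_simplices C n)"
proof (rule finite_subset)
  show "nd_simplices C n \<subseteq> Obj C \<times> {fs. set fs \<subseteq> Arr C \<and> length fs = n}"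
    using is_path_Arr is_path_Obj(1) by (auto simp: nd_simplices_def)
  show "finite (Obj C \<times> {fs. set fs \<subseteq> Arr C \<and> length fs = n})"
    using finite_Obj finite_Arr by (auto intro: finite_lists_length_eq)
qed

end

definition face_sum :: "('o, 'm) category => nat => 'o \<times> 'm list => ('o \<times> 'm list) \<Rightarrow>\<^sub>0 'k::field" where
  "face_sum E n si = (\<Sum>i\<le>Suc n. if face E i si \<in> nd_simplices E n
    then single (face E i si) ((-1) ^ i) else 0)"

lemma keys_sum_subset: "(\<And>a. a \<in> A ==> keys (f a) \<subseteq> U) ==> keys (sum f A) \<subseteq> U"
proof (induction A rule: infinite_finite_induct)
  case (insert a A)
  then show ?case using Poly_Mapping.keys_add[of "f a" "sum f A"] by auto
qed auto

lemma keys_face_sum: "keys (face_sum E n si) \<subseteq> nd_simplices E n"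
  unfolding face_sum_def by (rule keys_sum_subset) auto

lemma scale_0 [simp]: "scale c 0 = 0"
  by (rule poly_mapping_eqI) simp

lemma scale_sum: "scale c (sum f A) = (\<Sum>a\<in>A. scale c (f a))"
  by (induction A rule: infinite_finite_induct) (auto simp: scale_simps intro: poly_mapping_eqI)

lemma lin_sum:
  assumes h: "h \<in> lhom (free_space U) (free_space U')" and "finite A"
    and "\<And>a. a \<in> A ==> keys (f a) \<subseteq> U"
  shows "h (sum f A) = (\<Sum>a\<in>A. h (f a))"
proof -
  have "h (finsum (free_space U) f A) = finsum (free_space U') (\<lambda>a. h (f a)) A"
    by (rule lhom_finsum[OF h vs_free_space vs_free_space assms(2)]) (use assms(3) in auto)
  moreover have "keys (h (f a)) \<subseteq> U'" if "a \<in> A" for a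
    using lhomD(1)[OF h, of "f a"] assms(3)[OF that] by simp
  ultimately show ?thesis using assms(2,3) by (simp add: finsum_free_space)
qed

lemma nerve_bdry_lin: "nerve_bdry E n = lin (free_space (nd_simplices E n)) (face_sum E n)"
proof
  fix c :: "('a \<times> 'b list) \<Rightarrow>\<^sub>0 'k::field"
  have "scale (lookup c si) (face_sum E n si) = (\<Sum>i\<le>Suc n. if face E i si \<in> nd_simplices E n
      then single (face E i si) ((-1) ^ i * lookup c si) else 0)" for si
    unfolding face_sum_def scale_sum by (intro sum.cong refl) (auto simp: mult.commute intro: poly_mapping_eqI)
  then show "nerve_bdry E n c = lin (free_space (nd_simplices E n)) (face_sum E n) c"
    by (simp only: lin_free_space[OF keys_face_sum] nerve_bdry_def)
qed

lemma nerve_bdry_lhom: "nerve_bdry E n \<in> lhom (free_space U) (free_space (nd_simplices E n))"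
  unfolding nerve_bdry_lin by (rule lin_lhom[OF vs_free_space]) (simp add: keys_face_sum)

lemma nerve_bdry_single: "nerve_bdry E n (single si 1) = face_sum E n si"
  unfolding nerve_bdry_lin
  by (subst lin_single_at[OF vs_free_space]) (simp_all add: scale_simps keys_face_sum)

text \<open>When \<open>E\<close> has a terminal object, appending the arrow from the last vertex to it contracts the
  normalized chain complex of the nerve.\<close>

locale terminal_category = finite_category E for E :: "('o, 'm) category" +
  fixes T and bang
  assumes T: "T \<in> Obj E"
    and bang: "x \<in> Obj E ==> bang x \<in> Arr E \<and> Dom E (bang x) = x \<and> Cod E (bang x) = T"
    and bang_unique: "f \<in> Arr E ==> Cod E f = T ==> f = bang (Dom E f)"
begin

text \<open>Since \<open>bang T\<close> is an identity, appending it to a simplex that already ends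
  in \<open>T\<close> would give a degenerate simplex, which is zero in the normalized
  complex.\<close>

definition con :: "'o \<times> 'm list => ('o \<times> 'm list) \<Rightarrow>\<^sub>0 'k::field" where
  "con = (\<lambda>(x, fs). if path_end E x fs = T then 0
    else single (x, fs @ [bang (path_end E x fs)]) 1)"

definition s :: "nat => (('o \<times> 'm list) \<Rightarrow>\<^sub>0 'k::field) => (('o \<times> 'm list) \<Rightarrow>\<^sub>0 'k)" where
  "s n = lin (free_space (nd_simplices E (Suc n))) con"

lemma bang_nondeg: "x \<in> Obj E ==> bang x = Ident E x \<longleftrightarrow> x = T"
  using bang[of x] bang_unique[OF Ident_Arr[of x]] Cod_Ident[of x] Dom_Ident[of x] by metis

lemma nd_append:
  "(x, fs @ [g]) \<in> nd_simplices E (Suc n) \<longleftrightarrow> (x, fs) \<in> nd_simplices E n \<and> g \<in> Arr E \<and>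
    Dom E g = path_end E x fs \<and> g \<noteq> Ident E (Dom E g)"
  by (auto simp: nd_simplices_def is_path_append)

lemma keys_con: "si \<in> nd_simplices E n ==> keys (con si) \<subseteq> nd_simplices E (Suc n)"
  using bang bang_nondeg is_path_Obj(2)
  by (cases si) (auto simp: con_def nd_append nd_simplices_def is_path_append)

lemma s_lhom: "s n \<in> lhom (free_space (nd_simplices E n)) (free_space (nd_simplices E (Suc n)))"
  unfolding s_def by (rule lin_lhom[OF vs_free_space]) (simp add: keys_con)

lemma s_single: "si \<in> nd_simplices E n ==> s n (single si c) = scale c (con si)"
  unfolding s_def by (subst lin_single_at[OF vs_free_space]) (simp_all add: keys_con)

lemma face_append:
  assumes "length fs = Suc n"
  shows "i \<le> n ==> face E i (x, fs @ [g]) = (fst (face E i (x, fs)), snd (face E i (x, fs)) @ [g])"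
    and "face E (Suc n) (x, fs @ [g]) = (x, butlast fs @ [Comp E g (last fs)])"
    and "face E (Suc (Suc n)) (x, fs @ [g]) = (x, fs)"
    and "face E (Suc n) (x, fs) = (x, butlast fs)"
proof -
  obtain f fs' where fs: "fs = f # fs'" using assms by (cases fs) auto
  then have "fs \<noteq> []" by simp
  note l = last_conv_nth[OF this]
  show "i \<le> n ==> face E i (x, fs @ [g]) = (fst (face E i (x, fs)), snd (face E i (x, fs)) @ [g])"
  proof (cases "i = 0")
    case False
    then show "i \<le> n ==> face E i (x, fs @ [g]) = (fst (face E i (x, fs)), snd (face E i (x, fs)) @ [g])"
      using assms by (auto simp: face_def nth_append)
  qed (use fs in \<open>simp add: face_def\<close>)
  show "face E (Suc n) (x, fs @ [g]) = (x, butlast fs @ [Comp E g (last fs)])"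
    using assms l by (simp add: face_def nth_append butlast_conv_take)
qed (use assms in \<open>auto simp: face_def\<close>)

lemma path_end_face:
  assumes "length fs = Suc n" "i \<le> n" "is_path E x fs"
  shows "path_end E (fst (face E i (x, fs))) (snd (face E i (x, fs))) = path_end E x fs"
proof -
  have fs: "fs \<noteq> []" and sub: "set fs \<subseteq> Arr E" using assms is_path_Arr by auto
  have eq: "path_end E x fs = Cod E (last fs)" using fs by (rule path_end_Cod_last)
  show ?thesis
  proof (cases "i = 0")
    case True
    then show ?thesis using fs by (cases fs) (auto simp: face_def)
  next
    case False
    let ?l = "take (i - 1) fs @ Comp E (fs ! i) (fs ! (i - 1)) # drop (i + 1) fs"
    \<comment> \<open>The composed arrow is the last one only if \<open>i = n\<close>, and then its
      target is that of its second factor; otherwise the last arrow is untouched.\<close>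
    have "Cod E (last ?l) = Cod E (last fs)"
    proof (cases "drop (i + 1) fs = []")
      case True
      then have i: "i = n" using assms by simp
      have "Dom E (fs ! Suc j) = Cod E (fs ! j)" if "Suc j < length fs" "is_path E x fs" for j x fs
        using that
      proof (induction fs arbitrary: x j)
        case (Cons f fs)
        then show ?case by (cases j; cases fs) auto
      qed simp
      from this[of "i - 1" fs x] have "Dom E (fs ! i) = Cod E (fs ! (i - 1))"
        using assms False i by simp
      moreover have "fs ! i \<in> Arr E" "fs ! (i - 1) \<in> Arr E" using sub assms i by auto
      ultimately show ?thesis using True assms i fs by (simp add: Cod_Comp last_conv_nth)
    next
      case False
      then show ?thesis by (simp add: last_drop)
    qed
    then show ?thesis unfolding eq using assms False by (simp add: face_def path_end_Cod_last)
  qed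
qed

text \<open>Appending an arrow adds one face, numbered \<open>n + 2\<close>, which deletes it again
  and contributes \<open>si\<close> with the sign \<open>(-1) ^ n\<close>. The faces up to
  \<open>n\<close> commute with appending, and face \<open>n + 1\<close> composes the last arrow
  with the appended one, which by uniqueness gives the arrow appended to the shortened
  simplex.\<close>

lemma cone_single:
  assumes si: "si \<in> nd_simplices E (Suc n)"
  shows "nerve_bdry E (Suc n) (con si) = s n (face_sum E n si) + single si ((-1) ^ n :: 'k::field)"
proof -
  obtain x fs where xfs: "si = (x, fs)" by (cases si)
  have p: "is_path E x fs" and l: "length fs = Suc n" and nd: "\<forall>f\<in>set fs. f \<noteq> Ident E (Dom E f)"
    using si xfs by (auto simp: nd_simplices_def)
  define L where "L = path_end E x fs"
  define L' where "L' = path_end E x (butlast fs)"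
  have fs: "fs = butlast fs @ [last fs]" using l by (metis append_butlast_last_id list.size(3) nat.distinct(1))
  have p': "is_path E x (butlast fs)" "last fs \<in> Arr E" "Dom E (last fs) = L'" "Cod E (last fs) = L"
    using p is_path_append[of x "butlast fs" "last fs"] fs path_end_append[of E x "butlast fs" "last fs"]
    by (auto simp: L_def L'_def)
  have LO: "L \<in> Obj E" "L' \<in> Obj E" using is_path_Obj(2)[OF p] is_path_Obj(2)[OF p'(1)] by (auto simp: L_def L'_def)
  have nd': "(x, butlast fs) \<in> nd_simplices E n"
    using p'(1) l nd by (auto simp: nd_simplices_def dest: in_set_butlastD)
  have sf: "s n (face_sum E n si) = (\<Sum>i\<le>Suc n. if face E i si \<in> nd_simplices E n
      then scale ((-1) ^ i) (con (face E i si)) else (0 :: _ \<Rightarrow>\<^sub>0 'k))"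
  proof -
    have "s n (face_sum E n si) = (\<Sum>i\<le>Suc n. s n (if face E i si \<in> nd_simplices E n
        then single (face E i si) ((-1) ^ i) else 0))"
      unfolding face_sum_def by (rule lin_sum[OF s_lhom]) auto
    also have "\<dots> = (\<Sum>i\<le>Suc n. if face E i si \<in> nd_simplices E n
        then scale ((-1) ^ i) (con (face E i si)) else 0)"
      by (rule sum.cong) (use lhom_zero[OF s_lhom vs_free_space vs_free_space] in \<open>auto simp: s_single\<close>)
    finally show ?thesis .
  qed
  have pe: "path_end E (fst (face E i si)) (snd (face E i si)) = L" if "i \<le> n" for i
    using path_end_face[OF l that p] by (simp add: xfs L_def)
  have con_face: "con (face E i si) = (if L = T then 0 else
      single (fst (face E i si), snd (face E i si) @ [bang L]) (1::'k))" if "i \<le> n" for i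
    using pe[OF that] by (simp add: con_def case_prod_beta')
  have con_last: "con (face E (Suc n) si) = (if L' = T then 0 else
      single (x, butlast fs @ [bang L']) (1::'k))"
    unfolding xfs face_append(4)[OF l] by (simp add: con_def L'_def)
  have last_nd: "face E (Suc n) si \<in> nd_simplices E n" unfolding xfs face_append(4)[OF l] by (rule nd')
  show ?thesis
  proof (cases "L = T")
    case True
    \<comment> \<open>Here \<open>con si\<close> is zero, so the right-hand side has to vanish by
      itself: only the last face of \<open>si\<close> has a nonzero image under \<open>con\<close>,
      and this image is \<open>si\<close> again, with the opposite sign.\<close>
    have "L' \<noteq> T"
    proof
      assume "L' = T"
      then have "last fs = Ident E (Dom E (last fs))"
        using bang_unique[OF p'(2)] p'(3,4) True bang_nondeg[OF LO(2)] by simp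
      then show False using nd fs by (metis in_set_conv_decomp)
    qed
    moreover have "bang L' = last fs" using bang_unique[OF p'(2)] p'(3,4) True by simp
    ultimately have cl: "con (face E (Suc n) si) = single si (1::'k)"
      using con_last fs xfs by simp
    have "(\<Sum>i\<le>n. if face E i si \<in> nd_simplices E n
      then scale ((-1) ^ i) (con (face E i si)) else (0 :: _ \<Rightarrow>\<^sub>0 'k)) = 0"
      by (rule sum.neutral) (simp add: con_face True)
    then have "s n (face_sum E n si) = scale ((-1) ^ Suc n) (single si (1::'k))"
      unfolding sf sum.atMost_Suc using last_nd cl by simp
    moreover have "con si = (0 :: _ \<Rightarrow>\<^sub>0 'k)" using True by (simp add: con_def xfs L_def)
    ultimately show ?thesis
      using lhom_zero[OF nerve_bdry_lhom[of E "Suc n"] vs_free_space vs_free_space]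
      by (simp add: single_uminus[symmetric] single_add[symmetric])
  next
    case False
    note g = bang[OF LO(1)]
    let ?\<tau> = "(x, fs @ [bang L])"
    have csi: "con si = single ?\<tau> (1::'k)" using False by (simp add: con_def xfs L_def)
    have 1: "(if face E i ?\<tau> \<in> nd_simplices E (Suc n) then single (face E i ?\<tau>) ((-1) ^ i) else 0)
        = (if face E i si \<in> nd_simplices E n then scale ((-1) ^ i) (con (face E i si)) else (0 :: _ \<Rightarrow>\<^sub>0 'k))"
      if "i \<le> n" for i
    proof -
      have f: "face E i ?\<tau> = (fst (face E i si), snd (face E i si) @ [bang L])"
        unfolding xfs by (rule face_append(1)[OF l that])
      have "face E i ?\<tau> \<in> nd_simplices E (Suc n) \<longleftrightarrow> face E i si \<in> nd_simplices E n"
        unfolding f nd_append using g pe[OF that] bang_nondeg[OF LO(1)] False by simp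
      then show ?thesis using con_face[OF that] False f by simp
    qed
    have "Comp E (bang L) (last fs) = bang L'"
      using bang_unique[of "Comp E (bang L) (last fs)"] g p' by (simp add: Comp_Arr Dom_Comp Cod_Comp)
    then have f2: "face E (Suc n) ?\<tau> = (x, butlast fs @ [bang L'])"
      by (simp add: face_append(2)[OF l])
    have "face E (Suc n) ?\<tau> \<in> nd_simplices E (Suc n) \<longleftrightarrow> L' \<noteq> T"
      unfolding f2 nd_append using bang[OF LO(2)] bang_nondeg[OF LO(2)] nd' by (auto simp: L'_def)
    then have 2: "(if face E (Suc n) ?\<tau> \<in> nd_simplices E (Suc n)
        then single (face E (Suc n) ?\<tau>) ((-1) ^ Suc n) else 0)
        = scale ((-1) ^ Suc n) (con (face E (Suc n) si)) + (0 :: _ \<Rightarrow>\<^sub>0 'k)"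
      using con_last f2 by simp
    have 3: "(if face E (Suc (Suc n)) ?\<tau> \<in> nd_simplices E (Suc n)
        then single (face E (Suc (Suc n)) ?\<tau>) ((-1) ^ Suc (Suc n)) else 0)
        = single si ((-1) ^ n :: 'k)"
      using face_append(3)[OF l, of x "bang L"] si by (simp add: xfs)
    have "nerve_bdry E (Suc n) (con si) = (face_sum E (Suc n) ?\<tau> :: _ \<Rightarrow>\<^sub>0 'k)"
      unfolding csi nerve_bdry_single ..
    also have "\<dots> = (\<Sum>i\<le>n. if face E i si \<in> nd_simplices E n then scale ((-1) ^ i) (con (face E i si)) else 0)
        + scale ((-1) ^ Suc n) (con (face E (Suc n) si)) + single si ((-1) ^ n)"
      unfolding face_sum_def sum.atMost_Suc 2 3 by (simp add: 1)
    also have "\<dots> = s n (face_sum E n si) + single si ((-1) ^ n)"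
      unfolding sf sum.atMost_Suc using last_nd by simp
    finally show ?thesis .
  qed
qed

lemma cone:
  assumes "keys v \<subseteq> nd_simplices E (Suc n)"
  shows "nerve_bdry E (Suc n) (s (Suc n) v) = s n (nerve_bdry E n v) + scale ((-1) ^ n) v"
proof (rule free_ext[of "\<lambda>v. nerve_bdry E (Suc n) (s (Suc n) v)" _ "free_space (nd_simplices E (Suc n))", OF _ _ _ _ assms])
  let ?F = "\<lambda>m. free_space (nd_simplices E m)"
  show "(\<lambda>v. nerve_bdry E (Suc n) (s (Suc n) v)) \<in> lhom (?F (Suc n)) (?F (Suc n))"
    by (rule lhom_comp[OF s_lhom nerve_bdry_lhom])
  show "(\<lambda>v. s n (nerve_bdry E n v) + scale ((-1) ^ n) v) \<in> lhom (?F (Suc n)) (?F (Suc n))"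
    using lhom_add[OF lhom_comp[OF nerve_bdry_lhom s_lhom] lhom_scale[OF lhom_id vs_free_space] vs_free_space] by simp
  show "nerve_bdry E (Suc n) (s (Suc n) (single si 1))
      = s n (nerve_bdry E n (single si 1)) + scale ((-1) ^ n) (single si 1)"
    if "si \<in> nd_simplices E (Suc n)" for si
    using cone_single[OF that] by (simp add: s_single[OF that] scale_simps nerve_bdry_single)
qed (rule vs_free_space)

lemma nd_0: "si \<in> nd_simplices E 0 \<longleftrightarrow> (\<exists>x\<in>Obj E. si = (x, []))"
  by (cases si) (auto simp: nd_simplices_def)

end

lemma const_mod_simps [simp]:
  "car const_mod x = UNIV" "\<zero>\<^bsub>sp const_mod x\<^esub> = 0" "a \<oplus>\<^bsub>sp const_mod x\<^esub> b = a + b"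
  "c \<odot>\<^bsub>sp const_mod x\<^esub> a = c * a" "act const_mod f a = a"
  by (simp_all add: const_mod_def)

lemma vs_const_mod: "vs (sp const_mod x)"
  by (rule vsI) (auto simp: algebra_simps)

lemma fmod_const_mod: "fmod D const_mod"
  unfolding fmod_def by (auto intro!: lhomI simp: vs_const_mod)

lemma finsum_const_mod: "finite A ==> finsum (sp const_mod x) f A = sum f A"
proof (induction A rule: finite_induct)
  case empty
  show ?case by (subst abelian_monoid.finsum_empty[OF vs_comm_monoid(1)[OF vs_const_mod]]) simp
next
  case (insert a A)
  then show ?case
    by (subst abelian_monoid.finsum_insert[OF vs_comm_monoid(1)[OF vs_const_mod]]) auto
qed

text \<open>The overcategories \<open>Id/x\<close> used by the bar resolution. The simplex lying over a chain
  \<open>(a, des)\<close> of arrows and an arrow \<open>be\<close> from its last vertex to \<open>x\<close> is \<open>over_simplex D (a, des) be\<close>.\<close>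

abbreviation ovr :: "('o, 'm) category => 'o => ('o \<times> 'm, 'm \<times> 'm) category" where
  "ovr D x \<equiv> over_cat id_functor D D x"

lemma over_simps [simp]:
  "(a, be) \<in> Obj (ovr D x) \<longleftrightarrow> a \<in> Obj D \<and> be \<in> Arr D \<and> Dom D be = a \<and> Cod D be = x"
  "(de, be) \<in> Arr (ovr D x) \<longleftrightarrow> de \<in> Arr D \<and> be \<in> Arr D \<and> Dom D be = Cod D de \<and> Cod D be = x"
  "Dom (ovr D x) (de, be) = (Dom D de, Comp D be de)" "Cod (ovr D x) (de, be) = (Cod D de, be)"
  "Ident (ovr D x) (a, be) = (Ident D a, be)" "Comp (ovr D x) (de', be') (de, be) = (Comp D de' de, be')"
  by (auto simp: over_cat_def id_functor_def)

fun lift_arrows :: "('o, 'm) category => 'm list => 'm => ('m \<times> 'm) list" and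
    path_comp :: "('o, 'm) category => 'm list => 'm => 'm" where
  "lift_arrows D [] be = []"
| "lift_arrows D (de # des) be = (de, path_comp D des be) # lift_arrows D des be"
| "path_comp D [] be = be"
| "path_comp D (de # des) be = Comp D (path_comp D des be) de"

definition over_simplex where
  "over_simplex D = (\<lambda>(a, des) be. ((a, path_comp D des be), lift_arrows D des be))"

definition over_base where
  "over_base = (\<lambda>((a, be), fs). (a, map fst fs))"

definition over_end where
  "over_end D x = (\<lambda>(a, fs). snd (path_end (ovr D x) a fs))"

definition over_act where
  "over_act D g = (\<lambda>((a, be), fs). ((a, Comp D g be), map (\<lambda>(de, be'). (de, Comp D g be')) fs))"

lemma map_fst_lift_arrows [simp]: "map fst (lift_arrows D des be) = des" "length (lift_arrows D des be) = length des"
  by (induction des) auto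

context finite_category
begin

lemma finite_over: "finite_category (ovr C x)"
proof
  have "Obj (ovr C x) \<subseteq> Obj C \<times> Arr C" "Arr (ovr C x) \<subseteq> Arr C \<times> Arr C" by auto
  then show "finite (Obj (ovr C x))" "finite (Arr (ovr C x))"
    using finite_Obj finite_Arr by (auto intro: finite_subset)
qed (auto simp: Dom_Obj Cod_Obj Ident_Arr Dom_Ident Cod_Ident Comp_Arr Dom_Comp Cod_Comp Comp_assoc
  Comp_Ident_right Comp_Ident_left)

lemma terminal_over:
  assumes x: "x \<in> Obj C"
  shows "terminal_category (ovr C x) (x, Ident C x) (\<lambda>(a, be). (be, Ident C x))"
proof -
  interpret O: finite_category "ovr C x" by (rule finite_over)
  show ?thesis
  proof
    show "(x, Ident C x) \<in> Obj (ovr C x)" using x by (simp add: Ident_Arr Dom_Ident Cod_Ident)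
    fix z assume "z \<in> Obj (ovr C x)"
    then show "(case z of (a, be) => (be, Ident C x)) \<in> Arr (ovr C x) \<and>
        Dom (ovr C x) (case z of (a, be) => (be, Ident C x)) = z \<and>
        Cod (ovr C x) (case z of (a, be) => (be, Ident C x)) = (x, Ident C x)"
      using x Comp_Ident_left by (cases z) (auto simp: Ident_Arr Dom_Ident Cod_Ident)
  next
    fix f assume "f \<in> Arr (ovr C x)" "Cod (ovr C x) f = (x, Ident C x)"
    then show "f = (case Dom (ovr C x) f of (a, be) => (be, Ident C x))"
      using Comp_Ident_left by (cases f) auto
  qed
qed

lemma over_path:
  assumes "is_path (ovr C x) (a, be) fs"
  shows "path_end (ovr C x) (a, be) fs = (path_end C a (map fst fs), over_end C x ((a, be), fs))"
    and "over_end C x ((a, be), fs) \<in> Arr C" "Dom C (over_end C x ((a, be), fs)) = path_end C a (map fst fs)"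
    and "Cod C (over_end C x ((a, be), fs)) = x" "is_path C a (map fst fs)"
    and "over_simplex C (a, map fst fs) (over_end C x ((a, be), fs)) = ((a, be), fs)"
  using assms
proof (induction fs arbitrary: a be)
  case (Cons f fs)
  {
    case 1
    show ?case using 1 Cons.IH(1) by (cases f) (auto simp: over_end_def)
  next
    case 2
    show ?case using 2 Cons.IH(2) by (cases f) (auto simp: over_end_def)
  next
    case 3
    show ?case using 3 Cons.IH(3) by (cases f) (auto simp: over_end_def)
  next
    case 4
    show ?case using 4 Cons.IH(4) by (cases f) (auto simp: over_end_def)
  next
    case 5
    show ?case using 5 Cons.IH(5) by (cases f) auto
  next
    case 6
    obtain de be' where f: "f = (de, be')" by (cases f)
    show ?case using 6 Cons.IH(6)[of "Cod C de" be'] unfolding f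
      by (auto simp: over_end_def over_simplex_def)
  }
qed (auto simp: over_end_def over_simplex_def)

lemma path_over:
  assumes "is_path C a des" "be \<in> Arr C" "Dom C be = path_end C a des" "Cod C be = x"
  shows "path_comp C des be \<in> Arr C \<and> Dom C (path_comp C des be) = a \<and> Cod C (path_comp C des be) = x \<and>
    is_path (ovr C x) (a, path_comp C des be) (lift_arrows C des be) \<and>
    path_end (ovr C x) (a, path_comp C des be) (lift_arrows C des be) = (path_end C a des, be)"
  using assms
  by (induction des arbitrary: a) (auto simp: Comp_Arr Dom_Comp Cod_Comp Dom_Obj)

text \<open>If \<open>de\<close> is an identity, composing \<open>be\<close> with it changes
  nothing, so the source of the arrow is its target. Degeneracy in \<open>Id/x\<close> is thus
  tested on the underlying chain in \<open>C\<close>.\<close>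

lemma over_nondegenerate:
  assumes "(de, be) \<in> Arr (ovr C x)"
  shows "(de, be) = Ident (ovr C x) (Dom (ovr C x) (de, be)) \<longleftrightarrow> de = Ident C (Dom C de)"
proof -
  have "Comp C be de = be" if "de = Ident C (Dom C de)"
  proof -
    have "Dom C be = Dom C de" using that assms Cod_Ident[OF Dom_Obj[of de]] by simp
    then show ?thesis using that assms Comp_Ident_right[of be] by simp
  qed
  then show ?thesis by auto
qed

text \<open>With \<open>nd_over_simplex\<close>, this sets up a bijection between nondegenerate
  simplices of \<open>Id/x\<close> and pairs of a nondegenerate simplex of \<open>C\<close> and an
  arrow from its last vertex to \<open>x\<close>. It is the reason why the chains form a sum of
  representable functors, one for each simplex of \<open>C\<close>.\<close>

lemma nd_over:
  assumes "si \<in> nd_simplices (ovr C x) n"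
  shows "over_base si \<in> nd_simplices C n" "over_end C x si \<in> Arr C"
    "Dom C (over_end C x si) = path_end C (fst (over_base si)) (snd (over_base si))" "Cod C (over_end C x si) = x"
    "over_simplex C (over_base si) (over_end C x si) = si"
proof -
  obtain a be fs where si: "si = ((a, be), fs)" by (metis prod.collapse)
  have p: "is_path (ovr C x) (a, be) fs" and l: "length fs = n"
    and nd: "\<forall>f\<in>set fs. f \<noteq> Ident (ovr C x) (Dom (ovr C x) f)"
    using assms by (auto simp: si nd_simplices_def)
  have sub: "set fs \<subseteq> Arr (ovr C x)" by (rule finite_category.is_path_Arr[OF finite_over p])
  have "fst f \<noteq> Ident C (Dom C (fst f))" if "f \<in> set fs" for f
    using over_nondegenerate[of "fst f" "snd f" x] nd sub that by auto
  then show "over_base si \<in> nd_simplices C n"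
    using over_path(5)[OF p] l by (auto simp: si over_base_def nd_simplices_def)
qed (use assms over_path in \<open>auto simp: nd_simplices_def over_base_def\<close>)

lemma nd_over_simplex:
  assumes "(a, des) \<in> nd_simplices C n" "be \<in> Arr C" "Dom C be = path_end C a des" "Cod C be = x"
  shows "over_simplex C (a, des) be \<in> nd_simplices (ovr C x) n"
    "over_base (over_simplex C (a, des) be) = (a, des)" "over_end C x (over_simplex C (a, des) be) = be"
proof -
  have p: "is_path C a des" and l: "length des = n" and nd: "\<forall>f\<in>set des. f \<noteq> Ident C (Dom C f)"
    using assms(1) by (auto simp: nd_simplices_def)
  note po = path_over[OF p assms(2-4)]
  have sub: "set (lift_arrows C des be) \<subseteq> Arr (ovr C x)"
    using finite_category.is_path_Arr[OF finite_over] po by blast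
  have "f \<noteq> Ident (ovr C x) (Dom (ovr C x) f)" if f: "f \<in> set (lift_arrows C des be)" for f
  proof -
    have "fst f \<in> set des" using f map_fst_lift_arrows(1)[of C des be] by (metis image_eqI list.set_map)
    moreover have "(fst f, snd f) \<in> Arr (ovr C x)" using f sub by auto
    ultimately show ?thesis using over_nondegenerate[of "fst f" "snd f" x] nd by auto
  qed
  then show "over_simplex C (a, des) be \<in> nd_simplices (ovr C x) n"
    using po l by (auto simp: over_simplex_def nd_simplices_def)
  show "over_base (over_simplex C (a, des) be) = (a, des)" "over_end C x (over_simplex C (a, des) be) = be"
    using po by (simp_all add: over_base_def over_simplex_def over_end_def)
qed

lemma over_act_simplex:
  assumes "is_path C a des" "be \<in> Arr C" "Dom C be = path_end C a des" "g \<in> Arr C" "Dom C g = Cod C be"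
  shows "over_act C g (over_simplex C (a, des) be) = over_simplex C (a, des) (Comp C g be)"
proof -
  have "Comp C g (path_comp C des be) = path_comp C des (Comp C g be) \<and>
      map (\<lambda>(de, be'). (de, Comp C g be')) (lift_arrows C des be) = lift_arrows C des (Comp C g be)"
    using assms(1,3)
  proof (induction des arbitrary: a)
    case (Cons de des)
    then have *: "is_path C (Cod C de) des" "Dom C be = path_end C (Cod C de) des" "de \<in> Arr C" by auto
    show ?case using Cons.IH[OF *(1,2)] path_over[OF *(1) assms(2) *(2) refl] *(3) assms(4,5)
      by (simp add: Comp_assoc)
  qed simp
  then show ?thesis by (simp add: over_act_def over_simplex_def)
qed

lemma over_act_nd:
  assumes si: "si \<in> nd_simplices (ovr C x) n" and g: "g \<in> Arr C" "Dom C g = x"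
  shows "over_act C g si = over_simplex C (over_base si) (Comp C g (over_end C x si))"
    "over_act C g si \<in> nd_simplices (ovr C (Cod C g)) n" "over_base (over_act C g si) = over_base si"
    "over_end C (Cod C g) (over_act C g si) = Comp C g (over_end C x si)"
proof -
  obtain a des where b: "over_base si = (a, des)" by (cases "over_base si")
  note nd = nd_over[OF si, unfolded b fst_conv snd_conv]
  have p: "is_path C a des" using nd(1) by (simp add: nd_simplices_def)
  show 1: "over_act C g si = over_simplex C (over_base si) (Comp C g (over_end C x si))"
    using over_act_simplex[OF p nd(2,3), of g] g nd(4,5) b by simp
  have "Comp C g (over_end C x si) \<in> Arr C" "Dom C (Comp C g (over_end C x si)) = path_end C a des"
    "Cod C (Comp C g (over_end C x si)) = Cod C g"
    using nd g by (auto simp: Comp_Arr Dom_Comp Cod_Comp)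
  from nd_over_simplex[OF nd(1) this]
  show "over_act C g si \<in> nd_simplices (ovr C (Cod C g)) n" "over_base (over_act C g si) = over_base si"
    "over_end C (Cod C g) (over_act C g si) = Comp C g (over_end C x si)"
    unfolding 1 b .
qed

text \<open>The second part is needed because \<open>nerve_bdry\<close> drops degenerate faces, so
  moving along \<open>g\<close> must neither create nor destroy degeneracy. It changes only the maps
  to \<open>x\<close>, not the underlying chain on which degeneracy is decided.\<close>

lemma over_act_face:
  assumes si: "si \<in> nd_simplices (ovr C x) (Suc n)" and g: "g \<in> Arr C" "Dom C g = x" and i: "i \<le> Suc n"
  shows "face (ovr C (Cod C g)) i (over_act C g si) = over_act C g (face (ovr C x) i si)"
    and "over_act C g (face (ovr C x) i si) \<in> nd_simplices (ovr C (Cod C g)) n \<longleftrightarrow>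
      face (ovr C x) i si \<in> nd_simplices (ovr C x) n"
proof -
  obtain a be fs where si': "si = ((a, be), fs)" by (metis prod.collapse)
  have l: "length fs = Suc n" using si by (simp add: si' nd_simplices_def)
  let ?h = "\<lambda>(de, be'). (de, Comp C g be')"
  show 1: "face (ovr C (Cod C g)) i (over_act C g si) = over_act C g (face (ovr C x) i si)"
  proof -
    have c: "Comp (ovr C (Cod C g)) (?h u) (?h v) = ?h (Comp (ovr C x) u v)" for u v
      by (cases u; cases v) simp
    have d: "Cod (ovr C (Cod C g)) (?h u) = ?h (Cod (ovr C x) u)" for u by (cases u) simp
    obtain f fs' where fs: "fs = f # fs'" using l by (cases fs) auto
    show ?thesis
    proof (cases "i = 0")
      case True
      then show ?thesis unfolding si' over_act_def fs
        using d[of f] by (cases f) (simp add: face_def)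
    next
      case False
      then show ?thesis unfolding si' over_act_def using i l
        by (cases "i = Suc n") (simp_all add: face_def map_butlast take_map drop_map c nth_map)
    qed
  qed
  have "face (ovr C x) i si \<in> nd_simplices (ovr C x) n"
    if A: "over_act C g (face (ovr C x) i si) \<in> nd_simplices (ovr C (Cod C g)) n"
  proof -
    have A': "\<forall>f\<in>set (snd (over_act C g (face (ovr C x) i si))). f \<noteq> Ident (ovr C (Cod C g)) (Dom (ovr C (Cod C g)) f)"
      using A by (auto simp: nd_simplices_def)
    obtain b be' fs' where F: "face (ovr C x) i si = ((b, be'), fs')" by (metis prod.collapse)
    \<comment> \<open>That a face of a path is again a path is checked separately for the first
      face, the last face and a composed inner pair.\<close>
    have p: "is_path (ovr C x) (b, be') fs'"
    proof -
      have pth: "is_path (ovr C x) (a, be) fs" using si by (simp add: si' nd_simplices_def)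
      interpret O: finite_category "ovr C x" by (rule finite_over)
      have comp: "is_path (ovr C x) z (take j fs @ Comp (ovr C x) (fs ! Suc j) (fs ! j) # drop (j + 2) fs)"
        if "is_path (ovr C x) z fs" "Suc j < length fs" for z j fs
        using that
      proof (induction fs arbitrary: z j)
        case (Cons f fs)
        then show ?case
        proof (cases j)
          case 0
          then obtain f' fs'' where "fs = f' # fs''" using Cons.prems by (cases fs) auto
          then show ?thesis using Cons.prems 0 by (auto simp: O.Comp_Arr O.Dom_Comp O.Cod_Comp)
        qed auto
      qed simp
      obtain f fs'' where fs: "fs = f # fs''" using l by (cases fs) auto
      have bl: "is_path (ovr C x) (a, be) (butlast fs)"
      proof -
        have "fs \<noteq> []" using l by auto
        then show ?thesis
          using pth O.is_path_append[of "(a, be)" "butlast fs" "last fs"]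
          unfolding append_butlast_last_id[OF \<open>fs \<noteq> []\<close>] by blast
      qed
      show ?thesis
        using F pth l i comp[OF pth, of "i - 1"] bl fs unfolding si'
        by (cases "i = 0"; cases "i = Suc n") (auto simp: face_def)
    qed
    have "f \<noteq> Ident (ovr C x) (Dom (ovr C x) f)" if f: "f \<in> set fs'" for f
    proof
      assume id: "f = Ident (ovr C x) (Dom (ovr C x) f)"
      have fA: "f \<in> Arr (ovr C x)" using finite_category.is_path_Arr[OF finite_over p] f by blast
      obtain de be'' where ff: "f = (de, be'')" by (cases f)
      have "de = Ident C (Dom C de)" using over_nondegenerate[of de be'' x] id fA ff by simp
      moreover have gA: "(de, Comp C g be'') \<in> Arr (ovr C (Cod C g))"
        using fA ff g by (simp add: Comp_Arr Dom_Comp Cod_Comp)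
      moreover have "(de, Comp C g be'') \<in> set (snd (over_act C g (face (ovr C x) i si)))"
        using f ff by (force simp: F over_act_def)
      ultimately show False
        using over_nondegenerate[OF gA] A' by blast
    qed
    then show ?thesis using p A by (simp add: F nd_simplices_def over_act_def)
  qed
  then show "over_act C g (face (ovr C x) i si) \<in> nd_simplices (ovr C (Cod C g)) n \<longleftrightarrow>
      face (ovr C x) i si \<in> nd_simplices (ovr C x) n"
    using over_act_nd(2)[OF _ g] by blast
qed

end

section \<open>The bar complex as a projective resolution of the constant functor\<close>

context finite_category
begin

lemma bar_simps:
  "sp (mods (bar C) n) x = free_space (nd_simplices (ovr C x) n)"
  "act (mods (bar C) n) g = push (over_act C g)"
  "bdry (bar C) n x = nerve_bdry (ovr C x) n"
  "aug (bar C) x = lin (sp (const_mod :: ('o, 'm, 'k::field, 'k) kfunctor) x) (\<lambda>si. 1)"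
  by (simp_all add: bar_def over_chains_def over_act_def[abs_def] fun_eq_iff case_prod_beta'
    lin_def finsum_const_mod)

lemma fmod_bar: "fmod C (mods (bar C) n)"
  unfolding fmod_def bar_simps
proof (intro conjI ballI impI)
  fix f assume f: "f \<in> Arr C"
  show "push (over_act C f) \<in> lhom (free_space (nd_simplices (ovr C (Dom C f)) n))
      (free_space (nd_simplices (ovr C (Cod C f)) n))"
    by (rule push_lhom) (rule over_act_nd(2)[OF _ f refl])
  fix g v assume g: "g \<in> Arr C" "Dom C g = Cod C f"
    and v: "v \<in> carrier (free_space (nd_simplices (ovr C (Dom C f)) n))"
  show "push (over_act C (Comp C g f)) v = push (over_act C g) (push (over_act C f) v)"
    unfolding push_push
  proof (rule push_cong)
    fix si assume "si \<in> keys v"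
    then have si: "si \<in> nd_simplices (ovr C (Dom C f)) n" using v by auto
    note a = over_act_nd[OF si f refl]
    show "over_act C (Comp C g f) si = over_act C g (over_act C f si)"
      using over_act_nd(1)[OF a(2) g] over_act_nd(1)[OF si, of "Comp C g f"] a nd_over[OF si] f g
      by (simp add: Comp_Arr Dom_Comp Comp_assoc)
  qed
next
  fix x v assume x: "x \<in> Obj C" and v: "v \<in> carrier (free_space (nd_simplices (ovr C x) n))"
  have "push (over_act C (Ident C x)) v = push (\<lambda>si. si) v"
  proof (rule push_cong)
    fix si assume "si \<in> keys v"
    then have si: "si \<in> nd_simplices (ovr C x) n" using v by auto
    show "over_act C (Ident C x) si = si"
      using over_act_nd(1)[OF si, of "Ident C x"] x nd_over[OF si] Comp_Ident_left[of "over_end C x si"]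
      by (simp add: Ident_Arr Dom_Ident)
  qed
  then show "push (over_act C (Ident C x)) v = v" by (simp add: push_id)
qed (rule vs_free_space)

text \<open>The dual basis is indexed by the nondegenerate simplices of \<open>C\<close>, placed at
  their last vertices: \<open>e\<close> completes a simplex with the identity there, and a simplex
  of \<open>Id/x\<close> has as its single coordinate the underlying simplex together with its arrow
  to \<open>x\<close>.\<close>

lemma projective_bar: "projective C (mods (bar C) n :: ('o, 'm, 'k::field, _) kfunctor)"
proof -
  let ?B = "mods (bar C) n :: ('o, 'm, 'k, _) kfunctor"
  define d where "d = (\<lambda>(a, fs). path_end C a fs)"
  define e where "e = (\<lambda>i. single (over_simplex C i (Ident C (d i))) (1::'k))"
  define c where "c = (\<lambda>x. push (\<lambda>si. (over_base si, over_end C x si)) :: _ => (_ \<Rightarrow>\<^sub>0 'k))"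
  have d: "d i \<in> Obj C" if "i \<in> nd_simplices C n" for i
    using that is_path_Obj(2) by (auto simp: d_def nd_simplices_def)
  have eI: "over_simplex C i (Ident C (d i)) \<in> nd_simplices (ovr C (d i)) n"
      "over_base (over_simplex C i (Ident C (d i))) = i" "over_end C (d i) (over_simplex C i (Ident C (d i))) = Ident C (d i)"
    if "i \<in> nd_simplices C n" for i
    using nd_over_simplex[of "fst i" "snd i" n "Ident C (d i)" "d i"] that d[OF that]
    by (auto simp: Ident_Arr Dom_Ident Cod_Ident d_def case_prod_beta')
  have B: "dual_basis C ?B (nd_simplices C n) d e c"
    unfolding dual_basis_def bar_simps
  proof (intro conjI ballI)
    show "finite (nd_simplices C n)" by (rule finite_nd_simplices)
    fix i assume i: "i \<in> nd_simplices C n"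
    show "d i \<in> Obj C" by (rule d[OF i])
    show "e i \<in> carrier (free_space (nd_simplices (ovr C (d i)) n))" using eI(1)[OF i] by (simp add: e_def)
  next
    fix x assume x: "x \<in> Obj C"
    show "c x \<in> lhom (free_space (nd_simplices (ovr C x) n)) (free_space (free_gens C (nd_simplices C n) d x))"
      unfolding c_def by (rule push_lhom) (use nd_over in \<open>auto simp: free_gens_def d_def case_prod_beta'\<close>)
    fix v :: "_ \<Rightarrow>\<^sub>0 'k" assume v: "v \<in> carrier (free_space (nd_simplices (ovr C x) n))"
    have eq: "push (over_act C (over_end C x si)) (e (over_base si)) = single si 1"
      if si: "si \<in> nd_simplices (ovr C x) n" for si
    proof -
      note nd = nd_over[OF si]
      have dd: "Dom C (over_end C x si) = d (over_base si)" using nd(3) by (simp add: d_def case_prod_beta')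
      note ei = eI[OF nd(1)]
      have "over_act C (over_end C x si) (over_simplex C (over_base si) (Ident C (d (over_base si)))) = si"
        using over_act_nd(1)[OF ei(1) nd(2) dd] ei nd(5) Comp_Ident_right[OF nd(2)] dd by simp
      then show ?thesis by (simp add: e_def)
    qed
    have key: "\<And>si. si \<in> keys v ==> si \<in> nd_simplices (ovr C x) n" using v by auto
    let ?F = "free_space (nd_simplices (ovr C x) n)"
    have "lin ?F (\<lambda>(i, f). push (over_act C f) (e i)) (c x v)
        = lin ?F (\<lambda>si. (\<lambda>(i, f). push (over_act C f) (e i)) (over_base si, over_end C x si)) v"
      unfolding c_def by (rule lin_push[OF vs_free_space]) (use eq key in auto)
    also have "\<dots> = lin ?F (\<lambda>si. single si 1) v"
      by (rule lin_cong[OF vs_free_space]) (use eq key in auto)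
    also have "\<dots> = v" using lin_eq[OF lhom_id vs_free_space, of v] v by simp
    finally show "lin ?F (\<lambda>(i, f). push (over_act C f) (e i)) (c x v) = v" .
  next
    fix f and v :: "_ \<Rightarrow>\<^sub>0 'k" assume f: "f \<in> Arr C" and v: "v \<in> carrier (free_space (nd_simplices (ovr C (Dom C f)) n))"
    show "c (Cod C f) (push (over_act C f) v) = push (\<lambda>(i, h). (i, Comp C f h)) (c (Dom C f) v)"
      unfolding c_def push_push
      by (rule push_cong) (use v over_act_nd(3,4)[OF _ f refl] in auto)
  qed
  show ?thesis by (rule dual_basis_projective[OF finite_category_axioms fmod_bar B])
qed

lemma bar_bdry_nat:
  "nat_trans C (mods (bar C) (Suc n)) (mods (bar C) n :: ('o, 'm, 'k::field, _) kfunctor) (bdry (bar C) n)"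
proof (rule nat_transI)
  show "bdry (bar C) n x \<in> lhom (sp (mods (bar C) (Suc n)) x) (sp (mods (bar C) n) x)" for x
    unfolding bar_simps by (rule nerve_bdry_lhom)
  fix g and v :: "_ \<Rightarrow>\<^sub>0 'k"
  assume g: "g \<in> Arr C" and v: "v \<in> car (mods (bar C) (Suc n)) (Dom C g)"
  let ?x = "Dom C g" and ?y = "Cod C g"
  let ?F = "\<lambda>n x. free_space (nd_simplices (ovr C x) n)"
  have p: "push (over_act C g) \<in> lhom (?F n ?x) (?F n ?y)" for n
    by (rule push_lhom) (rule over_act_nd(2)[OF _ g refl])
  show "bdry (bar C) n ?y (act (mods (bar C) (Suc n)) g v) = act (mods (bar C) n) g (bdry (bar C) n ?x v)"
    unfolding bar_simps
  proof (rule free_ext[OF lhom_comp[OF p nerve_bdry_lhom] lhom_comp[OF nerve_bdry_lhom p] vs_free_space])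
    fix si assume si: "si \<in> nd_simplices (ovr C ?x) (Suc n)"
    have "push (over_act C g) (face_sum (ovr C ?x) n si :: _ \<Rightarrow>\<^sub>0 'k) = (\<Sum>i\<le>Suc n. push (over_act C g)
        (if face (ovr C ?x) i si \<in> nd_simplices (ovr C ?x) n then single (face (ovr C ?x) i si) ((-1) ^ i) else 0))"
      unfolding face_sum_def by (rule lin_sum[OF p]) auto
    also have "\<dots> = face_sum (ovr C ?y) n (over_act C g si)"
      unfolding face_sum_def
      by (intro sum.cong refl)
         (use over_act_face[OF si g refl] lhom_zero[OF p vs_free_space vs_free_space] in auto)
    finally show "nerve_bdry (ovr C ?y) n (push (over_act C g) (single si 1))
        = push (over_act C g) (nerve_bdry (ovr C ?x) n (single si (1::'k)))"
      by (simp add: nerve_bdry_single)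
  qed (use v in \<open>simp add: bar_simps\<close>)
qed

lemma const_mod_hom: "h \<in> lhom V (sp const_mod x) \<longleftrightarrow> (\<forall>v\<in>carrier V. \<forall>w\<in>carrier V. h (v \<oplus>\<^bsub>V\<^esub> w) = h v + h w) \<and>
    (\<forall>c. \<forall>v\<in>carrier V. h (c \<odot>\<^bsub>V\<^esub> v) = c * h v)"
  by (auto simp: module_hom_def)

lemma bar_aug_lhom: "aug (bar C) x \<in> lhom (free_space U) (sp const_mod y)"
proof -
  have "aug (bar C) x \<in> lhom (free_space U) (sp (const_mod :: ('o, 'm, 'k::field, 'k) kfunctor) x)"
    unfolding bar_simps by (rule lin_lhom[OF vs_const_mod]) simp
  then show ?thesis by (simp only: const_mod_hom)
qed

lemma bar_aug_single: "aug (bar C) x (single si c) = c"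
  unfolding bar_simps by (simp add: lin_single_at[OF vs_const_mod])

lemma bar_aug_nat: "nat_trans C (mods (bar C) 0) const_mod (aug (bar C))"
proof (rule nat_transI)
  show "aug (bar C) x \<in> lhom (sp (mods (bar C) 0) x) (sp const_mod x)" for x
    unfolding bar_simps(1) by (rule bar_aug_lhom)
  fix g v assume g: "g \<in> Arr C" and v: "v \<in> car (mods (bar C) 0) (Dom C g)"
  have p: "push (over_act C g) \<in> lhom (free_space (nd_simplices (ovr C (Dom C g)) 0)) (free_space (nd_simplices (ovr C (Cod C g)) 0))"
    by (rule push_lhom) (rule over_act_nd(2)[OF _ g refl])
  have "aug (bar C) (Cod C g) (push (over_act C g) v) = aug (bar C) (Dom C g) v"
    by (rule free_ext[OF lhom_comp[OF p bar_aug_lhom] _ vs_const_mod])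
       (use v in \<open>auto simp: bar_aug_single bar_simps(1) intro: bar_aug_lhom\<close>)
  then show "aug (bar C) (Cod C g) (act (mods (bar C) 0) g v) = act const_mod g (aug (bar C) (Dom C g) v)"
    by (simp add: bar_simps(2))
qed

text \<open>The contraction in degree zero. Face \<open>0\<close> of the simplex with the appended
  arrow is the terminal vertex, and face \<open>1\<close>, with sign \<open>-1\<close>, is the
  original vertex; the coefficients of the terminal vertex add up to the augmentation.\<close>

lemma cone_0:
  assumes x: "x \<in> Obj C" and v: "keys v \<subseteq> nd_simplices (ovr C x) 0"
  shows "nerve_bdry (ovr C x) 0 (terminal_category.s (ovr C x) (x, Ident C x) (\<lambda>(a, be). (be, Ident C x)) 0 v)
    = single ((x, Ident C x), []) (aug (bar C) x v) - (v :: _ \<Rightarrow>\<^sub>0 'k::field)"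
proof -
  interpret O: terminal_category "ovr C x" "(x, Ident C x)" "\<lambda>(a, be). (be, Ident C x)" by (rule terminal_over[OF x])
  let ?F = "\<lambda>m. free_space (nd_simplices (ovr C x) m)"
  let ?T = "((x, Ident C x), [])"
  have T: "?T \<in> nd_simplices (ovr C x) 0" using O.T by (simp add: O.nd_0)
  have sg: "(\<lambda>c. single ?T (c::'k)) \<in> lhom (sp const_mod x) (?F 0)"
    using T by (intro lhomI) (auto simp: single_add)
  have l: "(\<lambda>v. single ?T (aug (bar C) x v :: 'k) + scale (-1) v) \<in> lhom (?F 0) (?F 0)"
    using lhom_add[OF lhom_comp[OF bar_aug_lhom sg] lhom_scale[OF lhom_id vs_free_space, where c = "-1"] vs_free_space]
    unfolding free_space_simps .
  have "nerve_bdry (ovr C x) 0 (O.s 0 v) = single ?T (aug (bar C) x v) + scale (-1) v"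
  proof (rule free_ext[OF lhom_comp[OF O.s_lhom nerve_bdry_lhom] l vs_free_space _ v])
    fix si assume si: "si \<in> nd_simplices (ovr C x) 0"
    then obtain a be where a: "si = ((a, be), [])" "(a, be) \<in> Obj (ovr C x)" by (auto simp: O.nd_0)
    show "nerve_bdry (ovr C x) 0 (O.s 0 (single si 1))
        = single ?T (aug (bar C) x (single si 1)) + scale (-1) (single si (1::'k))"
    proof (cases "(a, be) = (x, Ident C x)")
      case True
      then have c: "O.con si = (0 :: _ \<Rightarrow>\<^sub>0 'k)" using a by (simp add: O.con_def)
      show ?thesis unfolding O.s_single[OF si] c scale_0
        using True a lhom_zero[OF nerve_bdry_lhom[of "ovr C x" 0] vs_free_space vs_free_space]
        by (simp add: bar_aug_single single_uminus scale_simps)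
    next
      case False
      have "O.s 0 (single si 1) = single ((a, be), [(be, Ident C x)]) (1::'k)"
        unfolding O.s_single[OF si] using False a by (auto simp: O.con_def)
      moreover have "face (ovr C x) 0 ((a, be), [(be, Ident C x)]) = ?T"
        "face (ovr C x) (Suc 0) ((a, be), [(be, Ident C x)]) = si"
        using a x by (auto simp: face_def)
      ultimately show ?thesis
        using T si by (simp add: nerve_bdry_single face_sum_def bar_aug_single single_uminus scale_simps)
    qed
  qed
  then show ?thesis by (simp add: scale_simps)
qed

lemma bar_aug_bdry:
  assumes x: "x \<in> Obj C" and v: "keys v \<subseteq> nd_simplices (ovr C x) 1"
  shows "aug (bar C) x (nerve_bdry (ovr C x) 0 v) = (0 :: 'k::field)"
proof -
  interpret O: terminal_category "ovr C x" "(x, Ident C x)" "\<lambda>(a, be). (be, Ident C x)" by (rule terminal_over[OF x])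
  have "aug (bar C) x (nerve_bdry (ovr C x) 0 v) = \<zero>\<^bsub>sp const_mod x\<^esub>"
  proof (rule free_ext[OF lhom_comp[OF nerve_bdry_lhom bar_aug_lhom] lhom_const_zero[OF vs_const_mod] vs_const_mod _ v])
    fix si assume si: "si \<in> nd_simplices (ovr C x) 1"
    then obtain z f where s: "si = (z, [f])" "f \<in> Arr (ovr C x)" "Dom (ovr C x) f = z"
      by (cases si) (auto simp: nd_simplices_def length_Suc_conv)
    have "(Cod (ovr C x) f, []) \<in> nd_simplices (ovr C x) 0" "(z, []) \<in> nd_simplices (ovr C x) 0"
      using O.Cod_Obj[OF s(2)] O.Dom_Obj[OF s(2)] s(3) by (auto simp: O.nd_0 simp del: over_simps)
    then have "face_sum (ovr C x) 0 si = single (Cod (ovr C x) f, []) (1::'k) + single (z, []) (-1)"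
      by (simp add: face_sum_def face_def s)
    then show "aug (bar C) x (nerve_bdry (ovr C x) 0 (single si (1::'k))) = \<zero>\<^bsub>sp const_mod x\<^esub>"
      using lhomD(2)[OF bar_aug_lhom[of x UNIV], of "single (Cod (ovr C x) f, []) 1" "single (z, []) (-1)"]
      by (simp add: nerve_bdry_single bar_aug_single)
  qed
  then show ?thesis by simp
qed

text \<open>Every simplex of \<open>Id/x\<close> is the image of one ending in a terminal object, and the latter are in the
  image of the contraction; this replaces the simplicial identities.\<close>

lemma bar_bdry_bdry:
  assumes "x \<in> Obj C" and "keys v \<subseteq> nd_simplices (ovr C x) (Suc (Suc n))"
  shows "nerve_bdry (ovr C x) n (nerve_bdry (ovr C x) (Suc n) v) = (0 :: _ \<Rightarrow>\<^sub>0 'k::field)"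
  using assms
proof (induction n arbitrary: x v rule: less_induct)
  fix n x and v :: "_ \<Rightarrow>\<^sub>0 'k"
  assume IH: "\<And>m x v. m < n ==> x \<in> Obj C ==> keys v \<subseteq> nd_simplices (ovr C x) (Suc (Suc m)) ==>
      nerve_bdry (ovr C x) m (nerve_bdry (ovr C x) (Suc m) v) = (0 :: _ \<Rightarrow>\<^sub>0 'k)"
    and x: "x \<in> Obj C" and v: "keys v \<subseteq> nd_simplices (ovr C x) (Suc (Suc n))"
  have gen: "nerve_bdry (ovr C x) n (nerve_bdry (ovr C x) (Suc n) (single si 1)) = (0 :: _ \<Rightarrow>\<^sub>0 'k)"
    if si: "si \<in> nd_simplices (ovr C x) (Suc (Suc n))" for si
  proof -
    note nd = nd_over[OF si]
    define a where "a = Dom C (over_end C x si)"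
    define rh where "rh = over_simplex C (over_base si) (Ident C a)"
    have a: "a \<in> Obj C" using nd(2) by (simp add: a_def Dom_Obj)
    interpret O: terminal_category "ovr C a" "(a, Ident C a)" "\<lambda>(z, be). (be, Ident C a)" by (rule terminal_over[OF a])
    have rh: "rh \<in> nd_simplices (ovr C a) (Suc (Suc n))" "over_end C a rh = Ident C a" "over_base rh = over_base si"
      using nd_over_simplex[of "fst (over_base si)" "snd (over_base si)" "Suc (Suc n)" "Ident C a" a] nd(1,3) a
      by (auto simp: rh_def a_def Ident_Arr Dom_Ident Cod_Ident)
    have act: "over_act C (over_end C x si) rh = si"
      using over_act_nd(1)[OF rh(1) nd(2)] rh nd(5) Comp_Ident_right[OF nd(2)] by (simp add: a_def)
    obtain z fs where zf: "rh = (z, fs)" by (cases rh)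
    \<comment> \<open>Deleting the last arrow of \<open>rh\<close> gives a simplex to which
      \<open>con\<close> appends the same arrow again; this arrow is nondegenerate, so the value of
      \<open>con\<close> is not zero.\<close>
    define \<tau> where "\<tau> = (z, butlast fs)"
    have fs: "fs = butlast fs @ [last fs]" and l: "length fs = Suc (Suc n)"
      using rh(1) zf by (auto simp: nd_simplices_def intro!: append_butlast_last_id[symmetric])
    have nda: "(z, butlast fs @ [last fs]) \<in> nd_simplices (ovr C a) (Suc (Suc n))" using rh(1) zf fs by simp
    then have \<tau>: "\<tau> \<in> nd_simplices (ovr C a) (Suc n)" and la: "last fs \<in> Arr (ovr C a)"
        "Dom (ovr C a) (last fs) = path_end (ovr C a) z (butlast fs)" "last fs \<noteq> Ident (ovr C a) (Dom (ovr C a) (last fs))"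
      unfolding O.nd_append \<tau>_def by auto
    have "path_end (ovr C a) z fs = (path_end C (fst z) (map fst fs), over_end C a (z, fs))"
      using over_path(1)[of a "fst z" "snd z" fs] rh(1) zf by (simp add: nd_simplices_def)
    then have "snd (path_end (ovr C a) z fs) = Ident C a" using rh(2) zf by simp
    moreover have "path_end (ovr C a) z fs = Cod (ovr C a) (last fs)" using fs by (metis path_end_append)
    moreover have "Cod (ovr C a) (last fs) \<in> Obj (ovr C a)" using O.Cod_Obj la by blast
    ultimately have "Cod (ovr C a) (last fs) = (a, Ident C a)"
      using a by (cases "Cod (ovr C a) (last fs)") (auto simp: Dom_Ident)
    note bu = O.bang_unique[OF la(1) this]
    have "O.con \<tau> = single rh (1::'k)"
    proof -
      have "path_end (ovr C a) z (butlast fs) \<noteq> (a, Ident C a)"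
      proof
        assume *: "path_end (ovr C a) z (butlast fs) = (a, Ident C a)"
        then have "last fs = (Ident C a, Ident C a)" using bu la(2) by simp
        then show False using la(2,3) * by simp
      qed
      then show ?thesis using bu la(2) fs zf by (simp add: O.con_def \<tau>_def)
    qed
    then have s\<tau>: "single rh 1 = O.s (Suc n) (single \<tau> (1::'k))"
      by (simp add: O.s_single[OF \<tau>] scale_simps)
    let ?F = "\<lambda>m. free_space (nd_simplices (ovr C a) m)"
    let ?d = "nerve_bdry (ovr C a)" and ?t = "single \<tau> (1::'k)"
    have tk: "keys ?t \<subseteq> nd_simplices (ovr C a) (Suc n)" using \<tau> by simp
    have dk: "keys (?d n ?t) \<subseteq> nd_simplices (ovr C a) n"
      using lhomD(1)[OF nerve_bdry_lhom[of "ovr C a" n UNIV], of ?t] by simp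
    have sk: "keys (O.s n (?d n ?t)) \<subseteq> nd_simplices (ovr C a) (Suc n)"
      using lhomD(1)[OF O.s_lhom, of "?d n ?t" n] dk by simp
    \<comment> \<open>The contraction formula one degree lower. The term with a double boundary is
      removed by the induction hypothesis, or for \<open>n = 0\<close> by the augmentation; what is
      left cancels the remaining term in the next computation.\<close>
    have ds: "?d n (O.s n (?d n ?t)) = scale ((-1) ^ Suc n) (?d n ?t)"
    proof (cases n)
      case 0
      then show ?thesis
        using cone_0[OF a, of "?d 0 ?t"] dk bar_aug_bdry[OF a, of ?t] tk by (simp add: scale_simps)
    next
      case (Suc m)
      have "?d m (?d (Suc m) ?t) = 0" using IH[OF _ a, of m ?t] tk Suc by simp
      then show ?thesis
        using O.cone[of "?d n ?t" m] dk Suc lhom_zero[OF O.s_lhom vs_free_space vs_free_space, of m] by simp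
    qed
    have "?d n (?d (Suc n) (single rh (1::'k))) = ?d n (O.s n (?d n ?t) + scale ((-1) ^ n) ?t)"
      unfolding s\<tau> O.cone[OF tk] ..
    also have "\<dots> = scale ((-1) ^ Suc n) (?d n ?t) + scale ((-1) ^ n) (?d n ?t)"
      using lhomD(2)[OF nerve_bdry_lhom[of "ovr C a" n UNIV], of "O.s n (?d n ?t)" "scale ((-1) ^ n) ?t"]
        lhomD(3)[OF nerve_bdry_lhom[of "ovr C a" n UNIV], of ?t "(-1) ^ n"] ds by (simp del: map_single)
    also have "\<dots> = 0" by (simp add: scale_simps(2)[symmetric] scale_simps(6))
    finally have z: "?d n (?d (Suc n) (single rh (1::'k))) = 0" .
    have g: "over_end C x si \<in> Arr C" "Dom C (over_end C x si) = a" "Cod C (over_end C x si) = x"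
      using nd by (auto simp: a_def)
    have nat: "nerve_bdry (ovr C x) m (push (over_act C (over_end C x si)) w) = push (over_act C (over_end C x si)) (?d m w)"
      if "keys w \<subseteq> nd_simplices (ovr C a) (Suc m)" for m and w :: "_ \<Rightarrow>\<^sub>0 'k"
      using nat_transD(3)[OF bar_bdry_nat g(1), of w m] that g by (simp add: bar_simps)
    have "nerve_bdry (ovr C x) n (nerve_bdry (ovr C x) (Suc n) (push (over_act C (over_end C x si)) (single rh 1)))
        = push (over_act C (over_end C x si)) (?d n (?d (Suc n) (single rh (1::'k))))"
      using nat[of "single rh 1" "Suc n"] nat[of "?d (Suc n) (single rh 1)" n] rh(1)
        lhomD(1)[OF nerve_bdry_lhom[of "ovr C a" "Suc n" UNIV], of "single rh 1"] by simp
    then show ?thesis using z act by (simp add: push_def)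
  qed
  have "nerve_bdry (ovr C x) n (nerve_bdry (ovr C x) (Suc n) v) = \<zero>\<^bsub>free_space (nd_simplices (ovr C x) n)\<^esub>"
    by (rule free_ext[OF lhom_comp[OF nerve_bdry_lhom nerve_bdry_lhom] lhom_const_zero[OF vs_free_space] vs_free_space _ v])
       (simp add: gen)
  then show "nerve_bdry (ovr C x) n (nerve_bdry (ovr C x) (Suc n) v) = 0" by simp
qed

theorem bar_resolution: "proj_resolution C const_mod (bar C :: ('o, 'm, 'k::field, _, 'k) aug_complex)"
  unfolding proj_resolution_def
proof (intro conjI allI projective_bar)
  show "resolution C const_mod (bar C :: ('o, 'm, 'k, _, 'k) aug_complex)"
  proof (rule resolutionI[OF finite_category_axioms fmod_const_mod fmod_bar bar_bdry_nat bar_aug_nat])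
    fix x :: 'o assume x: "x \<in> Obj C"
    interpret O: terminal_category "ovr C x" "(x, Ident C x)" "\<lambda>(z, be). (be, Ident C x)" by (rule terminal_over[OF x])
    fix w :: 'k
    show "\<exists>v\<in>car (mods (bar C) 0) x. aug (bar C) x v = w"
      by (rule bexI[of _ "single ((x, Ident C x), []) w"])
         (use O.T in \<open>auto simp: bar_simps(1) bar_aug_single O.nd_0\<close>)
    fix n and v :: "(('o \<times> 'm) \<times> ('m \<times> 'm) list) \<Rightarrow>\<^sub>0 'k"
    show "aug (bar C) x (bdry (bar C) 0 x v) = \<zero>\<^bsub>sp const_mod x\<^esub>" if "v \<in> car (mods (bar C) 1) x"
      using bar_aug_bdry[OF x, of v] that by (simp add: bar_simps(1-3))
    show "bdry (bar C) n x (bdry (bar C) (Suc n) x v) = \<zero>\<^bsub>sp (mods (bar C) n) x\<^esub>"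
      if "v \<in> car (mods (bar C) (Suc (Suc n))) x"
      using bar_bdry_bdry[OF x, of v n] that by (simp add: bar_simps(1-3))
    \<comment> \<open>The preimage is the contraction applied to \<open>- v\<close>, whose sign
      undoes the one in \<open>cone_0\<close>; in higher degrees the factor \<open>(-1) ^ n\<close>
      does the same for \<open>cone\<close>.\<close>
    show "\<exists>u\<in>car (mods (bar C) 1) x. v = bdry (bar C) 0 x u"
      if v: "v \<in> car (mods (bar C) 0) x" "aug (bar C) x v = \<zero>\<^bsub>sp const_mod x\<^esub>"
    proof (rule bexI[of _ "O.s 0 (- v)"])
      have k: "keys (- v) \<subseteq> nd_simplices (ovr C x) 0" using v by (simp add: bar_simps(1))
      have "aug (bar C) x (- v) = 0"
        using lhomD(3)[OF bar_aug_lhom[of x UNIV], of v "-1"] v by (simp add: scale_simps)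
      then show "v = bdry (bar C) 0 x (O.s 0 (- v))" using cone_0[OF x k] by (simp add: bar_simps(3))
      show "O.s 0 (- v) \<in> car (mods (bar C) 1) x"
        using lhomD(1)[OF O.s_lhom, of "- v" 0] k by (simp add: bar_simps(1))
    qed
    show "\<exists>u\<in>car (mods (bar C) (Suc (Suc n))) x. v = bdry (bar C) (Suc n) x u"
      if v: "v \<in> car (mods (bar C) (Suc n)) x" "bdry (bar C) n x v = \<zero>\<^bsub>sp (mods (bar C) n) x\<^esub>"
    proof (rule bexI[of _ "O.s (Suc n) (scale ((-1) ^ n) v)"])
      have k: "keys (scale ((-1) ^ n) v) \<subseteq> nd_simplices (ovr C x) (Suc n)"
        using v keys_scale[of "(-1) ^ n" v] by (auto simp: bar_simps(1))
      have "nerve_bdry (ovr C x) n (scale ((-1) ^ n) v) = 0"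
        using lhomD(3)[OF nerve_bdry_lhom[of "ovr C x" n UNIV], of v "(-1) ^ n"] v by (simp add: bar_simps)
      moreover have "scale ((-1) ^ n) (scale ((-1) ^ n) v) = v"
        by (simp add: scale_simps(3,4)[symmetric] power_mult_distrib[symmetric] scale_simps(4))
      ultimately show "v = bdry (bar C) (Suc n) x (O.s (Suc n) (scale ((-1) ^ n) v))"
        using O.cone[OF k] lhom_zero[OF O.s_lhom vs_free_space vs_free_space, of n] by (simp add: bar_simps(3))
      show "O.s (Suc n) (scale ((-1) ^ n) v) \<in> car (mods (bar C) (Suc (Suc n))) x"
        using lhomD(1)[OF O.s_lhom, of "scale ((-1) ^ n) v" "Suc n"] k by (simp add: bar_simps(1))
    qed
  qed
qed

end

section \<open>Left Kan extensions\<close>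

lemma lin_minus:
  assumes "vs W" "\<And>u. u \<in> U ==> ph u \<in> carrier W" "keys f \<subseteq> U" "keys g \<subseteq> U"
  shows "lin W ph (f - g) = lin W ph f \<oplus>\<^bsub>W\<^esub> (-1) \<odot>\<^bsub>W\<^esub> lin W ph g"
proof -
  have l: "lin W ph \<in> lhom (free_space U) W" by (rule lin_lhom[OF assms(1,2)])
  have "keys (scale (-1) g) \<subseteq> U" using keys_scale[of "-1" g] assms(4) by blast
  then show ?thesis
    using lhomD(2)[OF l, of f "scale (-1) g"] lhomD(3)[OF l, of g "-1"] assms by (simp add: scale_simps)
qed

lemma keys_minus_subset:
  assumes "keys f \<subseteq> U" "keys g \<subseteq> U"
  shows "keys (f - g :: _ \<Rightarrow>\<^sub>0 'k::field) \<subseteq> U"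
proof
  fix x assume "x \<in> keys (f - g)"
  then have "x \<in> keys f \<or> x \<in> keys g" by (auto simp: in_keys_iff lookup_minus)
  then show "x \<in> U" using assms by blast
qed

lemma linear_rels_carrier:
  assumes "vs V" "\<And>v. v \<in> carrier V ==> i v \<in> U"
  shows "linear_rels V i \<subseteq> carrier (free_space U)"
  unfolding linear_rels_def
  by (intro subsetI, elim UnE CollectE exE conjE; hypsubst; unfold free_space_simps; intro keys_minus_subset)
     (simp_all add: assms vs_closed)

lemma lin_single_diff:
  fixes W :: "('c::field, 'w) module"
  assumes "vs W" "ph a \<in> carrier W" "ph b \<in> carrier W"
  shows "lin W ph (single a 1 - single b c) = ph a \<oplus>\<^bsub>W\<^esub> (-1) \<odot>\<^bsub>W\<^esub> (c \<odot>\<^bsub>W\<^esub> ph b)"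
    and "ph d \<in> carrier W ==> lin W ph (single a 1 - single b 1 - single d 1)
      = ph a \<oplus>\<^bsub>W\<^esub> (-1) \<odot>\<^bsub>W\<^esub> ph b \<oplus>\<^bsub>W\<^esub> (-1) \<odot>\<^bsub>W\<^esub> ph d"
proof -
  show 1: "lin W ph (single a 1 - single b c) = ph a \<oplus>\<^bsub>W\<^esub> (-1) \<odot>\<^bsub>W\<^esub> (c \<odot>\<^bsub>W\<^esub> ph b)" for c
    by (subst lin_minus[OF assms(1), of "{a, b}"])
       (use assms in \<open>auto simp: lin_single_at[OF assms(1)] vs_smult(4)[OF assms(1)]\<close>)
  assume d: "ph d \<in> carrier W"
  have "keys (single a 1 - single b (1::'c)) \<subseteq> {a, b, d}"
    by (rule keys_minus_subset) auto
  then show "lin W ph (single a 1 - single b 1 - single d 1)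
      = ph a \<oplus>\<^bsub>W\<^esub> (-1) \<odot>\<^bsub>W\<^esub> ph b \<oplus>\<^bsub>W\<^esub> (-1) \<odot>\<^bsub>W\<^esub> ph d"
    by (subst lin_minus[OF assms(1), of "{a, b, d}"])
       (use assms d in \<open>auto simp: 1 lin_single_at[OF assms(1)] vs_smult(4)[OF assms(1)]\<close>)
qed

lemma lin_single_minus:
  assumes "vs W" "ph a \<in> carrier W" "ph b \<in> carrier W" "ph a = c \<odot>\<^bsub>W\<^esub> ph b"
  shows "lin W ph (single a 1 - single b c) = \<zero>\<^bsub>W\<^esub>"
  unfolding lin_single_diff(1)[where ph = ph, OF assms(1-3)] assms(4)
  by (rule vs_cancel(1)[OF assms(1) vs_closed(3)[OF assms(1,3)]])

lemma lin_linear_rels: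
  assumes W: "vs W" and V: "vs V" and ph: "(\<lambda>v. ph (i v)) \<in> lhom V W" and r: "r \<in> linear_rels V i"
  shows "lin W ph r = \<zero>\<^bsub>W\<^esub>"
  using r unfolding linear_rels_def
proof (elim UnE CollectE exE conjE)
  fix v w assume r: "r = single (i (v \<oplus>\<^bsub>V\<^esub> w)) 1 - single (i v) 1 - single (i w) 1"
    and vw: "v \<in> carrier V" "w \<in> carrier V"
  have cl: "ph (i (v \<oplus>\<^bsub>V\<^esub> w)) \<in> carrier W" "ph (i v) \<in> carrier W" "ph (i w) \<in> carrier W"
    using lhomD(1)[OF ph] vw vs_closed(2)[OF V vw] by auto
  show ?thesis
    unfolding r lin_single_diff(2)[where ph = ph, OF W cl]
    by (rule vs_move(3)[OF W cl lhomD(2)[OF ph vw]])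
next
  fix c v assume r: "r = single (i (c \<odot>\<^bsub>V\<^esub> v)) 1 - single (i v) c" and v: "v \<in> carrier V"
  show ?thesis unfolding r
    by (rule lin_single_minus[where ph = ph, OF W])
       (use lhomD[OF ph] v vs_closed(3)[OF V v] vs_closed(3)[OF W] in auto)
qed

context
  fixes U :: "'b set" and R :: "('b \<Rightarrow>\<^sub>0 'k::field) set"
  assumes R: "R \<subseteq> carrier (free_space U)"
begin

lemma gen_linear:
  assumes V: "vs V" and i: "\<And>v. v \<in> carrier V ==> i v \<in> U"
    and sub: "linear_rels V i \<subseteq> R"
  shows "(\<lambda>v. gen U R (i v)) \<in> lhom V (presented U R)"
proof -
  let ?W = "presented U R" and ?g = "gen U R"
  note W = vs_presented[OF R] and g = gen_closed[OF R] and rl = gen_rel[OF R]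
  show ?thesis
  proof (rule lhomI)
    fix v assume v: "v \<in> carrier V"
    show gv: "?g (i v) \<in> carrier ?W" by (rule g[OF i[OF v]])
    fix c
    note gcv = g[OF i[OF vs_closed(3)[OF V v]]]
    have "single (i (c \<odot>\<^bsub>V\<^esub> v)) 1 - single (i v) c \<in> R"
      using sub v unfolding linear_rels_def by blast
    from rl[OF this] show "?g (i (c \<odot>\<^bsub>V\<^esub> v)) = c \<odot>\<^bsub>?W\<^esub> ?g (i v)"
      unfolding lin_single_diff(1)[where ph = ?g, OF W gcv gv] vs_eq_iff[OF W gcv vs_closed(3)[OF W gv]] .
    fix w assume w: "w \<in> carrier V"
    note gw = g[OF i[OF w]] and gvw = g[OF i[OF vs_closed(2)[OF V v w]]]
    have "single (i (v \<oplus>\<^bsub>V\<^esub> w)) 1 - single (i v) 1 - single (i w) 1 \<in> R"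
      using sub v w unfolding linear_rels_def by blast
    from rl[OF this] show "?g (i (v \<oplus>\<^bsub>V\<^esub> w)) = ?g (i v) \<oplus>\<^bsub>?W\<^esub> ?g (i w)"
      unfolding lin_single_diff(2)[where ph = ?g, OF W gvw gv gw]
      using vs_move(1)[OF W gvw gv vs_closed(1)[OF W] gw] gv by (simp add: vs_zero[OF W])
  qed
qed

lemma gen_eq:
  assumes "a \<in> U" "b \<in> U" "single a 1 - single b 1 \<in> R"
  shows "gen U R a = gen U R b"
proof -
  note W = vs_presented[OF R] and g = gen_closed[OF R assms(1)] gen_closed[OF R assms(2)]
  have "gen U R a \<oplus>\<^bsub>presented U R\<^esub> (-1) \<odot>\<^bsub>presented U R\<^esub> gen U R b = \<zero>\<^bsub>presented U R\<^esub>"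
    using gen_rel[OF R assms(3)] unfolding lin_single_diff(1)[where ph = "gen U R", OF W g] vs_smult(4)[OF W g(2)] .
  then show ?thesis using vs_eq_iff[OF W g] by blast
qed

end

text \<open>The class of \<open>v\<close> placed at the object \<open>(a, be)\<close> of the
  overcategory, that is, the structure map of the colimit.\<close>

definition gla where
  "gla u D C F x a be v = gen (lan_gens u D C F x) (lan_rels u D C F x) (a, be, v)"

locale kan = D: finite_category D + C: finite_category C
  for D :: "('a, 'b) category" and C :: "('o, 'm) category" and u :: "('a, 'b, 'o, 'm) cat_functor" +
  assumes omap: "a \<in> Obj D ==> omap u a \<in> Obj C"
    and amap: "f \<in> Arr D ==> amap u f \<in> Arr C"
      "f \<in> Arr D ==> Dom C (amap u f) = omap u (Dom D f)"
      "f \<in> Arr D ==> Cod C (amap u f) = omap u (Cod D f)"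
    and amap_Ident: "a \<in> Obj D ==> amap u (Ident D a) = Ident C (omap u a)"
    and amap_Comp: "f \<in> Arr D ==> g \<in> Arr D ==> Dom D g = Cod D f ==> amap u (Comp D g f) = Comp C (amap u g) (amap u f)"
begin

definition ovo where
  "ovo x a be \<longleftrightarrow> a \<in> Obj D \<and> be \<in> Arr C \<and> Dom C be = omap u a \<and> Cod C be = x"

lemma gens_iff: "(a, be, v) \<in> lan_gens u D C F x \<longleftrightarrow> ovo x a be \<and> v \<in> car F a"
  by (auto simp: lan_gens_def over_cat_def ovo_def)

lemma rels_iff: "r \<in> lan_rels u D C F x \<longleftrightarrow>
    (\<exists>a be. ovo x a be \<and> r \<in> linear_rels (sp F a) (\<lambda>v. (a, be, v))) \<or>
    (\<exists>de be v. r = single (Cod D de, be, act F de v) 1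
       - single (Dom D de, Comp C be (amap u de), v) 1
      \<and> de \<in> Arr D \<and> ovo x (Cod D de) be \<and> v \<in> car F (Dom D de))"
proof -
  have "(de, be) \<in> Arr (over_cat u D C x) \<longleftrightarrow> de \<in> Arr D \<and> ovo x (Cod D de) be" for de be
    by (auto simp: over_cat_def ovo_def D.Cod_Obj)
  moreover have "(a, be) \<in> Obj (over_cat u D C x) \<longleftrightarrow> ovo x a be" for a be
    by (auto simp: over_cat_def ovo_def)
  ultimately show ?thesis unfolding lan_rels_def Un_iff mem_Collect_eq UN_iff Bex_def split_paired_Ex by (simp only: conj_assoc prod.case)
qed

lemma ovo_comp:
  assumes "de \<in> Arr D" "ovo x (Cod D de) be"
  shows "ovo x (Dom D de) (Comp C be (amap u de))"
  using assms by (auto simp: ovo_def D.Dom_Obj amap C.Comp_Arr C.Dom_Comp C.Cod_Comp)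

lemma ovo_act: "ovo x a be ==> g \<in> Arr C ==> Dom C g = x ==> ovo (Cod C g) a (Comp C g be)"
  by (auto simp: ovo_def C.Comp_Arr C.Dom_Comp C.Cod_Comp)

abbreviation L where "L \<equiv> lan u D C"
abbreviation la where "la \<equiv> gla u D C"
abbreviation Lm where "Lm \<equiv> lan_map u D C"

lemma L_sp: "sp (L F) x = presented (lan_gens u D C F x) (lan_rels u D C F x)"
  by (simp add: lan_def)

context
  fixes F :: "('a, 'b, 'k::field, 'v) kfunctor"
  assumes F: "fmod D F"
begin

lemma rels_carrier: "lan_rels u D C F x \<subseteq> carrier (free_space (lan_gens u D C F x))"
proof
  fix r assume "r \<in> lan_rels u D C F x"
  then show "r \<in> carrier (free_space (lan_gens u D C F x))" unfolding rels_iff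
  proof (elim disjE exE conjE)
    fix a be assume p: "ovo x a be" and r: "r \<in> linear_rels (sp F a) (\<lambda>v. (a, be, v))"
    have "linear_rels (sp F a) (\<lambda>v. (a, be, v)) \<subseteq> carrier (free_space (lan_gens u D C F x))"
      by (rule linear_rels_carrier[OF fmodD(1)[OF F]]) (use p in \<open>simp_all add: gens_iff ovo_def\<close>)
    with r show ?thesis by blast
  next
    fix de be v assume r: "r = single (Cod D de, be, act F de v) 1
       - single (Dom D de, Comp C be (amap u de), v) 1"
      and *: "de \<in> Arr D" "ovo x (Cod D de) be" "v \<in> car F (Dom D de)"
    show ?thesis unfolding r free_space_simps
      by (rule keys_minus_subset) (use * in \<open>simp_all add: gens_iff ovo_comp fmodD(3)[OF F]\<close>)
  qed
qed

lemma vs_lan: "vs (sp (L F) x)"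
  unfolding L_sp by (rule vs_presented[OF rels_carrier])

lemma la_lhom: "ovo x a be ==> la F x a be \<in> lhom (sp F a) (sp (L F) x)"
  unfolding L_sp gla_def[abs_def]
proof (rule gen_linear[OF rels_carrier])
  assume a: "ovo x a be"
  then show "vs (sp F a)" by (intro fmodD(1)[OF F]) (simp add: ovo_def)
  show "linear_rels (sp F a) (\<lambda>v. (a, be, v)) \<subseteq> lan_rels u D C F x"
    using a unfolding rels_iff subset_iff by (intro allI impI disjI1 exI conjI)
qed (simp add: gens_iff)

lemma la_closed: "ovo x a be ==> v \<in> car F a ==> la F x a be v \<in> car (L F) x"
  by (rule lhomD(1)[OF la_lhom])

lemma la_rel:
  assumes "de \<in> Arr D" "ovo x (Cod D de) be" "v \<in> car F (Dom D de)"
  shows "la F x (Cod D de) be (act F de v) = la F x (Dom D de) (Comp C be (amap u de)) v"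
  unfolding gla_def
proof (rule gen_eq[OF rels_carrier])
  show "single (Cod D de, be, act F de v) 1 - single (Dom D de, Comp C be (amap u de), v) 1
      \<in> lan_rels u D C F x"
    unfolding rels_iff using assms by blast
qed (use assms ovo_comp fmodD(3)[OF F] in \<open>auto simp: gens_iff\<close>)

lemma lan_ext:
  assumes "h \<in> lhom (sp (L F) x) V" "h' \<in> lhom (sp (L F) x) V" "vs V"
    and "\<And>a be v. ovo x a be ==> v \<in> car F a ==> h (la F x a be v) = h' (la F x a be v)"
    and "z \<in> car (L F) x"
  shows "h z = h' z"
  using presented_ext[OF rels_carrier assms(1,2)[unfolded L_sp] assms(3) _ assms(5)[unfolded L_sp]] assms(4)
  by (auto simp: gens_iff gla_def)

context
  fixes x and V :: "('k, 'w) module" and ph :: "'a => 'm => 'v => 'w"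
  assumes V: "vs V" and ph: "\<And>a be. ovo x a be ==> ph a be \<in> lhom (sp F a) V"
    and rel: "\<And>de be v. de \<in> Arr D ==> ovo x (Cod D de) be ==> v \<in> car F (Dom D de) ==>
      ph (Cod D de) be (act F de v) = ph (Dom D de) (Comp C be (amap u de)) v"
begin

lemma lan_rel_zero:
  assumes "r \<in> lan_rels u D C F x"
  shows "lin V (\<lambda>(a, be, v). ph a be v) r = \<zero>\<^bsub>V\<^esub>"
  using assms unfolding rels_iff
proof (elim disjE exE conjE)
  fix a be assume p: "ovo x a be" and r: "r \<in> linear_rels (sp F a) (\<lambda>v. (a, be, v))"
  have "vs (sp F a)" using p by (intro fmodD(1)[OF F]) (auto simp: ovo_def)
  from lin_linear_rels[OF V this, of "\<lambda>(a, be, v). ph a be v" "\<lambda>v. (a, be, v)"] p r ph[of a be]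
  show ?thesis by simp
next
  fix de be v assume *: "r = single (Cod D de, be, act F de v) 1
     - single (Dom D de, Comp C be (amap u de), v) 1"
    "de \<in> Arr D" "ovo x (Cod D de) be" "v \<in> car F (Dom D de)"
  have "ph (Dom D de) (Comp C be (amap u de)) v \<in> carrier V"
    by (rule lhomD(1)[OF ph[OF ovo_comp[OF *(2,3)]] *(4)])
  then show ?thesis unfolding *(1)
    by (intro lin_single_minus[OF V]) (use rel[OF *(2-4)] V in \<open>auto simp: vs_smult(4)\<close>)
qed

text \<open>\<open>ph\<close> is a cocone on the diagram of values of \<open>F\<close> over
  \<open>u/x\<close>; the map in question is the one that it induces on the colimit.\<close>

lemma lan_out:
  "pres_out V (\<lambda>(a, be, v). ph a be v) \<in> lhom (sp (L F) x) V"
  "ovo x a be ==> v \<in> car F a ==> pres_out V (\<lambda>(a, be, v). ph a be v) (la F x a be v) = ph a be v"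
proof -
  have c: "(\<lambda>(a, be, v). ph a be v) g \<in> carrier V" if "g \<in> lan_gens u D C F x" for g
    using that lhomD(1)[OF ph] by (cases g) (auto simp: gens_iff)
  note po = presented_out[OF rels_carrier V, of x "\<lambda>(a, be, v). ph a be v"]
  show "pres_out V (\<lambda>(a, be, v). ph a be v) \<in> lhom (sp (L F) x) V"
    unfolding L_sp by (rule po(1)[OF c lan_rel_zero])
  show "pres_out V (\<lambda>(a, be, v). ph a be v) (la F x a be v) = ph a be v"
    if "ovo x a be" "v \<in> car F a"
    unfolding gla_def using po(2)[OF c lan_rel_zero, of "(a, be, v)"] that by (simp add: gens_iff)
qed

end

text \<open>Covers two kinds of maps between Kan extensions at once: for the action of an arrow of
  \<open>C\<close>, \<open>rh\<close> changes the map \<open>be\<close> to the base object; for the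
  map induced by a natural transformation, \<open>et\<close> changes the vector.\<close>

lemma lan_pres_map:
  assumes F': "fmod D F'" and ps: "\<And>a be v. ovo x a be ==> v \<in> car F a ==> ovo y a (rh be) \<and> et a v \<in> car F' a"
    and ph: "\<And>a be. ovo x a be ==> (\<lambda>v. la F' y a (rh be) (et a v)) \<in> lhom (sp F a) (sp (L F') y)"
    and rel: "\<And>de be v. de \<in> Arr D ==> ovo x (Cod D de) be ==> v \<in> car F (Dom D de) ==>
      la F' y (Cod D de) (rh be) (et (Cod D de) (act F de v)) = la F' y (Dom D de) (rh (Comp C be (amap u de))) (et (Dom D de) v)"
    and vF': "vs (sp (L F') y)" and cF': "lan_rels u D C F' y \<subseteq> carrier (free_space (lan_gens u D C F' y))"
  shows "pres_map (lan_gens u D C F' y) (lan_rels u D C F' y) (\<lambda>(a, be, v). (a, rh be, et a v)) \<in> lhom (sp (L F) x) (sp (L F') y)"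
    and "ovo x a be ==> v \<in> car F a ==>
      pres_map (lan_gens u D C F' y) (lan_rels u D C F' y) (\<lambda>(a, be, v). (a, rh be, et a v)) (la F x a be v) = la F' y a (rh be) (et a v)"
proof -
  let ?m = "\<lambda>(a, be, v). (a, rh be, et a v)"
  have 1: "?m g \<in> lan_gens u D C F' y" if "g \<in> lan_gens u D C F x" for g
    using that ps by (cases g) (auto simp: gens_iff)
  have 2: "lin (presented (lan_gens u D C F' y) (lan_rels u D C F' y)) (\<lambda>g. gen (lan_gens u D C F' y) (lan_rels u D C F' y) (?m g)) r
      = \<zero>\<^bsub>presented (lan_gens u D C F' y) (lan_rels u D C F' y)\<^esub>" if "r \<in> lan_rels u D C F x" for r
    using lan_rel_zero[OF vF' ph rel that] by (simp add: L_sp gla_def case_prod_beta')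
  show "pres_map (lan_gens u D C F' y) (lan_rels u D C F' y) ?m \<in> lhom (sp (L F) x) (sp (L F') y)"
    unfolding L_sp by (rule presented_map(1)[OF rels_carrier cF' 1 2])
  show "pres_map (lan_gens u D C F' y) (lan_rels u D C F' y) ?m (la F x a be v) = la F' y a (rh be) (et a v)"
    if "ovo x a be" "v \<in> car F a"
    unfolding gla_def using presented_map(2)[OF rels_carrier cF' 1 2, where u = "(a, be, v)"] that
    by (simp add: gens_iff)
qed

end

lemma lan_act:
  assumes F: "fmod D F" and g: "g \<in> Arr C"
  shows "act (L F) g \<in> lhom (sp (L F) (Dom C g)) (sp (L F) (Cod C g))"
    and "ovo (Dom C g) a be ==> v \<in> car F a ==>
      act (L F) g (la F (Dom C g) a be v) = la F (Cod C g) a (Comp C g be) v"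
proof -
  have rel: "la F (Cod C g) (Cod D de) (Comp C g be) (act F de v) = la F (Cod C g) (Dom D de) (Comp C g (Comp C be (amap u de))) v"
    if d: "de \<in> Arr D" "ovo (Dom C g) (Cod D de) be" "v \<in> car F (Dom D de)" for de be v
    using la_rel[OF F d(1) ovo_act[OF d(2) g refl] d(3)] d amap[OF d(1)] g by (simp add: ovo_def C.Comp_assoc)
  note pm = lan_pres_map[OF F F, where x = "Dom C g" and y = "Cod C g" and rh = "Comp C g" and et = "\<lambda>a v. v",
      OF _ _ _ vs_lan[OF F] rels_carrier[OF F]]
  have a: "act (L F) g = pres_map (lan_gens u D C F (Cod C g)) (lan_rels u D C F (Cod C g)) (\<lambda>(a, be, v). (a, Comp C g be, v))"
    by (simp add: lan_def)
  show "act (L F) g \<in> lhom (sp (L F) (Dom C g)) (sp (L F) (Cod C g))"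
    unfolding a by (rule pm(1)) (use ovo_act[OF _ g refl] la_lhom[OF F] rel in auto)
  show "act (L F) g (la F (Dom C g) a be v) = la F (Cod C g) a (Comp C g be) v"
    if "ovo (Dom C g) a be" "v \<in> car F a"
    unfolding a by (rule pm(2)) (use ovo_act[OF _ g refl] la_lhom[OF F] rel that in auto)
qed

lemma lan_fmod:
  assumes F: "fmod D F"
  shows "fmod C (L F)"
  unfolding fmod_def
proof (intro conjI ballI impI)
  fix x z assume x: "x \<in> Obj C" and z: "z \<in> car (L F) x"
  note i = C.Ident_Arr[OF x] C.Dom_Ident[OF x] C.Cod_Ident[OF x]
  show "act (L F) (Ident C x) z = z"
  proof (rule lan_ext[OF F _ lhom_id vs_lan[OF F] _ z])
    show "act (L F) (Ident C x) \<in> lhom (sp (L F) x) (sp (L F) x)" using lan_act(1)[OF F i(1)] i by simp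
    show "act (L F) (Ident C x) (la F x a be v) = la F x a be v" if "ovo x a be" "v \<in> car F a" for a be v
      using lan_act(2)[OF F i(1)] i that C.Comp_Ident_left[of be] by (simp add: ovo_def)
  qed
next
  fix f g z assume f: "f \<in> Arr C" and g: "g \<in> Arr C" "Dom C g = Cod C f" and z: "z \<in> car (L F) (Dom C f)"
  note gf = C.Comp_Arr[OF f g] C.Dom_Comp[OF f g] C.Cod_Comp[OF f g]
  show "act (L F) (Comp C g f) z = act (L F) g (act (L F) f z)"
  proof (rule lan_ext[OF F _ _ vs_lan[OF F] _ z])
    show "act (L F) (Comp C g f) \<in> lhom (sp (L F) (Dom C f)) (sp (L F) (Cod C g))"
      using lan_act(1)[OF F gf(1)] gf by simp
    show "(\<lambda>z. act (L F) g (act (L F) f z)) \<in> lhom (sp (L F) (Dom C f)) (sp (L F) (Cod C g))"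
      using lhom_comp[OF lan_act(1)[OF F f] lan_act(1)[OF F g(1), unfolded g(2)]] .
    fix a be v assume av: "ovo (Dom C f) a be" "v \<in> car F a"
    have "Comp C (Comp C g f) be = Comp C g (Comp C f be)" using av f g by (simp add: ovo_def C.Comp_assoc)
    then show "act (L F) (Comp C g f) (la F (Dom C f) a be v) = act (L F) g (act (L F) f (la F (Dom C f) a be v))"
      using lan_act(2)[OF F gf(1)] lan_act(2)[OF F f av] lan_act(2)[OF F g(1), of a "Comp C f be" v] ovo_act[OF av(1) f refl] gf g av
      by simp
  qed
qed (rule vs_lan[OF F], rule lan_act(1)[OF F])

lemma lan_map:
  assumes F: "fmod D F" and G: "fmod D G" and et: "nat_trans D F G et"
  shows "Lm G et x \<in> lhom (sp (L F) x) (sp (L G) x)"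
    and "ovo x a be ==> v \<in> car F a ==> Lm G et x (la F x a be v) = la G x a be (et a v)"
    and "nat_trans C (L F) (L G) (Lm G et)"
proof -
  have "a \<in> Obj D" if "ovo x a be" for x a be using that by (simp add: ovo_def)
  note o = this
  have rel: "la G x (Cod D de) be (et (Cod D de) (act F de v)) = la G x (Dom D de) (Comp C be (amap u de)) (et (Dom D de) v)"
    if "de \<in> Arr D" "ovo x (Cod D de) be" "v \<in> car F (Dom D de)" for de be v x
    using la_rel[OF G that(1,2), of "et (Dom D de) v"] nat_transD(3)[OF et that(1,3)] nat_transD(2)[OF et D.Dom_Obj[OF that(1)] that(3)]
    by simp
  note pm = lan_pres_map[OF F G, where rh = "\<lambda>be. be" and et = et, OF _ _ _ vs_lan[OF G] rels_carrier[OF G]]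
  show 1: "Lm G et x \<in> lhom (sp (L F) x) (sp (L G) x)" for x
    unfolding lan_map_def
    by (rule pm(1)) (use nat_transD(2)[OF et o] lhom_comp[OF nat_transD(1)[OF et o] la_lhom[OF G]] rel in auto)
  show 2: "Lm G et x (la F x a be v) = la G x a be (et a v)" if "ovo x a be" "v \<in> car F a" for x a be v
    unfolding lan_map_def
    by (rule pm(2)) (use nat_transD(2)[OF et o] lhom_comp[OF nat_transD(1)[OF et o] la_lhom[OF G]] rel that in auto)
  show "nat_trans C (L F) (L G) (Lm G et)"
  proof (rule nat_transI[OF 1])
    fix g z assume g: "g \<in> Arr C" and z: "z \<in> car (L F) (Dom C g)"
    show "Lm G et (Cod C g) (act (L F) g z) = act (L G) g (Lm G et (Dom C g) z)"
      by (rule lan_ext[OF F lhom_comp[OF lan_act(1)[OF F g] 1] lhom_comp[OF 1 lan_act(1)[OF G g]] vs_lan[OF G] _ z])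
         (simp add: lan_act(2)[OF F g] lan_act(2)[OF G g] 2 ovo_act[OF _ g refl] nat_transD(2)[OF et o])
  qed
qed

end

lemma Fm_aug_simps: "mods (image_complex F Fm Fa P) n = F (mods P n)"
  "bdry (image_complex F Fm Fa P) n = Fm (mods P n) (bdry P n)" "aug (image_complex F Fm Fa P) = Fa (aug P)"
  by (simp_all add: image_complex_def)

section \<open>Kan extensions of projective functors and of resolutions\<close>

context kan
begin

text \<open>\<open>LK\<close> sends the representable functor at \<open>d i\<close> to the one at
  the image of \<open>d i\<close> under \<open>u\<close>, so a dual basis is carried over:
  \<open>e'\<close> places \<open>e\<close> at the identity, and a coordinate \<open>f\<close> of
  the vector in a generator at \<open>(a, be)\<close> becomes the image of \<open>f\<close> followed
  by \<open>be\<close>.\<close>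

lemma lan_projective:
  assumes P: "projective D F"
  shows "projective C (L F)"
proof -
  have F: "fmod D F" by (rule projective_fmod[OF D.finite_category_axioms P])
  obtain I :: "(nat \<times> 'a) set" and d e c where B: "dual_basis D F I d e c"
    by (rule projective_dual_basis[OF D.finite_category_axioms P])
  define d' where "d' = (\<lambda>i. omap u (d i))"
  define e' where "e' = (\<lambda>i. la F (d' i) (d i) (Ident C (d' i)) (e i))"
  define ph where "ph = (\<lambda>a be v. push (\<lambda>(i, f). (i, Comp C be (amap u f))) (c a v))"
  define c' where "c' = (\<lambda>x. pres_out (free_space (free_gens C I d' x)) (\<lambda>(a, be, v). ph a be v))"
  have dO: "d i \<in> Obj D" "d' i \<in> Obj C" if "i \<in> I" for i
    using dual_basisD(2)[OF B that] omap by (auto simp: d'_def)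
  have oe: "ovo (d' i) (d i) (Ident C (d' i))" if "i \<in> I" for i
    using dO[OF that] by (simp add: ovo_def C.Ident_Arr C.Dom_Ident C.Cod_Ident d'_def)
  have fg: "f \<in> Arr D \<and> Dom D f = d i \<and> Cod D f = a \<and> Comp C be (amap u f) \<in> Arr C \<and>
      Dom C (Comp C be (amap u f)) = d' i \<and> Cod C (Comp C be (amap u f)) = x \<and> i \<in> I"
    if "ovo x a be" "(i, f) \<in> free_gens D I d a" for x a be i f
    using that ovo_comp[of f x be] by (auto simp: free_gens_def ovo_def d'_def)
  have phl: "ph a be \<in> lhom (sp F a) (free_space (free_gens C I d' x))" if o: "ovo x a be" for x a be
    unfolding ph_def
  proof (rule lhom_comp[OF dual_basisD(4)[OF B] push_lhom])
    show "a \<in> Obj D" using o by (simp add: ovo_def)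
    fix q assume q: "q \<in> free_gens D I d a"
    obtain i f where [simp]: "q = (i, f)" by (cases q)
    show "(case q of (i, f) => (i, Comp C be (amap u f))) \<in> free_gens C I d' x"
      using fg[OF o, of i f] q by (simp add: free_gens_def)
  qed
  have phr: "ph (Cod D de) be (act F de v) = ph (Dom D de) (Comp C be (amap u de)) v"
    if de: "de \<in> Arr D" "ovo x (Cod D de) be" "v \<in> car F (Dom D de)" for de be v x
    unfolding ph_def dual_basisD(6)[OF B de(1,3)] push_push
  proof (rule push_cong)
    fix q assume "q \<in> keys (c (Dom D de) v)"
    then have "q \<in> free_gens D I d (Dom D de)" using dual_basisD(5)[OF B D.Dom_Obj[OF de(1)] de(3)] by blast
    then show "(case (case q of (i, h) => (i, Comp D de h)) of (i, f) => (i, Comp C be (amap u f)))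
        = (case q of (i, f) => (i, Comp C (Comp C be (amap u de)) (amap u f)))"
      using de by (cases q) (auto simp: free_gens_def amap_Comp amap ovo_def C.Comp_assoc)
  qed
  have c'l: "c' x \<in> lhom (sp (L F) x) (free_space (free_gens C I d' x))" for x
    unfolding c'_def by (rule lan_out(1)[OF F vs_free_space phl phr])
  have c'la: "c' x (la F x a be v) = ph a be v" if "ovo x a be" "v \<in> car F a" for x a be v
    unfolding c'_def by (rule lan_out(2)[OF F vs_free_space phl phr that])
  have LF: "fmod C (L F)" by (rule lan_fmod[OF F])
  have e'c: "e' i \<in> car (L F) (d' i)" if "i \<in> I" for i
    unfolding e'_def by (rule la_closed[OF F oe[OF that] dual_basisD(3)[OF B that]])
  have act_e': "act (L F) h (e' i) = la F x (d i) h (e i)" if "i \<in> I" "h \<in> Arr C" "Dom C h = d' i" "Cod C h = x" for i h x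
    using lan_act(2)[OF F that(2), of "d i" "Ident C (d' i)" "e i"] oe[OF that(1)] that dual_basisD(3)[OF B that(1)]
      C.Comp_Ident_right[OF that(2)] by (simp add: e'_def)
  have "dual_basis C (L F) I d' e' c'"
    unfolding dual_basis_def
  proof (intro conjI ballI)
    fix g z assume g: "g \<in> Arr C" and z: "z \<in> car (L F) (Dom C g)"
    have p: "push (\<lambda>(i, h). (i, Comp C g h)) \<in> lhom (free_space (free_gens C I d' (Dom C g))) (free_space (free_gens C I d' (Cod C g)))"
      by (rule push_lhom) (use g in \<open>auto simp: free_gens_def C.Comp_Arr C.Dom_Comp C.Cod_Comp\<close>)
    show "c' (Cod C g) (act (L F) g z) = push (\<lambda>(i, h). (i, Comp C g h)) (c' (Dom C g) z)"
    proof (rule lan_ext[OF F lhom_comp[OF lan_act(1)[OF F g] c'l] lhom_comp[OF c'l p] vs_free_space _ z])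
      fix a be v assume o: "ovo (Dom C g) a be" and v: "v \<in> car F a"
      have "ph a (Comp C g be) v = push (\<lambda>(i, h). (i, Comp C g h)) (ph a be v)"
        unfolding ph_def push_push
      proof (rule push_cong)
        fix q assume q: "q \<in> keys (c a v)"
        have "a \<in> Obj D" using o by (simp add: ovo_def)
        from dual_basisD(5)[OF B this v] q have "q \<in> free_gens D I d a" by blast
        then show "(case q of (i, f) => (i, Comp C (Comp C g be) (amap u f)))
            = (case (case q of (i, f) => (i, Comp C be (amap u f))) of (i, h) => (i, Comp C g h))"
          using o g by (cases q) (auto simp: free_gens_def ovo_def amap C.Comp_assoc)
      qed
      then show "c' (Cod C g) (act (L F) g (la F (Dom C g) a be v)) = push (\<lambda>(i, h). (i, Comp C g h)) (c' (Dom C g) (la F (Dom C g) a be v))"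
        using c'la[OF o v] c'la[OF ovo_act[OF o g refl] v] lan_act(2)[OF F g o v] by simp
    qed
  next
    fix x z assume x: "x \<in> Obj C" and z: "z \<in> car (L F) x"
    have ac: "(\<lambda>(i, h). act (L F) h (e' i)) q \<in> car (L F) x" if "q \<in> free_gens C I d' x" for q
      using that e'c fmodD(3)[OF LF] by (cases q) (force simp: free_gens_def)
    show "lin (sp (L F) x) (\<lambda>(i, h). act (L F) h (e' i)) (c' x z) = z"
    proof (rule lan_ext[OF F lhom_comp[OF c'l lin_lhom[OF vs_lan[OF F] ac]] lhom_id vs_lan[OF F] _ z])
      fix a be v assume o: "ovo x a be" and v: "v \<in> car F a"
      have a: "a \<in> Obj D" using o by (simp add: ovo_def)
      have key: "keys (c a v) \<subseteq> free_gens D I d a" by (rule dual_basisD(5)[OF B a v])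
      have Fc: "(\<lambda>(i, f). act F f (e i)) q \<in> car F a" if "q \<in> free_gens D I d a" for q
        using that dual_basisD(3)[OF B] fmodD(3)[OF F] by (cases q) (force simp: free_gens_def)
      have eq: "(\<lambda>(i, h). act (L F) h (e' i)) ((\<lambda>(i, f). (i, Comp C be (amap u f))) q) = la F x a be ((\<lambda>(i, f). act F f (e i)) q)"
        if q: "q \<in> free_gens D I d a" for q
      proof -
        obtain i f where [simp]: "q = (i, f)" by (cases q)
        note f = fg[OF o q[unfolded \<open>q = _\<close>]]
        show ?thesis using act_e'[of i "Comp C be (amap u f)" x] la_rel[OF F, of f x be "e i"] f o
            dual_basisD(3)[OF B, of i] by simp
      qed
      have cl: "la F x a be ((\<lambda>(i, f). act F f (e i)) q) \<in> car (L F) x" if "q \<in> free_gens D I d a" for q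
        by (rule la_closed[OF F o Fc[OF that]])
      have "lin (sp (L F) x) (\<lambda>(i, h). act (L F) h (e' i)) (c' x (la F x a be v))
          = lin (sp (L F) x) (\<lambda>q. (\<lambda>(i, h). act (L F) h (e' i)) ((\<lambda>(i, f). (i, Comp C be (amap u f))) q)) (c a v)"
        unfolding c'la[OF o v] ph_def
        by (rule lin_push[OF vs_lan[OF F]]) (unfold eq[OF subsetD[OF key]], rule cl[OF subsetD[OF key]])
      also have "\<dots> = lin (sp (L F) x) (\<lambda>q. la F x a be ((\<lambda>(i, f). act F f (e i)) q)) (c a v)"
        by (rule lin_cong[OF vs_lan[OF F]], erule cl[OF subsetD[OF key]], erule eq[OF subsetD[OF key]])
      also have "\<dots> = la F x a be (lin (sp F a) (\<lambda>(i, f). act F f (e i)) (c a v))"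
        by (rule lin_comp[OF la_lhom[OF F o] fmodD(1)[OF F a] vs_lan[OF F] Fc key, symmetric])
      finally show "lin (sp (L F) x) (\<lambda>(i, h). act (L F) h (e' i)) (c' x (la F x a be v)) = la F x a be v"
        using dual_basisD(7)[OF B a v] by simp
    qed
  qed (use dO e'c c'l dual_basisD(1)[OF B] in auto)
  then show ?thesis by (rule dual_basis_projective[OF C.finite_category_axioms LF])
qed

context
  fixes N :: "('o, 'm, 'k::field, 'z) kfunctor" and ka
    and P :: "('a, 'b, 'k, 'v, 'k) aug_complex"
    and Q :: "('o, 'm, 'k, 'q, 'z) aug_complex"
    and Fa :: "('a => 'v => 'k) => 'o => (('a \<times> 'm \<times> 'v) \<Rightarrow>\<^sub>0 'k) set => 'z"
  assumes ka: "nat_trans C (L (const_mod :: ('a, 'b, 'k, 'k) kfunctor)) N ka"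
    and P: "proj_resolution D const_mod P" and N: "fmod C N"
  defines "Fa \<equiv> (\<lambda>f x A. ka x (Lm (const_mod :: ('a, 'b, 'k, 'k) kfunctor) f x A))"
begin

lemma RPk: "resolution D const_mod P" and fP: "fmod D (mods P n)"
  using P resolutionD(2) by (auto simp: proj_resolution_def)

lemma Fa_nt: "nat_trans D (mods P n) const_mod f ==> nat_trans C (L (mods P n)) N (Fa f)"
  unfolding Fa_def by (rule nat_trans_comp[OF C.finite_category_axioms lan_map(3)[OF fP fmod_const_mod] ka])

lemma Fa_la:
  assumes "nat_trans D (mods P n) const_mod f" "ovo x a be" "v \<in> car (mods P n) a"
  shows "Fa f x (la (mods P n) x a be v) = ka x (la const_mod x a be (f a v))"
  unfolding Fa_def by (simp add: lan_map(2)[OF fP fmod_const_mod assms])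

lemma lan_image_nat:
  "fmod C (mods (image_complex L Lm Fa P) n)"
  "nat_trans C (mods (image_complex L Lm Fa P) (Suc n)) (mods (image_complex L Lm Fa P) n)
    (bdry (image_complex L Lm Fa P) n)"
  "nat_trans C (mods (image_complex L Lm Fa P) 0) N (aug (image_complex L Lm Fa P))"
  unfolding Fm_aug_simps
  by (rule lan_fmod[OF fP] lan_map(3)[OF fP fP resolutionD(3)[OF RPk]] Fa_nt[OF resolutionD(4)[OF RPk]])+

text \<open>Exactness of the image complex stays a hypothesis, since it is established by different
  arguments along \<open>t\<close> and along \<open>\<nabla>\<close>. The identities among the
  remaining conditions equate linear maps out of a colimit and are checked on generators.\<close>

lemma lan_ext_functor:
  assumes Q: "proj_resolution C N Q" and Y: "resolution C N (image_complex L Lm Fa P)"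
  shows "ext_functor D const_mod P C N Q L Lm Fa"
proof (rule ext_functor.intro)
  let ?K = "const_mod :: ('a, 'b, 'k, 'k) kfunctor"
  show "finite_category D" "finite_category C" "proj_resolution D const_mod P" "proj_resolution C N Q"
    "resolution C N (image_complex L Lm Fa P)"
    using Q Y P D.finite_category_axioms C.finite_category_axioms by auto
  show "nat_trans C (L (mods P n)) N (Fa f)" if "nat_trans D (mods P n) const_mod f" for n f
    by (rule Fa_nt[OF that])
  note lh = nat_transD(1)[OF Fa_nt]
  have aO: "ovo x a be ==> a \<in> Obj D" for x a be by (simp add: ovo_def)
  have kl: "(\<lambda>c. ka x (la ?K x a be c)) \<in> lhom (sp ?K a) (sp N x)" if "x \<in> Obj C" "ovo x a be" for x a be
    by (rule lhom_comp[OF la_lhom[OF fmod_const_mod that(2)] nat_transD(1)[OF ka that(1)]])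
  fix n and f g :: "'a => 'v => 'k" and x and z
  assume f: "nat_trans D (mods P n) const_mod f" and x: "x \<in> Obj C" and z: "z \<in> car (L (mods P n)) x"
  note V = fmodD(1)[OF N x]
  show "Fa (\<lambda>y v. c \<odot>\<^bsub>sp ?K y\<^esub> f y v) x z = c \<odot>\<^bsub>sp N x\<^esub> Fa f x z" for c
  proof (rule lan_ext[OF fP lh lhom_scale[OF lh] V _ z])
    show s: "nat_trans D (mods P n) const_mod (\<lambda>y v. c \<odot>\<^bsub>sp ?K y\<^esub> f y v)"
      by (rule nat_trans_scale[OF D.finite_category_axioms f fmod_const_mod])
    fix a be v assume "ovo x a be" "v \<in> car (mods P n) a"
    then show "Fa (\<lambda>y v. c \<odot>\<^bsub>sp ?K y\<^esub> f y v) x (la (mods P n) x a be v) = c \<odot>\<^bsub>sp N x\<^esub> Fa f x (la (mods P n) x a be v)"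
      using Fa_la[OF s] Fa_la[OF f] lhomD(3)[OF kl[OF x], of a be "f a v" c] by simp
  qed (use f x V in auto)
  assume g: "nat_trans D (mods P n) const_mod g"
  show "Fa f x z = Fa g x z" if "\<And>y v. y \<in> Obj D ==> v \<in> car (mods P n) y ==> f y v = g y v"
    by (rule lan_ext[OF fP lh[OF f x] lh[OF g x] V _ z]) (simp add: Fa_la[OF f] Fa_la[OF g] that aO)
  show "Fa (\<lambda>y v. f y v \<oplus>\<^bsub>sp ?K y\<^esub> g y v) x z = Fa f x z \<oplus>\<^bsub>sp N x\<^esub> Fa g x z"
  proof (rule lan_ext[OF fP lh lhom_add[OF lh lh] V _ z])
    show s: "nat_trans D (mods P n) const_mod (\<lambda>y v. f y v \<oplus>\<^bsub>sp ?K y\<^esub> g y v)"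
      by (rule nat_trans_add[OF D.finite_category_axioms f g fmod_const_mod])
    fix a be v assume "ovo x a be" "v \<in> car (mods P n) a"
    then show "Fa (\<lambda>y v. f y v \<oplus>\<^bsub>sp ?K y\<^esub> g y v) x (la (mods P n) x a be v)
        = Fa f x (la (mods P n) x a be v) \<oplus>\<^bsub>sp N x\<^esub> Fa g x (la (mods P n) x a be v)"
      using Fa_la[OF s] Fa_la[OF f] Fa_la[OF g] lhomD(2)[OF kl[OF x], of a be "f a v" "g a v"] by simp
  qed (use f g x V in auto)
next
  show "nat_trans C (L (mods P n)) (L (mods P m)) (Lm (mods P m) ph)"
    if "nat_trans D (mods P n) (mods P m) ph" for n m ph
    by (rule lan_map(3)[OF fP fP that])
  fix n m ph x z assume ph: "nat_trans D (mods P n) (mods P m) ph" and x: "x \<in> Obj C"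
    and z: "z \<in> car (L (mods P n)) x"
  note lm = lan_map[OF fP fP]
  have aO: "ovo x a be ==> a \<in> Obj D" for x a be by (simp add: ovo_def)
  show "Fa f x (Lm (mods P m) ph x z) = Fa (\<lambda>y v. f y (ph y v)) x z"
    if f: "nat_trans D (mods P m) const_mod f" for f
    by (rule lan_ext[OF fP lhom_comp[OF lm(1)[OF ph] nat_transD(1)[OF Fa_nt[OF f] x]]
          nat_transD(1)[OF Fa_nt[OF nat_trans_comp[OF D.finite_category_axioms ph f]] x] fmodD(1)[OF N x] _ z])
       (simp add: lm(2)[OF ph] Fa_la[OF f] Fa_la[OF nat_trans_comp[OF D.finite_category_axioms ph f]] nat_transD(2)[OF ph aO])
  show "Lm (mods P l) ps x (Lm (mods P m) ph x z) = Lm (mods P l) ps' x (Lm (mods P m') ph' x z)"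
    if ps: "nat_trans D (mods P m) (mods P l) ps" and ph': "nat_trans D (mods P n) (mods P m') ph'"
      and ps': "nat_trans D (mods P m') (mods P l) ps'"
      and eq: "\<And>y v. y \<in> Obj D ==> v \<in> car (mods P n) y ==> ps y (ph y v) = ps' y (ph' y v)"
    for m' l ps ph' ps'
    by (rule lan_ext[OF fP lhom_comp[OF lm(1)[OF ph] lm(1)[OF ps]] lhom_comp[OF lm(1)[OF ph'] lm(1)[OF ps']] vs_lan[OF fP] _ z])
       (simp add: lm(2)[OF ph] lm(2)[OF ps] lm(2)[OF ph'] lm(2)[OF ps'] nat_transD(2)[OF ph aO] nat_transD(2)[OF ph' aO] eq[OF aO])
qed

end

end

section \<open>Contractions\<close>

text \<open>Two lifts of the augmentation are available: the identity, and the family that is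
  \<open>s\<close> after the augmentation in degree zero and zero elsewhere. A homotopy between them
  is the contraction. All of this takes place over \<open>D\<close>, which is why restricting a
  resolution to a small subcategory, where a splitting exists, pays.\<close>

lemma contraction:
  assumes D: "finite_category D" and P: "proj_resolution D N P" and s: "nat_trans D N (mods P 0) s"
    and as: "\<And>x v. x \<in> Obj D ==> v \<in> car N x ==> aug P x (s x v) = v"
  obtains h where "\<And>n. nat_trans D (mods P n) (mods P (Suc n)) (h n)"
    "\<And>x v. x \<in> Obj D ==> v \<in> car (mods P 0) x ==>
      v = s x (aug P x v) \<oplus>\<^bsub>sp (mods P 0) x\<^esub> bdry P 0 x (h 0 x v)"
    "\<And>n x v. x \<in> Obj D ==> v \<in> car (mods P (Suc n)) x ==>
      v = bdry P (Suc n) x (h (Suc n) x v) \<oplus>\<^bsub>sp (mods P (Suc n)) x\<^esub> h n x (bdry P n x v)"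
proof -
  have R: "resolution D N P" using P by (simp add: proj_resolution_def)
  note N = resolutionD(1)[OF R] and fP = resolutionD(2)[OF R]
  let ?ps = "\<lambda>i x v. if i = 0 then s x (aug P x v) else \<zero>\<^bsub>sp (mods P i) x\<^esub>"
  have "(\<lambda>i x v. v) \<in> lifts D P 0 P (aug P)"
    by (rule liftsI) (auto simp: nat_trans_id)
  moreover have "?ps \<in> lifts D P 0 P (aug P)"
  proof (rule liftsI)
    show "nat_trans D (mods P (0 + i)) (mods P i) (?ps i)" for i
      using nat_trans_comp[OF D resolutionD(4)[OF R] s] nat_trans_zero[OF D fP] by (cases i) auto
    show "aug P x (?ps 0 x v) = aug P x v" if "x \<in> Obj D" "v \<in> car (mods P 0) x" for x v
      using as[OF that(1) nat_transD(2)[OF resolutionD(4)[OF R] that]] by simp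
    show "bdry P i x (?ps (Suc i) x v) = ?ps i x (bdry P (0 + i) x v)"
      if "x \<in> Obj D" "v \<in> car (mods P (Suc (0 + i))) x" for i x v
      using that resolution_exact(2)[OF R that(1), of v] nat_trans_zero_at[OF D s N fP that(1)]
        nat_trans_zero_at[OF D resolutionD(3)[OF R] fP fP that(1)] by (cases i) auto
  qed
  ultimately obtain h where h: "\<And>i. nat_trans D (mods P (0 + i)) (mods P (Suc i)) (h i)"
    "\<And>x v. x \<in> Obj D ==> v \<in> car (mods P 0) x ==>
      v = ?ps 0 x v \<oplus>\<^bsub>sp (mods P 0) x\<^esub> bdry P 0 x (h 0 x v)"
    "\<And>i x v. x \<in> Obj D ==> v \<in> car (mods P (Suc (0 + i))) x ==>
      v = ?ps (Suc i) x v \<oplus>\<^bsub>sp (mods P (Suc i)) x\<^esub> bdry P (Suc i) x (h (Suc i) x v)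
        \<oplus>\<^bsub>sp (mods P (Suc i)) x\<^esub> h i x (bdry P (0 + i) x v)"
    by (rule lifts_homotopy[OF D P R]) blast
  have h0: "\<And>i. nat_trans D (mods P i) (mods P (Suc i)) (h i)" using h(1) by simp
  have "v = bdry P (Suc i) x (h (Suc i) x v) \<oplus>\<^bsub>sp (mods P (Suc i)) x\<^esub> h i x (bdry P i x v)"
    if x: "x \<in> Obj D" and v: "v \<in> car (mods P (Suc i)) x" for i x v
  proof -
    have "bdry P (Suc i) x (h (Suc i) x v) \<in> car (mods P (Suc i)) x"
      by (rule nat_transD(2)[OF resolutionD(3)[OF R] x nat_transD(2)[OF h0 x v]])
    from vs_zero(1)[OF fmodD(1)[OF fP x] this] show ?thesis using h(3)[OF x, of v i] v by simp
  qed
  with h0 h(2) show thesis by (intro that[of h]) auto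
qed

text \<open>Unlike exactness, the identities assumed here are preserved when an additive functor is
  applied to the maps, so they can be verified for tensored complexes from those before
  tensoring.\<close>

lemma exact_of_contraction:
  assumes V: "\<And>n. vs (V n)" and W: "vs W"
    and d: "\<And>n. d n \<in> lhom (V (Suc n)) (V n)" and H: "\<And>n. H n \<in> lhom (V n) (V (Suc n))" and S: "S \<in> lhom W (V 0)"
    and 0: "\<And>z. z \<in> carrier (V 0) ==> z = S (ep z) \<oplus>\<^bsub>V 0\<^esub> d 0 (H 0 z)"
    and n: "\<And>n z. z \<in> carrier (V (Suc n)) ==> z = d (Suc n) (H (Suc n) z) \<oplus>\<^bsub>V (Suc n)\<^esub> H n (d n z)"
  shows "z \<in> carrier (V 0) ==> ep z = \<zero>\<^bsub>W\<^esub> ==> \<exists>u\<in>carrier (V 1). z = d 0 u"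
    and "z \<in> carrier (V (Suc m)) ==> d m z = \<zero>\<^bsub>V m\<^esub> ==> \<exists>u\<in>carrier (V (Suc (Suc m))). z = d (Suc m) u"
proof -
  assume z: "z \<in> carrier (V 0)" "ep z = \<zero>\<^bsub>W\<^esub>"
  have "d 0 (H 0 z) \<in> carrier (V 0)" by (rule lhomD(1)[OF d lhomD(1)[OF H z(1)]])
  then have "z = d 0 (H 0 z)" using 0[OF z(1)] z(2) lhom_zero[OF S W V] by (simp add: vs_zero[OF V])
  then show "\<exists>u\<in>carrier (V 1). z = d 0 u" using lhomD(1)[OF H z(1)] by auto
next
  assume z: "z \<in> carrier (V (Suc m))" "d m z = \<zero>\<^bsub>V m\<^esub>"
  have "d (Suc m) (H (Suc m) z) \<in> carrier (V (Suc m))" by (rule lhomD(1)[OF d lhomD(1)[OF H z(1)]])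
  then have "z = d (Suc m) (H (Suc m) z)" using n[OF z(1)] z(2) lhom_zero[OF H V V] by (simp add: vs_zero[OF V])
  then show "\<exists>u\<in>carrier (V (Suc (Suc m))). z = d (Suc m) u" using lhomD(1)[OF H z(1)] by auto
qed

section \<open>Pointwise tensor products\<close>

definition tg where "tg V W v w = gen (tensor_gens V W) (tensor_rels V W) (v, w)"
abbreviation tens where "tens V W \<equiv> presented (tensor_gens V W) (tensor_rels V W)"

context
  fixes V :: "('k::field, 'v) module" and W :: "('k, 'w) module"
  assumes V: "vs V" and W: "vs W"
begin

lemma tens_carrier: "tensor_rels V W \<subseteq> carrier (free_space (tensor_gens V W))"
proof -
  have "linear_rels V (\<lambda>v. (v, w)) \<subseteq> carrier (free_space (tensor_gens V W))" if "w \<in> carrier W" for w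
    by (rule linear_rels_carrier[OF V]) (simp add: tensor_gens_def that)
  moreover have "linear_rels W (\<lambda>w. (v, w)) \<subseteq> carrier (free_space (tensor_gens V W))" if "v \<in> carrier V" for v
    by (rule linear_rels_carrier[OF W]) (simp add: tensor_gens_def that)
  ultimately show ?thesis unfolding tensor_rels_def by blast
qed

lemma vs_tens: "vs (tens V W)"
  by (rule vs_presented[OF tens_carrier])

lemma tg_left: "w \<in> carrier W ==> (\<lambda>v. tg V W v w) \<in> lhom V (tens V W)"
  unfolding tg_def by (rule gen_linear[OF tens_carrier V]) (auto simp: tensor_gens_def tensor_rels_def)

lemma tg_right: "v \<in> carrier V ==> (\<lambda>w. tg V W v w) \<in> lhom W (tens V W)"
  unfolding tg_def by (rule gen_linear[OF tens_carrier W]) (auto simp: tensor_gens_def tensor_rels_def)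

lemma tens_ext:
  assumes "h \<in> lhom (tens V W) Z" "h' \<in> lhom (tens V W) Z" "vs Z"
    and "\<And>v w. v \<in> carrier V ==> w \<in> carrier W ==> h (tg V W v w) = h' (tg V W v w)"
    and "z \<in> carrier (tens V W)"
  shows "h z = h' z"
  by (rule presented_ext[OF tens_carrier assms(1-3) _ assms(5)])
     (use assms(4) in \<open>auto simp: tensor_gens_def tg_def\<close>)

context
  fixes Z :: "('k, 'z) module" and ph :: "'v => 'w => 'z"
  assumes Z: "vs Z" and ph: "\<And>v. v \<in> carrier V ==> ph v \<in> lhom W Z"
    and ph': "\<And>w. w \<in> carrier W ==> (\<lambda>v. ph v w) \<in> lhom V Z"
begin

lemma tens_rel_zero: "r \<in> tensor_rels V W ==> lin Z (\<lambda>(v, w). ph v w) r = \<zero>\<^bsub>Z\<^esub>"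
  unfolding tensor_rels_def
proof (elim UnE UN_E)
  fix w assume "w \<in> carrier W" "r \<in> linear_rels V (\<lambda>v. (v, w))"
  then show ?thesis using lin_linear_rels[OF Z V, of "\<lambda>(v, w). ph v w" "\<lambda>v. (v, w)"] ph' by simp
next
  fix v assume "v \<in> carrier V" "r \<in> linear_rels W (\<lambda>w. (v, w))"
  then show ?thesis using lin_linear_rels[OF Z W, of "\<lambda>(v, w). ph v w" "\<lambda>w. (v, w)"] ph by simp
qed

lemma tens_out:
  "pres_out Z (\<lambda>(v, w). ph v w) \<in> lhom (tens V W) Z"
  "v \<in> carrier V ==> w \<in> carrier W ==> pres_out Z (\<lambda>(v, w). ph v w) (tg V W v w) = ph v w"
proof -
  have c: "(\<lambda>(v, w). ph v w) g \<in> carrier Z" if "g \<in> tensor_gens V W" for g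
    using that lhomD(1)[OF ph] by (cases g) (auto simp: tensor_gens_def)
  show "pres_out Z (\<lambda>(v, w). ph v w) \<in> lhom (tens V W) Z"
    by (rule presented_out(1)[OF tens_carrier Z c tens_rel_zero])
  show "pres_out Z (\<lambda>(v, w). ph v w) (tg V W v w) = ph v w" if "v \<in> carrier V" "w \<in> carrier W"
    using presented_out(2)[OF tens_carrier Z c tens_rel_zero, where u = "(v, w)"] that
    by (simp add: tg_def tensor_gens_def)
qed

end

text \<open>The facts about \<open>tens V' W'\<close> enter as premises because in this context they
  are available for the fixed \<open>V\<close> and \<open>W\<close> only; outside it they are
  discharged by the lemmas just proved.\<close>

lemma tens_map:
  fixes V' :: "('k, 'v2) module" and W' :: "('k, 'w2) module"
  assumes f: "f \<in> lhom V V'" and g: "g \<in> lhom W W'" and V': "vs V'" and W': "vs W'"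
    and tc: "tensor_rels V' W' \<subseteq> carrier (free_space (tensor_gens V' W'))"
    and tl: "\<And>w. w \<in> carrier W' ==> (\<lambda>v. tg V' W' v w) \<in> lhom V' (tens V' W')"
    and tr: "\<And>v. v \<in> carrier V' ==> (\<lambda>w. tg V' W' v w) \<in> lhom W' (tens V' W')"
  shows "pres_map (tensor_gens V' W') (tensor_rels V' W') (\<lambda>(v, w). (f v, g w)) \<in> lhom (tens V W) (tens V' W')"
    and "v \<in> carrier V ==> w \<in> carrier W ==>
      pres_map (tensor_gens V' W') (tensor_rels V' W') (\<lambda>(v, w). (f v, g w)) (tg V W v w) = tg V' W' (f v) (g w)"
proof -
  have 1: "(\<lambda>(v, w). (f v, g w)) p \<in> tensor_gens V' W'" if "p \<in> tensor_gens V W" for p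
    using that lhomD(1)[OF f] lhomD(1)[OF g] by (auto simp: tensor_gens_def)
  have 2: "lin (tens V' W') (\<lambda>p. gen (tensor_gens V' W') (tensor_rels V' W') ((\<lambda>(v, w). (f v, g w)) p)) r = \<zero>\<^bsub>tens V' W'\<^esub>"
    if "r \<in> tensor_rels V W" for r
    using tens_rel_zero[OF vs_presented[OF tc] lhom_comp[OF g tr[OF lhomD(1)[OF f]]] lhom_comp[OF f tl[OF lhomD(1)[OF g]]] that]
    by (simp add: tg_def case_prod_beta')
  show "pres_map (tensor_gens V' W') (tensor_rels V' W') (\<lambda>(v, w). (f v, g w)) \<in> lhom (tens V W) (tens V' W')"
    by (rule presented_map(1)[OF tens_carrier tc 1 2])
  show "pres_map (tensor_gens V' W') (tensor_rels V' W') (\<lambda>(v, w). (f v, g w)) (tg V W v w) = tg V' W' (f v) (g w)"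
    if "v \<in> carrier V" "w \<in> carrier W"
    using presented_map(2)[OF tens_carrier tc 1 2, where u = "(v, w)"] that by (simp add: tensor_gens_def tg_def)
qed

end

locale pten = C: finite_category C for C :: "('o, 'm) category" +
  fixes M :: "('o, 'm, 'k::field, 'w) kfunctor"
  assumes M: "fmod C M"
begin

abbreviation PT where "PT \<equiv> ptensor C M"
abbreviation ptg where "ptg F x \<equiv> tg (sp F x) (sp M x)"
abbreviation PTc where "PTc \<equiv> image_complex PT (ptensor_map M) (ptensor_aug M)"
abbreviation K where "K \<equiv> const_mod :: ('o, 'm, 'k, 'k) kfunctor"

lemma PT_sp: "sp (PT F) x = tens (sp F x) (sp M x)"
  by (simp add: ptensor_def)

lemmas Mv = fmodD(1)[OF M]

context
  fixes F :: "('o, 'm, 'k, 'v) kfunctor"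
  assumes F: "fmod C F"
begin

lemmas Fv = fmodD(1)[OF F]

lemma PT_vs: "x \<in> Obj C ==> vs (sp (PT F) x)"
  unfolding PT_sp by (rule vs_tens[OF Fv Mv])

lemma PT_ext:
  assumes "x \<in> Obj C" "h \<in> lhom (sp (PT F) x) Z" "h' \<in> lhom (sp (PT F) x) Z" "vs Z"
    and "\<And>v w. v \<in> car F x ==> w \<in> car M x ==> h (ptg F x v w) = h' (ptg F x v w)"
    and "z \<in> car (PT F) x"
  shows "h z = h' z"
  by (rule tens_ext[OF Fv[OF assms(1)] Mv[OF assms(1)] assms(2,3)[unfolded PT_sp] assms(4,5) assms(6)[unfolded PT_sp]])

lemma PT_act:
  assumes "g \<in> Arr C"
  shows "act (PT F) g \<in> lhom (sp (PT F) (Dom C g)) (sp (PT F) (Cod C g))"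
    and "v \<in> car F (Dom C g) ==> w \<in> car M (Dom C g) ==>
      act (PT F) g (ptg F (Dom C g) v w) = ptg F (Cod C g) (act F g v) (act M g w)"
proof -
  note o = C.Dom_Obj[OF assms] C.Cod_Obj[OF assms]
  note V = Fv[OF o(1)] Mv[OF o(1)] and V' = Fv[OF o(2)] Mv[OF o(2)]
  note tm = tens_map[OF V fmodD(2)[OF F assms] fmodD(2)[OF M assms] V' tens_carrier[OF V'] tg_left[OF V'] tg_right[OF V']]
  have a: "act (PT F) g = pres_map (tensor_gens (sp F (Cod C g)) (sp M (Cod C g)))
      (tensor_rels (sp F (Cod C g)) (sp M (Cod C g))) (\<lambda>(v, w). (act F g v, act M g w))"
    by (simp add: ptensor_def)
  show "act (PT F) g \<in> lhom (sp (PT F) (Dom C g)) (sp (PT F) (Cod C g))"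
    unfolding a PT_sp by (rule tm(1))
  show "act (PT F) g (ptg F (Dom C g) v w) = ptg F (Cod C g) (act F g v) (act M g w)"
    if "v \<in> car F (Dom C g)" "w \<in> car M (Dom C g)"
    unfolding a by (rule tm(2)[OF _ _ that])
qed

lemma PT_fmod: "fmod C (PT F)"
  unfolding fmod_def
proof (intro conjI ballI impI)
  fix x z assume x: "x \<in> Obj C" and z: "z \<in> car (PT F) x"
  note i = C.Ident_Arr[OF x] C.Dom_Ident[OF x] C.Cod_Ident[OF x]
  show "act (PT F) (Ident C x) z = z"
    by (rule PT_ext[OF x PT_act(1)[OF i(1), unfolded i(2,3)] lhom_id PT_vs[OF x] _ z])
       (simp add: PT_act(2)[OF i(1), unfolded i(2,3)] fmodD(4)[OF F x] fmodD(4)[OF M x])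
next
  fix f g z assume f: "f \<in> Arr C" and g: "g \<in> Arr C" "Dom C g = Cod C f" and z: "z \<in> car (PT F) (Dom C f)"
  note gf = C.Comp_Arr[OF f g] C.Dom_Comp[OF f g] C.Cod_Comp[OF f g]
  show "act (PT F) (Comp C g f) z = act (PT F) g (act (PT F) f z)"
    by (rule PT_ext[OF C.Dom_Obj[OF f] PT_act(1)[OF gf(1), unfolded gf(2,3)]
          lhom_comp[OF PT_act(1)[OF f] PT_act(1)[OF g(1), unfolded g(2)]] PT_vs[OF C.Cod_Obj[OF g(1)]] _ z])
       (simp add: PT_act(2)[OF gf(1), unfolded gf(2,3)] PT_act(2)[OF f] PT_act(2)[OF g(1), unfolded g(2)]
         fmodD(3)[OF F f] fmodD(3)[OF M f] fmodD(5)[OF F f g] fmodD(5)[OF M f g])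
qed (rule PT_vs PT_act(1); assumption)+

lemma PT_map:
  assumes x: "x \<in> Obj C" and G: "vs (sp G x)" and h: "et x \<in> lhom (sp F x) (sp G x)"
  shows "ptensor_map M G et x \<in> lhom (sp (PT F) x) (sp (PT G) x)"
    and "v \<in> car F x ==> w \<in> car M x ==> ptensor_map M G et x (ptg F x v w) = ptg G x (et x v) w"
proof -
  note tm = tens_map[OF Fv[OF x] Mv[OF x] h lhom_id G Mv[OF x] tens_carrier[OF G Mv[OF x]] tg_left[OF G Mv[OF x]] tg_right[OF G Mv[OF x]]]
  show "ptensor_map M G et x \<in> lhom (sp (PT F) x) (sp (PT G) x)"
    unfolding ptensor_map_def PT_sp by (rule tm(1))
  show "ptensor_map M G et x (ptg F x v w) = ptg G x (et x v) w" if "v \<in> car F x" "w \<in> car M x"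
    unfolding ptensor_map_def by (rule tm(2)[OF _ _ that])
qed

end

lemma PT_map_nat:
  assumes F: "fmod C F" and G: "fmod C G" and h: "nat_trans C F G et"
  shows "nat_trans C (PT F) (PT G) (ptensor_map M G et)"
proof (rule nat_transI)
  note m = PT_map[where G = G and et = et, OF F _ fmodD(1)[OF G] nat_transD(1)[OF h]]
  show 1: "ptensor_map M G et x \<in> lhom (sp (PT F) x) (sp (PT G) x)" if "x \<in> Obj C" for x
    by (rule m(1)[OF that that that])
  fix g z assume g: "g \<in> Arr C" and z: "z \<in> car (PT F) (Dom C g)"
  note o = C.Dom_Obj[OF g] C.Cod_Obj[OF g]
  show "ptensor_map M G et (Cod C g) (act (PT F) g z) = act (PT G) g (ptensor_map M G et (Dom C g) z)"
    by (rule PT_ext[OF F o(1) lhom_comp[OF PT_act(1)[OF F g] 1[OF o(2)]] lhom_comp[OF 1[OF o(1)] PT_act(1)[OF G g]] PT_vs[OF G o(2)] _ z])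
       (simp add: PT_act(2)[OF F g] PT_act(2)[OF G g] m(2)[OF o(1) o(1) o(1)] m(2)[OF o(2) o(2) o(2)] nat_transD(3)[OF h g]
         fmodD(3)[OF F g] fmodD(3)[OF M g] nat_transD(2)[OF h o(1)])
qed

lemma PT_aug:
  assumes F: "fmod C F" and h: "nat_trans C F K f"
  shows "x \<in> Obj C ==> ptensor_aug M f x \<in> lhom (sp (PT F) x) (sp M x)"
    and "x \<in> Obj C ==> v \<in> car F x ==> w \<in> car M x ==>
      ptensor_aug M f x (ptg F x v w) = f x v \<odot>\<^bsub>sp M x\<^esub> w"
    and "nat_trans C (PT F) M (ptensor_aug M f)"
proof -
  let ?o = "\<lambda>x. pres_out (sp M x) (\<lambda>(c, w). c \<odot>\<^bsub>sp M x\<^esub> w)"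
  have ol: "?o x \<in> lhom (sp (PT K) x) (sp M x)" and og: "w \<in> car M x ==> ?o x (ptg K x c w) = c \<odot>\<^bsub>sp M x\<^esub> w"
    if x: "x \<in> Obj C" for x c w
  proof -
    have l: "(\<lambda>w. c \<odot>\<^bsub>sp M x\<^esub> w) \<in> lhom (sp M x) (sp M x)" for c
      by (rule lhom_scale[OF lhom_id Mv[OF x]])
    have r: "(\<lambda>c. c \<odot>\<^bsub>sp M x\<^esub> w) \<in> lhom (sp K x) (sp M x)" if "w \<in> car M x" for w
      by (rule lhomI) (use that vs_closed(3)[OF Mv[OF x]] vs_smult[OF Mv[OF x]] in auto)
    show "?o x \<in> lhom (sp (PT K) x) (sp M x)"
      unfolding PT_sp by (rule tens_out(1)[OF vs_const_mod Mv[OF x] Mv[OF x]]) (use l r in auto)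
    show "?o x (ptg K x c w) = c \<odot>\<^bsub>sp M x\<^esub> w" if "w \<in> car M x"
      by (rule tens_out(2)[OF vs_const_mod Mv[OF x] Mv[OF x]]) (use l r that in \<open>auto simp: const_mod_simps\<close>)
  qed
  note m = PT_map[where G = K and et = f, OF F _ vs_const_mod nat_transD(1)[OF h]]
  have a: "ptensor_aug M f x = (\<lambda>A. ?o x (ptensor_map M K f x A))" for x
    by (simp add: ptensor_aug_def fun_eq_iff ptensor_map_def const_mod_def)
  show 1: "ptensor_aug M f x \<in> lhom (sp (PT F) x) (sp M x)" if x: "x \<in> Obj C" for x
    unfolding a by (rule lhom_comp[OF m(1)[OF x x] ol[OF x]])
  show 2: "ptensor_aug M f x (ptg F x v w) = f x v \<odot>\<^bsub>sp M x\<^esub> w"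
    if x: "x \<in> Obj C" and "v \<in> car F x" "w \<in> car M x" for x v w
    unfolding a using m(2)[OF x x that(2,3)] og[OF x that(3)] by simp
  show "nat_trans C (PT F) M (ptensor_aug M f)"
  proof (rule nat_transI[OF 1])
    fix g z assume g: "g \<in> Arr C" and z: "z \<in> car (PT F) (Dom C g)"
    note o = C.Dom_Obj[OF g] C.Cod_Obj[OF g]
    show "ptensor_aug M f (Cod C g) (act (PT F) g z) = act M g (ptensor_aug M f (Dom C g) z)"
      by (rule PT_ext[OF F o(1) lhom_comp[OF PT_act(1)[OF F g] 1[OF o(2)]] lhom_comp[OF 1[OF o(1)] fmodD(2)[OF M g]] Mv[OF o(2)] _ z])
         (simp add: PT_act(2)[OF F g] 2[OF o(1)] 2[OF o(2)] fmodD(3)[OF F g] fmodD(3)[OF M g] nat_transD(3)[OF h g]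
           lhomD(3)[OF fmodD(2)[OF M g]])
  qed simp
qed

text \<open>Exactness is a condition at one object, where the complex consists of vector spaces
  only. Restricted to the identity of \<open>x\<close>, the resolution is still one by projectives
  and its augmentation splits; tensoring the resulting contraction with the value of
  \<open>M\<close> at \<open>x\<close> contracts the image.\<close>

lemma PT_resolution:
  assumes P: "proj_resolution C K P"
  shows "resolution C M (PTc P)"
proof (rule resolutionI[OF C.finite_category_axioms M]; (unfold Fm_aug_simps)?)
  have R: "resolution C K P" using P by (simp add: proj_resolution_def)
  note fP = resolutionD(2)[OF R] and dP = resolutionD(3)[OF R]
  note au = PT_aug[OF fP resolutionD(4)[OF R]]
  show "fmod C (PT (mods P n))" for n by (rule PT_fmod[OF fP])
  show "nat_trans C (PT (mods P (Suc n))) (PT (mods P n)) (ptensor_map M (mods P n) (bdry P n))" for n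
    by (rule PT_map_nat[OF fP fP dP])
  show "nat_trans C (PT (mods P 0)) M (ptensor_aug M (aug P))" by (rule au(3))
  fix x assume x: "x \<in> Obj C"
  note V = fmodD(1)[OF fP x]
  note d = nat_transD(1)[OF dP x]
  define S where "S = C\<lparr>Obj := {x}, Arr := {Ident C x}\<rparr>"
  note ix = C.Ident_Arr[OF x] C.Dom_Ident[OF x] C.Cod_Ident[OF x]
  have ii: "Comp C (Ident C x) (Ident C x) = Ident C x" using C.Comp_Ident_right[OF ix(1)] ix by simp
  interpret S: subcategory C S
    by unfold_locales (use x ix ii in \<open>auto simp: S_def\<close>)
  \<comment> \<open>Every arrow ending in \<open>x\<close> factors as the identity of
    \<open>x\<close> after itself, so representables restrict to sums of copies of \<open>k\<close>
    at the only object.\<close>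
  have PS: "proj_resolution S K P"
    unfolding proj_resolution_def
  proof (intro conjI allI)
    show "projective S (mods P n)" for n
      by (rule S.sub_projective[where hh = "\<lambda>f. Ident C x" and jj = "\<lambda>f. f"])
         (use P C.Comp_Ident_left ii in \<open>auto simp: proj_resolution_def S_def ix\<close>)
  qed (rule S.sub_resolution[OF R])
  \<comment> \<open>A preimage of \<open>1\<close> splits the augmentation, \<open>k\<close> being
    free on \<open>1\<close>.\<close>
  obtain e where e: "e \<in> car (mods P 0) x" "aug P x e = 1"
    using resolution_exact(1)[OF R x, of 1] by auto
  have s: "nat_trans S K (mods P 0) (\<lambda>y c. c \<odot>\<^bsub>sp (mods P 0) y\<^esub> e)"
  proof (rule nat_transI)
    fix y assume "y \<in> Obj S"
    then have [simp]: "y = x" by (simp add: S_def)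
    show "(\<lambda>c. c \<odot>\<^bsub>sp (mods P 0) y\<^esub> e) \<in> lhom (sp K y) (sp (mods P 0) y)"
      by (rule lhomI) (use vs_closed(3)[OF V] vs_smult[OF V] e in \<open>auto simp: const_mod_simps\<close>)
  next
    show "act K f v \<odot>\<^bsub>sp (mods P 0) (Cod S f)\<^esub> e = act (mods P 0) f (v \<odot>\<^bsub>sp (mods P 0) (Dom S f)\<^esub> e)"
      if "f \<in> Arr S" for f v
      using that fmodD(4)[OF fP x vs_closed(3)[OF V e(1)]] by (simp add: S_def ix const_mod_simps)
  qed
  have as: "aug P y (v \<odot>\<^bsub>sp (mods P 0) y\<^esub> e) = v" if "y \<in> Obj S" "v \<in> car K y" for y v
    using that lhomD(3)[OF nat_transD(1)[OF resolutionD(4)[OF R] x] e(1)] e(2) by (simp add: S_def)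
  obtain h where h: "\<And>n. nat_trans S (mods P n) (mods P (Suc n)) (h n)"
    "\<And>y v. y \<in> Obj S ==> v \<in> car (mods P 0) y ==>
      v = aug P y v \<odot>\<^bsub>sp (mods P 0) y\<^esub> e \<oplus>\<^bsub>sp (mods P 0) y\<^esub> bdry P 0 y (h 0 y v)"
    "\<And>n y v. y \<in> Obj S ==> v \<in> car (mods P (Suc n)) y ==>
      v = bdry P (Suc n) y (h (Suc n) y v) \<oplus>\<^bsub>sp (mods P (Suc n)) y\<^esub> h n y (bdry P n y v)"
    by (rule contraction[OF S.K.finite_category_axioms PS s]) (rule as, assumption+, rule that, assumption+)
  have xS: "x \<in> Obj S" by (simp add: S_def)
  note hl = nat_transD(1)[OF h(1) xS]
  let ?V = "\<lambda>n. sp (PT (mods P n)) x" and ?d = "\<lambda>n. ptensor_map M (mods P n) (bdry P n) x"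
    and ?H = "\<lambda>n. ptensor_map M (mods P (Suc n)) (h n) x" and ?S = "ptg (mods P 0) x e"
  note Mx = Mv[OF x]
  have dl: "?d n \<in> lhom (?V (Suc n)) (?V n)" and Hl: "?H n \<in> lhom (?V n) (?V (Suc n))" for n
    by (rule PT_map(1)[where et = "bdry P n", OF fP x V d]) (rule PT_map(1)[where et = "h n", OF fP x V hl])
  have dtg: "v \<in> car (mods P (Suc n)) x ==> w \<in> car M x ==>
      ?d n (ptg (mods P (Suc n)) x v w) = ptg (mods P n) x (bdry P n x v) w"
    and Htg: "v \<in> car (mods P n) x ==> w \<in> car M x ==>
      ?H n (ptg (mods P n) x v w) = ptg (mods P (Suc n)) x (h n x v) w" for n v w
    by (rule PT_map(2)[where et = "bdry P n", OF fP x V d], assumption+) (rule PT_map(2)[where et = "h n", OF fP x V hl], assumption+)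
  have Sl: "?S \<in> lhom (sp M x) (?V 0)" unfolding PT_sp by (rule tg_right[OF V Mx e(1)])
  have tl: "(\<lambda>v. ptg (mods P n) x v w) \<in> lhom (sp (mods P n) x) (?V n)" if "w \<in> car M x" for n w
    unfolding PT_sp by (rule tg_left[OF V Mx that])
  have c0: "z = ?S (ptensor_aug M (aug P) x z) \<oplus>\<^bsub>?V 0\<^esub> ?d 0 (?H 0 z)" if z: "z \<in> carrier (?V 0)" for z
  proof (rule PT_ext[OF fP x lhom_id lhom_add[OF lhom_comp[OF au(1)[OF x] Sl] lhom_comp[OF Hl dl]] _ _ z])
    fix v w assume v: "v \<in> car (mods P 0) x" and w: "w \<in> car M x"
    have A: "?S (aug P x v \<odot>\<^bsub>sp M x\<^esub> w) = ptg (mods P 0) x (aug P x v \<odot>\<^bsub>sp (mods P 0) x\<^esub> e) w"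
      using lhomD(3)[OF Sl w] lhomD(3)[OF tl[OF w] e(1)] by simp
    have B: "ptg (mods P 0) x v w = ptg (mods P 0) x (aug P x v \<odot>\<^bsub>sp (mods P 0) x\<^esub> e) w
        \<oplus>\<^bsub>?V 0\<^esub> ptg (mods P 0) x (bdry P 0 x (h 0 x v)) w"
      using arg_cong[OF h(2)[OF xS v], of "\<lambda>v. ptg (mods P 0) x v w"]
        lhomD(2)[OF tl[OF w, of 0] vs_closed(3)[OF V e(1)] lhomD(1)[OF d lhomD(1)[OF hl v]]] by simp
    show "ptg (mods P 0) x v w = ?S (ptensor_aug M (aug P) x (ptg (mods P 0) x v w)) \<oplus>\<^bsub>?V 0\<^esub> ?d 0 (?H 0 (ptg (mods P 0) x v w))"
      unfolding au(2)[OF x v w] Htg[OF v w] dtg[OF lhomD(1)[OF hl v] w] A by (rule B)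
  qed (rule PT_vs[OF fP x])+
  have c1: "z = ?d (Suc n) (?H (Suc n) z) \<oplus>\<^bsub>?V (Suc n)\<^esub> ?H n (?d n z)" if z: "z \<in> carrier (?V (Suc n))" for n z
  proof (rule PT_ext[OF fP x lhom_id lhom_add[OF lhom_comp[OF Hl dl] lhom_comp[OF dl Hl]] _ _ z])
    fix v w assume v: "v \<in> car (mods P (Suc n)) x" and w: "w \<in> car M x"
    have B: "ptg (mods P (Suc n)) x v w = ptg (mods P (Suc n)) x (bdry P (Suc n) x (h (Suc n) x v)) w
        \<oplus>\<^bsub>?V (Suc n)\<^esub> ptg (mods P (Suc n)) x (h n x (bdry P n x v)) w"
      using arg_cong[OF h(3)[OF xS v], of "\<lambda>v. ptg (mods P (Suc n)) x v w"]
        lhomD(2)[OF tl[OF w] lhomD(1)[OF d lhomD(1)[OF hl v]] lhomD(1)[OF hl lhomD(1)[OF d v]]] by simp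
    show "ptg (mods P (Suc n)) x v w = ?d (Suc n) (?H (Suc n) (ptg (mods P (Suc n)) x v w))
        \<oplus>\<^bsub>?V (Suc n)\<^esub> ?H n (?d n (ptg (mods P (Suc n)) x v w))"
      unfolding Htg[OF v w] dtg[OF lhomD(1)[OF hl v] w] dtg[OF v w] Htg[OF lhomD(1)[OF d v] w] by (rule B)
  qed (rule PT_vs[OF fP x])+
  note ex = exact_of_contraction[of ?V "sp M x" ?d ?H ?S "ptensor_aug M (aug P) x",
      OF PT_vs[OF fP x] Mx dl Hl Sl c0 c1]
  show "\<exists>v\<in>carrier (?V 0). ptensor_aug M (aug P) x v = w" if w: "w \<in> car M x" for w
    by (rule bexI[of _ "?S w"]) (use au(2)[OF x e(1) w] e(2) vs_smult(4)[OF Mx w] lhomD(1)[OF Sl w] in auto)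
  show "\<exists>u\<in>carrier (?V 1). z = ?d 0 u" if "z \<in> carrier (?V 0)" "ptensor_aug M (aug P) x z = \<zero>\<^bsub>sp M x\<^esub>" for z
    using ex(1) that by blast
  show "\<exists>u\<in>carrier (?V (Suc (Suc n))). z = ?d (Suc n) u" if "z \<in> carrier (?V (Suc n))" "?d n z = \<zero>\<^bsub>?V n\<^esub>" for z n
    using ex(2) that by blast
  have z: "ptg (mods P n) x \<zero>\<^bsub>sp (mods P n) x\<^esub> w = \<zero>\<^bsub>?V n\<^esub>" if "w \<in> car M x" for n w
    by (rule lhom_zero[OF tl[OF that] V PT_vs[OF fP x]])
  show "?d n (?d (Suc n) q) = \<zero>\<^bsub>?V n\<^esub>" if "q \<in> carrier (?V (Suc (Suc n)))" for n q
    by (rule PT_ext[OF fP x lhom_comp[OF dl dl] lhom_const_zero[OF PT_vs[OF fP x]] PT_vs[OF fP x] _ that])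
       (simp add: dtg lhomD(1)[OF d] resolution_exact(3)[OF R x] z)
  show "ptensor_aug M (aug P) x (?d 0 q) = \<zero>\<^bsub>sp M x\<^esub>" if "q \<in> carrier (?V 1)" for q
    by (rule PT_ext[OF fP x lhom_comp[OF dl au(1)[OF x]] lhom_const_zero[OF Mx] Mx _ that[unfolded One_nat_def]])
       (simp add: dtg au(2)[OF x] lhomD(1)[OF d] resolution_exact(2)[OF R x] vs_zero(3)[OF Mx])
qed

lemma PT_ext_functor:
  fixes P :: "('o, 'm, 'k, 'v, 'k) aug_complex" and Q :: "('o, 'm, 'k, 'q, 'w) aug_complex"
  assumes P: "proj_resolution C K P" and Q: "proj_resolution C M Q"
  shows "ext_functor C K P C M Q PT (ptensor_map M) (ptensor_aug M)"
proof (rule ext_functor.intro)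
  note CC = C.finite_category_axioms
  have fP: "fmod C (mods P n)" for n using P by (auto simp: proj_resolution_def resolution_def)
  show "finite_category C" "finite_category C" "proj_resolution C K P" "proj_resolution C M Q"
    "resolution C M (PTc P)"
    using P Q CC PT_resolution by auto
  note au = PT_aug[OF fP]
  show "nat_trans C (PT (mods P n)) M (ptensor_aug M f)" if "nat_trans C (mods P n) K f" for n f
    by (rule au(3)[OF that])
  fix n and f g :: "'o => 'v => 'k" and x and z
  assume f: "nat_trans C (mods P n) K f" and x: "x \<in> Obj C" and z: "z \<in> car (PT (mods P n)) x"
  note V = Mv[OF x]
  show "ptensor_aug M (\<lambda>y v. c \<odot>\<^bsub>sp K y\<^esub> f y v) x z = c \<odot>\<^bsub>sp M x\<^esub> ptensor_aug M f x z" for c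
    by (rule PT_ext[OF fP x au(1)[OF nat_trans_scale[OF CC f fmod_const_mod] x] lhom_scale[OF au(1)[OF f x] V] V _ z])
       (simp add: au(2)[OF nat_trans_scale[OF CC f fmod_const_mod, unfolded const_mod_simps] x] au(2)[OF f x] vs_smult(3)[OF V])
  assume g: "nat_trans C (mods P n) K g"
  show "ptensor_aug M f x z = ptensor_aug M g x z"
    if "\<And>y v. y \<in> Obj C ==> v \<in> car (mods P n) y ==> f y v = g y v"
    by (rule PT_ext[OF fP x au(1)[OF f x] au(1)[OF g x] V _ z]) (simp add: au(2)[OF f x] au(2)[OF g x] that[OF x])
  show "ptensor_aug M (\<lambda>y v. f y v \<oplus>\<^bsub>sp K y\<^esub> g y v) x z = ptensor_aug M f x z \<oplus>\<^bsub>sp M x\<^esub> ptensor_aug M g x z"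
    by (rule PT_ext[OF fP x au(1)[OF nat_trans_add[OF CC f g fmod_const_mod] x] lhom_add[OF au(1)[OF f x] au(1)[OF g x] V] V _ z])
       (simp add: au(2)[OF nat_trans_add[OF CC f g fmod_const_mod, unfolded const_mod_simps] x] au(2)[OF f x] au(2)[OF g x] vs_smult(2)[OF V])
next
  note CC = C.finite_category_axioms
  have fP: "fmod C (mods P n)" for n using P by (auto simp: proj_resolution_def resolution_def)
  note au = PT_aug[OF fP]
  show "nat_trans C (PT (mods P n)) (PT (mods P m)) (ptensor_map M (mods P m) ph)"
    if "nat_trans C (mods P n) (mods P m) ph" for n m ph
    by (rule PT_map_nat[OF fP fP that])
  have ml: "ptensor_map M (mods P m) ph x \<in> lhom (sp (PT (mods P n)) x) (sp (PT (mods P m)) x)"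
    and mg: "v \<in> car (mods P n) x ==> w \<in> car M x ==>
      ptensor_map M (mods P m) ph x (ptg (mods P n) x v w) = ptg (mods P m) x (ph x v) w"
    if "nat_trans C (mods P n) (mods P m) ph" "x \<in> Obj C" for n m ph x v w
    using PT_map[where et = ph, OF fP that(2) fmodD(1)[OF fP that(2)] nat_transD(1)[OF that]] by auto
  fix n m ph x z assume ph: "nat_trans C (mods P n) (mods P m) ph" and x: "x \<in> Obj C"
    and z: "z \<in> car (PT (mods P n)) x"
  show "ptensor_aug M f x (ptensor_map M (mods P m) ph x z) = ptensor_aug M (\<lambda>y v. f y (ph y v)) x z"
    if f: "nat_trans C (mods P m) K f" for f
    by (rule PT_ext[OF fP x lhom_comp[OF ml[OF ph x] au(1)[OF f x]] au(1)[OF nat_trans_comp[OF CC ph f] x] Mv[OF x] _ z])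
       (simp add: mg[OF ph x] au(2)[OF f x] au(2)[OF nat_trans_comp[OF CC ph f] x] nat_transD(2)[OF ph x])
  show "ptensor_map M (mods P l) ps x (ptensor_map M (mods P m) ph x z) = ptensor_map M (mods P l) ps' x (ptensor_map M (mods P m') ph' x z)"
    if ps: "nat_trans C (mods P m) (mods P l) ps" and ph': "nat_trans C (mods P n) (mods P m') ph'"
      and ps': "nat_trans C (mods P m') (mods P l) ps'"
      and eq: "\<And>y v. y \<in> Obj C ==> v \<in> car (mods P n) y ==> ps y (ph y v) = ps' y (ph' y v)"
    for m' l ps ph' ps'
    by (rule PT_ext[OF fP x lhom_comp[OF ml[OF ph x] ml[OF ps x]] lhom_comp[OF ml[OF ph' x] ml[OF ps' x]] PT_vs[OF fP x] _ z])
       (simp add: mg[OF ph x] mg[OF ps x] mg[OF ph' x] mg[OF ps' x] nat_transD(2)[OF ph x] nat_transD(2)[OF ph' x] eq[OF x])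
qed

end

section \<open>Tensor products over the category algebra\<close>

lemma env_simps [simp]:
  "Obj (env_cat C) = Obj C \<times> Obj C" "Arr (env_cat C) = Arr C \<times> Arr C"
  "Dom (env_cat C) (mu, ga) = (Dom C mu, Cod C ga)" "Cod (env_cat C) (mu, ga) = (Cod C mu, Dom C ga)"
  "Ident (env_cat C) (x, y) = (Ident C x, Ident C y)"
  "Comp (env_cat C) (mu', ga') (mu, ga) = (Comp C mu' mu, Comp C ga ga')"
  by (simp_all add: env_cat_def)

lemma finite_category_env:
  assumes "finite_category C"
  shows "finite_category (env_cat C)"
proof -
  interpret C: finite_category C by fact
  show ?thesis
    by unfold_locales
       (auto simp: C.finite_Obj C.finite_Arr C.Dom_Obj C.Cod_Obj C.Ident_Arr C.Dom_Ident C.Cod_Ident C.Comp_Arr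
         C.Dom_Comp C.Cod_Comp C.Comp_Ident_left C.Comp_Ident_right C.Comp_assoc)
qed

lemma bimod_simps [simp]:
  "sp (bimod C) (x, y) = free_space {al \<in> Arr C. Dom C al = y \<and> Cod C al = x}"
  "act (bimod C) (mu, ga) = push (\<lambda>al. Comp C mu (Comp C al ga))"
  by (simp_all add: bimod_def)

lemma (in finite_category) fmod_bimod: "fmod (env_cat C) (bimod C :: ('o \<times> 'o, 'm \<times> 'm, 'k::field, 'm \<Rightarrow>\<^sub>0 'k) kfunctor)"
  (is "fmod ?E ?B")
  unfolding fmod_def
proof (intro conjI ballI impI)
  fix p assume "p \<in> Obj ?E"
  then obtain x y where p: "p = (x, y)" "x \<in> Obj C" "y \<in> Obj C" by auto
  show "vs (sp ?B p)" by (simp add: p(1) vs_free_space)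
  fix v assume v: "v \<in> car ?B p"
  have "push (\<lambda>al. Comp C (Ident C x) (Comp C al (Ident C y))) v = push (\<lambda>al. al) v"
    by (rule push_cong) (use v p Comp_Ident_left Comp_Ident_right in auto)
  then show "act ?B (Ident ?E p) v = v" by (simp add: p push_id)
next
  fix p assume "p \<in> Arr ?E"
  then obtain mu ga where p: "p = (mu, ga)" "mu \<in> Arr C" "ga \<in> Arr C" by auto
  show "act ?B p \<in> lhom (sp ?B (Dom ?E p)) (sp ?B (Cod ?E p))"
    unfolding p env_simps bimod_simps
    by (rule push_lhom) (use p in \<open>auto simp: Comp_Arr Dom_Comp Cod_Comp\<close>)
  fix q v assume "q \<in> Arr ?E" and pq: "Dom ?E q = Cod ?E p" and v: "v \<in> car ?B (Dom ?E p)"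
  then obtain mu' ga' where q: "q = (mu', ga')" "mu' \<in> Arr C" "ga' \<in> Arr C" by auto
  show "act ?B (Comp ?E q p) v = act ?B q (act ?B p v)"
    unfolding p(1) q(1) env_simps bimod_simps push_push
    by (rule push_cong) (use pq v p q in \<open>auto simp: Comp_assoc Comp_Arr Dom_Comp Cod_Comp\<close>)
qed

lemma lin_lhom_right:
  assumes V: "vs V" and ph: "\<And>u. u \<in> U ==> ph u \<in> lhom W V" and f: "keys f \<subseteq> U" and W: "vs W"
  shows "(\<lambda>w. lin V (\<lambda>u. ph u w) f) \<in> lhom W V"
proof (rule lhomI)
  have l: "lin V (\<lambda>u. ph u w) \<in> lhom (free_space U) V" if "w \<in> carrier W" for w
    by (rule lin_lhom[OF V lhomD(1)[OF ph that]])
  fix w assume w: "w \<in> carrier W"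
  show "lin V (\<lambda>u. ph u w) f \<in> carrier V" using lhomD(1)[OF l[OF w]] f by simp
  fix c
  note cw = vs_closed(3)[OF W w, of c]
  have ls: "lin V (\<lambda>u. ph u w) (single u 1) = ph u w" if "w \<in> carrier W" "u \<in> U" for u w
    using lin_single_at[OF V, of "\<lambda>u. ph u w" u 1] lhomD(1)[OF ph[OF that(2)] that(1)] vs_smult(4)[OF V] by simp
  show "lin V (\<lambda>u. ph u (c \<odot>\<^bsub>W\<^esub> w)) f = c \<odot>\<^bsub>V\<^esub> lin V (\<lambda>u. ph u w) f"
    by (rule free_ext[OF l[OF cw] lhom_scale[OF l[OF w] V] V _ f]) (simp add: ls cw w lhomD(3)[OF ph])
  fix w' assume w': "w' \<in> carrier W"
  note ww = vs_closed(2)[OF W w w']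
  show "lin V (\<lambda>u. ph u (w \<oplus>\<^bsub>W\<^esub> w')) f = lin V (\<lambda>u. ph u w) f \<oplus>\<^bsub>V\<^esub> lin V (\<lambda>u. ph u w') f"
    by (rule free_ext[OF l[OF ww] lhom_add[OF l[OF w] l[OF w'] V] V _ f]) (simp add: ls ww w w' lhomD(2)[OF ph])
qed

definition gbt where
  "gbt C M B x y b w = gen (btensor_gens C M B x) (btensor_rels C M B x) (y, b, w)"

context pten
begin

abbreviation E where "E \<equiv> env_cat C"
abbreviation BT where "BT \<equiv> btensor C M"
abbreviation bt where "bt \<equiv> gbt C M"
abbreviation BTm where "BTm \<equiv> btensor_map C M"
abbreviation BTc where "BTc \<equiv> image_complex BT BTm (btensor_aug C M)"

lemma EC: "finite_category E"
  by (rule finite_category_env[OF C.finite_category_axioms])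

lemma BT_sp: "sp (BT B) x = presented (btensor_gens C M B x) (btensor_rels C M B x)"
  by (simp add: btensor_def)

lemma bt_gens: "(y, b, w) \<in> btensor_gens C M B x \<longleftrightarrow> y \<in> Obj C \<and> b \<in> car B (x, y) \<and> w \<in> car M y"
  by (simp add: btensor_gens_def)

context
  fixes B :: "('o \<times> 'o, 'm \<times> 'm, 'k, 'v) kfunctor"
  assumes B: "fmod E B"
begin

lemma Bv: "x \<in> Obj C ==> y \<in> Obj C ==> vs (sp B (x, y))"
  using fmodD(1)[OF B, of "(x, y)"] by simp

lemma B_right: "x \<in> Obj C ==> al \<in> Arr C ==> act B (Ident C x, al) \<in> lhom (sp B (x, Cod C al)) (sp B (x, Dom C al))"
  using fmodD(2)[OF B, of "(Ident C x, al)"] by (simp add: C.Ident_Arr C.Dom_Ident C.Cod_Ident)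

lemma B_left: "y \<in> Obj C ==> g \<in> Arr C ==> act B (g, Ident C y) \<in> lhom (sp B (Dom C g, y)) (sp B (Cod C g, y))"
  using fmodD(2)[OF B, of "(g, Ident C y)"] by (simp add: C.Ident_Arr C.Dom_Ident C.Cod_Ident)

text \<open>The two variables act independently, which makes the left action of \<open>g\<close>
  compatible with the tensor relation in the middle.\<close>

lemma B_commute:
  assumes "g \<in> Arr C" "al \<in> Arr C" "b \<in> car B (Dom C g, Cod C al)"
  shows "act B (g, Ident C (Dom C al)) (act B (Ident C (Dom C g), al) b) = act B (g, al) b"
    and "act B (Ident C (Cod C g), al) (act B (g, Ident C (Cod C al)) b) = act B (g, al) b"
  using fmodD(5)[OF B, of "(Ident C (Dom C g), al)" "(g, Ident C (Dom C al))" b]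
    fmodD(5)[OF B, of "(g, Ident C (Cod C al))" "(Ident C (Cod C g), al)" b] assms
  by (simp_all add: C.Ident_Arr C.Dom_Ident C.Cod_Ident C.Dom_Obj C.Cod_Obj C.Comp_Ident_left C.Comp_Ident_right)

context
  fixes x assumes x: "x \<in> Obj C"
begin

lemma bt_rels_carrier: "btensor_rels C M B x \<subseteq> carrier (free_space (btensor_gens C M B x))"
proof -
  have "linear_rels (sp B (x, y)) (\<lambda>b. (y, b, w)) \<subseteq> carrier (free_space (btensor_gens C M B x))"
    if "y \<in> Obj C" "w \<in> car M y" for y w
    by (rule linear_rels_carrier[OF Bv[OF x that(1)]]) (simp add: bt_gens that)
  moreover have "linear_rels (sp M y) (\<lambda>w. (y, b, w)) \<subseteq> carrier (free_space (btensor_gens C M B x))"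
    if "y \<in> Obj C" "b \<in> car B (x, y)" for y b
    by (rule linear_rels_carrier[OF Mv[OF that(1)]]) (simp add: bt_gens that)
  moreover have "single (Cod C al, b, act M al w) 1
       - single (Dom C al, act B (Ident C x, al) b, w) 1 \<in> carrier (free_space (btensor_gens C M B x))"
    if "al \<in> Arr C" "b \<in> car B (x, Cod C al)" "w \<in> car M (Dom C al)" for al b w
    unfolding free_space_simps
    by (rule keys_minus_subset) (use that in \<open>simp_all add: bt_gens C.Cod_Obj C.Dom_Obj fmodD(3)[OF M] lhomD(1)[OF B_right[OF x]]\<close>)
  ultimately show ?thesis unfolding btensor_rels_def by blast
qed

lemma BT_vs: "vs (sp (BT B) x)"
  unfolding BT_sp by (rule vs_presented[OF bt_rels_carrier])

lemma bt_left: "y \<in> Obj C ==> w \<in> car M y ==> (\<lambda>b. bt B x y b w) \<in> lhom (sp B (x, y)) (sp (BT B) x)"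
  unfolding gbt_def BT_sp
  by (rule gen_linear[OF bt_rels_carrier Bv[OF x]]) (simp_all add: bt_gens btensor_rels_def, blast)

lemma bt_right: "y \<in> Obj C ==> b \<in> car B (x, y) ==> bt B x y b \<in> lhom (sp M y) (sp (BT B) x)"
  unfolding gbt_def[abs_def] BT_sp
  by (rule gen_linear[OF bt_rels_carrier Mv]) (simp_all add: bt_gens btensor_rels_def, blast)

lemma bt_closed: "y \<in> Obj C ==> b \<in> car B (x, y) ==> w \<in> car M y ==> bt B x y b w \<in> car (BT B) x"
  by (rule lhomD(1)[OF bt_right])

lemma bt_rel:
  assumes "al \<in> Arr C" "b \<in> car B (x, Cod C al)" "w \<in> car M (Dom C al)"
  shows "bt B x (Cod C al) b (act M al w) = bt B x (Dom C al) (act B (Ident C x, al) b) w"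
  unfolding gbt_def
proof (rule gen_eq[OF bt_rels_carrier])
  show "single (Cod C al, b, act M al w) 1
       - single (Dom C al, act B (Ident C x, al) b, w) 1 \<in> btensor_rels C M B x"
    unfolding btensor_rels_def using assms by blast
qed (use assms in \<open>simp_all add: bt_gens C.Cod_Obj C.Dom_Obj fmodD(3)[OF M] lhomD(1)[OF B_right[OF x]]\<close>)

lemma BT_ext:
  assumes "h \<in> lhom (sp (BT B) x) V" "h' \<in> lhom (sp (BT B) x) V" "vs V"
    and "\<And>y b w. y \<in> Obj C ==> b \<in> car B (x, y) ==> w \<in> car M y ==> h (bt B x y b w) = h' (bt B x y b w)"
    and "z \<in> car (BT B) x"
  shows "h z = h' z"
  using presented_ext[OF bt_rels_carrier assms(1,2)[unfolded BT_sp] assms(3) _ assms(5)[unfolded BT_sp]] assms(4)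
  by (auto simp: bt_gens gbt_def)

context
  fixes V :: "('k, 'u) module" and ph :: "'o => 'v => 'w => 'u"
  assumes V: "vs V"
    and l: "\<And>y w. y \<in> Obj C ==> w \<in> car M y ==> (\<lambda>b. ph y b w) \<in> lhom (sp B (x, y)) V"
    and r: "\<And>y b. y \<in> Obj C ==> b \<in> car B (x, y) ==> ph y b \<in> lhom (sp M y) V"
    and rel: "\<And>al b w. al \<in> Arr C ==> b \<in> car B (x, Cod C al) ==> w \<in> car M (Dom C al) ==>
      ph (Cod C al) b (act M al w) = ph (Dom C al) (act B (Ident C x, al) b) w"
begin

lemma bt_rel_zero:
  assumes "q \<in> btensor_rels C M B x"
  shows "lin V (\<lambda>(y, b, w). ph y b w) q = \<zero>\<^bsub>V\<^esub>"
  using assms unfolding btensor_rels_def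
proof (elim UnE UN_E CollectE exE conjE)
  fix y w assume "y \<in> Obj C" "w \<in> car M y" "q \<in> linear_rels (sp B (x, y)) (\<lambda>b. (y, b, w))"
  then show ?thesis using lin_linear_rels[OF V Bv[OF x], of y "\<lambda>(y, b, w). ph y b w" "\<lambda>b. (y, b, w)"] l by simp
next
  fix y b assume "y \<in> Obj C" "b \<in> car B (x, y)" "q \<in> linear_rels (sp M y) (\<lambda>w. (y, b, w))"
  then show ?thesis using lin_linear_rels[OF V Mv, of y "\<lambda>(y, b, w). ph y b w" "\<lambda>w. (y, b, w)"] r by simp
next
  fix al b w assume q: "q = single (Cod C al, b, act M al w) 1
       - single (Dom C al, act B (Ident C x, al) b, w) 1"
    and *: "al \<in> Arr C" "b \<in> car B (x, Cod C al)" "w \<in> car M (Dom C al)"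
  have "ph (Dom C al) (act B (Ident C x, al) b) w \<in> carrier V"
    by (rule lhomD(1)[OF r[OF C.Dom_Obj[OF *(1)] lhomD(1)[OF B_right[OF x *(1)] *(2)]] *(3)])
  then show ?thesis unfolding q
    by (intro lin_single_minus[OF V]) (use rel[OF *] V in \<open>auto simp: vs_smult(4)\<close>)
qed

lemma bt_out:
  "pres_out V (\<lambda>(y, b, w). ph y b w) \<in> lhom (sp (BT B) x) V"
  "y \<in> Obj C ==> b \<in> car B (x, y) ==> w \<in> car M y ==>
    pres_out V (\<lambda>(y, b, w). ph y b w) (bt B x y b w) = ph y b w"
proof -
  have c: "(\<lambda>(y, b, w). ph y b w) g \<in> carrier V" if "g \<in> btensor_gens C M B x" for g
    using that lhomD(1)[OF r] by (cases g) (auto simp: bt_gens)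
  note po = presented_out[OF bt_rels_carrier V, of "\<lambda>(y, b, w). ph y b w"]
  show "pres_out V (\<lambda>(y, b, w). ph y b w) \<in> lhom (sp (BT B) x) V"
    unfolding BT_sp by (rule po(1)[OF c bt_rel_zero])
  show "pres_out V (\<lambda>(y, b, w). ph y b w) (bt B x y b w) = ph y b w"
    if "y \<in> Obj C" "b \<in> car B (x, y)" "w \<in> car M y"
    unfolding gbt_def using po(2)[OF c bt_rel_zero, of "(y, b, w)"] that by (simp add: bt_gens)
qed

end

lemma bt_pres_map:
  assumes rh: "\<And>y. y \<in> Obj C ==> rh y \<in> lhom (sp B (x, y)) (sp B' (x', y))"
    and rhr: "\<And>al b. al \<in> Arr C ==> b \<in> car B (x, Cod C al) ==>
      rh (Dom C al) (act B (Ident C x, al) b) = act B' (Ident C x', al) (rh (Cod C al) b)"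
    and V': "vs (sp (BT B') x')"
    and c': "btensor_rels C M B' x' \<subseteq> carrier (free_space (btensor_gens C M B' x'))"
    and l': "\<And>y w. y \<in> Obj C ==> w \<in> car M y ==> (\<lambda>b. bt B' x' y b w) \<in> lhom (sp B' (x', y)) (sp (BT B') x')"
    and r': "\<And>y b. y \<in> Obj C ==> b \<in> car B' (x', y) ==> bt B' x' y b \<in> lhom (sp M y) (sp (BT B') x')"
    and rel': "\<And>al b w. al \<in> Arr C ==> b \<in> car B' (x', Cod C al) ==> w \<in> car M (Dom C al) ==>
      bt B' x' (Cod C al) b (act M al w) = bt B' x' (Dom C al) (act B' (Ident C x', al) b) w"
  shows "pres_map (btensor_gens C M B' x') (btensor_rels C M B' x') (\<lambda>(y, b, w). (y, rh y b, w))
      \<in> lhom (sp (BT B) x) (sp (BT B') x')"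
    and "y \<in> Obj C ==> b \<in> car B (x, y) ==> w \<in> car M y ==>
      pres_map (btensor_gens C M B' x') (btensor_rels C M B' x') (\<lambda>(y, b, w). (y, rh y b, w)) (bt B x y b w)
      = bt B' x' y (rh y b) w"
proof -
  let ?m = "\<lambda>(y, b, w). (y, rh y b, w)"
  have 1: "?m g \<in> btensor_gens C M B' x'" if "g \<in> btensor_gens C M B x" for g
    using that lhomD(1)[OF rh] by (cases g) (auto simp: bt_gens)
  have 2: "lin (presented (btensor_gens C M B' x') (btensor_rels C M B' x'))
      (\<lambda>g. gen (btensor_gens C M B' x') (btensor_rels C M B' x') (?m g)) q
      = \<zero>\<^bsub>presented (btensor_gens C M B' x') (btensor_rels C M B' x')\<^esub>" if "q \<in> btensor_rels C M B x" for q
    using bt_rel_zero[OF V', where ph = "\<lambda>y b w. bt B' x' y (rh y b) w", OF lhom_comp[OF rh l'] r'[OF _ lhomD(1)[OF rh]] _ that]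
      rel'[OF _ lhomD(1)[OF rh[OF C.Cod_Obj]]] rhr
    by (simp add: BT_sp gbt_def case_prod_beta')
  show "pres_map (btensor_gens C M B' x') (btensor_rels C M B' x') ?m \<in> lhom (sp (BT B) x) (sp (BT B') x')"
    unfolding BT_sp by (rule presented_map(1)[OF bt_rels_carrier c' 1 2])
  show "pres_map (btensor_gens C M B' x') (btensor_rels C M B' x') ?m (bt B x y b w) = bt B' x' y (rh y b) w"
    if "y \<in> Obj C" "b \<in> car B (x, y)" "w \<in> car M y"
    unfolding gbt_def using presented_map(2)[OF bt_rels_carrier c' 1 2, where u = "(y, b, w)"] that
    by (simp add: bt_gens)
qed

end

end

lemma BT_act:
  assumes B: "fmod E B" and g: "g \<in> Arr C"
  shows "act (BT B) g \<in> lhom (sp (BT B) (Dom C g)) (sp (BT B) (Cod C g))"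
    and "y \<in> Obj C ==> b \<in> car B (Dom C g, y) ==> w \<in> car M y ==>
      act (BT B) g (bt B (Dom C g) y b w) = bt B (Cod C g) y (act B (g, Ident C y) b) w"
proof -
  note o = C.Dom_Obj[OF g] C.Cod_Obj[OF g]
  note pm = bt_pres_map[OF B o(1) B_left[OF B _ g] _ BT_vs[OF B o(2)] bt_rels_carrier[OF B o(2)]
      bt_left[OF B o(2)] bt_right[OF B o(2)] bt_rel[OF B o(2)]]
  have a: "act (BT B) g = pres_map (btensor_gens C M B (Cod C g)) (btensor_rels C M B (Cod C g))
      (\<lambda>(y, b, w). (y, act B (g, Ident C y) b, w))"
    by (simp add: btensor_def)
  show "act (BT B) g \<in> lhom (sp (BT B) (Dom C g)) (sp (BT B) (Cod C g))"
    unfolding a by (rule pm(1)) (simp_all add: B_commute[OF B g])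
  show "act (BT B) g (bt B (Dom C g) y b w) = bt B (Cod C g) y (act B (g, Ident C y) b) w"
    if "y \<in> Obj C" "b \<in> car B (Dom C g, y)" "w \<in> car M y"
    unfolding a by (rule pm(2)) (use that in \<open>simp_all add: B_commute[OF B g]\<close>)
qed

lemma BT_fmod:
  assumes B: "fmod E B"
  shows "fmod C (BT B)"
  unfolding fmod_def
proof (intro conjI ballI impI)
  fix x z assume x: "x \<in> Obj C" and z: "z \<in> car (BT B) x"
  note i = C.Ident_Arr[OF x] C.Dom_Ident[OF x] C.Cod_Ident[OF x]
  show "act (BT B) (Ident C x) z = z"
    by (rule BT_ext[OF B x BT_act(1)[OF B i(1), unfolded i(2,3)] lhom_id BT_vs[OF B x] _ z])
       (use fmodD(4)[OF B, of "(x, _)"] x in \<open>simp add: BT_act(2)[OF B i(1), unfolded i(2,3)]\<close>)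
next
  fix f g z assume f: "f \<in> Arr C" and g: "g \<in> Arr C" "Dom C g = Cod C f" and z: "z \<in> car (BT B) (Dom C f)"
  note gf = C.Comp_Arr[OF f g] C.Dom_Comp[OF f g] C.Cod_Comp[OF f g]
  have c: "act B (Comp C g f, Ident C y) b = act B (g, Ident C y) (act B (f, Ident C y) b)"
    if "y \<in> Obj C" "b \<in> car B (Dom C f, y)" for y b
    using fmodD(5)[OF B, of "(f, Ident C y)" "(g, Ident C y)" b] that f g C.Comp_Ident_right[OF C.Ident_Arr[OF that(1)]]
    by (simp add: C.Ident_Arr C.Dom_Ident C.Cod_Ident)
  show "act (BT B) (Comp C g f) z = act (BT B) g (act (BT B) f z)"
    by (rule BT_ext[OF B C.Dom_Obj[OF f] BT_act(1)[OF B gf(1), unfolded gf(2,3)]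
          lhom_comp[OF BT_act(1)[OF B f] BT_act(1)[OF B g(1), unfolded g(2)]] BT_vs[OF B C.Cod_Obj[OF g(1)]] _ z])
       (simp add: BT_act(2)[OF B gf(1), unfolded gf(2,3)] BT_act(2)[OF B f] BT_act(2)[OF B g(1), unfolded g(2)] c
         lhomD(1)[OF B_left[OF B _ f]])
qed (rule BT_vs[OF B] BT_act(1)[OF B]; assumption)+

definition Kx where "Kx x = E\<lparr>Obj := {x} \<times> Obj C, Arr := {Ident C x} \<times> Arr C\<rparr>"

lemma Kx_simps [simp]:
  "Obj (Kx x) = {x} \<times> Obj C" "Arr (Kx x) = {Ident C x} \<times> Arr C" "Dom (Kx x) = Dom E" "Cod (Kx x) = Cod E"
  "Ident (Kx x) = Ident E" "Comp (Kx x) = Comp E"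
  by (simp_all add: Kx_def)

lemma Kx_subcategory:
  assumes x: "x \<in> Obj C"
  shows "subcategory E (Kx x)"
proof -
  interpret E: finite_category E by (rule EC)
  note i = C.Ident_Arr[OF x] C.Dom_Ident[OF x] C.Cod_Ident[OF x]
  have ii: "Comp C (Ident C x) (Ident C x) = Ident C x" using C.Comp_Ident_right[OF i(1)] i by simp
  show ?thesis
    by unfold_locales
       (use x in \<open>auto simp: i ii C.finite_Obj C.finite_Arr C.Dom_Obj C.Cod_Obj C.Ident_Arr C.Dom_Ident C.Cod_Ident C.Comp_Arr
         C.Dom_Comp C.Cod_Comp C.Comp_Ident_left C.Comp_Ident_right C.Comp_assoc\<close>)
qed

text \<open>Only the values \<open>B (x, y)\<close> and the action in the second variable enter
  \<open>BT B\<close> at \<open>x\<close>, so naturality over \<open>Kx x\<close> suffices. The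
  contraction used for exactness is provided with that naturality only.\<close>

lemma BT_map:
  assumes B: "fmod E B" and B': "fmod E B'" and x: "x \<in> Obj C" and h: "nat_trans (Kx x) B B' et"
  shows "BTm B' et x \<in> lhom (sp (BT B) x) (sp (BT B') x)"
    and "y \<in> Obj C ==> b \<in> car B (x, y) ==> w \<in> car M y ==>
      BTm B' et x (bt B x y b w) = bt B' x y (et (x, y) b) w"
proof -
  have 1: "et (x, y) \<in> lhom (sp B (x, y)) (sp B' (x, y))" if "y \<in> Obj C" for y
    using nat_transD(1)[OF h, of "(x, y)"] that by simp
  have 2: "et (x, Dom C al) (act B (Ident C x, al) b) = act B' (Ident C x, al) (et (x, Cod C al) b)"
    if "al \<in> Arr C" "b \<in> car B (x, Cod C al)" for al b
    using nat_transD(3)[OF h, of "(Ident C x, al)" b] that by (simp add: C.Dom_Ident C.Cod_Ident x)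
  note pm = bt_pres_map[where rh = "\<lambda>y. et (x, y)", OF B x 1 2 BT_vs[OF B' x] bt_rels_carrier[OF B' x]
      bt_left[OF B' x] bt_right[OF B' x] bt_rel[OF B' x]]
  show "BTm B' et x \<in> lhom (sp (BT B) x) (sp (BT B') x)"
    unfolding btensor_map_def by (rule pm(1)) auto
  show "BTm B' et x (bt B x y b w) = bt B' x y (et (x, y) b) w"
    if "y \<in> Obj C" "b \<in> car B (x, y)" "w \<in> car M y"
    unfolding btensor_map_def by (rule pm(2)) (use that in auto)
qed

lemma BT_map_nat:
  assumes B: "fmod E B" and B': "fmod E B'" and h: "nat_trans E B B' et"
  shows "nat_trans C (BT B) (BT B') (BTm B' et)"
    and "x \<in> Obj C ==> y \<in> Obj C ==> b \<in> car B (x, y) ==> w \<in> car M y ==>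
      BTm B' et x (bt B x y b w) = bt B' x y (et (x, y) b) w"
proof -
  have k: "nat_trans (Kx x) B B' et" if x: "x \<in> Obj C" for x
    by (rule subcategory.sub_nat_trans[OF Kx_subcategory[OF x] h])
  note m = BT_map[OF B B' _ k]
  show "x \<in> Obj C ==> y \<in> Obj C ==> b \<in> car B (x, y) ==> w \<in> car M y ==>
      BTm B' et x (bt B x y b w) = bt B' x y (et (x, y) b) w"
    by (rule m(2))
  show "nat_trans C (BT B) (BT B') (BTm B' et)"
  proof (rule nat_transI)
    show 1: "BTm B' et x \<in> lhom (sp (BT B) x) (sp (BT B') x)" if "x \<in> Obj C" for x by (rule m(1)[OF that that])
    fix g z assume g: "g \<in> Arr C" and z: "z \<in> car (BT B) (Dom C g)"
    note o = C.Dom_Obj[OF g] C.Cod_Obj[OF g]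
    have n: "et (Cod C g, y) (act B (g, Ident C y) b) = act B' (g, Ident C y) (et (Dom C g, y) b)"
      if "y \<in> Obj C" "b \<in> car B (Dom C g, y)" for y b
      using nat_transD(3)[OF h, of "(g, Ident C y)" b] that g by (simp add: C.Ident_Arr C.Dom_Ident C.Cod_Ident)
    have c: "et (Dom C g, y) b \<in> car B' (Dom C g, y)" if "y \<in> Obj C" "b \<in> car B (Dom C g, y)" for y b
      using nat_transD(2)[OF h, of "(Dom C g, y)"] that o by simp
    show "BTm B' et (Cod C g) (act (BT B) g z) = act (BT B') g (BTm B' et (Dom C g) z)"
      by (rule BT_ext[OF B o(1) lhom_comp[OF BT_act(1)[OF B g] 1[OF o(2)]] lhom_comp[OF 1[OF o(1)] BT_act(1)[OF B' g]] BT_vs[OF B' o(2)] _ z])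
         (simp add: BT_act(2)[OF B g] BT_act(2)[OF B' g] m(2) o n c lhomD(1)[OF B_left[OF B _ g]])
  qed
qed

abbreviation bim where "bim \<equiv> bimod C :: ('o \<times> 'o, 'm \<times> 'm, 'k, 'm \<Rightarrow>\<^sub>0 'k) kfunctor"

lemmas bimod_fmod = C.fmod_bimod

lemma BT_aug:
  assumes B: "fmod E B" and h: "nat_trans E B bim f"
  shows "x \<in> Obj C ==> btensor_aug C M f x \<in> lhom (sp (BT B) x) (sp M x)"
    and "x \<in> Obj C ==> y \<in> Obj C ==> b \<in> car B (x, y) ==> w \<in> car M y ==>
      btensor_aug C M f x (bt B x y b w) = lin (sp M x) (\<lambda>al. act M al w) (f (x, y) b)"
    and "nat_trans C (BT B) M (btensor_aug C M f)"
proof -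
  let ?U = "\<lambda>x y. {al \<in> Arr C. Dom C al = y \<and> Cod C al = x}"
  let ?o = "\<lambda>x. pres_out (sp M x) (\<lambda>(y, b, w). lin (sp M x) (\<lambda>al. act M al w) b)"
  have ac: "(\<lambda>al. act M al w) al \<in> car M x" if "al \<in> ?U x y" "w \<in> car M y" for x y w al
    using fmodD(3)[OF M, of al w] that by auto
  have ol: "?o x \<in> lhom (sp (BT bim) x) (sp M x)"
    and og: "y \<in> Obj C ==> b \<in> car bim (x, y) ==> w \<in> car M y ==>
      ?o x (bt bim x y b w) = lin (sp M x) (\<lambda>al. act M al w) b" if x: "x \<in> Obj C" for x y b w
  proof -
    have l: "lin (sp M x) (\<lambda>al. act M al w) \<in> lhom (sp bim (x, y)) (sp M x)" if "w \<in> car M y" for y w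
      unfolding bimod_simps by (rule lin_lhom[OF Mv[OF x] ac[OF _ that]])
    have r: "(\<lambda>w. lin (sp M x) (\<lambda>al. act M al w) b) \<in> lhom (sp M y) (sp M x)"
      if "y \<in> Obj C" "b \<in> car bim (x, y)" for y b
      by (rule lin_lhom_right[OF Mv[OF x] _ _ Mv[OF that(1)], of "?U x y"]) (use that fmodD(2)[OF M] in auto)
    \<comment> \<open>For the map taking \<open>b \<otimes> w\<close> to \<open>b w\<close>, the
      tensor relation is associativity of the action of \<open>kC\<close> on \<open>M\<close>:
      applying \<open>b\<close> to \<open>al w\<close> gives the same as applying
      \<open>b al\<close> to \<open>w\<close>.\<close>
    have rel: "lin (sp M x) (\<lambda>be. act M be (act M al w)) b = lin (sp M x) (\<lambda>be. act M be w) (act bim (Ident C x, al) b)"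
      if *: "al \<in> Arr C" "b \<in> car bim (x, Cod C al)" "w \<in> car M (Dom C al)" for al b w
    proof -
      have k: "be \<in> Arr C \<and> Dom C be = Cod C al \<and> Cod C be = x" if "be \<in> keys b" for be
        using that *(2) by auto
      have eq: "act M (Comp C (Ident C x) (Comp C be al)) w = act M be (act M al w)"
        "act M be (act M al w) \<in> car M x" if "be \<in> keys b" for be
        using k[OF that] * C.Comp_Ident_left[of "Comp C be al"] fmodD(5)[OF M *(1), of be w] fmodD(3)[OF M, of be "act M al w"] fmodD(3)[OF M *(1,3)]
        by (simp_all add: C.Comp_Arr C.Cod_Comp)
      have "lin (sp M x) (\<lambda>be. act M be w) (act bim (Ident C x, al) b)
          = lin (sp M x) (\<lambda>be. act M (Comp C (Ident C x) (Comp C be al)) w) b"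
        unfolding bimod_simps by (rule lin_push[OF Mv[OF x]]) (simp add: eq)
      also have "\<dots> = lin (sp M x) (\<lambda>be. act M be (act M al w)) b"
        by (rule lin_cong[OF Mv[OF x]]) (simp_all add: eq)
      finally show ?thesis by simp
    qed
    show "?o x \<in> lhom (sp (BT bim) x) (sp M x)"
      by (rule bt_out(1)[OF bimod_fmod x Mv[OF x]]) (use l r rel in auto)
    show "?o x (bt bim x y b w) = lin (sp M x) (\<lambda>al. act M al w) b"
      if "y \<in> Obj C" "b \<in> car bim (x, y)" "w \<in> car M y"
      by (rule bt_out(2)[OF bimod_fmod x Mv[OF x]]) (use l r rel that in auto)
  qed
  note ma = nat_transD(1)[OF BT_map_nat(1)[OF B bimod_fmod h]] and mg = BT_map_nat(2)[OF B bimod_fmod h]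
  have a: "btensor_aug C M f x = (\<lambda>A. ?o x (BTm bim f x A))" for x
    by (simp add: btensor_aug_def fun_eq_iff lin_def)
  have fc: "f (x, y) b \<in> car bim (x, y)" if "x \<in> Obj C" "y \<in> Obj C" "b \<in> car B (x, y)" for x y b
    using nat_transD(2)[OF h, of "(x, y)"] that by simp
  show 1: "btensor_aug C M f x \<in> lhom (sp (BT B) x) (sp M x)" if x: "x \<in> Obj C" for x
    unfolding a by (rule lhom_comp[OF ma[OF x] ol[OF x]])
  show 2: "btensor_aug C M f x (bt B x y b w) = lin (sp M x) (\<lambda>al. act M al w) (f (x, y) b)"
    if x: "x \<in> Obj C" and *: "y \<in> Obj C" "b \<in> car B (x, y)" "w \<in> car M y" for x y b w
    unfolding a mg[OF x *] by (rule og[OF x *(1) fc[OF x *(1,2)] *(3)])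
  show "nat_trans C (BT B) M (btensor_aug C M f)"
  proof (rule nat_transI[OF 1])
    fix g z assume g: "g \<in> Arr C" and z: "z \<in> car (BT B) (Dom C g)"
    note o = C.Dom_Obj[OF g] C.Cod_Obj[OF g]
    show "btensor_aug C M f (Cod C g) (act (BT B) g z) = act M g (btensor_aug C M f (Dom C g) z)"
    proof (rule BT_ext[OF B o(1) lhom_comp[OF BT_act(1)[OF B g] 1[OF o(2)]] lhom_comp[OF 1[OF o(1)] fmodD(2)[OF M g]] Mv[OF o(2)] _ z])
      fix y b w assume *: "y \<in> Obj C" "b \<in> car B (Dom C g, y)" "w \<in> car M y"
      have k: "al \<in> Arr C \<and> Dom C al = y \<and> Cod C al = Dom C g" if "al \<in> keys (f (Dom C g, y) b)" for al
        using that fc[OF o(1) *(1,2)] by auto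
      have eq: "act M (Comp C g (Comp C al (Ident C y))) w = act M g (act M al w)"
        "act M g (act M al w) \<in> car M (Cod C g)" if "al \<in> keys (f (Dom C g, y) b)" for al
        using k[OF that] * g C.Comp_Ident_right[of al] fmodD(5)[OF M, of al g w] fmodD(3)[OF M, of al w] fmodD(3)[OF M g, of "act M al w"]
        by auto
      have n: "f (Cod C g, y) (act B (g, Ident C y) b) = push (\<lambda>al. Comp C g (Comp C al (Ident C y))) (f (Dom C g, y) b)"
        using nat_transD(3)[OF h, of "(g, Ident C y)" b] * g by (simp add: C.Ident_Arr C.Dom_Ident C.Cod_Ident)
      have "lin (sp M (Cod C g)) (\<lambda>al. act M al w) (f (Cod C g, y) (act B (g, Ident C y) b))
          = lin (sp M (Cod C g)) (\<lambda>al. act M (Comp C g (Comp C al (Ident C y))) w) (f (Dom C g, y) b)"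
        unfolding n by (rule lin_push[OF Mv[OF o(2)]]) (simp add: eq)
      also have "\<dots> = lin (sp M (Cod C g)) (\<lambda>al. act M g (act M al w)) (f (Dom C g, y) b)"
        by (rule lin_cong[OF Mv[OF o(2)]]) (simp_all add: eq)
      also have "\<dots> = act M g (lin (sp M (Dom C g)) (\<lambda>al. act M al w) (f (Dom C g, y) b))"
        by (rule lin_comp[OF fmodD(2)[OF M g] Mv[OF o(1)] Mv[OF o(2)] ac[OF _ *(3)], symmetric])
           (use fc[OF o(1) *(1,2)] in auto)
      finally show "btensor_aug C M f (Cod C g) (act (BT B) g (bt B (Dom C g) y b w))
          = act M g (btensor_aug C M f (Dom C g) (bt B (Dom C g) y b w))"
        unfolding BT_act(2)[OF B g *] 2[OF o(1) *] 2[OF o(2) *(1) lhomD(1)[OF B_left[OF B *(1) g] *(2)] *(3)] .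
    qed
  qed
qed

text \<open>Fixing the first variable turns a projective resolution of \<open>kC\<close> into one of the functor
  \<open>k Hom(-, x)\<close>, which is projective, so it splits naturally in the second variable.\<close>

lemma BT_resolution:
  assumes P: "proj_resolution E bim P"
  shows "resolution C M (BTc P)"
proof (rule resolutionI[OF C.finite_category_axioms M]; (unfold Fm_aug_simps)?)
  have R: "resolution E bim P" using P by (simp add: proj_resolution_def)
  note fP = resolutionD(2)[OF R] and dP = resolutionD(3)[OF R] and aP = resolutionD(4)[OF R]
  note au = BT_aug[OF fP aP]
  show "fmod C (BT (mods P n))" for n by (rule BT_fmod[OF fP])
  show "nat_trans C (BT (mods P (Suc n))) (BT (mods P n)) (BTm (mods P n) (bdry P n))" for n
    by (rule BT_map_nat(1)[OF fP fP dP])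
  show "nat_trans C (BT (mods P 0)) M (btensor_aug C M (aug P))" by (rule au(3))
  fix x assume x: "x \<in> Obj C"
  note ix = C.Ident_Arr[OF x] C.Dom_Ident[OF x] C.Cod_Ident[OF x]
  have ii: "Comp C (Ident C x) (Ident C x) = Ident C x" using C.Comp_Ident_right[OF ix(1)] ix by simp
  let ?U = "\<lambda>y. {al \<in> Arr C. Dom C al = y \<and> Cod C al = x}"
  interpret S: subcategory E "Kx x" by (rule Kx_subcategory[OF x])
  have PS: "proj_resolution (Kx x) bim P"
    unfolding proj_resolution_def
  proof (intro conjI allI)
    \<comment> \<open>An arrow \<open>(mu, ga)\<close> of the enveloping category ending over
      \<open>x\<close> is \<open>(mu, id)\<close> followed by \<open>(id, ga)\<close>, and the
      second factor belongs to \<open>Kx x\<close>.\<close>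
    show "projective (Kx x) (mods P n)" for n
    proof (rule S.sub_projective[where hh = "\<lambda>(mu, ga). (Ident C x, ga)" and jj = "\<lambda>(mu, ga). (mu, Ident C (Cod C ga))"])
      show "projective E (mods P n)" using P by (simp add: proj_resolution_def)
      fix f assume f: "f \<in> Arr E"
      obtain mu ga where m: "f = (mu, ga)" "mu \<in> Arr C" "ga \<in> Arr C" using f by auto
      note i = C.Cod_Obj[OF m(3)]
      show "(case f of (mu, ga) => (Ident C x, ga)) \<in> Arr (Kx x) \<and> (case f of (mu, ga) => (mu, Ident C (Cod C ga))) \<in> Arr E \<and>
        Dom E (case f of (mu, ga) => (Ident C x, ga)) = Cod E (case f of (mu, ga) => (mu, Ident C (Cod C ga))) \<and>
        Comp E (case f of (mu, ga) => (Ident C x, ga)) (case f of (mu, ga) => (mu, Ident C (Cod C ga))) = f"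
        if "Cod E f \<in> Obj (Kx x)"
        using that m C.Ident_Arr[OF i] C.Dom_Ident[OF i] C.Cod_Ident[OF i] ix C.Comp_Ident_left[of mu] C.Comp_Ident_left[of ga] by simp
      fix k assume "k \<in> Arr (Kx x)" "Dom E k = Cod E f"
      then obtain ga' where k: "k = (Ident C x, ga')" "ga' \<in> Arr C" "x = Cod C mu" "Cod C ga' = Dom C ga" using m ix by auto
      show "(case Comp E k f of (mu, ga) => (Ident C x, ga)) = Comp E k (case f of (mu, ga) => (Ident C x, ga)) \<and>
         (case Comp E k f of (mu, ga) => (mu, Ident C (Cod C ga))) = (case f of (mu, ga) => (mu, Ident C (Cod C ga)))"
        unfolding m(1) k(1) using ii k m C.Comp_Ident_left[of mu] C.Cod_Comp[of ga' ga] by simp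
    qed
  qed (rule S.sub_resolution[OF R])
  \<comment> \<open>By the Yoneda lemma a preimage of the identity of \<open>x\<close> determines
    the splitting \<open>s\<close> of the augmentation over \<open>Kx x\<close>.\<close>
  obtain e where e: "e \<in> car (mods P 0) (x, x)" "aug P (x, x) e = single (Ident C x) (1::'k)"
    using resolution_exact(1)[OF R, of "(x, x)" "single (Ident C x) 1"] x ix by auto
  define s where "s = (\<lambda>(x', y). lin (sp (mods P 0) (x', y)) (\<lambda>al. act (mods P 0) (Ident C x, al) e))"
  have V: "vs (sp (mods P n) (x, y))" if "y \<in> Obj C" for n y using Bv[OF fP x that] .
  have ec: "act (mods P 0) (Ident C x, al) e \<in> car (mods P 0) (x, y)" if "al \<in> ?U y" for al y
    using lhomD(1)[OF B_right[OF fP x], of al e 0] that e(1) by simp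
  have sl: "s (x, y) \<in> lhom (sp bim (x, y)) (sp (mods P 0) (x, y))" if "y \<in> Obj C" for y
    unfolding s_def prod.case bimod_simps by (rule lin_lhom[OF V[OF that] ec])
  have s: "nat_trans (Kx x) bim (mods P 0) s"
  proof (rule nat_transI)
    show "s p \<in> lhom (sp bim p) (sp (mods P 0) p)" if "p \<in> Obj (Kx x)" for p using sl that by auto
    fix k b assume "k \<in> Arr (Kx x)" and b: "b \<in> car bim (Dom (Kx x) k)"
    then obtain ga where k: "k = (Ident C x, ga)" "ga \<in> Arr C" by auto
    note o = C.Dom_Obj[OF k(2)] C.Cod_Obj[OF k(2)]
    have kb: "al \<in> Arr C \<and> Dom C al = Cod C ga \<and> Cod C al = x" if "al \<in> keys b" for al
      using that b k ix by auto
    have eq: "act (mods P 0) (Ident C x, Comp C (Ident C x) (Comp C al ga)) e = act (mods P 0) k (act (mods P 0) (Ident C x, al) e)"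
      "act (mods P 0) k (act (mods P 0) (Ident C x, al) e) \<in> car (mods P 0) (x, Dom C ga)" if "al \<in> keys b" for al
      using kb[OF that] k ix ii e(1) C.Comp_Ident_left[of "Comp C al ga"] fmodD(5)[OF fP, of "(Ident C x, al)" k e 0]
        lhomD(1)[OF B_right[OF fP x k(2)], of "act (mods P 0) (Ident C x, al) e" 0] ec[of al "Cod C ga"]
      by (simp_all add: C.Comp_Arr C.Cod_Comp)
    have "s (x, Dom C ga) (act bim k b) = lin (sp (mods P 0) (x, Dom C ga))
        (\<lambda>al. act (mods P 0) (Ident C x, Comp C (Ident C x) (Comp C al ga)) e) b"
      unfolding k(1) bimod_simps s_def prod.case by (rule lin_push[OF V[OF o(1)]]) (simp add: eq)
    also have "\<dots> = lin (sp (mods P 0) (x, Dom C ga)) (\<lambda>al. act (mods P 0) k (act (mods P 0) (Ident C x, al) e)) b"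
      by (rule lin_cong[OF V[OF o(1)]]) (simp_all add: eq)
    also have "\<dots> = act (mods P 0) k (s (x, Cod C ga) b)"
      unfolding s_def prod.case k(1)
      by (rule lin_comp[OF B_right[OF fP x k(2)] V[OF o(2)] V[OF o(1)] ec, symmetric]) (use b k ix in auto)
    finally show "s (Cod (Kx x) k) (act bim k b) = act (mods P 0) k (s (Dom (Kx x) k) b)" by (simp add: k(1) ix)
  qed
  have as: "aug P p (s p b) = b" if p: "p \<in> Obj (Kx x)" and b: "b \<in> car bim p" for p b
  proof -
    obtain y where y: "p = (x, y)" "y \<in> Obj C" using p by auto
    have al: "aug P (x, y) \<in> lhom (sp (mods P 0) (x, y)) (free_space (?U y))"
      using nat_transD(1)[OF aP, of "(x, y)"] x y by simp
    have kb: "keys b \<subseteq> ?U y" using b y by simp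
    have eq: "aug P (x, y) (act (mods P 0) (Ident C x, al) e) = single al 1" if "al \<in> keys b" for al
    proof -
      have al: "al \<in> Arr C" "Dom C al = y" "Cod C al = x" using that kb by auto
      show ?thesis using nat_transD(3)[OF aP, of "(Ident C x, al)" e] al ix e C.Comp_Ident_left[of al] by simp
    qed
    have "aug P (x, y) (s (x, y) b) = lin (free_space (?U y)) (\<lambda>al. aug P (x, y) (act (mods P 0) (Ident C x, al) e)) b"
      unfolding s_def prod.case by (rule lin_comp[OF al V[OF y(2)] vs_free_space ec kb])
    also have "\<dots> = lin (free_space (?U y)) (\<lambda>al. single al 1) b"
      by (rule lin_cong[OF vs_free_space]) (use kb eq in auto)
    also have "\<dots> = b" by (rule lin_eq[where h = "\<lambda>b. b", OF lhom_id vs_free_space kb])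
    finally show ?thesis by (simp add: y)
  qed
  obtain h where h: "\<And>n. nat_trans (Kx x) (mods P n) (mods P (Suc n)) (h n)"
    "\<And>p v. p \<in> Obj (Kx x) ==> v \<in> car (mods P 0) p ==>
      v = s p (aug P p v) \<oplus>\<^bsub>sp (mods P 0) p\<^esub> bdry P 0 p (h 0 p v)"
    "\<And>n p v. p \<in> Obj (Kx x) ==> v \<in> car (mods P (Suc n)) p ==>
      v = bdry P (Suc n) p (h (Suc n) p v) \<oplus>\<^bsub>sp (mods P (Suc n)) p\<^esub> h n p (bdry P n p v)"
    by (rule contraction[OF S.K.finite_category_axioms PS s]) (rule as, assumption+, rule that, assumption+)
  let ?V = "\<lambda>n. sp (BT (mods P n)) x" and ?d = "\<lambda>n. BTm (mods P n) (bdry P n) x"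
    and ?H = "\<lambda>n. BTm (mods P (Suc n)) (h n) x" and ?S = "bt (mods P 0) x x e"
  note Mx = Mv[OF x] and dS = S.sub_nat_trans[OF dP]
  have d: "v \<in> car (mods P (Suc n)) (x, y) ==> bdry P n (x, y) v \<in> car (mods P n) (x, y)"
    and hc: "v \<in> car (mods P n) (x, y) ==> h n (x, y) v \<in> car (mods P (Suc n)) (x, y)"
    and ac: "v \<in> car (mods P 0) (x, y) ==> aug P (x, y) v \<in> carrier (free_space (?U y))"
    if "y \<in> Obj C" for n y v
    using nat_transD(2)[OF dP, of "(x, y)"] nat_transD(2)[OF h(1), of "(x, y)"] nat_transD(2)[OF aP, of "(x, y)"] x that
    by (simp_all del: free_space_simps)
  have dl: "?d n \<in> lhom (?V (Suc n)) (?V n)" and Hl: "?H n \<in> lhom (?V n) (?V (Suc n))" for n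
    by (rule BT_map(1)[OF fP fP x dS]) (rule BT_map(1)[OF fP fP x h(1)])
  have dtg: "y \<in> Obj C ==> v \<in> car (mods P (Suc n)) (x, y) ==> w \<in> car M y ==>
      ?d n (bt (mods P (Suc n)) x y v w) = bt (mods P n) x y (bdry P n (x, y) v) w"
    and Htg: "y \<in> Obj C ==> v \<in> car (mods P n) (x, y) ==> w \<in> car M y ==>
      ?H n (bt (mods P n) x y v w) = bt (mods P (Suc n)) x y (h n (x, y) v) w" for n y v w
    by (rule BT_map(2)[OF fP fP x dS], assumption+) (rule BT_map(2)[OF fP fP x h(1)], assumption+)
  have Sl: "?S \<in> lhom (sp M x) (?V 0)" by (rule bt_right[OF fP x x e(1)])
  note tl = bt_left[OF fP x]
  \<comment> \<open>After tensoring, the splitting is the map taking \<open>w\<close> to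
    \<open>e \<otimes> w\<close>. Moving \<open>al\<close> across the tensor sign turns
    \<open>e \<otimes> al w\<close> into \<open>e al \<otimes> w\<close>, which is the value of
    \<open>s\<close> at \<open>al\<close> tensored with \<open>w\<close>.\<close>
  have c0: "z = ?S (btensor_aug C M (aug P) x z) \<oplus>\<^bsub>?V 0\<^esub> ?d 0 (?H 0 z)" if z: "z \<in> carrier (?V 0)" for z
  proof (rule BT_ext[OF fP x lhom_id lhom_add[OF lhom_comp[OF au(1)[OF x] Sl] lhom_comp[OF Hl dl]] _ _ z])
    fix y v w assume y: "y \<in> Obj C" and v: "v \<in> car (mods P 0) (x, y)" and w: "w \<in> car M y"
    note av = ac[OF y v, unfolded free_space_simps]
    have wc: "act M al w \<in> car M x" if "al \<in> ?U y" for al using fmodD(3)[OF M, of al w] that w by auto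
    have bc: "bt (mods P 0) x y (act (mods P 0) (Ident C x, al) e) w \<in> carrier (?V 0)" if "al \<in> ?U y" for al
      by (rule bt_closed[OF fP x y ec[OF that] w])
    have "?S (lin (sp M x) (\<lambda>al. act M al w) (aug P (x, y) v)) = lin (?V 0) (\<lambda>al. ?S (act M al w)) (aug P (x, y) v)"
      by (rule lin_comp[OF Sl Mx BT_vs[OF fP x] wc av])
    also have "\<dots> = lin (?V 0) (\<lambda>al. bt (mods P 0) x y (act (mods P 0) (Ident C x, al) e) w) (aug P (x, y) v)"
    proof (rule lin_cong[OF BT_vs[OF fP x]])
      fix al assume "al \<in> keys (aug P (x, y) v)"
      then have al: "al \<in> ?U y" using av by blast
      show "bt (mods P 0) x y (act (mods P 0) (Ident C x, al) e) w \<in> carrier (?V 0)" by (rule bc[OF al])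
      show "?S (act M al w) = bt (mods P 0) x y (act (mods P 0) (Ident C x, al) e) w"
        using bt_rel[OF fP x, of al e 0 w] al e(1) w by auto
    qed
    also have "\<dots> = bt (mods P 0) x y (s (x, y) (aug P (x, y) v)) w"
      unfolding s_def prod.case by (rule lin_comp[OF tl[OF y w] V[OF y] BT_vs[OF fP x] ec av, symmetric])
    finally have A: "?S (lin (sp M x) (\<lambda>al. act M al w) (aug P (x, y) v)) = bt (mods P 0) x y (s (x, y) (aug P (x, y) v)) w" .
    have "s (x, y) (aug P (x, y) v) \<in> car (mods P 0) (x, y)"
      by (rule lhomD(1)[OF sl[OF y]]) (use av in simp)
    then have B: "bt (mods P 0) x y v w = bt (mods P 0) x y (s (x, y) (aug P (x, y) v)) w
        \<oplus>\<^bsub>?V 0\<^esub> bt (mods P 0) x y (bdry P 0 (x, y) (h 0 (x, y) v)) w"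
      using arg_cong[OF h(2)[of "(x, y)" v], of "\<lambda>v. bt (mods P 0) x y v w"] y v
        lhomD(2)[OF tl[OF y w] _ d[OF y hc[OF y v]]] by simp
    show "bt (mods P 0) x y v w = ?S (btensor_aug C M (aug P) x (bt (mods P 0) x y v w)) \<oplus>\<^bsub>?V 0\<^esub> ?d 0 (?H 0 (bt (mods P 0) x y v w))"
      unfolding au(2)[OF x y v w] Htg[OF y v w] dtg[OF y hc[OF y v] w] A by (rule B)
  qed (rule BT_vs[OF fP x])+
  have c1: "z = ?d (Suc n) (?H (Suc n) z) \<oplus>\<^bsub>?V (Suc n)\<^esub> ?H n (?d n z)" if z: "z \<in> carrier (?V (Suc n))" for n z
  proof (rule BT_ext[OF fP x lhom_id lhom_add[OF lhom_comp[OF Hl dl] lhom_comp[OF dl Hl]] _ _ z])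
    fix y v w assume y: "y \<in> Obj C" and v: "v \<in> car (mods P (Suc n)) (x, y)" and w: "w \<in> car M y"
    have B: "bt (mods P (Suc n)) x y v w = bt (mods P (Suc n)) x y (bdry P (Suc n) (x, y) (h (Suc n) (x, y) v)) w
        \<oplus>\<^bsub>?V (Suc n)\<^esub> bt (mods P (Suc n)) x y (h n (x, y) (bdry P n (x, y) v)) w"
      using arg_cong[OF h(3)[of "(x, y)" v n], of "\<lambda>v. bt (mods P (Suc n)) x y v w"] y v
        lhomD(2)[OF tl[OF y w] d[OF y hc[OF y v]] hc[OF y d[OF y v]]] by simp
    show "bt (mods P (Suc n)) x y v w = ?d (Suc n) (?H (Suc n) (bt (mods P (Suc n)) x y v w))
        \<oplus>\<^bsub>?V (Suc n)\<^esub> ?H n (?d n (bt (mods P (Suc n)) x y v w))"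
      unfolding Htg[OF y v w] dtg[OF y hc[OF y v] w] dtg[OF y v w] Htg[OF y d[OF y v] w] by (rule B)
  qed (rule BT_vs[OF fP x])+
  note ex = exact_of_contraction[of ?V "sp M x" ?d ?H ?S "btensor_aug C M (aug P) x",
      OF BT_vs[OF fP x] Mx dl Hl Sl c0 c1]
  show "\<exists>v\<in>carrier (?V 0). btensor_aug C M (aug P) x v = w" if w: "w \<in> car M x" for w
    by (rule bexI[of _ "?S w"])
       (simp_all add: au(2)[OF x x e(1) w] e(2) lin_single_at[OF Mx] fmodD(4)[OF M x w] vs_smult(4)[OF Mx w] w lhomD(1)[OF Sl w])
  show "\<exists>u\<in>carrier (?V 1). z = ?d 0 u" if "z \<in> carrier (?V 0)" "btensor_aug C M (aug P) x z = \<zero>\<^bsub>sp M x\<^esub>" for z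
    using ex(1) that by blast
  show "\<exists>u\<in>carrier (?V (Suc (Suc n))). z = ?d (Suc n) u" if "z \<in> carrier (?V (Suc n))" "?d n z = \<zero>\<^bsub>?V n\<^esub>" for z n
    using ex(2) that by blast
  have z: "bt (mods P n) x y \<zero>\<^bsub>sp (mods P n) (x, y)\<^esub> w = \<zero>\<^bsub>?V n\<^esub>" if "y \<in> Obj C" "w \<in> car M y" for n y w
    by (rule lhom_zero[OF tl[OF that] V[OF that(1)] BT_vs[OF fP x]])
  show "?d n (?d (Suc n) q) = \<zero>\<^bsub>?V n\<^esub>" if "q \<in> carrier (?V (Suc (Suc n)))" for n q
    by (rule BT_ext[OF fP x lhom_comp[OF dl dl] lhom_const_zero[OF BT_vs[OF fP x]] BT_vs[OF fP x] _ that])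
       (simp add: dtg d x resolution_exact(3)[OF R] z)
  show "btensor_aug C M (aug P) x (?d 0 q) = \<zero>\<^bsub>sp M x\<^esub>" if "q \<in> carrier (?V 1)" for q
  proof (rule BT_ext[OF fP x lhom_comp[OF dl au(1)[OF x]] lhom_const_zero[OF Mx] Mx _ that[unfolded One_nat_def]])
    fix y v w assume y: "y \<in> Obj C" and v: "v \<in> car (mods P (Suc 0)) (x, y)" and w: "w \<in> car M y"
    have "aug P (x, y) (bdry P 0 (x, y) v) = 0"
      using resolution_exact(2)[OF R, of "(x, y)" v] x y v by simp
    then show "btensor_aug C M (aug P) x (?d 0 (bt (mods P (Suc 0)) x y v w)) = \<zero>\<^bsub>sp M x\<^esub>"
      unfolding dtg[OF y v w] au(2)[OF x y d[OF y v] w] by (simp add: lin_def abelian_monoid.finsum_empty[OF vs_comm_monoid(1)[OF Mx]])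
  qed
qed

lemma BT_ext_functor:
  fixes P :: "('o \<times> 'o, 'm \<times> 'm, 'k, 'v, 'm \<Rightarrow>\<^sub>0 'k) aug_complex" and Q :: "('o, 'm, 'k, 'q, 'w) aug_complex"
  assumes P: "proj_resolution E bim P" and Q: "proj_resolution C M Q"
  shows "ext_functor E bim P C M Q BT BTm (btensor_aug C M)"
proof (rule ext_functor.intro)
  note CC = EC
  have fP: "fmod E (mods P n)" for n using P by (auto simp: proj_resolution_def resolution_def)
  show "finite_category E" "finite_category C" "proj_resolution E bim P" "proj_resolution C M Q"
    "resolution C M (BTc P)"
    using P Q CC C.finite_category_axioms BT_resolution by auto
  note au = BT_aug[OF fP]
  show "nat_trans C (BT (mods P n)) M (btensor_aug C M f)" if "nat_trans E (mods P n) bim f" for n f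
    by (rule au(3)[OF that])
  fix n and f g :: "'o \<times> 'o => 'v => 'm \<Rightarrow>\<^sub>0 'k" and x and z
  assume f: "nat_trans E (mods P n) bim f" and x: "x \<in> Obj C" and z: "z \<in> car (BT (mods P n)) x"
  note V = Mv[OF x]
  have ac: "act M al w \<in> car M x" if "al \<in> {al \<in> Arr C. Dom C al = y \<and> Cod C al = x}" "w \<in> car M y" for al y w
    using that fmodD(3)[OF M] by auto
  have ll: "lin (sp M x) (\<lambda>al. act M al w) \<in> lhom (free_space {al \<in> Arr C. Dom C al = y \<and> Cod C al = x}) (sp M x)"
    if "w \<in> car M y" for y w
    by (rule lin_lhom[OF V ac[OF _ that]])
  have fc: "keys (f (x, y) b) \<subseteq> {al \<in> Arr C. Dom C al = y \<and> Cod C al = x}"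
    if "y \<in> Obj C" "b \<in> car (mods P n) (x, y)" "nat_trans E (mods P n) bim f" for f y b
    using nat_transD(2)[OF that(3), of "(x, y)" b] that x by simp
  show "btensor_aug C M (\<lambda>p v. c \<odot>\<^bsub>sp bim p\<^esub> f p v) x z = c \<odot>\<^bsub>sp M x\<^esub> btensor_aug C M f x z" for c
  proof (rule BT_ext[OF fP x au(1)[OF nat_trans_scale[OF CC f bimod_fmod] x] lhom_scale[OF au(1)[OF f x] V] V _ z])
    fix y b w assume *: "y \<in> Obj C" "b \<in> car (mods P n) (x, y)" "w \<in> car M y"
    show "btensor_aug C M (\<lambda>p v. c \<odot>\<^bsub>sp bim p\<^esub> f p v) x (bt (mods P n) x y b w) = c \<odot>\<^bsub>sp M x\<^esub> btensor_aug C M f x (bt (mods P n) x y b w)"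
      using lhomD(3)[OF ll[OF *(3)], of "f (x, y) b" c] fc[OF *(1,2) f]
      unfolding au(2)[OF nat_trans_scale[OF CC f bimod_fmod] x *] au(2)[OF f x *] by simp
  qed
  assume g: "nat_trans E (mods P n) bim g"
  show "btensor_aug C M f x z = btensor_aug C M g x z"
    if "\<And>y v. y \<in> Obj E ==> v \<in> car (mods P n) y ==> f y v = g y v"
    by (rule BT_ext[OF fP x au(1)[OF f x] au(1)[OF g x] V _ z]) (simp add: au(2)[OF f x] au(2)[OF g x] that x)
  show "btensor_aug C M (\<lambda>p v. f p v \<oplus>\<^bsub>sp bim p\<^esub> g p v) x z = btensor_aug C M f x z \<oplus>\<^bsub>sp M x\<^esub> btensor_aug C M g x z"
  proof (rule BT_ext[OF fP x au(1)[OF nat_trans_add[OF CC f g bimod_fmod] x] lhom_add[OF au(1)[OF f x] au(1)[OF g x] V] V _ z])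
    fix y b w assume *: "y \<in> Obj C" "b \<in> car (mods P n) (x, y)" "w \<in> car M y"
    show "btensor_aug C M (\<lambda>p v. f p v \<oplus>\<^bsub>sp bim p\<^esub> g p v) x (bt (mods P n) x y b w)
        = btensor_aug C M f x (bt (mods P n) x y b w) \<oplus>\<^bsub>sp M x\<^esub> btensor_aug C M g x (bt (mods P n) x y b w)"
      using lhomD(2)[OF ll[OF *(3)], of "f (x, y) b" "g (x, y) b"] fc[OF *(1,2) f] fc[OF *(1,2) g]
      unfolding au(2)[OF nat_trans_add[OF CC f g bimod_fmod] x *] au(2)[OF f x *] au(2)[OF g x *] by simp
  qed
next
  note CC = EC
  have fP: "fmod E (mods P n)" for n using P by (auto simp: proj_resolution_def resolution_def)
  note au = BT_aug[OF fP]
  show "nat_trans C (BT (mods P n)) (BT (mods P m)) (BTm (mods P m) ph)"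
    if "nat_trans E (mods P n) (mods P m) ph" for n m ph
    by (rule BT_map_nat(1)[OF fP fP that])
  note ml = nat_transD(1)[OF BT_map_nat(1)[OF fP fP]] and mg = BT_map_nat(2)[OF fP fP]
  fix n m ph x z assume ph: "nat_trans E (mods P n) (mods P m) ph" and x: "x \<in> Obj C"
    and z: "z \<in> car (BT (mods P n)) x"
  have cl: "ph (x, y) b \<in> car (mods P m) (x, y)"
    if "nat_trans E (mods P n) (mods P m) ph" "y \<in> Obj C" "b \<in> car (mods P n) (x, y)" for n m ph y b
    using nat_transD(2)[OF that(1), of "(x, y)" b] that x by simp
  show "btensor_aug C M f x (BTm (mods P m) ph x z) = btensor_aug C M (\<lambda>y v. f y (ph y v)) x z"
    if f: "nat_trans E (mods P m) bim f" for f
    by (rule BT_ext[OF fP x lhom_comp[OF ml[OF ph x] au(1)[OF f x]] au(1)[OF nat_trans_comp[OF CC ph f] x] Mv[OF x] _ z])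
       (simp add: mg[OF ph x] au(2)[OF f x] au(2)[OF nat_trans_comp[OF CC ph f] x] cl[OF ph])
  show "BTm (mods P l) ps x (BTm (mods P m) ph x z) = BTm (mods P l) ps' x (BTm (mods P m') ph' x z)"
    if ps: "nat_trans E (mods P m) (mods P l) ps" and ph': "nat_trans E (mods P n) (mods P m') ph'"
      and ps': "nat_trans E (mods P m') (mods P l) ps'"
      and eq: "\<And>y v. y \<in> Obj E ==> v \<in> car (mods P n) y ==> ps y (ph y v) = ps' y (ph' y v)"
    for m' l ps ph' ps'
    by (rule BT_ext[OF fP x lhom_comp[OF ml[OF ph x] ml[OF ps x]] lhom_comp[OF ml[OF ph' x] ml[OF ps' x]] BT_vs[OF fP x] _ z])
       (simp add: mg[OF ph x] mg[OF ps x] mg[OF ph' x] mg[OF ps' x] cl[OF ph] cl[OF ph'] eq x)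
qed

end

section \<open>Change of resolution\<close>

lemma lifts_comp:
  assumes D: "finite_category D" and ps: "ps \<in> lifts D P 0 Q (aug P)" and ph: "ph \<in> lifts D Q 0 Y (aug Q)"
  shows "(\<lambda>i x v. ph i x (ps i x v)) \<in> lifts D P 0 Y (aug P)"
proof (rule liftsI)
  note c = nat_transD(2)[OF liftsD(1)[OF ps], unfolded add_0]
  show "nat_trans D (mods P (0 + i)) (mods Y i) (\<lambda>x v. ph i x (ps i x v))" for i
    using nat_trans_comp[OF D liftsD(1)[OF ps] liftsD(1)[OF ph], of i] by simp
  show "aug Y x (ph 0 x (ps 0 x v)) = aug P x v" if "x \<in> Obj D" "v \<in> car (mods P 0) x" for x v
    using liftsD(2)[OF ps that] liftsD(2)[OF ph that(1) c[OF that]] by simp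
  show "bdry Y i x (ph (Suc i) x (ps (Suc i) x v)) = ph i x (ps i x (bdry P (0 + i) x v))"
    if "x \<in> Obj D" "v \<in> car (mods P (Suc (0 + i))) x" for i x v
    using liftsD(3)[OF ps that(1), of v i] liftsD(3)[OF ph that(1), of "ps (Suc i) x v" i] that(2) c[OF that(1), of v "Suc i"] by simp
qed

lemma lifts_id: "(\<lambda>i x v. v) \<in> lifts D P 0 P (aug P)"
  by (rule liftsI) (auto simp: nat_trans_id)

context
  fixes D :: "('o, 'm) category" and N :: "('o, 'm, 'k::field, 'z) kfunctor"
    and P :: "('o, 'm, 'k, 'v, 'z) aug_complex" and Q :: "('o, 'm, 'k, 'q, 'z) aug_complex" and L :: "('o, 'm, 'k, 'w) kfunctor"
    and ph
  assumes D: "finite_category D" and P: "proj_resolution D N P" and Q: "proj_resolution D N Q" and L: "fmod D L"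
    and ph: "ph \<in> lifts D Q 0 P (aug Q)"
begin

lemma RPQ: "resolution D N P" "resolution D N Q"
  using P Q by (auto simp: proj_resolution_def)

text \<open>A lift \<open>ps\<close> in the opposite direction exists as \<open>P\<close> is
  projective, and \<open>ph\<close> after \<open>ps\<close> lifts the same augmentation as the
  identity of \<open>P\<close>; hence pulling back along \<open>ph\<close> can be undone up to
  coboundaries.\<close>

lemma comparison_inj:
  assumes f: "f \<in> cocycles D P L n" and g: "g \<in> cocycles D P L n"
    and c: "cohom D Q L n (\<lambda>x v. f x (ph n x v)) (\<lambda>x v. g x (ph n x v))"
  shows "cohom D P L n f g"
proof -
  obtain ps where ps: "ps \<in> lifts D P 0 Q (aug P)" by (rule lifts_exist[OF D P RPQ(2) aug_cocycle[OF RPQ(1)]])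
  have id: "cohom D P L n h (\<lambda>x v. h x (ph n x (ps n x v)))" if "h \<in> cocycles D P L n" for h
    using lifts_unique[OF D P RPQ(1) L lifts_comp[OF D ps ph] lifts_id that] by simp
  note tr = cohom_trans[OF D RPQ(1) L]
  show ?thesis
    using tr[OF id[OF f] tr[OF cohom_comp[OF D P RPQ(2) L ps c, unfolded add_0] cohom_sym[OF D RPQ(1) L id[OF g]]]] .
qed

lemma comparison_surj:
  assumes g: "g \<in> cocycles D Q L n"
  obtains f where "f \<in> cocycles D P L n" "cohom D Q L n (\<lambda>x v. f x (ph n x v)) g"
proof -
  obtain ps where ps: "ps \<in> lifts D P 0 Q (aug P)" by (rule lifts_exist[OF D P RPQ(2) aug_cocycle[OF RPQ(1)]])
  show thesis
  proof (rule that)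
    show "(\<lambda>x v. g x (ps n x v)) \<in> cocycles D P L n" using cocycle_comp[OF D P RPQ(2) L ps g] by simp
    show "cohom D Q L n (\<lambda>x v. g x (ps n x (ph n x v))) g"
      using lifts_unique[OF D Q RPQ(2) L lifts_id lifts_comp[OF D ph ps] g] by simp
  qed
qed

end

text \<open>When the image complex is itself projective, pulling back along the comparison with
  \<open>Q\<close> is bijective on classes. Only the passage from \<open>f\<close> to
  \<open>Fa f\<close> is then left to test, which the last two hypotheses do degree by
  degree.\<close>

lemma (in ext_functor) induced_map_bij:
  assumes PY: "\<And>n. projective E (F (mods P n))"
    and inj: "\<And>n f g. f \<in> cocycles D P M n ==> g \<in> cocycles D P M n ==> cohom E Y N n (Fa f) (Fa g) ==> cohom D P M n f g"
    and surj: "\<And>n g. g \<in> cocycles E Y N n ==> \<exists>f\<in>cocycles D P M n. cohom E Y N n (Fa f) g"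
  shows "bij_betw (induced_map E N Q Y Fa) (carrier (ext_algebra D P M)) (carrier (ext_algebra E Q N))"
proof -
  obtain ph where ph: "ph \<in> lifts E Q 0 Y (aug Q)" by (rule lift_exists)
  have PRY: "proj_resolution E N Y" using PY Y by (simp add: proj_resolution_def Y_simps)
  note eqD = coh_class_eq_iff[OF D RP fM] and eqE = coh_class_eq_iff[OF E RQ fN]
    and cD = ext_space_simps(1)[OF D RP fM] and cE = ext_space_simps(1)[OF E RQ fN]
  have i: "A = B" if AB: "A \<in> carrier (ext_space D P M n)" "B \<in> carrier (ext_space D P M n)" "H n A = H n B" for n A B
  proof -
    from AB obtain f g where f: "f \<in> cocycles D P M n" "A = coh_class D P M n f"
      and g: "g \<in> cocycles D P M n" "B = coh_class D P M n g" unfolding cD by blast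
    have "cohom E Q N n (\<lambda>x v. Fa f x (ph n x v)) (\<lambda>x v. Fa g x (ph n x v))"
      using AB(3) unfolding f(2) g(2) H_eq[OF f(1) ph] H_eq[OF g(1) ph] eqE[OF H_cocycle[OF f(1) ph] H_cocycle[OF g(1) ph]] .
    then have "cohom D P M n f g"
      by (rule inj[OF f(1) g(1) comparison_inj[OF E PRY Q fN ph Fa_cocycle[OF f(1)] Fa_cocycle[OF g(1)]]])
    then show ?thesis unfolding f(2) g(2) eqD[OF f(1) g(1)] .
  qed
  have s: "\<exists>A\<in>carrier (ext_space D P M n). H n A = B" if B: "B \<in> carrier (ext_space E Q N n)" for n B
  proof -
    from B obtain g where g: "g \<in> cocycles E Q N n" "B = coh_class E Q N n g" unfolding cE by blast
    obtain g' where g': "g' \<in> cocycles E Y N n" "cohom E Q N n (\<lambda>x v. g' x (ph n x v)) g"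
      by (rule comparison_surj[OF E PRY Q fN ph g(1)])
    obtain f where f: "f \<in> cocycles D P M n" "cohom E Y N n (Fa f) g'" using surj[OF g'(1)] by blast
    have "cohom E Q N n (\<lambda>x v. Fa f x (ph n x v)) g"
      by (rule cohom_trans[OF E RQ fN cohom_comp[OF E Q Y fN ph f(2), unfolded add_0] g'(2)])
    then have "H n (coh_class D P M n f) = B"
      unfolding g(2) H_eq[OF f(1) ph] eqE[OF H_cocycle[OF f(1) ph] g(1)] .
    then show ?thesis using f(1) cD by blast
  qed
  have z: "H n \<zero>\<^bsub>ext_space D P M n\<^esub> = \<zero>\<^bsub>ext_space E Q N n\<^esub>" for n
    by (rule lhom_zero[OF H_lhom vs_ext_space[OF D RP fM] vs_ext_space[OF E RQ fN]])
  have z': "\<zero>\<^bsub>ext_space D P M n\<^esub> \<in> carrier (ext_space D P M n)" for n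
    by (rule vs_closed(1)[OF vs_ext_space[OF D RP fM]])
  show ?thesis
    unfolding bij_betw_def
  proof (intro conjI inj_onI equalityI subsetI)
    fix c d assume "c \<in> carrier (ext_algebra D P M)" "d \<in> carrier (ext_algebra D P M)"
      "induced_map E N Q Y Fa c = induced_map E N Q Y Fa d"
    then have "c n = d n" for n by (intro i[of _ n]) (simp_all add: ext_algebra_def fun_eq_iff induced_map_H)
    then show "c = d" by blast
  next
    fix e assume "e \<in> induced_map E N Q Y Fa ` carrier (ext_algebra D P M)"
    then show "e \<in> carrier (ext_algebra E Q N)"
      using induced_map_hom by (auto simp: algebra_hom_def ring_hom_def)
  next
    fix e assume e: "e \<in> carrier (ext_algebra E Q N)"
    then have "\<forall>n. \<exists>A\<in>carrier (ext_space D P M n). H n A = e n" using s by (simp add: ext_algebra_def)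
    then obtain c where c: "\<And>n. c n \<in> carrier (ext_space D P M n)" "\<And>n. H n (c n) = e n" by metis
    \<comment> \<open>The preimage is chosen degree by degree; injectivity makes it vanish wherever
      \<open>e\<close> does, so it has finitely many nonzero components.\<close>
    have "{n. c n \<noteq> \<zero>\<^bsub>ext_space D P M n\<^esub>} \<subseteq> {n. e n \<noteq> \<zero>\<^bsub>ext_space E Q N n\<^esub>}"
      using i[OF c(1) z'] z c(2) by auto
    then have "c \<in> carrier (ext_algebra D P M)"
      using c(1) e finite_subset by (auto simp: ext_algebra_def)
    moreover have "induced_map E N Q Y Fa c = e" by (simp add: fun_eq_iff induced_map_H c(2))
    ultimately show "e \<in> induced_map E N Q Y Fa ` carrier (ext_algebra D P M)" by blast
  qed
qed

lemma identity_image: "image_complex (\<lambda>G. G) (\<lambda>_ et. et) (\<lambda>f. f) P = P"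
  by (simp add: image_complex_def)

text \<open>Change of resolution is the map induced by the identity functor, so
  \<open>to_bar\<close> inherits multiplicativity and bijectivity from the general results.\<close>

lemma identity_ext_functor:
  assumes D: "finite_category D" and P: "proj_resolution D M P" and Q: "proj_resolution D M Q"
  shows "ext_functor D M P D M Q (\<lambda>G. G) (\<lambda>_ et. et) (\<lambda>f. f)"
proof (rule ext_functor.intro)
  show "resolution D M (image_complex (\<lambda>G. G) (\<lambda>_ et. et) (\<lambda>f. f) P)"
    unfolding identity_image using P by (simp add: proj_resolution_def)
qed (use D P Q in auto)

context finite_category
begin

lemma to_bar_facts:
  fixes P :: "('o, 'm, 'k::field, 'v, 'k) aug_complex"
  assumes P: "proj_resolution C const_mod P"
  shows "to_bar C P \<in> algebra_hom (ext_algebra C P const_mod) (ext_algebra C (bar C) const_mod)"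
    and "bij_betw (to_bar C P) (carrier (ext_algebra C P const_mod)) (carrier (ext_algebra C (bar C) const_mod))"
proof -
  have PK: "resolution C const_mod P" "fmod C (const_mod :: ('o, 'm, 'k, 'k) kfunctor)"
    using P fmod_const_mod by (auto simp: proj_resolution_def)
  interpret ext_functor C const_mod P C const_mod "bar C" "\<lambda>G. G" "\<lambda>_ et. et" "\<lambda>f. f"
    by (rule identity_ext_functor[OF finite_category_axioms P bar_resolution])
  have t: "to_bar C P = induced_map C const_mod (bar C) P (\<lambda>f. f)" by (simp add: to_bar_def fun_eq_iff)
  show "to_bar C P \<in> algebra_hom (ext_algebra C P const_mod) (ext_algebra C (bar C) const_mod)"
    using induced_map_hom unfolding t identity_image .
  show "bij_betw (to_bar C P) (carrier (ext_algebra C P const_mod)) (carrier (ext_algebra C (bar C) const_mod))"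
    using induced_map_bij cohom_eq[OF finite_category_axioms PK] P
    unfolding t identity_image by (fastforce simp: proj_resolution_def)
qed

end

section \<open>Left Kan extensions from the category of factorizations\<close>

lemma fact_simps [simp]:
  "Obj (fact_cat C) = Arr C"
  "(al, mu, ga) \<in> Arr (fact_cat C) \<longleftrightarrow> al \<in> Arr C \<and> mu \<in> Arr C \<and> ga \<in> Arr C \<and> Dom C mu = Cod C al \<and> Cod C ga = Dom C al"
  "Dom (fact_cat C) (al, mu, ga) = al" "Cod (fact_cat C) (al, mu, ga) = Comp C mu (Comp C al ga)"
  "Ident (fact_cat C) al = (al, Ident C (Cod C al), Ident C (Dom C al))"
  "Comp (fact_cat C) (be, mu', ga') (al, mu, ga) = (al, Comp C mu' mu, Comp C ga ga')"
  by (simp_all add: fact_cat_def)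

lemma fact_functor_simps [simp]:
  "omap (fact_target C) = Cod C" "amap (fact_target C) (al, mu, ga) = mu"
  "omap (fact_nabla C) al = (Cod C al, Dom C al)" "amap (fact_nabla C) (al, mu, ga) = (mu, ga)"
  by (simp_all add: fact_target_def fact_nabla_def)

lemma finite_category_fact:
  assumes "finite_category C"
  shows "finite_category (fact_cat C)"
proof -
  interpret C: finite_category C by fact
  have "Arr (fact_cat C) \<subseteq> Arr C \<times> Arr C \<times> Arr C" by (auto simp: fact_cat_def)
  then have "finite (Arr (fact_cat C))" by (rule finite_subset) (simp add: C.finite_Arr)
  then show ?thesis
    by unfold_locales
       (use C.Comp_Ident_left C.Comp_Ident_right in \<open>auto simp: C.finite_Arr C.Dom_Obj C.Cod_Obj C.Ident_Arr C.Dom_Ident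
         C.Cod_Ident C.Comp_Arr C.Dom_Comp C.Cod_Comp C.Comp_assoc\<close>, metis+)
qed

text \<open>Preimages of the components \<open>p i\<close> are found in each summand and added up.
  Applied to the inclusions of the summands of \<open>LK\<close> along \<open>\<nabla>\<close>, this
  reduces exactness at \<open>(x, y)\<close> to exactness of the original complex at the arrows from
  \<open>y\<close> to \<open>x\<close>.\<close>

lemma exact_of_sum:
  assumes H: "finite H" and V: "vs V" and V': "vs V'" and d: "d \<in> lhom V V'"
    and io: "\<And>i u. i \<in> H ==> u \<in> carrier (W i) ==> io i u \<in> carrier V"
    and io': "\<And>i u. i \<in> H ==> u \<in> carrier (W i) ==> d (io i u) = io' i (e i u)"
    and z: "z = finsum V' (\<lambda>i. io' i (p i)) H"
    and ex: "\<And>i. i \<in> H ==> \<exists>u\<in>carrier (W i). e i u = p i"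
  shows "\<exists>u\<in>carrier V. d u = z"
proof -
  from ex obtain u where u: "\<And>i. i \<in> H ==> u i \<in> carrier (W i) \<and> e i (u i) = p i" by metis
  then have c: "(\<lambda>i. io i (u i)) \<in> H \<rightarrow> carrier V" using io by auto
  have "d (finsum V (\<lambda>i. io i (u i)) H) = finsum V' (\<lambda>i. d (io i (u i))) H" by (rule lhom_finsum[OF d V V' H c])
  also have "\<dots> = z" unfolding z
    by (rule abelian_monoid.finsum_cong'[OF vs_comm_monoid(1)[OF V']])
       (use u io' lhomD(1)[OF d io] in \<open>auto simp: Pi_iff, metis\<close>)
  finally show ?thesis using abelian_monoid.finsum_closed[OF vs_comm_monoid(1)[OF V] c] by blast
qed

lemma lhom_finsum_fun:
  assumes "vs W" "finite A" "\<And>i. i \<in> A ==> h i \<in> lhom V W" "vs V"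
  shows "(\<lambda>v. finsum W (\<lambda>i. h i v) A) \<in> lhom V W"
proof -
  interpret W: abelian_monoid W by (rule vs_comm_monoid(1)[OF assms(1)])
  have c: "v \<in> carrier V ==> i \<in> A ==> h i v \<in> carrier W" for i v using lhomD(1)[OF assms(3)] .
  have fs: "(\<lambda>x. \<zero>\<^bsub>W\<^esub>) \<in> lhom V W" by (rule lhom_const_zero[OF assms(1)])
  have "(\<lambda>v. finsum W (\<lambda>i. h i v) B) \<in> lhom V W" if "finite B" "B \<subseteq> A" for B
    using that
  proof (induction B rule: finite_induct)
    case empty
    show ?case using fs by simp
  next
    case (insert i B)
    then have i: "i \<in> A" "B \<subseteq> A" by auto
    have ad: "(\<lambda>v. h i v \<oplus>\<^bsub>W\<^esub> finsum W (\<lambda>i. h i v) B) \<in> lhom V W"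
      by (rule lhom_add[OF assms(3)[OF i(1)] insert.IH[OF i(2)] assms(1)])
    have "finsum W (\<lambda>i. h i v) (insert i B) = h i v \<oplus>\<^bsub>W\<^esub> finsum W (\<lambda>i. h i v) B" if "v \<in> carrier V" for v
      by (rule W.finsum_insert) (use insert i c[OF that] in auto)
    then show ?case by (rule lhom_cong[OF ad assms(4)])
  qed
  then show ?thesis using assms(2) by blast
qed

locale fact = C: finite_category C for C :: "('o, 'm) category"
begin

abbreviation FF where "FF \<equiv> fact_cat C"
abbreviation EE where "EE \<equiv> env_cat C"
abbreviation nmap where "nmap \<equiv> lan_map (fact_nabla C) FF EE"
abbreviation tmap where "tmap \<equiv> lan_map (fact_target C) FF C"

lemma FC: "finite_category FF" and EC: "finite_category EE"
  by (rule finite_category_fact[OF C.finite_category_axioms] finite_category_env[OF C.finite_category_axioms])+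

end

sublocale fact \<subseteq> t: kan "fact_cat C" C "fact_target C"
proof -
  interpret F: finite_category "fact_cat C" by (rule FC)
  show "kan (fact_cat C) C (fact_target C)"
    by unfold_locales (auto simp: C.Cod_Obj C.Cod_Comp C.Comp_Arr)
qed

sublocale fact \<subseteq> n: kan "fact_cat C" "env_cat C" "fact_nabla C"
proof -
  interpret F: finite_category "fact_cat C" by (rule FC)
  interpret E: finite_category "env_cat C" by (rule EC)
  show "kan (fact_cat C) (env_cat C) (fact_nabla C)"
    by unfold_locales (auto simp: C.Cod_Obj C.Dom_Obj C.Cod_Comp C.Dom_Comp C.Comp_Arr)
qed

context fact
begin

abbreviation kF where "kF \<equiv> const_mod :: ('m, 'm \<times> 'm \<times> 'm, 'k::field, 'k) kfunctor"
abbreviation kC where "kC \<equiv> const_mod :: ('o, 'm, 'k::field, 'k) kfunctor"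
abbreviation kCC where "kCC \<equiv> bimod C :: ('o \<times> 'o, 'm \<times> 'm, 'k::field, 'm \<Rightarrow>\<^sub>0 'k) kfunctor"
abbreviation prd where "prd mu al ga \<equiv> Comp C mu (Comp C al ga)"

lemma t_ovo: "t.ovo x al mu \<longleftrightarrow> al \<in> Arr C \<and> mu \<in> Arr C \<and> Dom C mu = Cod C al \<and> Cod C mu = x"
  by (simp add: t.ovo_def)

lemma n_ovo: "n.ovo (x, y) al (mu, ga) \<longleftrightarrow> al \<in> Arr C \<and> mu \<in> Arr C \<and> ga \<in> Arr C \<and> Dom C mu = Cod C al \<and> Cod C ga = Dom C al
    \<and> Cod C mu = x \<and> Dom C ga = y"
  by (auto simp: n.ovo_def)

lemma prd_arr:
  assumes "n.ovo (x, y) al (mu, ga)"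
  shows "prd mu al ga \<in> Arr C" "Dom C (prd mu al ga) = y" "Cod C (prd mu al ga) = x"
  using assms by (auto simp: n_ovo C.Comp_Arr C.Dom_Comp C.Cod_Comp)

lemmas bim_fmod = C.fmod_bimod

lemma target_const:
  shows "nat_trans C (t.L kF) kC lan_target_const"
    and "t.ovo x al mu ==> lan_target_const x (t.la kF x al mu c) = c"
proof -
  have 1: "lan_target_const x \<in> lhom (sp (t.L kF) x) (sp kC x)"
    and 2: "t.ovo x al mu ==> lan_target_const x (t.la kF x al mu c) = c" for x al mu c
  proof -
    have l: "(\<lambda>v. v) \<in> lhom (sp kF a) (sp kC x)" for a by (rule lhomI) auto
    note t = t.lan_out[where V = "sp kC x" and ph = "\<lambda>a be v. v" and x = x, OF fmod_const_mod vs_const_mod l]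
    show "lan_target_const x \<in> lhom (sp (t.L kF) x) (sp kC x)"
      unfolding lan_target_const_def by (rule t(1)) simp
    show "t.ovo x al mu ==> lan_target_const x (t.la kF x al mu c) = c"
      unfolding lan_target_const_def by (rule t(2)) simp_all
  qed
  show "t.ovo x al mu ==> lan_target_const x (t.la kF x al mu c) = c" by (rule 2)
  show "nat_trans C (t.L kF) kC lan_target_const"
  proof (rule nat_transI[OF 1])
    fix g z assume g: "g \<in> Arr C" and z: "z \<in> car (t.L kF) (Dom C g)"
    show "lan_target_const (Cod C g) (act (t.L kF) g z) = act kC g (lan_target_const (Dom C g) z)"
      by (rule t.lan_ext[OF fmod_const_mod lhom_comp[OF t.lan_act(1)[OF fmod_const_mod g] 1] lhom_comp[OF 1 fmodD(2)[OF fmod_const_mod g]] vs_const_mod _ z])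
         (simp add: t.lan_act(2)[OF fmod_const_mod g] 2 t.ovo_act[OF _ g refl])
  qed
qed

text \<open>The composite \<open>mu al ga\<close> does not change along arrows of the overcategory,
  being constant on each of its connected components; this is why the formula descends to the
  colimit.\<close>

lemma nabla_const:
  shows "nat_trans EE (n.L kF) kCC (lan_nabla_const C)"
    and "n.ovo (x, y) al (mu, ga) ==> lan_nabla_const C (x, y) (n.la kF (x, y) al (mu, ga) c) = single (prd mu al ga) c"
proof -
  let ?ph = "\<lambda>al (mu, ga) c. single (prd mu al ga) c"
  have l: "?ph al be \<in> lhom (sp kF al) (sp kCC (x, y))" if "n.ovo (x, y) al be" for x y al be
  proof -
    obtain mu ga where b: "be = (mu, ga)" by (cases be)
    show ?thesis unfolding b prod.case
      unfolding bimod_simps by (rule lhomI) (use prd_arr[OF that[unfolded b]] in \<open>auto simp: single_add scale_simps\<close>)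
  qed
  have r: "?ph (Cod FF de) be (act kF de v) = ?ph (Dom FF de) (Comp EE be (amap (fact_nabla C) de)) v"
    if "de \<in> Arr FF" "n.ovo (x, y) (Cod FF de) be" for x y de be v
    using that by (cases de; cases be) (auto simp: n_ovo C.Comp_assoc C.Comp_Arr C.Dom_Comp C.Cod_Comp)
  have 1: "lan_nabla_const C (x, y) \<in> lhom (sp (n.L kF) (x, y)) (sp kCC (x, y))"
    and 2: "n.ovo (x, y) al (mu, ga) ==> lan_nabla_const C (x, y) (n.la kF (x, y) al (mu, ga) c) = single (prd mu al ga) c"
    if "x \<in> Obj C" "y \<in> Obj C" for x y al mu ga c
  proof -
    have V: "vs (sp (bimod C) (x, y))" using that fmodD(1)[OF bim_fmod, of "(x, y)"] by simp
    show "lan_nabla_const C (x, y) \<in> lhom (sp (n.L kF) (x, y)) (sp kCC (x, y))"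
      unfolding lan_nabla_const_def by (rule n.lan_out(1)[OF fmod_const_mod V l r])
    show "lan_nabla_const C (x, y) (n.la kF (x, y) al (mu, ga) c) = single (prd mu al ga) c"
      if ov: "n.ovo (x, y) al (mu, ga)"
    proof -
      have "lan_nabla_const C (x, y) (n.la kF (x, y) al (mu, ga) c) = ?ph al (mu, ga) c"
        unfolding lan_nabla_const_def by (rule n.lan_out(2)[OF fmod_const_mod V l r ov]) simp_all
      then show ?thesis by simp
    qed
  qed
  show "n.ovo (x, y) al (mu, ga) ==> lan_nabla_const C (x, y) (n.la kF (x, y) al (mu, ga) c) = single (prd mu al ga) c"
    by (rule 2) (auto simp: n_ovo C.Cod_Obj C.Dom_Obj)
  have c1: "lan_nabla_const C p \<in> lhom (sp (n.L kF) p) (sp kCC p)" if "p \<in> Obj EE" for p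
    using 1[of "fst p" "snd p"] that by (cases p) simp
  show "nat_trans EE (n.L kF) kCC (lan_nabla_const C)"
  proof (rule nat_transI[OF c1])
    fix g z assume g: "g \<in> Arr EE" and z: "z \<in> car (n.L kF) (Dom EE g)"
    note o = n.C.Dom_Obj[OF g] n.C.Cod_Obj[OF g]
    show "lan_nabla_const C (Cod EE g) (act (n.L kF) g z) = act kCC g (lan_nabla_const C (Dom EE g) z)"
    proof (rule n.lan_ext[OF fmod_const_mod lhom_comp[OF n.lan_act(1)[OF fmod_const_mod g] c1[OF o(2)]]
          lhom_comp[OF c1[OF o(1)] fmodD(2)[OF bim_fmod g]] fmodD(1)[OF bim_fmod o(2)] _ z])
      fix al be v assume ov: "n.ovo (Dom EE g) al be" "v \<in> car kF al"
      obtain mu ga a b where b: "be = (mu, ga)" "g = (a, b)" by (metis surj_pair)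
      have gO: "Dom C a \<in> Obj C" "Cod C a \<in> Obj C" "Dom C b \<in> Obj C" "Cod C b \<in> Obj C"
        using o b by auto
      have eq: "prd (Comp C a mu) al (Comp C ga b) = prd a (prd mu al ga) b"
        using ov(1) g b by (auto simp: n_ovo C.Comp_assoc C.Comp_Arr C.Dom_Comp C.Cod_Comp)
      show "lan_nabla_const C (Cod EE g) (act (n.L kF) g (n.la kF (Dom EE g) al be v))
          = act kCC g (lan_nabla_const C (Dom EE g) (n.la kF (Dom EE g) al be v))"
        using n.lan_act(2)[OF fmod_const_mod g ov] n.ovo_act[OF ov(1) g refl] ov(1) eq
        by (simp add: b 2[OF gO(1,4)] 2[OF gO(2,3)])
    qed
  qed
qed

lemma nabla_aug_eq:
  "(\<lambda>f x A. lan_nabla_const C x (lan_map (fact_nabla C) (fact_cat C) (env_cat C) const_mod f x A)) = lan_nabla_aug C"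
  by (simp add: fun_eq_iff lan_nabla_aug_def)

lemma target_aug_eq:
  "(\<lambda>f x A. lan_target_const x (lan_map (fact_target C) (fact_cat C) C const_mod f x A)) = lan_target_aug C"
  by (simp add: fun_eq_iff lan_target_aug_def)

context
  fixes G :: "('m, 'm \<times> 'm \<times> 'm, 'k::field, 'v) kfunctor"
  assumes G: "fmod FF G"
begin

lemma nabla_aug:
  assumes f: "nat_trans FF G kF f"
  shows "nat_trans EE (n.L G) kCC (lan_nabla_aug C f)"
    and "n.ovo (x, y) al (mu, ga) ==> v \<in> car G al ==>
      lan_nabla_aug C f (x, y) (n.la G (x, y) al (mu, ga) v) = single (prd mu al ga) (f al v)"
proof -
  show "nat_trans EE (n.L G) kCC (lan_nabla_aug C f)"
    unfolding nabla_aug_eq[symmetric] by (rule nat_trans_comp[OF EC n.lan_map(3)[OF G fmod_const_mod f] nabla_const(1)])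
  show "lan_nabla_aug C f (x, y) (n.la G (x, y) al (mu, ga) v) = single (prd mu al ga) (f al v)"
    if "n.ovo (x, y) al (mu, ga)" "v \<in> car G al"
    unfolding lan_nabla_aug_def n.lan_map(2)[OF G fmod_const_mod f that] by (rule nabla_const(2)[OF that(1)])
qed

lemma target_aug:
  assumes f: "nat_trans FF G kF f"
  shows "nat_trans C (t.L G) kC (lan_target_aug C f)"
    and "t.ovo x al mu ==> v \<in> car G al ==> lan_target_aug C f x (t.la G x al mu v) = f al v"
proof -
  show "nat_trans C (t.L G) kC (lan_target_aug C f)"
    unfolding target_aug_eq[symmetric]
    by (rule nat_trans_comp[OF C.finite_category_axioms t.lan_map(3)[OF G fmod_const_mod f] target_const(1)])
  show "lan_target_aug C f x (t.la G x al mu v) = f al v"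
    if "t.ovo x al mu" "v \<in> car G al"
    unfolding lan_target_aug_def t.lan_map(2)[OF G fmod_const_mod f that] by (rule target_const(2)[OF that(1)])
qed

end

text \<open>The overcategory \<open>\<nabla>/(x, y)\<close> is the disjoint union, over \<open>de : y \<rightarrow> x\<close>, of categories with
  terminal object \<open>[de]\<close>, so \<open>LK\<close> along \<open>\<nabla>\<close> at \<open>(x, y)\<close> is the direct sum of the values at the
  \<open>[de]\<close> and in particular exact.\<close>

definition nab_in where
  "nab_in G de = n.la G (Cod C de, Dom C de) de (Ident C (Cod C de), Ident C (Dom C de))"

text \<open>With \<open>be = (mu, ga)\<close>, the pair \<open>(al, be)\<close> encodes the arrow
  from \<open>[al]\<close> to \<open>[mu al ga]\<close>, which leads from a generator to the
  terminal object of its component. The generator is moved along it and then lies in one summand;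
  the projections to the other summands send it to zero.\<close>

definition nab_pr :: "('m, 'm \<times> 'm \<times> 'm, 'k::field, 'v) kfunctor => 'm => _ => 'v" where
  "nab_pr G de = pres_out (sp G de)
    (\<lambda>(al, be, v). if prd (fst be) al (snd be) = de then act G (al, be) v else \<zero>\<^bsub>sp G de\<^esub>)"

abbreviation hom where "hom x y \<equiv> {al \<in> Arr C. Dom C al = y \<and> Cod C al = x}"

lemma nab_ovo: "de \<in> hom x y ==> n.ovo (x, y) de (Ident C x, Ident C y)"
  by (auto simp: n_ovo C.Ident_Arr C.Dom_Obj C.Cod_Obj C.Dom_Ident C.Cod_Ident)

lemma prd_ident: "de \<in> hom x y ==> prd (Ident C x) de (Ident C y) = de"
  using C.Comp_Ident_left C.Comp_Ident_right by auto

context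
  fixes G :: "('m, 'm \<times> 'm \<times> 'm, 'k::field, 'v) kfunctor"
  assumes G: "fmod FF G"
begin

lemma G_act:
  assumes "n.ovo (x, y) al (mu, ga)"
  shows "act G (al, mu, ga) \<in> lhom (sp G al) (sp G (prd mu al ga))"
  using fmodD(2)[OF G, of "(al, mu, ga)"] assms by (simp add: n_ovo)

lemma nab_pr:
  assumes de: "de \<in> hom x y"
  shows "nab_pr G de \<in> lhom (sp (n.L G) (x, y)) (sp G de)"
    and "n.ovo (x, y) al (mu, ga) ==> v \<in> car G al ==>
      nab_pr G de (n.la G (x, y) al (mu, ga) v) = (if prd mu al ga = de then act G (al, mu, ga) v else \<zero>\<^bsub>sp G de\<^esub>)"
proof -
  let ?ph = "\<lambda>al be v. if prd (fst be) al (snd be) = de then act G (al, be) v else \<zero>\<^bsub>sp G de\<^esub>"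
  have V: "vs (sp G de)" using fmodD(1)[OF G, of de] de by simp
  have l: "?ph al be \<in> lhom (sp G al) (sp G de)" if ov: "n.ovo (x, y) al be" for al be
  proof -
    obtain mu ga where b: "be = (mu, ga)" by (cases be)
    show ?thesis using G_act[OF ov[unfolded b]] lhom_const_zero[OF V]
      by (cases "prd mu al ga = de") (simp_all add: b)
  qed
  have r: "?ph (Cod FF a) be (act G a v) = ?ph (Dom FF a) (Comp EE be (amap (fact_nabla C) a)) v"
    if a: "a \<in> Arr FF" and ov: "n.ovo (x, y) (Cod FF a) be" and v: "v \<in> car G (Dom FF a)" for a be v
  proof -
    obtain al mu' ga' mu ga where b: "a = (al, mu', ga')" "be = (mu, ga)" by (metis surj_pair)
    have "prd mu (prd mu' al ga') ga = prd (Comp C mu mu') al (Comp C ga' ga)"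
      using a ov by (auto simp: b n_ovo C.Comp_assoc C.Comp_Arr C.Dom_Comp C.Cod_Comp)
    moreover have "act G (al, Comp C mu mu', Comp C ga' ga) v = act G (prd mu' al ga', mu, ga) (act G (al, mu', ga') v)"
      using fmodD(5)[OF G a, of "(prd mu' al ga', mu, ga)" v] a ov v by (simp add: b n_ovo)
    ultimately show ?thesis by (simp add: b)
  qed
  show "nab_pr G de \<in> lhom (sp (n.L G) (x, y)) (sp G de)"
    unfolding nab_pr_def by (rule n.lan_out(1)[OF G V l r])
  show "nab_pr G de (n.la G (x, y) al (mu, ga) v) = (if prd mu al ga = de then act G (al, mu, ga) v else \<zero>\<^bsub>sp G de\<^esub>)"
    if "n.ovo (x, y) al (mu, ga)" "v \<in> car G al"
    using n.lan_out(2)[OF G V l r that] by (simp add: nab_pr_def)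
qed

lemma nab_in_lhom: "de \<in> hom x y ==> nab_in G de \<in> lhom (sp G de) (sp (n.L G) (x, y))"
proof -
  assume de: "de \<in> hom x y"
  then have "Cod C de = x" "Dom C de = y" by simp_all
  then show ?thesis unfolding nab_in_def by (simp only: n.la_lhom[OF G nab_ovo[OF de]])
qed

text \<open>The relation for the arrow \<open>(al, mu, ga)\<close> rewrites a generator at
  \<open>al\<close> as one at \<open>mu al ga\<close> with identity maps, so on each generator the
  sum has a single term that can be nonzero.\<close>

lemma nab_sum:
  assumes z: "z \<in> car (n.L G) (x, y)"
  shows "z = finsum (sp (n.L G) (x, y)) (\<lambda>de. nab_in G de (nab_pr G de z)) (hom x y)"
proof (rule n.lan_ext[OF G lhom_id lhom_finsum_fun[OF n.vs_lan[OF G] _ _ n.vs_lan[OF G]] n.vs_lan[OF G] _ z])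
  let ?V = "sp (n.L G) (x, y)"
  interpret V: abelian_monoid ?V by (rule vs_comm_monoid(1)[OF n.vs_lan[OF G]])
  show "finite (hom x y)" using C.finite_Arr by simp
  show "(\<lambda>z. nab_in G de (nab_pr G de z)) \<in> lhom ?V ?V" if "de \<in> hom x y" for de
    by (rule lhom_comp[OF nab_pr(1)[OF that] nab_in_lhom[OF that]])
  fix al be v assume ov: "n.ovo (x, y) al be" and v: "v \<in> car G al"
  obtain mu ga where b: "be = (mu, ga)" by (cases be)
  note ov = ov[unfolded b]
  let ?de = "prd mu al ga" and ?u = "act G (al, mu, ga) v"
  have d: "?de \<in> hom x y" using prd_arr[OF ov] by simp
  have "nab_in G ?de ?u = n.la G (x, y) ?de (Ident C x, Ident C y) ?u" using d by (simp add: nab_in_def)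
  also have "\<dots> = n.la G (x, y) al (Comp C (Ident C x) mu, Comp C ga (Ident C y)) v"
    using n.la_rel[OF G, of "(al, mu, ga)" "(x, y)" "(Ident C x, Ident C y)" v] ov v nab_ovo[OF d] by (simp add: n_ovo)
  also have "\<dots> = n.la G (x, y) al (mu, ga) v"
    using ov C.Comp_Ident_left[of mu] C.Comp_Ident_right[of ga] by (simp add: n_ovo)
  finally have e: "nab_in G ?de ?u = n.la G (x, y) al (mu, ga) v" .
  have uc: "n.la G (x, y) al (mu, ga) v \<in> carrier ?V" by (rule n.la_closed[OF G ov v])
  have z0: "nab_in G de \<zero>\<^bsub>sp G de\<^esub> = \<zero>\<^bsub>?V\<^esub>" if "de \<in> hom x y" for de
    using lhom_zero[OF nab_in_lhom[OF that] fmodD(1)[OF G] n.vs_lan[OF G]] that by simp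
  have "finsum ?V (\<lambda>de. nab_in G de (nab_pr G de (n.la G (x, y) al (mu, ga) v))) (hom x y)
      = finsum ?V (\<lambda>de. if ?de = de then n.la G (x, y) al (mu, ga) v else \<zero>\<^bsub>?V\<^esub>) (hom x y)"
  proof (rule V.finsum_cong')
    fix de assume de: "de \<in> hom x y"
    show "nab_in G de (nab_pr G de (n.la G (x, y) al (mu, ga) v)) = (if ?de = de then n.la G (x, y) al (mu, ga) v else \<zero>\<^bsub>?V\<^esub>)"
      unfolding nab_pr(2)[OF de ov v] using e z0[OF de] by (cases "?de = de") simp_all
  qed (use uc in simp_all)
  also have "\<dots> = n.la G (x, y) al (mu, ga) v"
    by (rule V.finsum_singleton[where f = "\<lambda>_. n.la G (x, y) al (mu, ga) v", OF d]) (use C.finite_Arr uc in simp_all)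
  finally show "n.la G (x, y) al be v = finsum ?V (\<lambda>de. nab_in G de (nab_pr G de (n.la G (x, y) al be v))) (hom x y)"
    by (simp add: b)
qed

text \<open>Reads off the coefficients of the augmentation summand by summand: if it vanishes on
  \<open>z\<close>, then \<open>f\<close> vanishes on every component of \<open>z\<close>.\<close>

lemma nab_pr_aug:
  assumes f: "nat_trans FF G kF f" and de: "de \<in> hom x y" and z: "z \<in> car (n.L G) (x, y)"
  shows "f de (nab_pr G de z) = lookup (lan_nabla_aug C f (x, y) z) de"
proof (rule n.lan_ext[OF G lhom_comp[OF nab_pr(1)[OF de] nat_transD(1)[OF f]] lhom_comp[OF nat_transD(1)[OF nabla_aug(1)[OF G f]]] vs_const_mod _ z])
  show "de \<in> Obj FF" "(x, y) \<in> Obj EE" using de by (auto simp: C.Dom_Obj C.Cod_Obj)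
  show "(\<lambda>c. lookup c de) \<in> lhom (sp kCC (x, y)) (sp kF de)"
    by (rule lhomI) (simp_all add: lookup_add flip: scale_simps)
  fix al be v assume ov: "n.ovo (x, y) al be" and v: "v \<in> car G al"
  obtain mu ga where b: "be = (mu, ga)" by (cases be)
  note ov = ov[unfolded b]
  have "f (prd mu al ga) (act G (al, mu, ga) v) = f al v"
    using nat_transD(3)[OF f, of "(al, mu, ga)" v] ov v by (simp add: n_ovo)
  moreover have "f de \<zero>\<^bsub>sp G de\<^esub> = 0"
    using lhom_zero[OF nat_transD(1)[OF f] fmodD(1)[OF G] vs_const_mod, of de] de by simp
  ultimately show "f de (nab_pr G de (n.la G (x, y) al be v)) = lookup (lan_nabla_aug C f (x, y) (n.la G (x, y) al be v)) de"
    using nab_pr(2)[OF de ov v] nabla_aug(2)[OF G f ov v] by (auto simp: b lookup_single when_def)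
qed

end

lemma nab_pr_map:
  assumes G: "fmod FF G" and G': "fmod FF G'" and et: "nat_trans FF G G' et" and de: "de \<in> hom x y"
    and z: "z \<in> car (n.L G) (x, y)"
  shows "nab_pr G' de (nmap G' et (x, y) z) = et de (nab_pr G de z)"
proof (rule n.lan_ext[OF G lhom_comp[OF n.lan_map(1)[OF G G' et] nab_pr(1)[OF G' de]]
      lhom_comp[OF nab_pr(1)[OF G de] nat_transD(1)[OF et]] fmodD(1)[OF G'] _ z])
  show "de \<in> Obj FF" "de \<in> Obj FF" using de by auto
  fix al be v assume ov: "n.ovo (x, y) al be" and v: "v \<in> car G al"
  obtain mu ga where b: "be = (mu, ga)" by (cases be)
  note ov = ov[unfolded b]
  have "et al v \<in> car G' al" using nat_transD(2)[OF et _ v] ov by (simp add: n_ovo)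
  moreover have "et (prd mu al ga) (act G (al, mu, ga) v) = act G' (al, mu, ga) (et al v)"
    using nat_transD(3)[OF et, of "(al, mu, ga)" v] ov v by (simp add: n_ovo)
  moreover have "et de \<zero>\<^bsub>sp G de\<^esub> = \<zero>\<^bsub>sp G' de\<^esub>"
    using lhom_zero[OF nat_transD(1)[OF et] fmodD(1)[OF G] fmodD(1)[OF G'], of de] de by simp
  ultimately show "nab_pr G' de (nmap G' et (x, y) (n.la G (x, y) al be v)) = et de (nab_pr G de (n.la G (x, y) al be v))"
    using nab_pr(2)[OF G de ov v] nab_pr(2)[OF G' de ov, of "et al v"] n.lan_map(2)[OF G G' et ov v] by (auto simp: b)
qed

abbreviation Lnab where
  "Lnab \<equiv> image_complex (lan (fact_nabla C) (fact_cat C) (env_cat C)) (lan_map (fact_nabla C) (fact_cat C) (env_cat C)) (lan_nabla_aug C)"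

lemma nabla_resolution:
  assumes P: "proj_resolution FF kF P"
  shows "proj_resolution EE kCC (Lnab P)"
proof -
  have R: "resolution FF kF P" using P by (simp add: proj_resolution_def)
  note fP = resolutionD(2)[OF R] and dP = resolutionD(3)[OF R] and aP = resolutionD(4)[OF R]
  have "resolution EE kCC (Lnab P)"
  proof (rule resolutionI[OF EC bim_fmod])
    note nt = n.lan_image_nat[OF nabla_const(1) P bim_fmod, unfolded nabla_aug_eq]
    show "fmod EE (mods (Lnab P) n)" for n by (rule nt(1))
    show "nat_trans EE (mods (Lnab P) (Suc n)) (mods (Lnab P) n) (bdry (Lnab P) n)" for n by (rule nt(2))
    show "nat_trans EE (mods (Lnab P) 0) kCC (aug (Lnab P))" by (rule nt(3))
    fix p assume p: "p \<in> Obj EE"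
    obtain x y where xy: "p = (x, y)" "x \<in> Obj C" "y \<in> Obj C" using p by auto
    let ?V = "\<lambda>n. sp (n.L (mods P n)) (x, y)" and ?d = "\<lambda>n. nmap (mods P n) (bdry P n) (x, y)"
    let ?a = "lan_nabla_aug C (aug P) (x, y)"
    have fin: "finite (hom x y)" using C.finite_Arr by simp
    have H: "de \<in> Obj FF" if "de \<in> hom x y" for de using that by simp
    note dl = n.lan_map(1)[OF fP fP dP] and V = n.vs_lan[OF fP]
    have din: "?d n (nab_in (mods P (Suc n)) de u) = nab_in (mods P n) de (bdry P n de u)"
      if "de \<in> hom x y" "u \<in> car (mods P (Suc n)) de" for n de u
      using n.lan_map(2)[OF fP fP dP nab_ovo[OF that(1)] that(2)] that(1) by (auto simp: nab_in_def)
    have al: "?a \<in> lhom (?V 0) (sp kCC (x, y))" using nat_transD(1)[OF nt(3) p] by (simp add: Fm_aug_simps xy)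
    have ain: "?a (nab_in (mods P 0) de u) = single de (aug P de u)"
      if "de \<in> hom x y" "u \<in> car (mods P 0) de" for de u
      using nabla_aug(2)[OF fP aP nab_ovo[OF that(1)] that(2)] prd_ident[OF that(1)] that(1) by (auto simp: nab_in_def)
    show "\<exists>v\<in>car (mods (Lnab P) 0) p. aug (Lnab P) p v = w" if w: "w \<in> car kCC p" for w
      unfolding Fm_aug_simps xy(1)
    proof (rule exact_of_sum[where io = "nab_in (mods P 0)" and e = "aug P" and io' = single and p = "lookup w" and W = "sp (mods P 0)",
        OF fin V vs_free_space al[unfolded bimod_simps] lhomD(1)[OF nab_in_lhom[OF fP]] ain])
      have k: "keys w \<subseteq> hom x y" using w by (simp add: xy)
      show "w = finsum (free_space (hom x y)) (\<lambda>de. single de (lookup w de)) (hom x y)"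
        by (subst finsum_free_space[OF fin]) (use k fin in \<open>auto intro!: poly_mapping_eqI
          simp: lookup_sum lookup_single when_def in_keys_iff subset_iff sum.delta\<close>)
      show "\<exists>u\<in>car (mods P 0) de. aug P de u = lookup w de" if "de \<in> hom x y" for de
        using resolution_exact(1)[OF R H[OF that], of "lookup w de"] by auto
    qed
    show "aug (Lnab P) p (bdry (Lnab P) 0 p v) = \<zero>\<^bsub>sp kCC p\<^esub>" if "v \<in> car (mods (Lnab P) 1) p" for v
      unfolding Fm_aug_simps xy(1)
    proof (rule n.lan_ext[OF fP lhom_comp[OF dl al] lhom_const_zero fmodD(1)[OF bim_fmod p[unfolded xy(1)]] _ that[unfolded Fm_aug_simps xy(1) One_nat_def]])
      fix al be v assume ov: "n.ovo (x, y) al be" and v: "v \<in> car (mods P (Suc 0)) al"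
      obtain mu ga where b: "be = (mu, ga)" by (cases be)
      have a: "al \<in> Obj FF" using ov by (simp add: b n_ovo)
      show "?a (?d 0 (n.la (mods P (Suc 0)) (x, y) al be v)) = \<zero>\<^bsub>sp kCC (x, y)\<^esub>"
        using n.lan_map(2)[OF fP fP dP ov v] nabla_aug(2)[OF fP aP ov[unfolded b] nat_transD(2)[OF dP a v]]
          resolution_exact(2)[OF R a, of v] v by (simp add: b)
    qed (simp_all add: vs_free_space)
    show "bdry (Lnab P) n p (bdry (Lnab P) (Suc n) p v) = \<zero>\<^bsub>sp (mods (Lnab P) n) p\<^esub>"
      if "v \<in> car (mods (Lnab P) (Suc (Suc n))) p" for n v
      unfolding Fm_aug_simps xy(1)
    proof (rule n.lan_ext[OF fP lhom_comp[OF dl dl] lhom_const_zero[OF V] V _ that[unfolded Fm_aug_simps xy(1)]])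
      fix al be v assume ov: "n.ovo (x, y) al be" and v: "v \<in> car (mods P (Suc (Suc n))) al"
      have a: "al \<in> Obj FF" using ov by (simp add: n.ovo_def)
      show "?d n (?d (Suc n) (n.la (mods P (Suc (Suc n))) (x, y) al be v)) = \<zero>\<^bsub>?V n\<^esub>"
        using n.lan_map(2)[OF fP fP dP ov v] n.lan_map(2)[OF fP fP dP ov nat_transD(2)[OF dP a v]]
          resolution_exact(3)[OF R a, of v n] v lhom_zero[OF n.la_lhom[OF fP ov] fmodD(1)[OF fP a] V] by simp
    qed
    show "\<exists>u\<in>car (mods (Lnab P) 1) p. z = bdry (Lnab P) 0 p u"
      if z: "z \<in> car (mods (Lnab P) 0) p" "aug (Lnab P) p z = \<zero>\<^bsub>sp kCC p\<^esub>" for z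
    proof -
      note z = z[unfolded Fm_aug_simps xy(1)]
      have "\<exists>u\<in>carrier (?V (Suc 0)). ?d 0 u = z"
      proof (rule exact_of_sum[where io = "nab_in (mods P (Suc 0))" and e = "bdry P 0" and io' = "nab_in (mods P 0)"
            and p = "\<lambda>de. nab_pr (mods P 0) de z" and W = "sp (mods P (Suc 0))", OF fin V V dl lhomD(1)[OF nab_in_lhom[OF fP]] din nab_sum[OF fP z(1)]])
        show "\<exists>u\<in>car (mods P (Suc 0)) de. bdry P 0 de u = nab_pr (mods P 0) de z" if "de \<in> hom x y" for de
          using resolution_exact(4)[OF R H[OF that] lhomD(1)[OF nab_pr(1)[OF fP that] z(1)]]
            nab_pr_aug[OF fP aP that z(1)] z(2) by auto
      qed
      then show ?thesis by (auto simp: Fm_aug_simps xy(1))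
    qed
    show "\<exists>u\<in>car (mods (Lnab P) (Suc (Suc n))) p. z = bdry (Lnab P) (Suc n) p u"
      if z: "z \<in> car (mods (Lnab P) (Suc n)) p" "bdry (Lnab P) n p z = \<zero>\<^bsub>sp (mods (Lnab P) n) p\<^esub>" for n z
    proof -
      note z = z[unfolded Fm_aug_simps xy(1)]
      have "\<exists>u\<in>carrier (?V (Suc (Suc n))). ?d (Suc n) u = z"
      proof (rule exact_of_sum[where io = "nab_in (mods P (Suc (Suc n)))" and e = "bdry P (Suc n)" and io' = "nab_in (mods P (Suc n))"
            and p = "\<lambda>de. nab_pr (mods P (Suc n)) de z" and W = "sp (mods P (Suc (Suc n)))", OF fin V V dl lhomD(1)[OF nab_in_lhom[OF fP]] din nab_sum[OF fP z(1)]])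
        show "\<exists>u\<in>car (mods P (Suc (Suc n))) de. bdry P (Suc n) de u = nab_pr (mods P (Suc n)) de z"
          if "de \<in> hom x y" for de
          using resolution_exact(5)[OF R H[OF that] lhomD(1)[OF nab_pr(1)[OF fP that] z(1)]]
            nab_pr_map[OF fP fP dP that z(1)] z(2) lhom_zero[OF nab_pr(1)[OF fP that] V fmodD(1)[OF fP H[OF that]]] by auto
      qed
      then show ?thesis by (auto simp: Fm_aug_simps xy(1))
    qed
  qed
  moreover have "projective EE (mods (Lnab P) n)" for n
    unfolding Fm_aug_simps by (rule n.lan_projective) (use P in \<open>simp add: proj_resolution_def\<close>)
  ultimately show ?thesis by (simp add: proj_resolution_def)
qed

end

section \<open>Comparison of the two tensor products\<close>

locale factm = fact C + pten C M
  for C :: "('o, 'm) category" and M :: "('o, 'm, 'k::field, 'w) kfunctor"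
begin

text \<open>\<open>thet\<close> with the second tensor factor \<open>w\<close> held fixed. A map out
  of a tensor product whose first factor is a colimit is built in two stages, and this is the one
  out of the colimit.\<close>

definition thw :: "('m, 'm \<times> 'm \<times> 'm, 'k, 'v) kfunctor => _" where
  "thw G x w = pres_out (sp (PT (t.L G)) x)
    (\<lambda>(al, be, v). ptg (t.L G) x (t.la G x al (fst be) v) (act M (prd (fst be) al (snd be)) w))"

text \<open>On generators, \<open>[al, (mu, ga), v] \<otimes> w\<close> goes to \<open>[al, mu, v] \<otimes> M(mu al ga) w\<close>.\<close>

definition thet :: "('m, 'm \<times> 'm \<times> 'm, 'k, 'v) kfunctor => 'o => (('o \<times> _ \<times> 'w) \<Rightarrow>\<^sub>0 'k) set => _" where
  "thet G x = pres_out (sp (PT (t.L G)) x) (\<lambda>(y, b, w). thw G x w b)"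

lemma n_t_ovo: "n.ovo (x, y) al (mu, ga) ==> t.ovo x al mu"
  by (simp add: n_ovo t_ovo)

lemma M_prd: "n.ovo (x, y) al (mu, ga) ==> act M (prd mu al ga) \<in> lhom (sp M y) (sp M x)"
  using fmodD(2)[OF M, of "prd mu al ga"] prd_arr[of x y al mu ga] by simp

context
  fixes G :: "('m, 'm \<times> 'm \<times> 'm, 'k, 'v) kfunctor"
  assumes G: "fmod FF G"
begin

lemma tLG: "fmod C (t.L G)" and nLG: "fmod EE (n.L G)"
  by (rule t.lan_fmod[OF G] n.lan_fmod[OF G])+

lemma PTL_left: "x \<in> Obj C ==> w \<in> car M x ==> (\<lambda>v. ptg (t.L G) x v w) \<in> lhom (sp (t.L G) x) (sp (PT (t.L G)) x)"
  and PTL_right: "x \<in> Obj C ==> v \<in> car (t.L G) x ==> ptg (t.L G) x v \<in> lhom (sp M x) (sp (PT (t.L G)) x)"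
  unfolding PT_sp by (rule tg_left tg_right; simp add: t.vs_lan[OF G] Mv)+

text \<open>Along an arrow of the overcategory the class in \<open>LK\<close> along \<open>t\<close>
  is unchanged by the relation there, and so is \<open>M(mu al ga) w\<close>, because the composite
  \<open>mu al ga\<close> is; thus the relations of the colimit are respected.\<close>

lemma thw:
  assumes x: "x \<in> Obj C" and w: "w \<in> car M y"
  shows "thw G x w \<in> lhom (sp (n.L G) (x, y)) (sp (PT (t.L G)) x)"
    and "n.ovo (x, y) al (mu, ga) ==> v \<in> car G al ==>
      thw G x w (n.la G (x, y) al (mu, ga) v) = ptg (t.L G) x (t.la G x al mu v) (act M (prd mu al ga) w)"
proof -
  let ?ph = "\<lambda>al be v. ptg (t.L G) x (t.la G x al (fst be) v) (act M (prd (fst be) al (snd be)) w)"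
  note V = PT_vs[OF tLG x]
  have l: "?ph al be \<in> lhom (sp G al) (sp (PT (t.L G)) x)" if ov: "n.ovo (x, y) al be" for al be
  proof -
    obtain mu ga where b: "be = (mu, ga)" by (cases be)
    show ?thesis unfolding b fst_conv snd_conv
      by (rule lhom_comp[OF t.la_lhom[OF G n_t_ovo[OF ov[unfolded b]]] PTL_left[OF x lhomD(1)[OF M_prd[OF ov[unfolded b]] w]]])
  qed
  have r: "?ph (Cod FF a) be (act G a v) = ?ph (Dom FF a) (Comp EE be (amap (fact_nabla C) a)) v"
    if a: "a \<in> Arr FF" and ov: "n.ovo (x, y) (Cod FF a) be" and v: "v \<in> car G (Dom FF a)" for a be v
  proof -
    obtain al mu' ga' mu ga where b: "a = (al, mu', ga')" "be = (mu, ga)" by (metis surj_pair)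
    have "prd mu (prd mu' al ga') ga = prd (Comp C mu mu') al (Comp C ga' ga)"
      using a ov by (auto simp: b n_ovo C.Comp_assoc C.Comp_Arr C.Dom_Comp C.Cod_Comp)
    then show ?thesis using t.la_rel[OF G a, of x mu v] n_t_ovo[OF ov[unfolded b(2)]] v by (simp add: b)
  qed
  show "thw G x w \<in> lhom (sp (n.L G) (x, y)) (sp (PT (t.L G)) x)"
    unfolding thw_def by (rule n.lan_out(1)[OF G V l r])
  show "thw G x w (n.la G (x, y) al (mu, ga) v) = ptg (t.L G) x (t.la G x al mu v) (act M (prd mu al ga) w)"
    if "n.ovo (x, y) al (mu, ga)" "v \<in> car G al"
    using n.lan_out(2)[OF G V l r that] by (simp add: thw_def)
qed

text \<open>Besides linearity in \<open>w\<close>, the relation of the tensor product over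
  \<open>kC\<close> has to be respected. Moving \<open>ep\<close> across the tensor sign replaces
  \<open>ga\<close> by \<open>ga ep\<close> on one side and \<open>w\<close> by
  \<open>M(ep) w\<close> on the other, and both yield \<open>M(mu al ga ep) w\<close>.\<close>

lemma thet:
  assumes x: "x \<in> Obj C"
  shows "thet G x \<in> lhom (sp (BT (n.L G)) x) (sp (PT (t.L G)) x)"
    and "n.ovo (x, y) al (mu, ga) ==> v \<in> car G al ==> w \<in> car M y ==>
      thet G x (bt (n.L G) x y (n.la G (x, y) al (mu, ga) v) w) = ptg (t.L G) x (t.la G x al mu v) (act M (prd mu al ga) w)"
proof -
  note V = PT_vs[OF tLG x]
  have r: "(\<lambda>w. thw G x w b) \<in> lhom (sp M y) (sp (PT (t.L G)) x)" if y: "y \<in> Obj C" and b: "b \<in> car (n.L G) (x, y)" for y b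
  proof (rule lhomI)
    note My = Mv[OF y]
    have gl: "(\<lambda>w. ptg (t.L G) x (t.la G x al mu v) (act M (prd mu al ga) w)) \<in> lhom (sp M y) (sp (PT (t.L G)) x)"
      if "n.ovo (x, y) al (mu, ga)" "v \<in> car G al" for al mu ga v
      by (rule lhom_comp[OF M_prd[OF that(1)] PTL_right[OF x t.la_closed[OF G n_t_ovo[OF that(1)] that(2)]]])
    fix w assume w: "w \<in> car M y"
    show "thw G x w b \<in> car (PT (t.L G)) x" by (rule lhomD(1)[OF thw(1)[OF x w] b])
    fix c
    note cw = vs_closed(3)[OF My w, of c]
    show "thw G x (c \<odot>\<^bsub>sp M y\<^esub> w) b = c \<odot>\<^bsub>sp (PT (t.L G)) x\<^esub> thw G x w b"
    proof (rule n.lan_ext[OF G thw(1)[OF x cw] lhom_scale[OF thw(1)[OF x w] V] V _ b])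
      fix al be v assume ov: "n.ovo (x, y) al be" and v: "v \<in> car G al"
      obtain mu ga where b: "be = (mu, ga)" by (cases be)
      show "thw G x (c \<odot>\<^bsub>sp M y\<^esub> w) (n.la G (x, y) al be v) = c \<odot>\<^bsub>sp (PT (t.L G)) x\<^esub> thw G x w (n.la G (x, y) al be v)"
        using thw(2)[OF x cw ov[unfolded b] v] thw(2)[OF x w ov[unfolded b] v] lhomD(3)[OF gl[OF ov[unfolded b] v] w, of c]
        by (simp add: b)
    qed
    fix w' assume w': "w' \<in> car M y"
    note ww = vs_closed(2)[OF My w w']
    show "thw G x (w \<oplus>\<^bsub>sp M y\<^esub> w') b = thw G x w b \<oplus>\<^bsub>sp (PT (t.L G)) x\<^esub> thw G x w' b"
    proof (rule n.lan_ext[OF G thw(1)[OF x ww] lhom_add[OF thw(1)[OF x w] thw(1)[OF x w'] V] V _ b])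
      fix al be v assume ov: "n.ovo (x, y) al be" and v: "v \<in> car G al"
      obtain mu ga where b: "be = (mu, ga)" by (cases be)
      show "thw G x (w \<oplus>\<^bsub>sp M y\<^esub> w') (n.la G (x, y) al be v)
          = thw G x w (n.la G (x, y) al be v) \<oplus>\<^bsub>sp (PT (t.L G)) x\<^esub> thw G x w' (n.la G (x, y) al be v)"
        using thw(2)[OF x ww ov[unfolded b] v] thw(2)[OF x w ov[unfolded b] v] thw(2)[OF x w' ov[unfolded b] v]
          lhomD(2)[OF gl[OF ov[unfolded b] v] w w'] by (simp add: b)
    qed
  qed
  have rel: "thw G x (act M ep w) b = thw G x w (act (n.L G) (Ident C x, ep) b)"
    if e: "ep \<in> Arr C" and b: "b \<in> car (n.L G) (x, Cod C ep)" and w: "w \<in> car M (Dom C ep)" for ep b w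
  proof -
    note ew = fmodD(3)[OF M e w] and ix = C.Ident_Arr[OF x] C.Dom_Ident[OF x] C.Cod_Ident[OF x]
    have ie: "(Ident C x, ep) \<in> Arr EE" using e ix by simp
    show ?thesis
    proof (rule n.lan_ext[OF G thw(1)[OF x ew] lhom_comp[OF B_right[OF nLG x e] thw(1)[OF x w]] V _ b])
      fix al be v assume ov: "n.ovo (x, Cod C ep) al be" and v: "v \<in> car G al"
      obtain mu ga where b: "be = (mu, ga)" by (cases be)
      note ov = ov[unfolded b]
      have ov': "n.ovo (x, Dom C ep) al (mu, Comp C ga ep)" using ov e by (simp add: n_ovo C.Comp_Arr C.Dom_Comp C.Cod_Comp)
      have 1: "act (n.L G) (Ident C x, ep) (n.la G (x, Cod C ep) al (mu, ga) v) = n.la G (x, Dom C ep) al (mu, Comp C ga ep) v"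
        using n.lan_act(2)[OF G ie, of al "(mu, ga)" v] ov v ix C.Comp_Ident_left[of mu] by (simp add: n_ovo)
      have eq: "prd mu al (Comp C ga ep) = Comp C (prd mu al ga) ep"
        using ov e by (simp add: n_ovo C.Comp_assoc C.Comp_Arr C.Dom_Comp C.Cod_Comp)
      have 2: "act M (prd mu al (Comp C ga ep)) w = act M (prd mu al ga) (act M ep w)"
        using fmodD(5)[OF M e, of "prd mu al ga" w] prd_arr[OF ov] w by (simp add: eq)
      show "thw G x (act M ep w) (n.la G (x, Cod C ep) al be v) = thw G x w (act (n.L G) (Ident C x, ep) (n.la G (x, Cod C ep) al be v))"
        unfolding b 1 thw(2)[OF x w ov' v] thw(2)[OF x ew ov v] 2 ..
    qed
  qed
  show "thet G x \<in> lhom (sp (BT (n.L G)) x) (sp (PT (t.L G)) x)"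
    unfolding thet_def by (rule bt_out(1)[OF nLG x V]) (use thw(1)[OF x] r rel in auto)
  show "thet G x (bt (n.L G) x y (n.la G (x, y) al (mu, ga) v) w) = ptg (t.L G) x (t.la G x al mu v) (act M (prd mu al ga) w)"
    if ov: "n.ovo (x, y) al (mu, ga)" and v: "v \<in> car G al" and w: "w \<in> car M y"
  proof -
    have y: "y \<in> Obj C" using ov by (auto simp: n_ovo C.Dom_Obj)
    have "thet G x (bt (n.L G) x y (n.la G (x, y) al (mu, ga) v) w) = thw G x w (n.la G (x, y) al (mu, ga) v)"
      unfolding thet_def
      by (rule bt_out(2)[OF nLG x V, where ph = "\<lambda>y b w. thw G x w b"]) (use thw(1)[OF x] r rel y w n.la_closed[OF G ov v] in auto)
    then show ?thesis using thw(2)[OF x w ov v] by simp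
  qed
qed

lemma BT_lan_ext:
  assumes x: "x \<in> Obj C" and h: "h \<in> lhom (sp (BT (n.L G)) x) V" and h': "h' \<in> lhom (sp (BT (n.L G)) x) V" and V: "vs V"
    and eq: "\<And>y al mu ga v w. n.ovo (x, y) al (mu, ga) ==> y \<in> Obj C ==> v \<in> car G al ==> w \<in> car M y ==>
      h (bt (n.L G) x y (n.la G (x, y) al (mu, ga) v) w) = h' (bt (n.L G) x y (n.la G (x, y) al (mu, ga) v) w)"
    and z: "z \<in> car (BT (n.L G)) x"
  shows "h z = h' z"
proof (rule BT_ext[OF nLG x h h' V _ z])
  fix y b w assume y: "y \<in> Obj C" and b: "b \<in> car (n.L G) (x, y)" and w: "w \<in> car M y"
  note l = bt_left[OF nLG x y w]
  show "h (bt (n.L G) x y b w) = h' (bt (n.L G) x y b w)"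
  proof (rule n.lan_ext[OF G lhom_comp[OF l h] lhom_comp[OF l h'] V _ b])
    show "h (bt (n.L G) x y (n.la G (x, y) al be v) w) = h' (bt (n.L G) x y (n.la G (x, y) al be v) w)"
      if "n.ovo (x, y) al be" "v \<in> car G al" for al be v
      using eq[of y al "fst be" "snd be" v w] that y w by simp
  qed
qed

lemma thet_nat: "nat_trans C (BT (n.L G)) (PT (t.L G)) (thet G)"
proof (rule nat_transI[OF thet(1)])
  fix g z assume g: "g \<in> Arr C" and z: "z \<in> car (BT (n.L G)) (Dom C g)"
  note o = C.Dom_Obj[OF g] C.Cod_Obj[OF g]
  show "thet G (Cod C g) (act (BT (n.L G)) g z) = act (PT (t.L G)) g (thet G (Dom C g) z)"
  proof (rule BT_lan_ext[OF o(1) lhom_comp[OF BT_act(1)[OF nLG g] thet(1)[OF o(2)]] lhom_comp[OF thet(1)[OF o(1)] PT_act(1)[OF tLG g]] PT_vs[OF tLG o(2)] _ z])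
    fix y al mu ga v w assume ov: "n.ovo (Dom C g, y) al (mu, ga)" and y: "y \<in> Obj C" and v: "v \<in> car G al" and w: "w \<in> car M y"
    have gy: "(g, Ident C y) \<in> Arr EE" using g y by (simp add: C.Ident_Arr)
    have ov': "n.ovo (Cod C g, y) al (Comp C g mu, ga)" using ov g by (simp add: n_ovo C.Comp_Arr C.Dom_Comp C.Cod_Comp)
    have 1: "act (n.L G) (g, Ident C y) (n.la G (Dom C g, y) al (mu, ga) v) = n.la G (Cod C g, y) al (Comp C g mu, ga) v"
      using n.lan_act(2)[OF G gy, of al "(mu, ga)" v] ov v y C.Comp_Ident_right[of ga]
      by (auto simp: n_ovo C.Ident_Arr C.Dom_Ident C.Cod_Ident)
    have 2: "act M (prd (Comp C g mu) al ga) w = act M g (act M (prd mu al ga) w)"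
      using fmodD(5)[OF M prd_arr(1)[OF ov] g, of w] prd_arr[OF ov] w ov g
      by (simp add: n_ovo C.Comp_assoc C.Comp_Arr C.Dom_Comp C.Cod_Comp)
    note tc = t.la_closed[OF G n_t_ovo[OF ov] v] and mc = lhomD(1)[OF M_prd[OF ov] w]
    show "thet G (Cod C g) (act (BT (n.L G)) g (bt (n.L G) (Dom C g) y (n.la G (Dom C g, y) al (mu, ga) v) w))
        = act (PT (t.L G)) g (thet G (Dom C g) (bt (n.L G) (Dom C g) y (n.la G (Dom C g, y) al (mu, ga) v) w))"
      unfolding BT_act(2)[OF nLG g y n.la_closed[OF G ov v] w] 1 thet(2)[OF o(2) ov' v w] thet(2)[OF o(1) ov v w]
        PT_act(2)[OF tLG g tc mc] 2 t.lan_act(2)[OF G g n_t_ovo[OF ov] v] ..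
  qed
qed

text \<open>On a generator both sides are \<open>f al v\<close> times \<open>M(mu al ga) w\<close>:
  the augmentation along \<open>\<nabla>\<close> produces the arrow \<open>mu al ga\<close>, which
  then acts on \<open>w\<close>, while on the side of \<open>t\<close> this action has already been
  performed by \<open>thet\<close>.\<close>

lemma thet_aug:
  assumes f: "nat_trans FF G kF f" and x: "x \<in> Obj C" and z: "z \<in> car (BT (n.L G)) x"
  shows "ptensor_aug M (lan_target_aug C f) x (thet G x z) = btensor_aug C M (lan_nabla_aug C f) x z"
proof -
  note tf = target_aug[OF G f] and nf = nabla_aug[OF G f]
  note pa = PT_aug[OF tLG tf(1)] and ba = BT_aug[OF nLG nf(1)]
  show ?thesis
  proof (rule BT_lan_ext[OF x lhom_comp[OF thet(1)[OF x] pa(1)[OF x]] ba(1)[OF x] Mv[OF x] _ z])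
    fix y al mu ga v w assume ov: "n.ovo (x, y) al (mu, ga)" and y: "y \<in> Obj C" and v: "v \<in> car G al" and w: "w \<in> car M y"
    note mc = lhomD(1)[OF M_prd[OF ov] w]
    show "ptensor_aug M (lan_target_aug C f) x (thet G x (bt (n.L G) x y (n.la G (x, y) al (mu, ga) v) w))
        = btensor_aug C M (lan_nabla_aug C f) x (bt (n.L G) x y (n.la G (x, y) al (mu, ga) v) w)"
      unfolding thet(2)[OF x ov v w] pa(2)[OF x t.la_closed[OF G n_t_ovo[OF ov] v] mc] ba(2)[OF x y n.la_closed[OF G ov v] w]
        nf(2)[OF ov v] tf(2)[OF n_t_ovo[OF ov] v]
      by (rule lin_single_at[where ph = "\<lambda>al. act M al w", OF Mv[OF x] mc, symmetric])
  qed
qed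

end

lemma thet_map:
  assumes G: "fmod FF G" and G': "fmod FF G'" and et: "nat_trans FF G G' et" and x: "x \<in> Obj C"
    and z: "z \<in> car (BT (n.L G)) x"
  shows "thet G' x (BTm (n.L G') (nmap G' et) x z)
      = ptensor_map M (t.L G') (tmap G' et) x (thet G x z)"
proof -
  note nm = n.lan_map[OF G G' et] and tm = t.lan_map[OF G G' et]
  note bm = BT_map_nat[OF nLG[OF G] nLG[OF G'] nm(3)]
  note pm = PT_map[where et = "tmap G' et", OF tLG[OF G] x fmodD(1)[OF tLG[OF G'] x] tm(1)]
  show ?thesis
  proof (rule BT_lan_ext[OF G x lhom_comp[OF nat_transD(1)[OF bm(1) x] thet(1)[OF G' x]] lhom_comp[OF thet(1)[OF G x] pm(1)] PT_vs[OF tLG[OF G'] x] _ z])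
    fix y al mu ga v w assume ov: "n.ovo (x, y) al (mu, ga)" and y: "y \<in> Obj C" and v: "v \<in> car G al" and w: "w \<in> car M y"
    have v': "et al v \<in> car G' al" using nat_transD(2)[OF et _ v] ov by (simp add: n_ovo)
    show "thet G' x (BTm (n.L G') (nmap G' et) x (bt (n.L G) x y (n.la G (x, y) al (mu, ga) v) w))
      = ptensor_map M (t.L G') (tmap G' et) x (thet G x (bt (n.L G) x y (n.la G (x, y) al (mu, ga) v) w))"
      unfolding bm(2)[OF x y n.la_closed[OF G ov v] w] nm(2)[OF ov v] thet(2)[OF G' x ov v' w] thet(2)[OF G x ov v w]
        pm(2)[OF t.la_closed[OF G n_t_ovo[OF ov] v] lhomD(1)[OF M_prd[OF ov] w]] tm(2)[OF n_t_ovo[OF ov] v] ..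
  qed
qed

end

section \<open>The constant functor in place of \<open>M\<close>, and exactness of \<open>LK\<close>
  along \<open>t\<close>\<close>

locale factk = factm C "const_mod :: ('o, 'm, 'k::field, 'k) kfunctor"
  for C :: "('o, 'm) category" and field_type :: "'k::field itself"
begin

text \<open>The unit constraint of the pointwise tensor product, from \<open>N \<otimes> k\<close>
  to \<open>N\<close>; it brings a complex tensored with \<open>k\<close> back to the original
  one.\<close>

definition lam :: "('o, 'm, 'k, 'v) kfunctor => _" where
  "lam N x = pres_out (sp N x) (\<lambda>(v, c). c \<odot>\<^bsub>sp N x\<^esub> v)"

context
  fixes N :: "('o, 'm, 'k, 'v) kfunctor"
  assumes N: "fmod C N"
begin

lemma lam:
  assumes x: "x \<in> Obj C"
  shows "lam N x \<in> lhom (sp (PT N) x) (sp N x)"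
    and "v \<in> car N x ==> lam N x (ptg N x v c) = c \<odot>\<^bsub>sp N x\<^esub> v"
proof -
  note V = fmodD(1)[OF N x]
  have l: "(\<lambda>c. c \<odot>\<^bsub>sp N x\<^esub> v) \<in> lhom (sp K x) (sp N x)" if "v \<in> car N x" for v
    by (rule lhomI) (use that vs_closed(3)[OF V] vs_smult[OF V] in auto)
  have r: "(\<lambda>v. c \<odot>\<^bsub>sp N x\<^esub> v) \<in> lhom (sp N x) (sp N x)" for c by (rule lhom_scale[OF lhom_id V])
  show "lam N x \<in> lhom (sp (PT N) x) (sp N x)"
    unfolding lam_def PT_sp by (rule tens_out(1)[OF V vs_const_mod V]) (use l r in auto)
  show "lam N x (ptg N x v c) = c \<odot>\<^bsub>sp N x\<^esub> v" if "v \<in> car N x"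
    unfolding lam_def by (rule tens_out(2)[OF V vs_const_mod V]) (use l r that in auto)
qed

lemma lam_nat: "nat_trans C (PT N) N (lam N)"
proof (rule nat_transI[OF lam(1)])
  fix g z assume g: "g \<in> Arr C" and z: "z \<in> car (PT N) (Dom C g)"
  note o = C.Dom_Obj[OF g] C.Cod_Obj[OF g]
  show "lam N (Cod C g) (act (PT N) g z) = act N g (lam N (Dom C g) z)"
    by (rule PT_ext[OF N o(1) lhom_comp[OF PT_act(1)[OF N g] lam(1)[OF o(2)]] lhom_comp[OF lam(1)[OF o(1)] fmodD(2)[OF N g]] fmodD(1)[OF N o(2)] _ z])
       (simp add: PT_act(2)[OF N g] lam(2)[OF o(1)] lam(2)[OF o(2)] fmodD(3)[OF N g] lhomD(3)[OF fmodD(2)[OF N g]])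
qed

lemma lam_aug:
  assumes f: "nat_trans C N K f" and x: "x \<in> Obj C" and z: "z \<in> car (PT N) x"
  shows "f x (lam N x z) = ptensor_aug K f x z"
  by (rule PT_ext[OF N x lhom_comp[OF lam(1)[OF x] nat_transD(1)[OF f x]] PT_aug(1)[OF N f x] vs_const_mod _ z])
     (simp add: lam(2)[OF x] PT_aug(2)[OF N f x] lhomD(3)[OF nat_transD(1)[OF f x]])

end

lemma lam_map:
  assumes N: "fmod C N" and N': "fmod C N'" and et: "nat_trans C N N' et" and x: "x \<in> Obj C" and z: "z \<in> car (PT N) x"
  shows "lam N' x (ptensor_map K N' et x z) = et x (lam N x z)"
proof -
  note pm = PT_map[where et = et, OF N x fmodD(1)[OF N' x] nat_transD(1)[OF et x]]
  show ?thesis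
    by (rule PT_ext[OF N x lhom_comp[OF pm(1) lam(1)[OF N' x]] lhom_comp[OF lam(1)[OF N x] nat_transD(1)[OF et x]] fmodD(1)[OF N' x] _ z])
       (simp add: pm(2) lam(2)[OF N x] lam(2)[OF N' x] nat_transD(2)[OF et x] lhomD(3)[OF nat_transD(1)[OF et x]])
qed

text \<open>The maps \<open>lam\<close> form a chain map from the tensored complex back to
  \<open>R\<close> over the identity. Following a lift into the tensored complex they give a lift of
  the identity of \<open>R\<close>, which induces the identity on classes; \<open>lam_aug\<close>
  identifies this pullback with the one in \<open>ext_ptensor\<close>.\<close>

lemma ext_ptensor_id:
  assumes R: "proj_resolution C K R" and c: "c \<in> carrier (ext_algebra C R K)"
  shows "ext_ptensor C K R R c = c"
proof
  fix n
  note CC = C.finite_category_axioms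
  interpret ext_functor C K R C K R PT "ptensor_map K" "ptensor_aug K"
    by (rule PT_ext_functor[OF R R])
  have cn: "c n \<in> carrier (ext_space C R K n)" using c by (simp add: ext_algebra_def)
  then obtain f where f: "f \<in> cocycles C R K n" "c n = coh_class C R K n f"
    unfolding ext_space_simps(1)[OF CC RP fM] by blast
  obtain ph where ph: "ph \<in> lifts C R 0 Y (aug R)" by (rule lift_exists)
  note fR = resolutionD(2)[OF RP] and dR = resolutionD(3)[OF RP] and aR = resolutionD(4)[OF RP]
  have l: "(\<lambda>i. lam (mods R i)) \<in> lifts C Y 0 R (aug Y)"
  proof (rule liftsI)
    show "nat_trans C (mods Y (0 + i)) (mods R i) (lam (mods R i))" for i
      using lam_nat[OF fR] by (simp add: Y_simps)
    show "aug R x (lam (mods R 0) x v) = aug Y x v" if "x \<in> Obj C" "v \<in> car (mods Y 0) x" for x v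
      using lam_aug[OF fR aR] that by (simp add: Y_simps)
    show "bdry R i x (lam (mods R (Suc i)) x v) = lam (mods R i) x (bdry Y (0 + i) x v)"
      if "x \<in> Obj C" "v \<in> car (mods Y (Suc (0 + i))) x" for i x v
      using lam_map[OF fR fR dR] that by (simp add: Y_simps)
  qed
  have 1: "cohom C R K n f (\<lambda>x v. f x (lam (mods R n) x (ph n x v)))"
    using lifts_unique[OF CC R RP fM lifts_comp[OF CC ph l] lifts_id f(1)] by simp
  have 2: "cohom C R K n (\<lambda>x v. f x (lam (mods R n) x (ph n x v))) (\<lambda>x v. ptensor_aug K f x (ph n x v))"
    by (rule cohom_eq[OF CC RP fM cohomD(2)[OF 1]])
       (use lam_aug[OF fR cocyclesD(1)[OF f(1)]] nat_transD(2)[OF liftsD(1)[OF ph]] in \<open>simp add: Y_simps\<close>)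
  have "coh_class C R K n f = coh_class C R K n (\<lambda>x v. ptensor_aug K f x (ph n x v))"
    using coh_class_eq_iff[OF CC RP fM f(1) cohomD(2)[OF 2]] cohom_trans[OF CC RP fM 1 2] by blast
  then show "ext_ptensor C K R R c n = c n"
    unfolding ext_ptensor_def induced_map_H f(2) H_eq[OF f(1) ph] by simp
qed

text \<open>\<open>LK\<close> along \<open>t\<close> is a natural retract of \<open>LK\<close> along \<open>\<nabla>\<close> tensored with the constant functor.\<close>

definition ti :: "('m, 'm \<times> 'm \<times> 'm, 'k, 'v) kfunctor => _" where
  "ti G x = pres_out (sp (BT (n.L G)) x)
    (\<lambda>(al, mu, v). bt (n.L G) x (Dom C al) (n.la G (x, Dom C al) al (mu, Ident C (Dom C al)) v) 1)"

lemma ti_ovo: "t.ovo x al mu ==> n.ovo (x, Dom C al) al (mu, Ident C (Dom C al))"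
  by (simp add: t_ovo n_ovo C.Ident_Arr C.Dom_Obj C.Dom_Ident C.Cod_Ident)

context
  fixes G :: "('m, 'm \<times> 'm \<times> 'm, 'k, 'v) kfunctor"
  assumes G: "fmod FF G"
begin

text \<open>Compatibility with an arrow \<open>(al, mu, ga)\<close> rests on the tensor relation:
  \<open>ga\<close> is moved across to the second factor, where it acts trivially on
  \<open>1\<close>.\<close>

lemma ti:
  assumes x: "x \<in> Obj C"
  shows "ti G x \<in> lhom (sp (t.L G) x) (sp (BT (n.L G)) x)"
    and "t.ovo x al mu ==> v \<in> car G al ==>
      ti G x (t.la G x al mu v) = bt (n.L G) x (Dom C al) (n.la G (x, Dom C al) al (mu, Ident C (Dom C al)) v) 1"
proof -
  note nL = nLG[OF G]
  note V = BT_vs[OF nL x] and ix = C.Ident_Arr[OF x] C.Dom_Ident[OF x] C.Cod_Ident[OF x]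
  let ?ph = "\<lambda>al mu v. bt (n.L G) x (Dom C al) (n.la G (x, Dom C al) al (mu, Ident C (Dom C al)) v) 1"
  have l: "?ph al mu \<in> lhom (sp G al) (sp (BT (n.L G)) x)" if ov: "t.ovo x al mu" for al mu
    by (rule lhom_comp[OF n.la_lhom[OF G ti_ovo[OF ov]] bt_left[OF nL x]]) (use ov in \<open>simp_all add: t_ovo C.Dom_Obj\<close>)
  have r: "?ph (Cod FF a) be (act G a v) = ?ph (Dom FF a) (Comp C be (amap (fact_target C) a)) v"
    if a: "a \<in> Arr FF" and ov: "t.ovo x (Cod FF a) be" and v: "v \<in> car G (Dom FF a)" for a be v
  proof -
    obtain al mu ga where b: "a = (al, mu, ga)" by (metis surj_pair)
    let ?al' = "prd mu al ga"
    have A: "al \<in> Arr C" "mu \<in> Arr C" "ga \<in> Arr C" "Dom C mu = Cod C al" "Cod C ga = Dom C al" using a by (simp_all add: b)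
    have d: "Dom C ?al' = Dom C ga" "Cod C ?al' = Cod C mu" using A by (simp_all add: C.Comp_Arr C.Dom_Comp C.Cod_Comp)
    have bo: "be \<in> Arr C" "Dom C be = Cod C mu" "Cod C be = x" using ov d by (simp_all add: t_ovo b)
    have ov1: "t.ovo x al (Comp C be mu)" using A bo by (simp add: t_ovo C.Comp_Arr C.Dom_Comp C.Cod_Comp)
    have v': "v \<in> car G al" using v by (simp add: b)
    have ie: "(Ident C x, ga) \<in> Arr EE" using A ix by simp
    have 1: "n.la G (x, Dom C ga) ?al' (be, Ident C (Dom C ga)) (act G a v) = n.la G (x, Dom C ga) al (Comp C be mu, ga) v"
      using n.la_rel[OF G a, of "(x, Dom C ga)" "(be, Ident C (Dom C ga))" v] ti_ovo[OF ov] v C.Comp_Ident_right[OF A(3)]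
      by (simp add: b d)
    have 2: "act (n.L G) (Ident C x, ga) (n.la G (x, Cod C ga) al (Comp C be mu, Ident C (Dom C al)) v) = n.la G (x, Dom C ga) al (Comp C be mu, ga) v"
      using n.lan_act(2)[OF G ie, of al "(Comp C be mu, Ident C (Dom C al))" v] ti_ovo[OF ov1] v' ix A
        C.Comp_Ident_left[of "Comp C be mu"] C.Comp_Ident_left[OF A(3)] ov1 by (simp add: t_ovo)
    have "?ph al (Comp C be mu) v = bt (n.L G) x (Cod C ga) (n.la G (x, Cod C ga) al (Comp C be mu, Ident C (Dom C al)) v) (act K ga 1)"
      by (simp add: A)
    also have "\<dots> = bt (n.L G) x (Dom C ga) (n.la G (x, Dom C ga) al (Comp C be mu, ga) v) 1"
      using bt_rel[OF nL x A(3), of "n.la G (x, Cod C ga) al (Comp C be mu, Ident C (Dom C al)) v" 1]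
        n.la_closed[OF G ti_ovo[OF ov1] v'] A by (simp add: 2[unfolded A(5)])
    finally show ?thesis by (simp add: b d 1[unfolded b])
  qed
  show "ti G x \<in> lhom (sp (t.L G) x) (sp (BT (n.L G)) x)"
    unfolding ti_def by (rule t.lan_out(1)[OF G V l r])
  show "ti G x (t.la G x al mu v) = bt (n.L G) x (Dom C al) (n.la G (x, Dom C al) al (mu, Ident C (Dom C al)) v) 1"
    if "t.ovo x al mu" "v \<in> car G al"
    unfolding ti_def by (rule t.lan_out(2)[OF G V l r that])
qed

text \<open>The identity in the middle position makes \<open>thet\<close> return the original class
  tensored with \<open>1\<close>, and \<open>lam\<close> removes the factor
  \<open>1\<close>.\<close>

lemma lam_thet_ti:
  assumes x: "x \<in> Obj C" and z: "z \<in> car (t.L G) x"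
  shows "lam (t.L G) x (thet G x (ti G x z)) = z"
proof (rule t.lan_ext[OF G lhom_comp[OF ti(1)[OF x] lhom_comp[OF thet(1)[OF G x] lam(1)[OF tLG[OF G] x]]] lhom_id t.vs_lan[OF G] _ z])
  show "lam (t.L G) x (thet G x (ti G x (t.la G x al mu v))) = t.la G x al mu v" if ov: "t.ovo x al mu" and v: "v \<in> car G al" for al mu v
    using ti(2)[OF x ov v] thet(2)[OF G x ti_ovo[OF ov] v, of 1] lam(2)[OF tLG[OF G] x t.la_closed[OF G ov v], of 1]
      vs_smult(4)[OF t.vs_lan[OF G] t.la_closed[OF G ov v]] by simp
qed

lemma ti_aug:
  assumes f: "nat_trans FF G kF f" and x: "x \<in> Obj C" and z: "z \<in> car (t.L G) x"
  shows "btensor_aug C K (lan_nabla_aug C f) x (ti G x z) = lan_target_aug C f x z"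
proof -
  note tf = target_aug[OF G f] and nf = nabla_aug[OF G f]
  note ba = BT_aug[OF nLG[OF G] nf(1)]
  show ?thesis
  proof (rule t.lan_ext[OF G lhom_comp[OF ti(1)[OF x] ba(1)[OF x]] nat_transD(1)[OF tf(1) x] vs_const_mod _ z])
    fix al mu v assume ov: "t.ovo x al mu" and v: "v \<in> car G al"
    have y: "Dom C al \<in> Obj C" using ov by (simp add: t_ovo C.Dom_Obj)
    show "btensor_aug C K (lan_nabla_aug C f) x (ti G x (t.la G x al mu v)) = lan_target_aug C f x (t.la G x al mu v)"
      unfolding ti(2)[OF x ov v] tf(2)[OF ov v]
      by (subst ba(2)[OF x y n.la_closed[OF G ti_ovo[OF ov] v]])
         (simp_all add: nf(2)[OF ti_ovo[OF ov] v] lin_single_at[OF vs_const_mod])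
  qed
qed

end

lemma ti_map:
  assumes G: "fmod FF G" and G': "fmod FF G'" and et: "nat_trans FF G G' et" and x: "x \<in> Obj C"
    and z: "z \<in> car (t.L G) x"
  shows "BTm (n.L G') (nmap G' et) x (ti G x z)
      = ti G' x (tmap G' et x z)"
proof -
  note nm = n.lan_map[OF G G' et] and tm = t.lan_map[OF G G' et]
  note bm = BT_map_nat[OF nLG[OF G] nLG[OF G'] nm(3)]
  show ?thesis
  proof (rule t.lan_ext[OF G lhom_comp[OF ti(1)[OF G x] nat_transD(1)[OF bm(1) x]] lhom_comp[OF tm(1) ti(1)[OF G' x]] BT_vs[OF nLG[OF G'] x] _ z])
    fix al mu v assume ov: "t.ovo x al mu" and v: "v \<in> car G al"
    have y: "Dom C al \<in> Obj C" "al \<in> Obj FF" using ov by (simp_all add: t_ovo C.Dom_Obj)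
    show "BTm (n.L G') (nmap G' et) x (ti G x (t.la G x al mu v))
      = ti G' x (tmap G' et x (t.la G x al mu v))"
      unfolding ti(2)[OF G x ov v] tm(2)[OF ov v] ti(2)[OF G' x ov nat_transD(2)[OF et y(2) v]]
      by (subst bm(2)[OF x y(1) n.la_closed[OF G ti_ovo[OF ov] v]]) (simp_all add: nm(2)[OF ti_ovo[OF ov] v])
  qed
qed

abbreviation Ltar where
  "Ltar \<equiv> image_complex (lan (fact_target C) (fact_cat C) C) (lan_map (fact_target C) (fact_cat C) C) (lan_target_aug C)"

text \<open>A retract of an exact complex is exact: a cycle is sent by \<open>ti\<close> into the
  image of \<open>P\<close> under \<open>LK\<close> along \<open>\<nabla>\<close> and the tensor
  product with \<open>k\<close>, filled there, and the filling is brought back by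
  \<open>pp\<close>.\<close>

lemma target_resolution:
  assumes P: "proj_resolution FF kF P"
  shows "proj_resolution C K (Ltar P)"
proof -
  have R: "resolution FF kF P" using P by (simp add: proj_resolution_def)
  note fP = resolutionD(2)[OF R] and dP = resolutionD(3)[OF R] and aP = resolutionD(4)[OF R]
  note A = BT_resolution[OF nabla_resolution[OF P]]
  let ?A = "BTc (Lnab P)"
  \<comment> \<open>The retraction: a chain map compatible with the augmentations, and left inverse
    to \<open>ti\<close>.\<close>
  define pp where "pp = (\<lambda>n x z. lam (t.L (mods P n)) x (thet (mods P n) x z))"
  note tl = tLG[OF fP]
  have ppc: "pp n x u \<in> car (t.L (mods P n)) x" if "x \<in> Obj C" "u \<in> car (BT (n.L (mods P n))) x" for n x u
    unfolding pp_def by (rule lhomD(1)[OF lam(1)[OF tl that(1)] lhomD(1)[OF thet(1)[OF fP that(1)] that(2)]])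
  have ppd: "tmap (mods P n) (bdry P n) x (pp (Suc n) x u)
      = pp n x (BTm (n.L (mods P n)) (nmap (mods P n) (bdry P n)) x u)"
    if x: "x \<in> Obj C" and u: "u \<in> car (BT (n.L (mods P (Suc n)))) x" for n x u
    unfolding pp_def thet_map[OF fP fP dP x u]
    by (rule lam_map[OF tl tl t.lan_map(3)[OF fP fP dP] x lhomD(1)[OF thet(1)[OF fP x] u], symmetric])
  have ppa: "lan_target_aug C (aug P) x (pp 0 x u) = btensor_aug C K (lan_nabla_aug C (aug P)) x u"
    if x: "x \<in> Obj C" and u: "u \<in> car (BT (n.L (mods P 0))) x" for x u
    unfolding pp_def lam_aug[OF tl target_aug(1)[OF fP aP] x lhomD(1)[OF thet(1)[OF fP x] u]] thet_aug[OF fP aP x u] ..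
  have "resolution C K (Ltar P)"
  proof (rule resolutionI[OF C.finite_category_axioms fmod_const_mod])
    note nt = t.lan_image_nat[OF target_const(1) P fmod_const_mod, unfolded target_aug_eq]
    show "fmod C (mods (Ltar P) n)" for n by (rule nt(1))
    show "nat_trans C (mods (Ltar P) (Suc n)) (mods (Ltar P) n) (bdry (Ltar P) n)" for n by (rule nt(2))
    show "nat_trans C (mods (Ltar P) 0) K (aug (Ltar P))" by (rule nt(3))
    fix x assume x: "x \<in> Obj C"
    let ?V = "\<lambda>n. sp (t.L (mods P n)) x" and ?d = "\<lambda>n. tmap (mods P n) (bdry P n) x"
    let ?a = "lan_target_aug C (aug P) x"
    note dl = t.lan_map(1)[OF fP fP dP] and V = t.vs_lan[OF fP] and ta = target_aug[OF fP aP]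
    note al = nat_transD(1)[OF ta(1) x]
    show "\<exists>v\<in>car (mods (Ltar P) 0) x. aug (Ltar P) x v = w" if w: "w \<in> car K x" for w
    proof -
      obtain u where "u \<in> car (BT (n.L (mods P 0))) x" "w = btensor_aug C K (lan_nabla_aug C (aug P)) x u"
        using resolution_exact(1)[OF A x w] unfolding Fm_aug_simps by blast
      then show ?thesis unfolding Fm_aug_simps using ppa[OF x, of u] ppc[OF x, of u 0] by (intro bexI[of _ "pp 0 x u"]) simp_all
    qed
    show "aug (Ltar P) x (bdry (Ltar P) 0 x v) = \<zero>\<^bsub>sp K x\<^esub>" if "v \<in> car (mods (Ltar P) 1) x" for v
      unfolding Fm_aug_simps
    proof (rule t.lan_ext[OF fP lhom_comp[OF dl al] lhom_const_zero[OF vs_const_mod] vs_const_mod _ that[unfolded Fm_aug_simps One_nat_def]])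
      fix al be v assume ov: "t.ovo x al be" and v: "v \<in> car (mods P (Suc 0)) al"
      have a: "al \<in> Obj FF" using ov by (simp add: t_ovo)
      show "?a (?d 0 (t.la (mods P (Suc 0)) x al be v)) = \<zero>\<^bsub>sp K x\<^esub>"
        using t.lan_map(2)[OF fP fP dP ov v] ta(2)[OF ov nat_transD(2)[OF dP a v]] resolution_exact(2)[OF R a, of v] v by simp
    qed
    show "bdry (Ltar P) n x (bdry (Ltar P) (Suc n) x v) = \<zero>\<^bsub>sp (mods (Ltar P) n) x\<^esub>"
      if "v \<in> car (mods (Ltar P) (Suc (Suc n))) x" for n v
      unfolding Fm_aug_simps
    proof (rule t.lan_ext[OF fP lhom_comp[OF dl dl] lhom_const_zero[OF V] V _ that[unfolded Fm_aug_simps]])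
      fix al be v assume ov: "t.ovo x al be" and v: "v \<in> car (mods P (Suc (Suc n))) al"
      have a: "al \<in> Obj FF" using ov by (simp add: t_ovo)
      show "?d n (?d (Suc n) (t.la (mods P (Suc (Suc n))) x al be v)) = \<zero>\<^bsub>?V n\<^esub>"
        using t.lan_map(2)[OF fP fP dP ov v] t.lan_map(2)[OF fP fP dP ov nat_transD(2)[OF dP a v]]
          resolution_exact(3)[OF R a, of v n] v lhom_zero[OF t.la_lhom[OF fP ov] fmodD(1)[OF fP a] V] by simp
    qed
    show "\<exists>u\<in>car (mods (Ltar P) 1) x. z = bdry (Ltar P) 0 x u"
      if z: "z \<in> car (mods (Ltar P) 0) x" "aug (Ltar P) x z = \<zero>\<^bsub>sp K x\<^esub>" for z
    proof -
      note z = z[unfolded Fm_aug_simps]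
      have "ti (mods P 0) x z \<in> car (mods ?A 0) x" unfolding Fm_aug_simps by (rule lhomD(1)[OF ti(1)[OF fP x] z(1)])
      from resolution_exact(4)[OF A x this] obtain u where u: "u \<in> car (BT (n.L (mods P (Suc 0)))) x"
        "ti (mods P 0) x z = BTm (n.L (mods P 0)) (nmap (mods P 0) (bdry P 0)) x u"
        using ti_aug[OF fP aP x z(1)] z(2) unfolding Fm_aug_simps by auto
      have "z = ?d 0 (pp (Suc 0) x u)"
        using lam_thet_ti[OF fP x z(1)] ppd[OF x u(1)] by (simp add: u(2) pp_def)
      then show ?thesis using ppc[OF x u(1)] unfolding Fm_aug_simps One_nat_def by blast
    qed
    show "\<exists>u\<in>car (mods (Ltar P) (Suc (Suc n))) x. z = bdry (Ltar P) (Suc n) x u"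
      if z: "z \<in> car (mods (Ltar P) (Suc n)) x" "bdry (Ltar P) n x z = \<zero>\<^bsub>sp (mods (Ltar P) n) x\<^esub>" for n z
    proof -
      note z = z[unfolded Fm_aug_simps]
      have "ti (mods P (Suc n)) x z \<in> car (mods ?A (Suc n)) x" unfolding Fm_aug_simps by (rule lhomD(1)[OF ti(1)[OF fP x] z(1)])
      note * = resolution_exact(5)[OF A x this]
      obtain u where u: "u \<in> car (BT (n.L (mods P (Suc (Suc n))))) x"
        "ti (mods P (Suc n)) x z = BTm (n.L (mods P (Suc n))) (nmap (mods P (Suc n)) (bdry P (Suc n))) x u"
      proof -
        have "bdry ?A n x (ti (mods P (Suc n)) x z) = \<zero>\<^bsub>sp (mods ?A n) x\<^esub>"
          unfolding Fm_aug_simps ti_map[OF fP fP dP x z(1)] z(2) by (rule lhom_zero[OF ti(1)[OF fP x] V BT_vs[OF nLG[OF fP] x]])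
        from * [OF this] that show thesis unfolding Fm_aug_simps by blast
      qed
      have "z = ?d (Suc n) (pp (Suc (Suc n)) x u)"
        using lam_thet_ti[OF fP x z(1)] ppd[OF x u(1)] by (simp add: u(2) pp_def)
      then show ?thesis using ppc[OF x u(1)] unfolding Fm_aug_simps by blast
    qed
  qed
  moreover have "projective C (mods (Ltar P) n)" for n
    unfolding Fm_aug_simps by (rule t.lan_projective) (use P in \<open>simp add: proj_resolution_def\<close>)
  ultimately show ?thesis by (simp add: proj_resolution_def)
qed

end

section \<open>The left Kan extension along the target functor\<close>

lemma algebra_hom_compose: "f \<in> algebra_hom A B ==> g \<in> algebra_hom B Z ==> (\<lambda>c. g (f c)) \<in> algebra_hom A Z"
  unfolding algebra_hom_def using ring_hom_trans[of f A B g Z] lhom_comp[of f A B g Z] by (simp add: comp_def)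

context factk
begin

text \<open>The unit of the adjunction between \<open>LK\<close> and restriction along \<open>t\<close>.\<close>

definition eta where "eta G a = t.la G (Cod C a) a (Ident C (Cod C a))"

lemma eta_ovo: "a \<in> Arr C ==> t.ovo (Cod C a) a (Ident C (Cod C a))"
  by (simp add: t_ovo C.Ident_Arr C.Cod_Obj C.Dom_Ident C.Cod_Ident)

context
  fixes G :: "('m, 'm \<times> 'm \<times> 'm, 'k, 'v) kfunctor"
  assumes G: "fmod FF G"
begin

lemma eta_lhom: "a \<in> Arr C ==> eta G a \<in> lhom (sp G a) (sp (t.L G) (Cod C a))"
  unfolding eta_def by (rule t.la_lhom[OF G eta_ovo])

lemma act_eta:
  assumes "t.ovo x a mu" "v \<in> car G a"
  shows "act (t.L G) mu (eta G a v) = t.la G x a mu v"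
  using t.lan_act(2)[OF G, of mu a "Ident C (Cod C a)" v] eta_ovo[of a] assms C.Comp_Ident_right[of mu]
  by (simp add: eta_def t_ovo)

lemma eta_act:
  assumes a: "a \<in> Arr FF" and v: "v \<in> car G (Dom FF a)"
  shows "eta G (Cod FF a) (act G a v) = act (t.L G) (fst (snd a)) (eta G (Dom FF a) v)"
proof -
  obtain al mu ga where b: "a = (al, mu, ga)" by (metis surj_pair)
  have A: "al \<in> Arr C" "mu \<in> Arr C" "ga \<in> Arr C" "Dom C mu = Cod C al" "Cod C ga = Dom C al" using a by (simp_all add: b)
  have d: "prd mu al ga \<in> Arr C" "Cod C (prd mu al ga) = Cod C mu" using A by (simp_all add: C.Comp_Arr C.Dom_Comp C.Cod_Comp)
  show ?thesis
    using t.la_rel[OF G a, of "Cod C mu" "Ident C (Cod C mu)" v] eta_ovo[OF d(1)] v A d C.Comp_Ident_left[OF A(2)]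
      act_eta[of "Cod C mu" al mu v] by (simp add: b eta_def t_ovo)
qed

text \<open>Transposition along the adjunction: the constant functor restricted along
  \<open>t\<close> is again constant, so a map from \<open>LK G\<close> to \<open>k\<close>
  corresponds to one from \<open>G\<close> to \<open>k\<close>.\<close>

lemma eta_nat:
  assumes h: "nat_trans C (t.L G) K h"
  shows "nat_trans FF G kF (\<lambda>a v. h (Cod C a) (eta G a v))"
proof (rule nat_transI)
  have kk: "(\<lambda>c. c) \<in> lhom (sp K (Cod C a)) (sp kF a)" for a by (rule lhomI) auto
  show "(\<lambda>v. h (Cod C a) (eta G a v)) \<in> lhom (sp G a) (sp kF a)" if "a \<in> Obj FF" for a
    by (rule lhom_comp[OF lhom_comp[OF eta_lhom nat_transD(1)[OF h]] kk]) (use that in \<open>simp_all add: C.Cod_Obj\<close>)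
  fix a v assume a: "a \<in> Arr FF" and v: "v \<in> car G (Dom FF a)"
  obtain al mu ga where b: "a = (al, mu, ga)" by (metis surj_pair)
  have A: "al \<in> Arr C" "mu \<in> Arr C" "Dom C mu = Cod C al" using a by (simp_all add: b)
  have d: "Cod C (prd mu al ga) = Cod C mu" using a by (simp add: b C.Comp_Arr C.Dom_Comp C.Cod_Comp)
  show "h (Cod C (Cod FF a)) (eta G (Cod FF a) (act G a v)) = act kF a (h (Cod C (Dom FF a)) (eta G (Dom FF a) v))"
    unfolding eta_act[OF a v] using nat_transD(3)[OF h A(2), of "eta G al v"] lhomD(1)[OF eta_lhom[OF A(1)], of v] v A d
    by (simp add: b)
qed

lemma target_aug_eta:
  assumes "nat_trans FF G kF f" "a \<in> Arr C" "v \<in> car G a"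
  shows "lan_target_aug C f (Cod C a) (eta G a v) = f a v"
  unfolding eta_def by (rule target_aug(2)[OF G assms(1) eta_ovo[OF assms(2)] assms(3)])

text \<open>Together with \<open>target_aug_eta\<close>, this makes the two transpositions inverse
  to each other on carriers. A generator is the image of a unit element under the action of
  \<open>mu\<close>, and the action on \<open>k\<close> is trivial.\<close>

lemma eta_target_aug:
  assumes h: "nat_trans C (t.L G) K h" and x: "x \<in> Obj C" and z: "z \<in> car (t.L G) x"
  shows "lan_target_aug C (\<lambda>a v. h (Cod C a) (eta G a v)) x z = h x z"
proof (rule t.lan_ext[OF G nat_transD(1)[OF target_aug(1)[OF G eta_nat[OF h]] x] nat_transD(1)[OF h x] vs_const_mod _ z])
  fix a mu v assume ov: "t.ovo x a mu" and v: "v \<in> car G a"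
  have "eta G a v \<in> car (t.L G) (Dom C mu)" using lhomD(1)[OF eta_lhom v] ov by (simp add: t_ovo)
  then show "lan_target_aug C (\<lambda>a v. h (Cod C a) (eta G a v)) x (t.la G x a mu v) = h x (t.la G x a mu v)"
    using target_aug(2)[OF G eta_nat[OF h] ov v] act_eta[OF ov v] nat_transD(3)[OF h, of mu "eta G a v"] ov
    by (simp add: t_ovo)
qed

end

lemma eta_map:
  assumes G: "fmod FF G" and G': "fmod FF G'" and h: "nat_trans FF G G' h" and a: "a \<in> Arr C" and v: "v \<in> car G a"
  shows "tmap G' h (Cod C a) (eta G a v) = eta G' a (h a v)"
  unfolding eta_def by (rule t.lan_map(2)[OF G G' h eta_ovo[OF a] v])

lemma target_ext_functor:
  assumes P: "proj_resolution FF kF P" and R: "proj_resolution C K R"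
  shows "ext_functor FF kF P C K R (lan (fact_target C) FF C) tmap (lan_target_aug C)"
  using t.lan_ext_functor[OF target_const(1) P fmod_const_mod R] target_resolution[OF P]
  unfolding target_aug_eq proj_resolution_def by blast

lemma nabla_ext_functor:
  assumes P: "proj_resolution FF kF P" and S: "proj_resolution EE bim S"
  shows "ext_functor FF kF P EE bim S (lan (fact_nabla C) FF EE) nmap (lan_nabla_aug C)"
  using n.lan_ext_functor[OF nabla_const(1) P bimod_fmod S] nabla_resolution[OF P]
  unfolding nabla_aug_eq proj_resolution_def by blast

text \<open>Transposition identifies the cochains with values in \<open>k\<close> degree by degree
  and respects boundaries by \<open>eta_map\<close>, so cocycles correspond to cocycles and
  coboundaries to coboundaries.\<close>

lemma target_bij:
  assumes P: "proj_resolution FF kF P" and R: "proj_resolution C K R"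
  shows "bij_betw (induced_map C K R (Ltar P) (lan_target_aug C)) (carrier (ext_algebra FF P kF)) (carrier (ext_algebra C R K))"
proof -
  interpret T: ext_functor FF kF P C K R "lan (fact_target C) FF C" "tmap" "lan_target_aug C"
    by (rule target_ext_functor[OF P R])
  note CC = C.finite_category_axioms
  note fP = resolutionD(2)[OF T.RP] and dP = resolutionD(3)[OF T.RP]
  have RY: "resolution C K (Ltar P)" using target_resolution[OF P] by (simp add: proj_resolution_def)
  show ?thesis
  proof (rule T.induced_map_bij)
    show "projective C (t.L (mods P n))" for n using target_resolution[OF P] by (simp add: proj_resolution_def Fm_aug_simps)
  next
    fix n f g assume f: "f \<in> cocycles FF P kF n" and g: "g \<in> cocycles FF P kF n"
      and c: "cohom C (Ltar P) K n (lan_target_aug C f) (lan_target_aug C g)"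
    from cohomE[OF CC RY fmod_const_mod c] obtain b where b: "b \<in> coboundaries C (Ltar P) K n"
      "\<And>x v. x \<in> Obj C ==> v \<in> car (mods (Ltar P) n) x ==>
        lan_target_aug C g x v = lan_target_aug C f x v \<oplus>\<^bsub>sp K x\<^esub> b x v" by blast
    \<comment> \<open>The coboundary found over \<open>C\<close> is transposed back to the category
      of factorizations through the unit.\<close>
    define b' where "b' = (\<lambda>a v. b (Cod C a) (eta (mods P n) a v))"
    have bn: "nat_trans C (t.L (mods P n)) K b" using b(1) by (simp add: coboundaries_def Fm_aug_simps)
    note b'n = eta_nat[OF fP bn, folded b'_def]
    have ec: "eta (mods P m) a v \<in> car (t.L (mods P m)) (Cod C a)" if "a \<in> Arr C" "v \<in> car (mods P m) a" for m a v
      by (rule lhomD(1)[OF eta_lhom[OF fP that(1)] that(2)])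
    show "cohom FF P kF n f g"
    proof (rule cohomI[OF FC T.RP fmod_const_mod f])
      show "b' \<in> coboundaries FF P kF n"
      proof (cases n)
        case 0
        then have "\<forall>x\<in>Obj C. \<forall>v\<in>car (t.L (mods P 0)) x. b x v = 0"
          using b(1) by (simp add: coboundaries_def Fm_aug_simps)
        then show ?thesis using b'n 0 ec by (simp add: coboundaries_def b'_def C.Cod_Obj)
      next
        case (Suc m)
        then obtain h where h: "nat_trans C (t.L (mods P m)) K h"
          "\<forall>x\<in>Obj C. \<forall>v\<in>car (t.L (mods P (Suc m))) x. b x v = h x (tmap (mods P m) (bdry P m) x v)"
          using b(1) by (auto simp: coboundaries_def Fm_aug_simps)
        have "b' a v = (\<lambda>a v. h (Cod C a) (eta (mods P m) a v)) a (bdry P m a v)"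
          if a: "a \<in> Arr C" and v: "v \<in> car (mods P (Suc m)) a" for a v
          using h(2) ec[OF a v] eta_map[OF fP fP dP a v] C.Cod_Obj[OF a] by (simp add: b'_def Suc)
        then show ?thesis using b'n eta_nat[OF fP h(1)] unfolding coboundaries_def Suc
          by (auto intro!: exI[of _ "\<lambda>a v. h (Cod C a) (eta (mods P m) a v)"])
      qed
      fix a v assume a: "a \<in> Obj FF" and v: "v \<in> car (mods P n) a"
      have a': "a \<in> Arr C" using a by simp
      show "g a v = f a v \<oplus>\<^bsub>sp kF a\<^esub> b' a v"
        using b(2)[of "Cod C a" "eta (mods P n) a v"] ec[OF a' v] target_aug_eta[OF fP cocyclesD(1)[OF f] a' v]
          target_aug_eta[OF fP cocyclesD(1)[OF g] a' v] C.Cod_Obj[OF a'] by (simp add: Fm_aug_simps b'_def)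
    qed
  next
    fix n g assume g: "g \<in> cocycles C (Ltar P) K n"
    have gn: "nat_trans C (t.L (mods P n)) K g" using cocyclesD(1)[OF g] by (simp add: Fm_aug_simps)
    let ?f = "\<lambda>a v. g (Cod C a) (eta (mods P n) a v)"
    show "\<exists>f\<in>cocycles FF P kF n. cohom C (Ltar P) K n (lan_target_aug C f) g"
    proof (rule bexI[of _ ?f])
      show "?f \<in> cocycles FF P kF n"
        unfolding cocycles_def
      proof (intro CollectI conjI ballI)
        show "nat_trans FF (mods P n) kF ?f" by (rule eta_nat[OF fP gn])
        fix a v assume a: "a \<in> Obj FF" and v: "v \<in> car (mods P (Suc n)) a"
        have a': "a \<in> Arr C" using a by simp
        have "g (Cod C a) (tmap (mods P n) (bdry P n) (Cod C a) (eta (mods P (Suc n)) a v)) = 0"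
          using cocyclesD(2)[OF g C.Cod_Obj[OF a'], of "eta (mods P (Suc n)) a v"] lhomD(1)[OF eta_lhom[OF fP a'] v]
          by (simp add: Fm_aug_simps)
        then show "g (Cod C a) (eta (mods P n) a (bdry P n a v)) = \<zero>\<^bsub>sp kF a\<^esub>"
          using eta_map[OF fP fP dP a' v] by simp
      qed
      show "cohom C (Ltar P) K n (lan_target_aug C ?f) g"
        by (rule cohom_sym[OF CC RY fmod_const_mod], rule cohom_eq[OF CC RY fmod_const_mod g])
           (simp add: Fm_aug_simps eta_target_aug[OF fP gn])
    qed
  qed
qed

end

section \<open>The diagram\<close>

context pten
begin

text \<open>Carries a comparison of two resolutions of \<open>k\<close> over to the tensored
  complexes, so that in the diagram the order of pulling back and tensoring can be
  exchanged.\<close>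

lemma PT_lift:
  assumes R: "resolution C K R" and Y: "resolution C K Y" and ph: "ph \<in> lifts C R 0 Y (aug R)"
  shows "(\<lambda>i. ptensor_map M (mods Y i) (ph i))
    \<in> lifts C (PTc R) 0 (PTc Y) (ptensor_aug M (aug R))"
proof (rule liftsI; unfold Fm_aug_simps add_0)
  note fR = resolutionD(2)[OF R] and dR = resolutionD(3)[OF R] and aR = resolutionD(4)[OF R]
  note fY = resolutionD(2)[OF Y] and dY = resolutionD(3)[OF Y] and aY = resolutionD(4)[OF Y]
  note phn = liftsD(1)[OF ph, unfolded add_0]
  show n: "nat_trans C (PT (mods R i)) (PT (mods Y i)) (ptensor_map M (mods Y i) (ph i))" for i
    by (rule PT_map_nat[OF fR fY phn])
  have phg: "ptensor_map M (mods Y i) (ph i) x (ptg (mods R i) x v w) = ptg (mods Y i) x (ph i x v) w"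
    if "x \<in> Obj C" "v \<in> car (mods R i) x" "w \<in> car M x" for i x v w
    by (rule PT_map(2)[where et = "ph i", OF fR that(1) fmodD(1)[OF fY that(1)] nat_transD(1)[OF phn that(1)] that(2,3)])
  fix x z assume x: "x \<in> Obj C"
  show "ptensor_aug M (aug Y) x (ptensor_map M (mods Y 0) (ph 0) x z) = ptensor_aug M (aug R) x z"
    if "z \<in> car (PT (mods R 0)) x"
    by (rule PT_ext[OF fR x lhom_comp[OF nat_transD(1)[OF n x] PT_aug(1)[OF fY aY x]] PT_aug(1)[OF fR aR x] Mv[OF x] _ that])
       (simp add: phg[OF x] PT_aug(2)[OF fY aY x] PT_aug(2)[OF fR aR x] nat_transD(2)[OF phn x] liftsD(2)[OF ph x])
  fix i assume z: "z \<in> car (PT (mods R (Suc i))) x"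
  have dYg: "ptensor_map M (mods Y i) (bdry Y i) x (ptg (mods Y (Suc i)) x v w) = ptg (mods Y i) x (bdry Y i x v) w"
    if "v \<in> car (mods Y (Suc i)) x" "w \<in> car M x" for v w
    by (rule PT_map(2)[where et = "bdry Y i", OF fY x fmodD(1)[OF fY x] nat_transD(1)[OF dY x] that])
  have dRg: "ptensor_map M (mods R i) (bdry R i) x (ptg (mods R (Suc i)) x v w) = ptg (mods R i) x (bdry R i x v) w"
    if "v \<in> car (mods R (Suc i)) x" "w \<in> car M x" for v w
    by (rule PT_map(2)[where et = "bdry R i", OF fR x fmodD(1)[OF fR x] nat_transD(1)[OF dR x] that])
  show "ptensor_map M (mods Y i) (bdry Y i) x (ptensor_map M (mods Y (Suc i)) (ph (Suc i)) x z)
      = ptensor_map M (mods Y i) (ph i) x (ptensor_map M (mods R i) (bdry R i) x z)"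
    by (rule PT_ext[OF fR x lhom_comp[OF nat_transD(1)[OF n x] nat_transD(1)[OF PT_map_nat[OF fY fY dY] x]]
          lhom_comp[OF nat_transD(1)[OF PT_map_nat[OF fR fR dR] x] nat_transD(1)[OF n x]] PT_vs[OF fY x] _ z])
       (simp add: phg[OF x] dYg dRg nat_transD(2)[OF phn x] nat_transD(2)[OF dR x] liftsD(3)[OF ph x, unfolded add_0])
qed

lemma PT_aug_map:
  assumes G: "fmod C G" and N: "fmod C N" and et: "nat_trans C G N et" and f: "nat_trans C N K f" and x: "x \<in> Obj C"
    and z: "z \<in> car (PT G) x"
  shows "ptensor_aug M f x (ptensor_map M N et x z) = ptensor_aug M (\<lambda>x v. f x (et x v)) x z"
proof -
  note g = nat_trans_comp[OF C.finite_category_axioms et f]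
  note m = PT_map[where et = et, OF G x fmodD(1)[OF N x] nat_transD(1)[OF et x]]
  show ?thesis
    by (rule PT_ext[OF G x lhom_comp[OF m(1) PT_aug(1)[OF N f x]] PT_aug(1)[OF G g x] Mv[OF x] _ z])
       (simp add: m(2) PT_aug(2)[OF N f x] PT_aug(2)[OF G g x] nat_transD(2)[OF et x])
qed

lemma BT_lift:
  assumes R: "resolution E bim R" and Y: "resolution E bim Y" and ph: "ph \<in> lifts E R 0 Y (aug R)"
  shows "(\<lambda>i. BTm (mods Y i) (ph i))
    \<in> lifts C (BTc R) 0 (BTc Y) (btensor_aug C M (aug R))"
proof (rule liftsI; unfold Fm_aug_simps add_0)
  note fR = resolutionD(2)[OF R] and dR = resolutionD(3)[OF R] and aR = resolutionD(4)[OF R]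
  note fY = resolutionD(2)[OF Y] and dY = resolutionD(3)[OF Y] and aY = resolutionD(4)[OF Y]
  note phn = liftsD(1)[OF ph, unfolded add_0]
  note n = BT_map_nat[OF fR fY phn]
  show "nat_trans C (BT (mods R i)) (BT (mods Y i)) (BTm (mods Y i) (ph i))" for i
    by (rule n(1))
  fix x z assume x: "x \<in> Obj C"
  have cl: "ph i (x, y) v \<in> car (mods Y i) (x, y)" if "y \<in> Obj C" "v \<in> car (mods R i) (x, y)" for i y v
    using nat_transD(2)[OF phn, of "(x, y)"] x that by simp
  have dc: "bdry R i (x, y) v \<in> car (mods R i) (x, y)" if "y \<in> Obj C" "v \<in> car (mods R (Suc i)) (x, y)" for i y v
    using nat_transD(2)[OF dR, of "(x, y)"] x that by simp
  show "btensor_aug C M (aug Y) x (BTm (mods Y 0) (ph 0) x z) = btensor_aug C M (aug R) x z"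
    if "z \<in> car (BT (mods R 0)) x"
    by (rule BT_ext[OF fR x lhom_comp[OF nat_transD(1)[OF n(1) x] BT_aug(1)[OF fY aY x]] BT_aug(1)[OF fR aR x] Mv[OF x] _ that])
       (use x in \<open>simp add: n(2) BT_aug(2)[OF fY aY x] BT_aug(2)[OF fR aR x] cl liftsD(2)[OF ph]\<close>)
  fix i assume z: "z \<in> car (BT (mods R (Suc i))) x"
  note mY = BT_map_nat[OF fY fY dY] and mR = BT_map_nat[OF fR fR dR]
  show "BTm (mods Y i) (bdry Y i) x (BTm (mods Y (Suc i)) (ph (Suc i)) x z)
      = BTm (mods Y i) (ph i) x (BTm (mods R i) (bdry R i) x z)"
    by (rule BT_ext[OF fR x lhom_comp[OF nat_transD(1)[OF n(1) x] nat_transD(1)[OF mY(1) x]]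
          lhom_comp[OF nat_transD(1)[OF mR(1) x] nat_transD(1)[OF n(1) x]] BT_vs[OF fY x] _ z])
       (use x in \<open>simp add: n(2) mY(2) mR(2) cl dc liftsD(3)[OF ph, unfolded add_0]\<close>)
qed

lemma BT_aug_map:
  assumes G: "fmod E G" and N: "fmod E N" and et: "nat_trans E G N et" and f: "nat_trans E N bim f" and x: "x \<in> Obj C"
    and z: "z \<in> car (BT G) x"
  shows "btensor_aug C M f x (BTm N et x z) = btensor_aug C M (\<lambda>x v. f x (et x v)) x z"
proof -
  note g = nat_trans_comp[OF EC et f]
  note m = BT_map_nat[OF G N et]
  have cl: "et (x, y) v \<in> car N (x, y)" if "y \<in> Obj C" "v \<in> car G (x, y)" for y v
    using nat_transD(2)[OF et, of "(x, y)"] x that by simp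
  show ?thesis
    by (rule BT_ext[OF G x lhom_comp[OF nat_transD(1)[OF m(1) x] BT_aug(1)[OF N f x]] BT_aug(1)[OF G g x] Mv[OF x] _ z])
       (simp add: m(2) x BT_aug(2)[OF N f x] BT_aug(2)[OF G g x] cl)
qed

end

context factm
begin

lemma diagram:
  assumes P: "proj_resolution FF kF P" and R: "proj_resolution C K R" and S: "proj_resolution EE bim S" and Q: "proj_resolution C M Q"
    and c: "c \<in> carrier (ext_algebra FF P kF)"
  shows "ext_ptensor C M R Q (induced_map C K R
        (image_complex (lan (fact_target C) FF C) tmap (lan_target_aug C) P) (lan_target_aug C) c)
      = ext_btensor C M S Q (induced_map EE bim S (Lnab P) (lan_nabla_aug C) c)"
proof
  fix n
  \<comment> \<open>Exactness of \<open>LK\<close> along \<open>t\<close> does not involve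
    \<open>M\<close>; it is taken from the case of the constant functor.\<close>
  interpret k: factk C "TYPE('k)" by unfold_locales (rule fmod_const_mod)
  note CC = C.finite_category_axioms
  let ?T = "k.Ltar P"
  note PT' = k.target_resolution[OF P] and PN = nabla_resolution[OF P]
  interpret T: ext_functor FF kF P C K R "lan (fact_target C) FF C" "tmap" "lan_target_aug C"
    by (rule k.target_ext_functor[OF P R])
  interpret N: ext_functor FF kF P EE bim S "lan (fact_nabla C) FF EE" "nmap" "lan_nabla_aug C"
    by (rule k.nabla_ext_functor[OF P S])
  interpret A: ext_functor C K R C M Q PT "ptensor_map M" "ptensor_aug M" by (rule PT_ext_functor[OF R Q])
  interpret A': ext_functor C K ?T C M Q PT "ptensor_map M" "ptensor_aug M" by (rule PT_ext_functor[OF PT' Q])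
  interpret B: ext_functor EE bim S C M Q BT "BTm" "btensor_aug C M" by (rule BT_ext_functor[OF S Q])
  have RT: "resolution C K ?T" and RN: "resolution EE bim (Lnab P)" using PT' PN by (auto simp: proj_resolution_def)
  note fP = resolutionD(2)[OF T.RP] and dP = resolutionD(3)[OF T.RP] and aP = resolutionD(4)[OF T.RP]
  have "c n \<in> carrier (ext_space FF P kF n)" using c by (simp add: ext_algebra_def)
  then obtain f where f: "f \<in> cocycles FF P kF n" "c n = coh_class FF P kF n f"
    unfolding ext_space_simps(1)[OF FC T.RP T.fM] by blast
  obtain ph where ph: "ph \<in> lifts C R 0 ?T (aug R)" by (rule T.lift_exists)
  obtain ph' where ph': "ph' \<in> lifts C Q 0 A.Y (aug Q)" by (rule A.lift_exists)
  obtain si where si: "si \<in> lifts EE S 0 (Lnab P) (aug S)" by (rule N.lift_exists)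
  obtain si' where si': "si' \<in> lifts C Q 0 B.Y (aug Q)" by (rule B.lift_exists)
  let ?f = "lan_target_aug C f" and ?g = "lan_nabla_aug C f"
  note fn = cocyclesD(1)[OF f(1)]
  note tf = target_aug(1)[OF fP fn] and nf = nabla_aug(1)[OF fP fn]
  let ?a = "\<lambda>x v. ptensor_aug M (\<lambda>x v. ?f x (ph n x v)) x (ph' n x v)"
  let ?b = "\<lambda>x v. btensor_aug C M (\<lambda>p v. ?g p (si n p v)) x (si' n x v)"
  have lhs: "ext_ptensor C M R Q (induced_map C K R ?T (lan_target_aug C) c) n = coh_class C Q M n ?a"
    unfolding ext_ptensor_def A.induced_map_H T.induced_map_H f(2) T.H_eq[OF f(1) ph] A.H_eq[OF T.H_cocycle[OF f(1) ph] ph'] ..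
  have rhs: "ext_btensor C M S Q (induced_map EE bim S (Lnab P) (lan_nabla_aug C) c) n = coh_class C Q M n ?b"
    unfolding ext_btensor_def B.induced_map_H N.induced_map_H f(2) N.H_eq[OF f(1) si] B.H_eq[OF N.H_cocycle[OF f(1) si] si'] ..
  have th: "(\<lambda>i. thet (mods P i)) \<in> lifts C (BTc (Lnab P)) 0 A'.Y
      (btensor_aug C M (lan_nabla_aug C (aug P)))"
    by (rule liftsI; unfold Fm_aug_simps add_0) (use thet_nat[OF fP] thet_aug[OF fP aP] thet_map[OF fP fP dP] in simp_all)
  \<comment> \<open>The first route: from \<open>Q\<close> to \<open>R\<close> tensored with
    \<open>M\<close>, then the comparison of \<open>R\<close> with the image of \<open>P\<close>
    under \<open>LK\<close> along \<open>t\<close>, tensored with \<open>M\<close>.\<close>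
  have l1: "(\<lambda>i x v. ptensor_map M (mods ?T i) (ph i) x (ph' i x v)) \<in> lifts C Q 0 A'.Y (aug Q)"
    by (rule lifts_comp[OF CC ph']) (use PT_lift[OF A.RP RT ph] in \<open>simp add: Fm_aug_simps\<close>)
  have l2: "(\<lambda>i x v. BTm (mods (Lnab P) i) (si i) x (si' i x v))
      \<in> lifts C Q 0 (BTc (Lnab P)) (aug Q)"
    by (rule lifts_comp[OF CC si']) (use BT_lift[OF B.RP RN si] in \<open>simp add: Fm_aug_simps\<close>)
  \<comment> \<open>The second route passes through \<open>S\<close> and \<open>LK\<close> along
    \<open>\<nabla>\<close>, and \<open>thet\<close> makes it end in the same complex as the
    first.\<close>
  have l3: "(\<lambda>i x v. thet (mods P i) x (BTm (mods (Lnab P) i) (si i) x (si' i x v))) \<in> lifts C Q 0 A'.Y (aug Q)"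
    by (rule lifts_comp[OF CC l2]) (use th in \<open>simp add: Fm_aug_simps\<close>)
  note co = A'.Fa_cocycle[OF T.Fa_cocycle[OF f(1)]]
  \<comment> \<open>\<open>Q\<close> is projective and the common target is exact, so the two routes
    pull back the one cocycle \<open>co\<close> to cohomologous ones. The remaining steps rewrite
    these pullbacks as the two iterated ones in the diagram.\<close>
  note main = lifts_unique[OF CC Q A'.Y M l3 l1 co, unfolded add_0]
  have phc: "ph' n x v \<in> car (PT (mods R n)) x" and sic: "si' n x v \<in> car (BT (mods S n)) x"
    if "x \<in> Obj C" "v \<in> car (mods Q n) x" for x v
    using nat_transD(2)[OF liftsD(1)[OF ph', of n] that(1)] nat_transD(2)[OF liftsD(1)[OF si', of n] that(1)] that(2)
    by (simp_all add: Fm_aug_simps)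
  have phn: "nat_trans C (mods R n) (t.L (mods P n)) (ph n)" and sin: "nat_trans EE (mods S n) (n.L (mods P n)) (si n)"
    using liftsD(1)[OF ph, of n] liftsD(1)[OF si, of n] by (simp_all add: Fm_aug_simps)
  have "cohom C Q M n (\<lambda>x v. ptensor_aug M ?f x (ptensor_map M (mods ?T n) (ph n) x (ph' n x v))) ?a"
    by (rule cohom_eq[OF CC A.RQ M cohomD(1)[OF main]])
       (simp add: Fm_aug_simps PT_aug_map[OF resolutionD(2)[OF A.RP] tLG[OF fP] phn tf _ phc])
  note 1 = cohom_sym[OF CC A.RQ M this]
  have 2: "cohom C Q M n (\<lambda>x v. ptensor_aug M ?f x (thet (mods P n) x (BTm (mods (Lnab P) n) (si n) x (si' n x v)))) ?b"
  proof (rule cohom_eq[OF CC A.RQ M cohomD(2)[OF main]])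
    fix x v assume x: "x \<in> Obj C" and v: "v \<in> car (mods Q n) x"
    note fS = resolutionD(2)[OF B.RP]
    have "BTm (n.L (mods P n)) (si n) x (si' n x v) \<in> car (BT (n.L (mods P n))) x"
      by (rule nat_transD(2)[OF BT_map_nat(1)[OF fS nLG[OF fP] sin] x sic[OF x v]])
    then show "?b x v = ptensor_aug M ?f x (thet (mods P n) x (BTm (mods (Lnab P) n) (si n) x (si' n x v)))"
      unfolding Fm_aug_simps by (simp add: thet_aug[OF fP fn x] BT_aug_map[OF fS nLG[OF fP] sin nf x sic[OF x v]])
  qed
  have "cohom C Q M n ?a ?b"
    by (rule cohom_trans[OF CC A.RQ M 1 cohom_trans[OF CC A.RQ M main 2]])
  then show "ext_ptensor C M R Q (induced_map C K R ?T (lan_target_aug C) c) n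
      = ext_btensor C M S Q (induced_map EE bim S (Lnab P) (lan_nabla_aug C) c) n"
    unfolding lhs rhs using coh_class_eq_iff[OF CC A.RQ M cohomD(1) cohomD(2)] by blast
qed

end

theorem theorem3p4p2:
  fixes C :: "('o, 'm) category"
    and M :: "('o, 'm, 'k::alg_closed_field, 'w) kfunctor"
    and P :: "('m, 'm \<times> 'm \<times> 'm, 'k, 'p, 'k) aug_complex"
    and R :: "('o, 'm, 'k, 'r, 'k) aug_complex"
    and S :: "('o \<times> 'o, 'm \<times> 'm, 'k, 's, 'm \<Rightarrow>\<^sub>0 'k) aug_complex"
    and Q :: "('o, 'm, 'k, 'q, 'w) aug_complex"
  assumes "finite_category C"
    and "kmodule C M"
    and "projective_resolution (fact_cat C) const_mod P"
    and "projective_resolution C const_mod R"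
    and "projective_resolution (env_cat C) (bimod C) S"
    and "projective_resolution C M Q"
  shows
    "ext_lan_target C P R
        \<in> algebra_hom (ext_algebra (fact_cat C) P const_mod) (ext_algebra C R const_mod) \<and>
     bij_betw (ext_lan_target C P R)
        (carrier (ext_algebra (fact_cat C) P const_mod)) (carrier (ext_algebra C R const_mod)) \<and>
     ext_ptensor C M R Q
        \<in> algebra_hom (ext_algebra C R const_mod) (ext_algebra C Q M) \<and>
     ext_lan_nabla C P S
        \<in> algebra_hom (ext_algebra (fact_cat C) P const_mod) (ext_algebra (env_cat C) S (bimod C)) \<and>
     inj_on (ext_lan_nabla C P S) (carrier (ext_algebra (fact_cat C) P const_mod)) \<and>
     ext_btensor C M S Q
        \<in> algebra_hom (ext_algebra (env_cat C) S (bimod C)) (ext_algebra C Q M) \<and>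
     (\<forall>c \<in> carrier (ext_algebra (fact_cat C) P const_mod).
        ext_ptensor C M R Q (ext_lan_target C P R c) = ext_btensor C M S Q (ext_lan_nabla C P S c))"
proof -
  interpret C: finite_category C by fact
  have M: "fmod C M" using assms(2) by (simp add: kmodule_iff)
  interpret k: factk C "TYPE('k)" by unfold_locales (rule fmod_const_mod)
  interpret m: factm C M by unfold_locales (rule M)
  note F = k.FC and E = k.EC
  have P: "proj_resolution (fact_cat C) const_mod P" and R: "proj_resolution C const_mod R"
    and S: "proj_resolution (env_cat C) (bimod C) S" and Q: "proj_resolution C M Q"
    using assms(3-6) projective_resolution_iff[OF F fmod_const_mod, of P] projective_resolution_iff[OF assms(1) fmod_const_mod, of R]
      projective_resolution_iff[OF E k.bimod_fmod, of S] projective_resolution_iff[OF assms(1) M, of Q] by auto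
  let ?B = "bar (fact_cat C) :: ('m, 'm \<times> 'm \<times> 'm, 'k, _, 'k) aug_complex"
  have B: "proj_resolution (fact_cat C) const_mod ?B" by (rule finite_category.bar_resolution[OF F])
  note tb = finite_category.to_bar_facts[OF F P]
  let ?A = "ext_algebra (fact_cat C) P const_mod :: ('k, _) module"
  \<comment> \<open>The Kan extensions are applied to the bar resolution, so both maps factor
    through \<open>to_bar\<close>, a bijective algebra homomorphism by change of resolution.\<close>
  have et: "ext_lan_target C P R = (\<lambda>c. induced_map C const_mod R (k.Ltar ?B) (lan_target_aug C) (to_bar (fact_cat C) P c))"
    by (simp add: fun_eq_iff ext_lan_target_def)
  have en: "ext_lan_nabla C P S = (\<lambda>c. induced_map (env_cat C) (bimod C) S (k.Lnab ?B) (lan_nabla_aug C) (to_bar (fact_cat C) P c))"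
    by (simp add: fun_eq_iff ext_lan_nabla_def)
  have 1: "ext_lan_target C P R \<in> algebra_hom ?A (ext_algebra C R const_mod)"
    unfolding et by (rule algebra_hom_compose[OF tb(1) ext_functor.induced_map_hom[OF k.target_ext_functor[OF B R]]])
  have 2: "bij_betw (ext_lan_target C P R) (carrier ?A) (carrier (ext_algebra C R const_mod))"
    using bij_betw_trans[OF tb(2) k.target_bij[OF B R]] unfolding et comp_def .
  have 3: "ext_ptensor C M R Q \<in> algebra_hom (ext_algebra C R const_mod) (ext_algebra C Q M)"
    unfolding ext_ptensor_def by (rule ext_functor.induced_map_hom[OF m.PT_ext_functor[OF R Q]])
  have 4: "ext_lan_nabla C P S \<in> algebra_hom ?A (ext_algebra (env_cat C) S (bimod C))"
    unfolding en by (rule algebra_hom_compose[OF tb(1) ext_functor.induced_map_hom[OF k.nabla_ext_functor[OF B S]]])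
  have 5: "ext_btensor C M S Q \<in> algebra_hom (ext_algebra (env_cat C) S (bimod C)) (ext_algebra C Q M)"
    unfolding ext_btensor_def by (rule ext_functor.induced_map_hom[OF m.BT_ext_functor[OF S Q]])
  have tc: "to_bar (fact_cat C) P c \<in> carrier (ext_algebra (fact_cat C) ?B const_mod)" if "c \<in> carrier ?A" for c
    using bij_betwE[OF tb(2)] that by blast
  have 6: "ext_ptensor C M R Q (ext_lan_target C P R c) = ext_btensor C M S Q (ext_lan_nabla C P S c)" if "c \<in> carrier ?A" for c
    unfolding et en by (rule m.diagram[OF B R S Q tc[OF that]])
  \<comment> \<open>For the constant functor in place of \<open>M\<close> the diagram factors an isomorphism through the map
    induced by \<open>LK\<close> along \<open>\<nabla>\<close>.\<close>
  have "ext_lan_target C P R c = ext_btensor C const_mod S R (ext_lan_nabla C P S c)" if "c \<in> carrier ?A" for c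
    using k.diagram[OF B R S R tc[OF that]] k.ext_ptensor_id[OF R bij_betwE[OF 2, rule_format, OF that]]
    unfolding et en by simp
  then have 7: "inj_on (ext_lan_nabla C P S) (carrier ?A)"
    using bij_betw_imp_inj_on[OF 2] unfolding inj_on_def by metis
  from 1 2 3 4 5 6 7 show ?thesis by blast
qed

end
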